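(* Consider the bond market model described in the context, on the time horizon $[0,\bar S]$, driven by infinitely many independent Wiener processes. Then for every $S$ with $0<S\le\bar S$ the bond market is not complete on $[0,S]$; that is, there exists a bounded $\mathcal F_S$-measurable random variable $\xi$ for which there are no constant $c\in\mathbb R$ and admissible strategy $\varphi\in\mathcal A$ with $$\xi=c+\int_0^S\langle\varphi_t,d\hat P_t\rangle_{G^*,G}\quad \mathbb P\text{-a.s.}$$
   Context: Setting. Fix $0<\bar S<\infty$ and a filtered probability space $(\Omega,\mathcal F,(\mathcal F_t)_{t\in[0,\bar S]},\mathbb P)$ satisfying the usual conditions, whose filtration is generated (up to the usual augmentation) by a sequence of independent standard Wiener processes $W^i$, $i=1,2,\dots$; $W=(W^1,W^2,\dots)$ is regarded as a cylindrical Wiener process in $l^2$. Let $H=L^2[0,\bar S]$ and let $G=H^1[0,\bar S]$ be the Hilbert space of absolutely continuous functions with square integrable derivative, with norm $|g|_G^2=|g(0)|^2+\int_0^{\bar S}(g'(s))^2ds$; $G^*$ is its dual. Forward rates. $f_t=f_0+\int_0^t\alpha_s\,ds+\int_0^t\sigma_s\,dW_s$ in $H$, $t\in[0,\bar S]$, with initial curve $f_0\in H$, i.e. $df(t,T)=\alpha(t,T)dt+\sum_{i}\sigma^i(t,T)dW^i(t)$, where $\alpha_t=\alpha(t,\cdot)$ and $\sigma_t:l^2\to H$, $(\sigma_tu)(T)=\sum_i\sigma^i(t,T)u^i$. One assumes: $\alpha(t,T)=\sigma^i(t,T)=0$ for $t\ge T$ and all $i$; $\alpha$ is an $H$-valued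 process with $\int_0^{\bar S}|\alpha_t|_H\,dt<\infty$ a.s.; $\sigma$ is a predictable process with values in the Hilbert-Schmidt operators $L_{HS}(l^2,H)$ (a.s.) and $\int_0^{\bar S}\|\sigma_t\|^2_{L_{HS}(l^2,H)}dt<\infty$ a.s.; and the HJM (no-arbitrage) condition $\int_t^T\alpha(t,u)du=\frac12\sum_i\big(\int_t^T\sigma^i(t,u)du\big)^2$ for all $t,T\in[0,\bar S]$, equivalently every $\hat P(\cdot,T)$ below is a local martingale. Prices. The discounted bond price is $\hat P(t,T)=e^{-\int_0^Tf(t,u)du}$, and $\hat P_t=\hat P(t,\cdot)\in G$. Put $b^i(t,T)=-\int_0^T\sigma^i(t,u)du$ and $\Gamma_t:l^2\to G$, $(\Gamma_tu)(T)=\hat P(t,T)\sum_ib^i(t,T)u^i$. Then $\hat P_t=\hat P_0+\int_0^t\Gamma_s\,dW_s$. $\Gamma_t^*:G^*\to l^2$ denotes the adjoint of $\Gamma_t$ ($l^2$ identified with its dual). Strategies. A trading strategy is a predictable process with values in some fixed one of the classes: (A) $\sum_{i=1}^m\alpha_i\delta_{T_i}$ with $m\in\mathbb N\cup\{\infty\}$, $\alpha_i\in\mathbb R$, $T_i\in[0,\bar S]$, $\sum_i|\alpha_i|<\infty$; (B) finite signed measures on $[0,\bar S]$; (C) $G^*$. All these are contained in $G^*$. A strategy $\varphi$ is $\hat P$-integrable if $\int_0^{\bar S}|\Gamma_s^*\varphi_s|_{l^2}^2ds<\infty$ a.s., and then $\int_0^t\langle\varphi_s,d\hat P_s\rangle_{G^*,G}:=\int_0^t\langle\Gamma_s^*\varphi_s,dW_s\rangle_{l^2}$.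 A trading strategy is admissible (the set is $\mathcal A$) if it is $\hat P$-integrable and $\int_0^{t}\langle\varphi_s,d\hat P_s\rangle_{G^*,G}$, $t\in[0,\bar S]$, is a martingale. Completeness. The market is complete on $[0,S]$ if every bounded $\mathcal F_S$-measurable $\xi$ can be written as $\xi=c+\int_0^S\langle\varphi_t,d\hat P_t\rangle_{G^*,G}$ with $c$ a constant and $\varphi\in\mathcal A$. *)

theory Defs
  imports
    "HOL-Probability.Probability"
    "HOL-Library.Function_Algebras"
    "HOL-Library.Extended_Nat"
begin

section \<open>Function spaces as seminormed spaces\<close>

text \<open>
  The spaces $L^2[0,\bar S]$, $H^1[0,\bar S]$ and its dual depend on the real parameter $\bar S$.
  Each of them is described by an extended squared seminorm \<open>q\<close> on a vector space of functions:
  the space itself is \<open>{x. q x < \<infinity>}\<close>, and \<open>x\<close>, \<open>y\<close> are the same element iff \<open>q (x - y) = 0\<close>.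
  Algebraic operations on functions are pointwise.
\<close>

instantiation "fun" :: (type, real_vector) real_vector
begin

definition scaleR_fun_def: "c *\<^sub>R f = (\<lambda>x. c *\<^sub>R f x)"

instance
  by standard (simp_all add: scaleR_fun_def fun_eq_iff scaleR_add_right scaleR_add_left)

end

definition seminorm_of :: "('v \<Rightarrow> ennreal) \<Rightarrow> 'v \<Rightarrow> ennreal" where
  "seminorm_of q x = (if q x = \<infinity> then \<infinity> else ennreal (sqrt (enn2real (q x))))"

text \<open>
  The Borel \<open>\<sigma>\<close>-algebra of the seminormed space \<open>{x. q x < \<infinity>}\<close>.  Its space is \<open>UNIV\<close>, so that a
  measurable map may take values outside the seminormed space (on a measurable set).
\<close>

definition seminorm_borel :: "('v::real_vector \<Rightarrow> ennreal) \<Rightarrow> 'v measure" where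
  "seminorm_borel q = sigma UNIV
     {U. U \<subseteq> {x. q x < \<infinity>} \<and> (\<forall>x\<in>U. \<exists>e>0. \<forall>y. q (y - x) < e \<longrightarrow> y \<in> U)}"

definition sqnorm_real :: "real \<Rightarrow> ennreal" where
  "sqnorm_real x = ennreal (x\<^sup>2)"

text \<open>
  A Hilbert-Schmidt operator \<open>\<Psi>\<close> from \<open>l\<^sup>2\<close> into the space of \<open>q\<close> is identified with the sequence
  \<open>i \<mapsto> \<Psi> e\<^sub>i\<close> of images of the standard basis; its squared Hilbert-Schmidt norm is
  \<open>\<Sum>i. q (\<Psi> e\<^sub>i)\<close>.  For the real line this is \<open>l\<^sup>2\<close> itself.
\<close>

definition sqnorm_HS :: "('v \<Rightarrow> ennreal) \<Rightarrow> (nat \<Rightarrow> 'v) \<Rightarrow> ennreal" where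
  "sqnorm_HS q \<Psi> = (\<Sum>i. q (\<Psi> i))"

definition l2 :: "(nat \<Rightarrow> real) set" where
  "l2 = {u. sqnorm_HS sqnorm_real u < \<infinity>}"

text \<open>$H = L^2[0,\bar S]$, with Borel measurable representatives.\<close>

definition sqnorm_H :: "real \<Rightarrow> (real \<Rightarrow> real) \<Rightarrow> ennreal" where
  "sqnorm_H Sb h =
     (if set_borel_measurable lborel {0..Sb} h
      then \<integral>\<^sup>+T\<in>{0..Sb}. ennreal ((h T)\<^sup>2) \<partial>lborel else \<infinity>)"

text \<open>
  $G = H^1[0,\bar S]$: a function is absolutely continuous with square integrable derivative \<open>g'\<close> iff
  it is the indefinite integral of \<open>g'\<close>.  Since \<open>g'\<close> is unique almost everywhere, the infimum below
  ranges over at most one value; it is \<open>\<infinity>\<close> if there is no such \<open>g'\<close>.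
\<close>

definition sqnorm_G :: "real \<Rightarrow> (real \<Rightarrow> real) \<Rightarrow> ennreal" where
  "sqnorm_G Sb g =
     (INF g'\<in>{g'. sqnorm_H Sb g' < \<infinity> \<and>
                  (\<forall>T\<in>{0..Sb}. g T = g 0 + (LINT s:{0..T}|lborel. g' s))}.
        ennreal ((g 0)\<^sup>2) + sqnorm_H Sb g')"

definition G_space :: "real \<Rightarrow> (real \<Rightarrow> real) set" where
  "G_space Sb = {g. sqnorm_G Sb g < \<infinity>}"

definition linear_on_G :: "real \<Rightarrow> ((real \<Rightarrow> real) \<Rightarrow> real) \<Rightarrow> bool" where
  "linear_on_G Sb \<phi> \<longleftrightarrow>
     (\<forall>g\<in>G_space Sb. \<forall>h\<in>G_space Sb. \<phi> (g + h) = \<phi> g + \<phi> h) \<and>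
     (\<forall>c. \<forall>g\<in>G_space Sb. \<phi> (c *\<^sub>R g) = c * \<phi> g)"

definition sqnorm_Gdual :: "real \<Rightarrow> ((real \<Rightarrow> real) \<Rightarrow> real) \<Rightarrow> ennreal" where
  "sqnorm_Gdual Sb \<phi> =
     (if linear_on_G Sb \<phi>
      then SUP g\<in>{g. sqnorm_G Sb g \<le> 1}. ennreal ((\<phi> g)\<^sup>2) else \<infinity>)"

text \<open>
  The values of a functional outside \<open>G_space Sb\<close> are irrelevant.  As \<open>\<phi>\<close> is bounded with respect
  to the seminorm, \<open>\<phi> g\<close> depends only on \<open>g\<close> restricted to $[0,\bar S]$.
\<close>

definition Gdual :: "real \<Rightarrow> ((real \<Rightarrow> real) \<Rightarrow> real) set" where
  "Gdual Sb = {\<phi>. sqnorm_Gdual Sb \<phi> < \<infinity>}"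

text \<open>
  \<open>A\<close> is the Bochner integral of \<open>\<alpha>\<close>; the definition parallels \<^const>\<open>has_bochner_integral\<close>, which is
  not applicable because the spaces above are not types.
\<close>

definition has_seminorm_integral ::
    "('v::real_vector \<Rightarrow> ennreal) \<Rightarrow> 'a measure \<Rightarrow> ('a \<Rightarrow> 'v) \<Rightarrow> 'v \<Rightarrow> bool" where
  "has_seminorm_integral q N \<alpha> A \<longleftrightarrow>
     \<alpha> \<in> N \<rightarrow>\<^sub>M seminorm_borel q \<and>
     (\<exists>s. (\<forall>k. Bochner_Integration.simple_bochner_integrable N (s k) \<and> (\<forall>x\<in>space N. q (s k x) < \<infinity>)) \<and>
          (\<lambda>k. \<integral>\<^sup>+x. seminorm_of q (\<alpha> x - s k x) \<partial>N) \<longlonglongrightarrow> 0 \<and>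
          (\<lambda>k. q (Bochner_Integration.simple_bochner_integral N (s k) - A)) \<longlonglongrightarrow> 0)"


section \<open>Stochastic processes on $[0,\bar S]$\<close>

definition standard_wiener :: "'w measure \<Rightarrow> real \<Rightarrow> (real \<Rightarrow> 'w \<Rightarrow> real) \<Rightarrow> bool" where
  "standard_wiener M Sb B \<longleftrightarrow>
     (\<forall>t\<in>{0..Sb}. B t \<in> borel_measurable M) \<and>
     (AE \<omega> in M. B 0 \<omega> = 0) \<and>
     (AE \<omega> in M. continuous_on {0..Sb} (\<lambda>t. B t \<omega>)) \<and>
     (\<forall>s t. 0 \<le> s \<and> s < t \<and> t \<le> Sb \<longrightarrow>
        distributed M lborel (\<lambda>\<omega>. B t \<omega> - B s \<omega>) (normal_density 0 (sqrt (t - s)))) \<and>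
     (\<forall>n \<tau>. 0 \<le> \<tau> 0 \<and> (\<forall>j<n. \<tau> j \<le> \<tau> (Suc j)) \<and> \<tau> n \<le> Sb \<longrightarrow>
        prob_space.indep_vars M (\<lambda>_. borel) (\<lambda>j \<omega>. B (\<tau> (Suc j)) \<omega> - B (\<tau> j) \<omega>) {..<n})"

definition usual_conditions :: "'w measure \<Rightarrow> real \<Rightarrow> (real \<Rightarrow> 'w measure) \<Rightarrow> bool" where
  "usual_conditions M Sb F \<longleftrightarrow>
     complete_measure M \<and>
     (\<forall>t\<in>{0..Sb}. subalgebra M (F t)) \<and>
     (\<forall>s t. 0 \<le> s \<and> s \<le> t \<and> t \<le> Sb \<longrightarrow> sets (F s) \<subseteq> sets (F t)) \<and>
     null_sets M \<subseteq> sets (F 0) \<and>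
     (\<forall>t\<in>{0..<Sb}. sets (F t) = (\<Inter>u\<in>{t<..Sb}. sets (F u)))"

definition wiener_generated ::
    "'w measure \<Rightarrow> real \<Rightarrow> (real \<Rightarrow> 'w measure) \<Rightarrow> (nat \<Rightarrow> real \<Rightarrow> 'w \<Rightarrow> real) \<Rightarrow> bool" where
  "wiener_generated M Sb F W \<longleftrightarrow>
     (\<forall>t\<in>{0..Sb}. sets (F t) = sigma_sets (space M)
        (null_sets M \<union> {W i s -` B \<inter> space M | i s B. s \<in> {0..t} \<and> B \<in> sets borel}))"

definition predictable_algebra ::
    "'w measure \<Rightarrow> real \<Rightarrow> (real \<Rightarrow> 'w measure) \<Rightarrow> (real \<times> 'w) measure" where
  "predictable_algebra M Sb F = sigma ({0..Sb} \<times> space M)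
     ({{0} \<times> A | A. A \<in> sets (F 0)} \<union>
      {{s<..t} \<times> A | s t A. 0 \<le> s \<and> s \<le> t \<and> t \<le> Sb \<and> A \<in> sets (F s)})"

definition martingale_on ::
    "'w measure \<Rightarrow> real \<Rightarrow> (real \<Rightarrow> 'w measure) \<Rightarrow> (real \<Rightarrow> 'w \<Rightarrow> real) \<Rightarrow> bool" where
  "martingale_on M Sb F X \<longleftrightarrow>
     (\<forall>t\<in>{0..Sb}. X t \<in> borel_measurable (F t) \<and> integrable M (X t)) \<and>
     (\<forall>s t. 0 \<le> s \<and> s \<le> t \<and> t \<le> Sb \<longrightarrow>
        (AE \<omega> in M. real_cond_exp M (F s) (X t) \<omega> = X s \<omega>))"


section \<open>The stochastic integral with respect to the cylindrical Wiener process\<close>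

text \<open>
  Elementary integrand: on \<open>(\<tau>\<^sub>j, \<tau>\<^sub>j\<^sub>+\<^sub>1]\<close>, \<open>j < n\<close>, it equals the finitely valued
  \<open>F \<tau>\<^sub>j\<close>-measurable random operator \<open>\<xi>\<^sub>j\<close>, which vanishes on \<open>e\<^sub>i\<close> for \<open>i \<ge> m\<close>.
\<close>

definition elementary_integrand ::
    "real \<Rightarrow> (real \<Rightarrow> 'w measure) \<Rightarrow> ('v::real_vector \<Rightarrow> ennreal) \<Rightarrow>
     nat \<Rightarrow> nat \<Rightarrow> (nat \<Rightarrow> real) \<Rightarrow> (nat \<Rightarrow> 'w \<Rightarrow> nat \<Rightarrow> 'v) \<Rightarrow> bool" where
  "elementary_integrand Sb F q n m \<tau> \<xi> \<longleftrightarrow>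
     0 \<le> \<tau> 0 \<and> (\<forall>j<n. \<tau> j \<le> \<tau> (Suc j)) \<and> \<tau> n \<le> Sb \<and>
     (\<forall>j<n. simple_function (F (\<tau> j)) (\<xi> j) \<and>
            (\<forall>\<omega>\<in>space (F (\<tau> j)). (\<forall>i. q (\<xi> j \<omega> i) < \<infinity>) \<and> (\<forall>i\<ge>m. \<xi> j \<omega> i = 0)))"

definition elementary_process ::
    "nat \<Rightarrow> (nat \<Rightarrow> real) \<Rightarrow> (nat \<Rightarrow> 'w \<Rightarrow> nat \<Rightarrow> 'v::real_vector) \<Rightarrow> real \<Rightarrow> 'w \<Rightarrow> nat \<Rightarrow> 'v" where
  "elementary_process n \<tau> \<xi> t \<omega> = (\<Sum>j<n. indicator {\<tau> j<..\<tau> (Suc j)} t *\<^sub>R \<xi> j \<omega>)"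

definition elementary_integral ::
    "(nat \<Rightarrow> real \<Rightarrow> 'w \<Rightarrow> real) \<Rightarrow> nat \<Rightarrow> nat \<Rightarrow> (nat \<Rightarrow> real) \<Rightarrow>
     (nat \<Rightarrow> 'w \<Rightarrow> nat \<Rightarrow> 'v::real_vector) \<Rightarrow> real \<Rightarrow> 'w \<Rightarrow> 'v" where
  "elementary_integral W n m \<tau> \<xi> t \<omega> =
     (\<Sum>j<n. \<Sum>i<m. (W i (min t (\<tau> (Suc j))) \<omega> - W i (min t (\<tau> j)) \<omega>) *\<^sub>R \<xi> j \<omega> i)"

text \<open>
  \<open>X\<close> is (a version of) the process $\int_0^t \Phi_s\,dW_s$, $t\in[0,\bar S]$: there are elementary
  \<open>\<Phi>\<^sub>k\<close> with $\int_0^{\bar S}\|\Phi_k-\Phi\|_{HS}^2\,dt \to 0$ whose integrals converge to \<open>X\<close> uniformly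
  on $[0,\bar S]$.  Passing to subsequences, it makes no difference whether convergence is understood
  in probability or almost surely; the latter avoids measurability side conditions.
\<close>

definition has_stochastic_integral ::
    "'w measure \<Rightarrow> real \<Rightarrow> (real \<Rightarrow> 'w measure) \<Rightarrow> (nat \<Rightarrow> real \<Rightarrow> 'w \<Rightarrow> real) \<Rightarrow>
     ('v::real_vector \<Rightarrow> ennreal) \<Rightarrow> (real \<Rightarrow> 'w \<Rightarrow> nat \<Rightarrow> 'v) \<Rightarrow> (real \<Rightarrow> 'w \<Rightarrow> 'v) \<Rightarrow> bool" where
  "has_stochastic_integral M Sb F W q \<Phi> X \<longleftrightarrow>
     (\<exists>n m \<tau> \<xi>.
        (\<forall>k. elementary_integrand Sb F q (n k) (m k) (\<tau> k) (\<xi> k)) \<and>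
        (AE \<omega> in M.
           (\<lambda>k. \<integral>\<^sup>+t\<in>{0..Sb}. sqnorm_HS q (elementary_process (n k) (\<tau> k) (\<xi> k) t \<omega> - \<Phi> t \<omega>) \<partial>lborel)
             \<longlonglongrightarrow> 0) \<and>
        (AE \<omega> in M.
           (\<lambda>k. SUP t\<in>{0..Sb}. q (elementary_integral W (n k) (m k) (\<tau> k) (\<xi> k) t \<omega> - X t \<omega>))
             \<longlonglongrightarrow> 0))"


section \<open>The bond market\<close>

text \<open>
  \<open>f t \<omega> T\<close>, \<open>\<alpha> t \<omega> T\<close> and \<open>\<sigma> t \<omega> i T\<close> stand for $f(t,T)$, $\alpha(t,T)$ and $\sigma^i(t,T)$;
  the index \<open>i\<close> starts at \<open>0\<close>.
\<close>

locale bond_market = prob_space M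
  for M :: "'w measure"
    and Sb :: real
    and F :: "real \<Rightarrow> 'w measure"
    and W :: "nat \<Rightarrow> real \<Rightarrow> 'w \<Rightarrow> real"
    and f0 :: "real \<Rightarrow> real"
    and f :: "real \<Rightarrow> 'w \<Rightarrow> real \<Rightarrow> real"
    and \<alpha> :: "real \<Rightarrow> 'w \<Rightarrow> real \<Rightarrow> real"
    and \<sigma> :: "real \<Rightarrow> 'w \<Rightarrow> nat \<Rightarrow> real \<Rightarrow> real" +
  assumes horizon: "0 < Sb"
    and wiener: "\<And>i. standard_wiener M Sb (W i)"
    and wiener_indep:
      "indep_vars (\<lambda>_. Pi\<^sub>M {0..Sb} (\<lambda>_. borel)) (\<lambda>i \<omega>. \<lambda>t\<in>{0..Sb}. W i t \<omega>) UNIV"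
    and usual: "usual_conditions M Sb F"
    and generated: "wiener_generated M Sb F W"
    and initial_curve: "sqnorm_H Sb f0 < \<infinity>"
    and after_maturity:
      "AE \<omega> in M. \<forall>t\<in>{0..Sb}. \<forall>T\<in>{0..Sb}. T \<le> t \<longrightarrow> \<alpha> t \<omega> T = 0 \<and> (\<forall>i. \<sigma> t \<omega> i T = 0)"
    and drift_measurable:
      "(\<lambda>(t, \<omega>). \<alpha> t \<omega>) \<in> restrict_space borel {0..Sb} \<Otimes>\<^sub>M M \<rightarrow>\<^sub>M seminorm_borel (sqnorm_H Sb)"
    and drift_in_H: "\<And>t \<omega>. t \<in> {0..Sb} \<Longrightarrow> \<omega> \<in> space M \<Longrightarrow> sqnorm_H Sb (\<alpha> t \<omega>) < \<infinity>"
    and drift_integrable: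
      "AE \<omega> in M. (\<integral>\<^sup>+t\<in>{0..Sb}. seminorm_of (sqnorm_H Sb) (\<alpha> t \<omega>) \<partial>lborel) < \<infinity>"
    and volatility_predictable:
      "(\<lambda>(t, \<omega>). \<sigma> t \<omega>) \<in> predictable_algebra M Sb F \<rightarrow>\<^sub>M seminorm_borel (sqnorm_HS (sqnorm_H Sb))"
    and volatility_HS:
      "AE \<omega> in M. \<forall>t\<in>{0..Sb}. sqnorm_HS (sqnorm_H Sb) (\<sigma> t \<omega>) < \<infinity>"
    and volatility_integrable:
      "AE \<omega> in M. (\<integral>\<^sup>+t\<in>{0..Sb}. sqnorm_HS (sqnorm_H Sb) (\<sigma> t \<omega>) \<partial>lborel) < \<infinity>"
    and forward_rates:
      "\<exists>X. has_stochastic_integral M Sb F W (sqnorm_H Sb) \<sigma> X \<and>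
           (AE \<omega> in M. \<forall>t\<in>{0..Sb}. \<exists>A.
              has_seminorm_integral (sqnorm_H Sb) (restrict_space lborel {0..t}) (\<lambda>s. \<alpha> s \<omega>) A \<and>
              sqnorm_H Sb (f t \<omega> - (f0 + A + X t \<omega>)) = 0)"
    and HJM:
      "AE \<omega> in M. \<forall>t\<in>{0..Sb}. \<forall>T\<in>{0..Sb}.
         (LBINT u=t..T. \<alpha> t \<omega> u) = 1/2 * (\<Sum>i. (LBINT u=t..T. \<sigma> t \<omega> i u)\<^sup>2)"

definition discounted_price :: "(real \<Rightarrow> real) \<Rightarrow> real \<Rightarrow> real" where
  "discounted_price h T = exp (- (LINT u:{0..T}|lborel. h u))"

definition bond_volatility :: "(nat \<Rightarrow> real \<Rightarrow> real) \<Rightarrow> nat \<Rightarrow> real \<Rightarrow> real" where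
  "bond_volatility s i T = - (LINT u:{0..T}|lborel. s i u)"

text \<open>\<open>price_operator (f t \<omega>) (\<sigma> t \<omega>)\<close> is $\Gamma_t(\omega) : l^2 \to G$.\<close>

definition price_operator ::
    "(real \<Rightarrow> real) \<Rightarrow> (nat \<Rightarrow> real \<Rightarrow> real) \<Rightarrow> (nat \<Rightarrow> real) \<Rightarrow> real \<Rightarrow> real" where
  "price_operator h s u T = discounted_price h T * (\<Sum>i. bond_volatility s i T * u i)"

definition adjoint_l2 ::
    "((nat \<Rightarrow> real) \<Rightarrow> (real \<Rightarrow> real)) \<Rightarrow> ((real \<Rightarrow> real) \<Rightarrow> real) \<Rightarrow> nat \<Rightarrow> real" where
  "adjoint_l2 \<Gamma> \<phi> = (THE y. y \<in> l2 \<and> (\<forall>u\<in>l2. \<phi> (\<Gamma> u) = (\<Sum>i. y i * u i)))"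


section \<open>Trading strategies and completeness\<close>

definition point_mass_portfolios :: "real \<Rightarrow> ((real \<Rightarrow> real) \<Rightarrow> real) set" where
  "point_mass_portfolios Sb = {\<phi> \<in> Gdual Sb. \<exists>(m::enat) a \<tau>.
     (\<forall>i. enat i < m \<longrightarrow> \<tau> i \<in> {0..Sb}) \<and>
     summable (\<lambda>i. if enat i < m then \<bar>a i\<bar> else 0) \<and>
     (\<forall>g\<in>G_space Sb. \<phi> g = (\<Sum>i. if enat i < m then a i * g (\<tau> i) else 0))}"

text \<open>Finite signed measures are differences of two finite measures.\<close>

definition measure_portfolios :: "real \<Rightarrow> ((real \<Rightarrow> real) \<Rightarrow> real) set" where
  "measure_portfolios Sb = {\<phi> \<in> Gdual Sb. \<exists>\<mu> \<nu>.
     finite_measure \<mu> \<and> sets \<mu> = sets (restrict_space borel {0..Sb}) \<and>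
     finite_measure \<nu> \<and> sets \<nu> = sets (restrict_space borel {0..Sb}) \<and>
     (\<forall>g\<in>G_space Sb. \<phi> g = (LINT T|\<mu>. g T) - (LINT T|\<nu>. g T))}"

definition strategy_classes :: "real \<Rightarrow> ((real \<Rightarrow> real) \<Rightarrow> real) set set" where
  "strategy_classes Sb = {point_mass_portfolios Sb, measure_portfolios Sb, Gdual Sb}"

definition trading_strategy ::
    "'w measure \<Rightarrow> real \<Rightarrow> (real \<Rightarrow> 'w measure) \<Rightarrow> ((real \<Rightarrow> real) \<Rightarrow> real) set \<Rightarrow>
     (real \<Rightarrow> 'w \<Rightarrow> (real \<Rightarrow> real) \<Rightarrow> real) \<Rightarrow> bool" where
  "trading_strategy M Sb F K \<phi> \<longleftrightarrow>
     (\<lambda>(t, \<omega>). \<phi> t \<omega>) \<in> predictable_algebra M Sb F \<rightarrow>\<^sub>M seminorm_borel (sqnorm_Gdual Sb) \<and>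
     (\<forall>t\<in>{0..Sb}. \<forall>\<omega>\<in>space M. \<phi> t \<omega> \<in> K)"

text \<open>\<open>strategy_integrand f \<sigma> \<phi>\<close> is the \<open>l\<^sup>2\<close>-valued process $\Gamma_t^*\varphi_t$.\<close>

definition strategy_integrand ::
    "(real \<Rightarrow> 'w \<Rightarrow> real \<Rightarrow> real) \<Rightarrow> (real \<Rightarrow> 'w \<Rightarrow> nat \<Rightarrow> real \<Rightarrow> real) \<Rightarrow>
     (real \<Rightarrow> 'w \<Rightarrow> (real \<Rightarrow> real) \<Rightarrow> real) \<Rightarrow> real \<Rightarrow> 'w \<Rightarrow> nat \<Rightarrow> real" where
  "strategy_integrand f \<sigma> \<phi> t \<omega> = adjoint_l2 (price_operator (f t \<omega>) (\<sigma> t \<omega>)) (\<phi> t \<omega>)"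

definition price_integrable ::
    "'w measure \<Rightarrow> real \<Rightarrow> (real \<Rightarrow> 'w \<Rightarrow> real \<Rightarrow> real) \<Rightarrow>
     (real \<Rightarrow> 'w \<Rightarrow> nat \<Rightarrow> real \<Rightarrow> real) \<Rightarrow> (real \<Rightarrow> 'w \<Rightarrow> (real \<Rightarrow> real) \<Rightarrow> real) \<Rightarrow> bool" where
  "price_integrable M Sb f \<sigma> \<phi> \<longleftrightarrow>
     (AE \<omega> in M.
        (\<integral>\<^sup>+t\<in>{0..Sb}. sqnorm_HS sqnorm_real (strategy_integrand f \<sigma> \<phi> t \<omega>) \<partial>lborel) < \<infinity>)"

text \<open>
  \<open>X\<close> is a version of $\int_0^t \langle\varphi_s, d\hat P_s\rangle_{G^*,G}$, $t\in[0,\bar S]$; it is unique up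
  to indistinguishability.
\<close>

definition has_price_integral ::
    "'w measure \<Rightarrow> real \<Rightarrow> (real \<Rightarrow> 'w measure) \<Rightarrow> (nat \<Rightarrow> real \<Rightarrow> 'w \<Rightarrow> real) \<Rightarrow>
     (real \<Rightarrow> 'w \<Rightarrow> real \<Rightarrow> real) \<Rightarrow> (real \<Rightarrow> 'w \<Rightarrow> nat \<Rightarrow> real \<Rightarrow> real) \<Rightarrow>
     (real \<Rightarrow> 'w \<Rightarrow> (real \<Rightarrow> real) \<Rightarrow> real) \<Rightarrow> (real \<Rightarrow> 'w \<Rightarrow> real) \<Rightarrow> bool" where
  "has_price_integral M Sb F W f \<sigma> \<phi> X \<longleftrightarrow>
     has_stochastic_integral M Sb F W sqnorm_real (strategy_integrand f \<sigma> \<phi>) X"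

text \<open>
  An integral process of \<open>\<phi>\<close> exists whenever \<open>\<phi>\<close> is integrable; all its versions are
  indistinguishable, so (the filtration being complete) one of them is a martingale iff all are.
\<close>

definition admissible ::
    "'w measure \<Rightarrow> real \<Rightarrow> (real \<Rightarrow> 'w measure) \<Rightarrow> (nat \<Rightarrow> real \<Rightarrow> 'w \<Rightarrow> real) \<Rightarrow>
     (real \<Rightarrow> 'w \<Rightarrow> real \<Rightarrow> real) \<Rightarrow> (real \<Rightarrow> 'w \<Rightarrow> nat \<Rightarrow> real \<Rightarrow> real) \<Rightarrow>
     ((real \<Rightarrow> real) \<Rightarrow> real) set \<Rightarrow> (real \<Rightarrow> 'w \<Rightarrow> (real \<Rightarrow> real) \<Rightarrow> real) \<Rightarrow> bool" where
  "admissible M Sb F W f \<sigma> K \<phi> \<longleftrightarrow>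
     trading_strategy M Sb F K \<phi> \<and>
     price_integrable M Sb f \<sigma> \<phi> \<and>
     (\<forall>X. has_price_integral M Sb F W f \<sigma> \<phi> X \<longrightarrow> martingale_on M Sb F X)"

definition market_complete ::
    "'w measure \<Rightarrow> real \<Rightarrow> (real \<Rightarrow> 'w measure) \<Rightarrow> (nat \<Rightarrow> real \<Rightarrow> 'w \<Rightarrow> real) \<Rightarrow>
     (real \<Rightarrow> 'w \<Rightarrow> real \<Rightarrow> real) \<Rightarrow> (real \<Rightarrow> 'w \<Rightarrow> nat \<Rightarrow> real \<Rightarrow> real) \<Rightarrow>
     ((real \<Rightarrow> real) \<Rightarrow> real) set \<Rightarrow> real \<Rightarrow> bool" where
  "market_complete M Sb F W f \<sigma> K S \<longleftrightarrow>
     (\<forall>\<xi>. \<xi> \<in> borel_measurable (F S) \<and> (\<exists>B. \<forall>\<omega>\<in>space M. \<bar>\<xi> \<omega>\<bar> \<le> B) \<longrightarrow>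
        (\<exists>c \<phi> X. admissible M Sb F W f \<sigma> K \<phi> \<and> has_price_integral M Sb F W f \<sigma> \<phi> X \<and>
                 (AE \<omega> in M. \<xi> \<omega> = c + X S \<omega>)))"

end

theory Submission
  imports Defs
begin

text \<open>
  The coordinate \<open>i\<close> of $\Gamma_t^*\varphi_t$ is bounded by $C(t,\omega)\,|\sigma^i_t|_H$, and these
  norms tend to zero. By the Borel-Cantelli argument there is a deterministic subsequence $r$ with
  $|\sigma^{r_k}_t|_H \le 4^{-k}$ eventually, for almost all $(t,\omega)$. Put $Y_{r_k} = 2^{-k}$ and
  $Y_i = 0$ otherwise: no nonzero multiple of $Y$ is of the form $\Gamma_t^*\varphi_t$. The claim
  $\xi = \sin(\sum_i Y_i W^i_S)$ is orthogonal to the increments $c \cdot dW$ for all finitely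
  supported \<open>c\<close> orthogonal to $Y$. Hence the integrand of any representation of $\xi$ would be parallel
  to $Y$ almost everywhere, so it would vanish, and $\xi$ would be constant.

  Stochastic calculus is avoided in the orthogonality step: approximating elementary integrands are stopped
  along their grid once their quadratic variation exceeds a constant. The stopped sums have
  exponential moments, so that they converge in $L^2$, while the martingale property lets them be
  tested against the component along \<open>c\<close>.
\<close>

section \<open>Wiener increments are independent of the past\<close>

text \<open>The adjoint of \<Gamma> is Hilbert-Schmidt, so at a fixed (t, \<omega>) its range is not
  all of l2. The obstacle is that the missed directions move with (t, \<omega>), whereas the claim
  is fixed beforehand; a rate of decay shared by almost all (t, \<omega>) along one subsequence
  removes this dependence. The sine is chosen because it is bounded and odd. Moving the Gaussian
  variable Z by h times an increment in a direction orthogonal to Y changes the variance only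
  through h^2, so the characteristic function is even in h, and its odd part, which contains sin Z
  times the increment, vanishes. A second obstacle is the notion of integral: it provides almost
  sure limits of elementary integrals, without moments. The martingale X has a bounded value at S,
  hence is bounded up to S, and the stopped elementary sums approach the equally stopped X; the
  isometry for elementary sums then suffices. Finally the integrand is a pathwise definite
  description, so its coordinates must be identified and shown to be measurable in time before its
  integrals can be estimated.\<close>

lemma sets_preimage:
  assumes "f \<in> M \<rightarrow>\<^sub>M N" "B \<in> sets N"
  shows "{x\<in>space M. f x \<in> B} \<in> sets M"
proof -
  have "{x\<in>space M. f x \<in> B} = f -` B \<inter> space M" by auto
  then show ?thesis using measurable_sets[OF assms] by simp
qed

text \<open>The noise and its filtration alone. All estimates for stochastic integrals live here;
  the bond market becomes an instance once its integrands are to be analysed.\<close>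

locale cylindrical_wiener = prob_space M
  for M :: "'w measure" and Sb :: real and F :: "real \<Rightarrow> 'w measure"
    and W :: "nat \<Rightarrow> real \<Rightarrow> 'w \<Rightarrow> real" +
  assumes horizon: "0 < Sb"
    and wiener: "\<And>i. standard_wiener M Sb (W i)"
    and wiener_indep:
      "indep_vars (\<lambda>_. Pi\<^sub>M {0..Sb} (\<lambda>_. borel)) (\<lambda>i \<omega>. \<lambda>t\<in>{0..Sb}. W i t \<omega>) UNIV"
    and usual: "usual_conditions M Sb F"
    and generated: "wiener_generated M Sb F W"
begin

lemma W_meas: "t \<in> {0..Sb} \<Longrightarrow> W i t \<in> borel_measurable M"
  using wiener by (auto simp: standard_wiener_def)

lemma F_subalgebra: "t \<in> {0..Sb} \<Longrightarrow> subalgebra M (F t)"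
  using usual by (auto simp: usual_conditions_def)

lemma F_space: "t \<in> {0..Sb} \<Longrightarrow> space (F t) = space M"
  using F_subalgebra by (auto simp: subalgebra_def)

lemma F_sets_M: "t \<in> {0..Sb} \<Longrightarrow> A \<in> sets (F t) \<Longrightarrow> A \<in> sets M"
  using F_subalgebra by (auto simp: subalgebra_def)

lemma F_mono: "0 \<le> s \<Longrightarrow> s \<le> t \<Longrightarrow> t \<le> Sb \<Longrightarrow> sets (F s) \<subseteq> sets (F t)"
  using usual by (auto simp: usual_conditions_def)

lemma F_meas_mono:
  assumes "0 \<le> s" "s \<le> t" "t \<le> Sb" "f \<in> F s \<rightarrow>\<^sub>M N"
  shows "f \<in> F t \<rightarrow>\<^sub>M N"
proof -
  have "space (F s) = space (F t)" using F_space[of s] F_space[of t] assms by auto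
  then show ?thesis using assms(4) F_mono[OF assms(1-3)]
    unfolding measurable_def by auto
qed

lemma F_meas_M:
  assumes "t \<in> {0..Sb}" "f \<in> F t \<rightarrow>\<^sub>M N"
  shows "f \<in> M \<rightarrow>\<^sub>M N"
  using measurable_from_subalg[OF F_subalgebra[OF assms(1)] assms(2)] .

lemma W_adapted:
  assumes "0 \<le> s" "s \<le> t" "t \<le> Sb"
  shows "W i s \<in> borel_measurable (F t)"
proof (rule measurableI)
  fix B :: "real set" assume "B \<in> sets borel"
  then have "W i s -` B \<inter> space M \<in> sigma_sets (space M)
        (null_sets M \<union> {W i s -` B \<inter> space M | i s B. s \<in> {0..t} \<and> B \<in> sets borel})"
    using assms by (intro sigma_sets.Basic) auto
  then show "W i s -` B \<inter> space (F t) \<in> sets (F t)"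
    using generated assms F_space[of t] by (auto simp: wiener_generated_def)
qed auto

text \<open>Rectangles at finitely many times: together they form a pi-system for the past, and
  \<open>inc\<close> is the counterpart for the increments over one interval.\<close>

definition cyl :: "nat \<Rightarrow> real set \<Rightarrow> (nat \<Rightarrow> real \<Rightarrow> real set) \<Rightarrow> 'w set" where
  "cyl m R B = {\<omega>\<in>space M. \<forall>i<m. \<forall>r\<in>R. W i r \<omega> \<in> B i r}"

definition inc :: "nat \<Rightarrow> real \<Rightarrow> real \<Rightarrow> (nat \<Rightarrow> real set) \<Rightarrow> 'w set" where
  "inc m s t D = {\<omega>\<in>space M. \<forall>i<m. W i t \<omega> - W i s \<omega> \<in> D i}"

text \<open>\<open>standard_wiener\<close> supplies independence only for successive increments
  along a finite grid. The values at the times in R become partial sums of such increments once 0,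
  s, R and finally t are lined up in one grid.\<close>

lemma increment_indep_past:
  assumes st: "0 \<le> s" "s \<le> t" "t \<le> Sb" and R: "finite R" "R \<subseteq> {0..s}"
    and B: "\<And>r. B r \<in> sets borel" and D: "D \<in> sets borel"
  shows "prob {\<omega>\<in>space M. (\<forall>r\<in>R. W i r \<omega> \<in> B r) \<and> W i t \<omega> - W i s \<omega> \<in> D} =
     prob {\<omega>\<in>space M. \<forall>r\<in>R. W i r \<omega> \<in> B r} * prob {\<omega>\<in>space M. W i t \<omega> - W i s \<omega> \<in> D}"
proof -
  define L where "L = sorted_list_of_set (insert 0 (insert s R))"
  define n where "n = length L - 1"
  \<comment> \<open>t is appended after the sorted list, so that increment number n runs exactly
    from s to t and the earlier ones cover [0, s].\<close>
  define \<tau> where "\<tau> j = (if j \<le> n then L ! j else t)" for j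
  have setL: "set L = insert 0 (insert s R)" using R unfolding L_def by (subst set_sorted_list_of_set) auto
  have sL: "sorted L" by (simp add: L_def)
  have lenL: "length L = Suc n" using setL unfolding n_def by (cases L) auto
  have rng: "L ! j \<in> {0..s}" if "j \<le> n" for j
  proof -
    have "L ! j \<in> set L" using that lenL by (intro nth_mem) auto
    then show ?thesis using setL R st by auto
  qed
  have t0: "\<tau> 0 = 0"
  proof -
    obtain k where "k < length L" "L ! k = 0" using setL by (metis in_set_conv_nth insertI1)
    then have "L ! 0 \<le> 0" using sorted_nth_mono[OF sL, of 0 k] by auto
    then show ?thesis using rng[of 0] by (auto simp: \<tau>_def)
  qed
  have tn: "\<tau> n = s"
  proof -
    obtain k where "k < length L" "L ! k = s" using setL by (metis in_set_conv_nth insertI1 insertI2)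
    then have "s \<le> L ! n" using sorted_nth_mono[OF sL, of k n] lenL by auto
    then show ?thesis using rng[of n] by (auto simp: \<tau>_def)
  qed
  have tSn: "\<tau> (Suc n) = t" by (simp add: \<tau>_def)
  have tmono: "\<tau> j \<le> \<tau> (Suc j)" if "j < Suc n" for j
    using that sorted_nth_mono[OF sL, of j "Suc j"] rng[of j] lenL st by (auto simp: \<tau>_def)
  define Z where "Z j \<omega> = W i (\<tau> (Suc j)) \<omega> - W i (\<tau> j) \<omega>" for j \<omega>
  have iv: "indep_vars (\<lambda>_. borel) Z {..<Suc n}"
    using wiener[of i] t0 tmono tSn st unfolding standard_wiener_def Z_def by auto
  have ivr: "indep_var (PiM {..<n} (\<lambda>_. borel)) (\<lambda>\<omega>. restrict (\<lambda>j. Z j \<omega>) {..<n})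
      (PiM {n} (\<lambda>_. borel)) (\<lambda>\<omega>. restrict (\<lambda>j. Z j \<omega>) {n})"
    by (rule indep_var_restrict[OF iv]) auto
  \<comment> \<open>The past event read off the increments alone; a time r in R enters through its
    index k in the grid.\<close>
  define A1 where "A1 = {x \<in> space (PiM {..<n} (\<lambda>_. borel :: real measure)).
      \<forall>k\<in>{k. k \<le> n \<and> \<tau> k \<in> R}. (\<Sum>j<k. x j) \<in> B (\<tau> k)}"
  define A2 where "A2 = {x \<in> space (PiM {n} (\<lambda>_. borel :: real measure)). x n \<in> D}"
  have A1: "A1 \<in> sets (PiM {..<n} (\<lambda>_. borel))"
    unfolding A1_def
  proof (rule sets.sets_Collect_finite_All)
    fix k assume k: "k \<in> {k. k \<le> n \<and> \<tau> k \<in> R}"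
    have "(\<lambda>x. \<Sum>j<k. x j) \<in> borel_measurable (PiM {..<n} (\<lambda>_. borel :: real measure))"
      using k by (intro borel_measurable_sum measurable_component_singleton) auto
    from sets_preimage[OF this B[of "\<tau> k"]]
    show "{x \<in> space (PiM {..<n} (\<lambda>_. borel :: real measure)). (\<Sum>j<k. x j) \<in> B (\<tau> k)}
      \<in> sets (PiM {..<n} (\<lambda>_. borel))" .
  qed (use R in auto)
  have A2: "A2 \<in> sets (PiM {n} (\<lambda>_. borel))"
    unfolding A2_def using D by measurable
  have Wsum: "W i (\<tau> k) \<omega> = W i 0 \<omega> + (\<Sum>j<k. Z j \<omega>)" for k \<omega>
    unfolding Z_def using t0 sum_lessThan_telescope[of "\<lambda>j. W i (\<tau> j) \<omega>" k] by simp
  have ex: "\<exists>k\<le>n. \<tau> k = r" if "r \<in> R" for r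
  proof -
    have "r \<in> set L" using setL that by auto
    then obtain k where "k < length L" "L ! k = r" unfolding in_set_conv_nth by auto
    then show ?thesis using lenL by (intro exI[of _ k]) (auto simp: \<tau>_def)
  qed
  let ?X1 = "\<lambda>\<omega>. restrict (\<lambda>j. Z j \<omega>) {..<n}" and ?X2 = "\<lambda>\<omega>. restrict (\<lambda>j. Z j \<omega>) {n}"
  have key1: "(\<forall>r\<in>R. W i r \<omega> \<in> B r) \<longleftrightarrow> ?X1 \<omega> \<in> A1" if "W i 0 \<omega> = 0" for \<omega>
  proof -
    have "(\<forall>r\<in>R. W i r \<omega> \<in> B r) \<longleftrightarrow> (\<forall>k\<in>{k. k \<le> n \<and> \<tau> k \<in> R}. W i (\<tau> k) \<omega> \<in> B (\<tau> k))"
      using ex by fastforce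
    also have "\<dots> \<longleftrightarrow> (\<forall>k\<in>{k. k \<le> n \<and> \<tau> k \<in> R}. (\<Sum>j<k. ?X1 \<omega> j) \<in> B (\<tau> k))"
    proof (rule ball_cong[OF refl])
      fix k assume k: "k \<in> {k. k \<le> n \<and> \<tau> k \<in> R}"
      have "(\<Sum>j<k. ?X1 \<omega> j) = (\<Sum>j<k. Z j \<omega>)" using k by (intro sum.cong) auto
      then show "W i (\<tau> k) \<omega> \<in> B (\<tau> k) \<longleftrightarrow> (\<Sum>j<k. ?X1 \<omega> j) \<in> B (\<tau> k)"
        using Wsum[of k \<omega>] that by auto
    qed
    also have "\<dots> \<longleftrightarrow> ?X1 \<omega> \<in> A1" by (auto simp: A1_def space_PiM)
    finally show ?thesis .
  qed
  have key2: "W i t \<omega> - W i s \<omega> \<in> D \<longleftrightarrow> ?X2 \<omega> \<in> A2" for \<omega>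
    by (auto simp: A2_def space_PiM Z_def tn tSn)
  have W0: "AE \<omega> in M. W i 0 \<omega> = 0" using wiener[of i] by (auto simp: standard_wiener_def)
  have m1: "?X1 -` A1 \<inter> space M \<in> events" and m2: "?X2 -` A2 \<inter> space M \<in> events"
    using indep_var_rv1[OF ivr] indep_var_rv2[OF ivr] A1 A2 by (auto intro: measurable_sets)
  have mR: "{\<omega>\<in>space M. \<forall>r\<in>R. W i r \<omega> \<in> B r} \<in> events"
  proof (rule sets.sets_Collect_finite_All)
    fix r assume "r \<in> R"
    then have "r \<in> {0..Sb}" using R st by auto
    then show "{\<omega> \<in> space M. W i r \<omega> \<in> B r} \<in> events"
      by (rule sets_preimage[OF W_meas B])
  qed (use R in auto)
  have eq2: "{\<omega>\<in>space M. W i t \<omega> - W i s \<omega> \<in> D} = ?X2 -` A2 \<inter> space M"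
    using key2 by auto
  have "prob {\<omega>\<in>space M. (\<forall>r\<in>R. W i r \<omega> \<in> B r) \<and> W i t \<omega> - W i s \<omega> \<in> D}
      = prob ((?X1 -` A1 \<inter> space M) \<inter> (?X2 -` A2 \<inter> space M))"
  \<comment> \<open>Path values and partial sums differ by W i 0, which vanishes only almost surely,
    so the events agree up to a null set.\<close>
  proof (rule finite_measure_eq_AE)
    show "AE \<omega> in M. (\<omega> \<in> {\<omega>\<in>space M. (\<forall>r\<in>R. W i r \<omega> \<in> B r) \<and> W i t \<omega> - W i s \<omega> \<in> D})
       = (\<omega> \<in> (?X1 -` A1 \<inter> space M) \<inter> (?X2 -` A2 \<inter> space M))"
      using W0 by eventually_elim (use key1 key2 in auto)
    have "{\<omega>\<in>space M. (\<forall>r\<in>R. W i r \<omega> \<in> B r) \<and> W i t \<omega> - W i s \<omega> \<in> D} =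
       {\<omega>\<in>space M. \<forall>r\<in>R. W i r \<omega> \<in> B r} \<inter> (?X2 -` A2 \<inter> space M)" using key2 by auto
    then show "{\<omega>\<in>space M. (\<forall>r\<in>R. W i r \<omega> \<in> B r) \<and> W i t \<omega> - W i s \<omega> \<in> D} \<in> events"
      using mR m2 by auto
  qed (use m1 m2 in auto)
  also have "\<dots> = prob ((\<lambda>x. (?X1 x, ?X2 x)) -` (A1 \<times> A2) \<inter> space M)"
    by (rule arg_cong[of _ _ prob]) auto
  also have "\<dots> = prob (?X1 -` A1 \<inter> space M) * prob (?X2 -` A2 \<inter> space M)"
    by (rule indep_varD[OF ivr A1 A2])
  also have "prob (?X1 -` A1 \<inter> space M) = prob {\<omega>\<in>space M. \<forall>r\<in>R. W i r \<omega> \<in> B r}"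
  proof (rule finite_measure_eq_AE)
    show "AE \<omega> in M. (\<omega> \<in> ?X1 -` A1 \<inter> space M) = (\<omega> \<in> {\<omega>\<in>space M. \<forall>r\<in>R. W i r \<omega> \<in> B r})"
      using W0 by eventually_elim (use key1 in auto)
  qed (use m1 mR in auto)
  finally show ?thesis unfolding eq2 .
qed

lemma path_prod:
  assumes "\<And>i. A i \<in> sets (PiM {0..Sb} (\<lambda>_. borel :: real measure))"
  shows "prob {\<omega>\<in>space M. \<forall>i<m. (\<lambda>t\<in>{0..Sb}. W i t \<omega>) \<in> A i} =
    (\<Prod>i<m. prob {\<omega>\<in>space M. (\<lambda>t\<in>{0..Sb}. W i t \<omega>) \<in> A i})"
proof (cases "m = 0")
  \<comment> \<open>For m = 0 the intersection used below would be \<open>UNIV\<close> instead of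
    \<open>space M\<close>.\<close>
  case True then show ?thesis by (simp add: prob_space)
next
  case False
  have "prob (\<Inter>i\<in>{..<m}. (\<lambda>\<omega>. \<lambda>t\<in>{0..Sb}. W i t \<omega>) -` A i \<inter> space M)
     = (\<Prod>i\<in>{..<m}. prob ((\<lambda>\<omega>. \<lambda>t\<in>{0..Sb}. W i t \<omega>) -` A i \<inter> space M))"
    using False by (intro indep_varsD[OF wiener_indep]) (auto simp: assms)
  moreover have "(\<Inter>i\<in>{..<m}. (\<lambda>\<omega>. \<lambda>t\<in>{0..Sb}. W i t \<omega>) -` A i \<inter> space M) =
     {\<omega>\<in>space M. \<forall>i<m. (\<lambda>t\<in>{0..Sb}. W i t \<omega>) \<in> A i}" using False by auto
  moreover have "(\<lambda>\<omega>. \<lambda>t\<in>{0..Sb}. W i t \<omega>) -` A i \<inter> space M =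
      {\<omega>\<in>space M. (\<lambda>t\<in>{0..Sb}. W i t \<omega>) \<in> A i}" for i by auto
  ultimately show ?thesis by simp
qed

text \<open>Independence of the coordinates factors both sides over i < m, and
  \<open>increment_indep_past\<close> splits every factor.\<close>

lemma cyl_inc_indep:
  assumes st: "0 \<le> s" "s \<le> t" "t \<le> Sb" and R: "finite R" "R \<subseteq> {0..s}"
    and B: "\<And>i r. B i r \<in> sets borel" and D: "\<And>i. D i \<in> sets borel"
  shows "prob (cyl m R B \<inter> inc m s t D) = prob (cyl m R B) * prob (inc m s t D)"
proof -
  let ?P = "PiM {0..Sb} (\<lambda>_. borel :: real measure)"
  define A1 where "A1 i = {x\<in>space ?P. \<forall>r\<in>R. x r \<in> B i r}" for i
  define A2 where "A2 i = {x\<in>space ?P. x t - x s \<in> D i}" for i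
  have RS: "r \<in> R \<Longrightarrow> r \<in> {0..Sb}" for r using R st by auto
  have comp: "(\<lambda>x. x r) \<in> borel_measurable ?P" if "r \<in> {0..Sb}" for r
    using that by (rule measurable_component_singleton)
  have A1: "A1 i \<in> sets ?P" for i
    unfolding A1_def
  proof (rule sets.sets_Collect_finite_All)
    fix r assume "r \<in> R"
    from sets_preimage[OF comp[OF RS[OF this]] B[of i r]]
    show "{x \<in> space ?P. x r \<in> B i r} \<in> sets ?P" .
  qed (use R in auto)
  have A2: "A2 i \<in> sets ?P" for i
  proof -
    have "(\<lambda>x. x t - x s) \<in> borel_measurable ?P"
      using st by (intro borel_measurable_diff comp) auto
    from sets_preimage[OF this D[of i]] show ?thesis
      by (simp only: A2_def)
  qed
  let ?X = "\<lambda>i \<omega>. \<lambda>t\<in>{0..Sb}. W i t \<omega>"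
  have sp: "?X i \<omega> \<in> space ?P" for i \<omega> by (simp add: space_PiM)
  have e1: "?X i \<omega> \<in> A1 i \<longleftrightarrow> (\<forall>r\<in>R. W i r \<omega> \<in> B i r)" for i \<omega>
    using sp RS by (auto simp: A1_def)
  have e2: "?X i \<omega> \<in> A2 i \<longleftrightarrow> W i t \<omega> - W i s \<omega> \<in> D i" for i \<omega>
    using sp st by (auto simp: A2_def)
  have "cyl m R B \<inter> inc m s t D = {\<omega>\<in>space M. \<forall>i<m. ?X i \<omega> \<in> A1 i \<inter> A2 i}"
    unfolding cyl_def inc_def Int_iff e1 e2 by auto
  then have "prob (cyl m R B \<inter> inc m s t D) = (\<Prod>i<m. prob {\<omega>\<in>space M. ?X i \<omega> \<in> A1 i \<inter> A2 i})"
    using path_prod[of "\<lambda>i. A1 i \<inter> A2 i" m] A1 A2 by auto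
  also have "\<dots> = (\<Prod>i<m. prob {\<omega>\<in>space M. ?X i \<omega> \<in> A1 i} * prob {\<omega>\<in>space M. ?X i \<omega> \<in> A2 i})"
    unfolding Int_iff e1 e2 using increment_indep_past[OF st R B D] by simp
  also have "\<dots> = prob {\<omega>\<in>space M. \<forall>i<m. ?X i \<omega> \<in> A1 i} * prob {\<omega>\<in>space M. \<forall>i<m. ?X i \<omega> \<in> A2 i}"
    using path_prod[of A1 m] path_prod[of A2 m] A1 A2 by (simp add: prod.distrib)
  finally show ?thesis unfolding e1 e2 cyl_def inc_def .
qed

lemma cyl_event:
  assumes "finite R" "R \<subseteq> {0..Sb}" "\<And>i r. B i r \<in> sets borel"
  shows "cyl m R B \<in> events"
proof -
  have "{\<omega>\<in>space M. \<forall>i\<in>{..<m}. \<forall>r\<in>R. W i r \<omega> \<in> B i r} \<in> events"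
  proof (rule sets.sets_Collect_finite_All, rule sets.sets_Collect_finite_All)
    fix i r assume "r \<in> R"
    then have "r \<in> {0..Sb}" using assms(2) by auto
    then show "{\<omega> \<in> space M. W i r \<omega> \<in> B i r} \<in> events"
      by (rule sets_preimage[OF W_meas assms(3)])
  qed (use assms in auto)
  then show ?thesis unfolding cyl_def by (simp only: lessThan_iff Ball_def)
qed

lemma inc_event:
  assumes "0 \<le> s" "s \<le> t" "t \<le> Sb" "\<And>i. D i \<in> sets borel"
  shows "inc m s t D \<in> events"
proof -
  have "{\<omega>\<in>space M. \<forall>i\<in>{..<m}. W i t \<omega> - W i s \<omega> \<in> D i} \<in> events"
  proof (rule sets.sets_Collect_finite_All)
    fix i
    have "(\<lambda>\<omega>. W i t \<omega> - W i s \<omega>) \<in> borel_measurable M"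
      using assms by (intro borel_measurable_diff W_meas) auto
    then show "{\<omega> \<in> space M. W i t \<omega> - W i s \<omega> \<in> D i} \<in> events"
      by (rule sets_preimage[OF _ assms(4)])
  qed auto
  then show ?thesis unfolding inc_def by (simp only: lessThan_iff Ball_def)
qed

text \<open>Both sides are generated by pi-systems: null sets with cylinders for the past, increment
  rectangles for the future. Null sets are independent of everything and absorb intersections, so
  adding them keeps stability under intersection.\<close>

lemma filtration_indep_increments:
  assumes st: "0 \<le> s" "s \<le> t" "t \<le> Sb"
  shows "indep_set (sets (F s))
    (sigma_sets (space M) {inc m s t D | D. \<forall>i. D i \<in> sets (borel :: real measure)})"
proof -
  \<comment> \<open>Cylinders involve at least m coordinates; an increment rectangle can then be
    padded with \<open>UNIV\<close> to the same number of coordinates.\<close>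
  define CY where "CY = {cyl k R B | k R B. m \<le> k \<and> finite R \<and> R \<subseteq> {0..s} \<and> (\<forall>i r. B i r \<in> sets (borel :: real measure))}"
  define IN where "IN = {inc m s t D | D. \<forall>i. D i \<in> sets (borel :: real measure)}"
  have CYe: "CY \<subseteq> events" using cyl_event st by (fastforce simp: CY_def)
  have ind: "indep_set (null_sets M \<union> CY) IN"
    unfolding indep_sets2_eq
  proof (intro conjI ballI)
    show "null_sets M \<union> CY \<subseteq> events" using CYe by auto
    show "IN \<subseteq> events" using inc_event[OF st] by (auto simp: IN_def)
    fix a b assume a: "a \<in> null_sets M \<union> CY" and b: "b \<in> IN"
    from b obtain D where D: "b = inc m s t D" "\<And>i. D i \<in> sets borel" by (auto simp: IN_def)
    then have be: "b \<in> events" using inc_event[OF st] by auto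
    from a show "prob (a \<inter> b) = prob a * prob b"
    proof
      assume n: "a \<in> null_sets M"
      then have "a \<inter> b \<in> null_sets M" using be null_set_Int2 by blast
      with n show ?thesis by (simp add: measure_eq_0_null_sets)
    next
      assume "a \<in> CY"
      then obtain k R B where k: "a = cyl k R B" "m \<le> k" "finite R" "R \<subseteq> {0..s}" "\<And>i r. B i r \<in> sets borel"
        by (auto simp: CY_def)
      have "b = inc k s t (\<lambda>i. if i < m then D i else UNIV)"
        using D k(2) by (auto simp: inc_def)
      then show ?thesis using cyl_inc_indep[OF st k(3,4,5), of "\<lambda>i. if i < m then D i else UNIV" k] D k(1) by auto
    qed
  qed
  have st1: "Int_stable (null_sets M \<union> CY)"
  proof (rule Int_stableI)
    fix a b assume a: "a \<in> null_sets M \<union> CY" and b: "b \<in> null_sets M \<union> CY"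
    have ae: "a \<in> events" and be: "b \<in> events" using a b CYe by auto
    show "a \<inter> b \<in> null_sets M \<union> CY"
    proof (cases "a \<in> null_sets M \<or> b \<in> null_sets M")
      case True then show ?thesis using ae be null_set_Int1 null_set_Int2 by blast
    next
      case False
      then obtain k R B k' R' B' where
        1: "a = cyl k R B" "m \<le> k" "finite R" "R \<subseteq> {0..s}" "\<And>i r. B i r \<in> sets borel" and
        2: "b = cyl k' R' B'" "m \<le> k'" "finite R'" "R' \<subseteq> {0..s}" "\<And>i r. B' i r \<in> sets borel"
        using a b by (auto simp: CY_def)
      \<comment> \<open>Both cylinders are written over the union of their times, with
        \<open>UNIV\<close> in the positions that one of them leaves free.\<close>
      have "a \<inter> b = cyl (max k k') (R \<union> R')
         (\<lambda>i r. (if i < k \<and> r \<in> R then B i r else UNIV) \<inter> (if i < k' \<and> r \<in> R' then B' i r else UNIV))"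
        (is "_ = ?c")
      proof (rule set_eqI, rule iffI)
        fix \<omega> assume "\<omega> \<in> a \<inter> b"
        then show "\<omega> \<in> ?c" unfolding 1 2 cyl_def by (auto split: if_splits)
      next
        fix \<omega> assume c: "\<omega> \<in> ?c"
        have "W i r \<omega> \<in> B i r" if "i < k" "r \<in> R" for i r
        proof -
          have "i < max k k'" "r \<in> R \<union> R'" using that by auto
          then show ?thesis using c that unfolding cyl_def by (auto split: if_splits)
        qed
        moreover have "W i r \<omega> \<in> B' i r" if "i < k'" "r \<in> R'" for i r
        proof -
          have "i < max k k'" "r \<in> R \<union> R'" using that by auto
          then show ?thesis using c that unfolding cyl_def by (auto split: if_splits)
        qed
        ultimately show "\<omega> \<in> a \<inter> b" using c unfolding 1 2 cyl_def by auto
      qed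
      moreover have "?c \<in> CY"
      proof -
        have "cyl k R B \<in> CY" if "m \<le> k" "finite R" "R \<subseteq> {0..s}" "\<And>i r. B i r \<in> sets borel" for k R B
          unfolding CY_def using that by blast
        from this[of "max k k'" "R \<union> R'"] show ?thesis using 1 2 by (simp add: sets.Int)
      qed
      ultimately show ?thesis by auto
    qed
  qed
  have st2: "Int_stable IN"
  proof (rule Int_stableI)
    fix a b assume "a \<in> IN" "b \<in> IN"
    then obtain D D' where "a = inc m s t D" "\<And>i. D i \<in> sets borel" "b = inc m s t D'" "\<And>i. D' i \<in> sets borel"
      by (auto simp: IN_def)
    moreover from this have "inc m s t (\<lambda>i. D i \<inter> D' i) \<in> IN" unfolding IN_def by blast
    moreover have "inc m s t (\<lambda>i. D i \<inter> D' i) = inc m s t D \<inter> inc m s t D'" by (auto simp: inc_def)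
    ultimately show "a \<inter> b \<in> IN" by simp
  qed
  have "indep_set (sigma_sets (space M) (null_sets M \<union> CY)) (sigma_sets (space M) IN)"
    by (rule indep_set_sigma_sets[OF ind st1 st2])
  moreover have "sets (F s) \<subseteq> sigma_sets (space M) (null_sets M \<union> CY)"
  proof -
    have "sets (F s) = sigma_sets (space M)
        (null_sets M \<union> {W i r -` B \<inter> space M | i r B. r \<in> {0..s} \<and> B \<in> sets borel})"
      using generated st by (auto simp: wiener_generated_def)
    also have "\<dots> \<subseteq> sigma_sets (space M) (null_sets M \<union> CY)"
    proof (rule sigma_sets_mono')
      have "W i r -` B \<inter> space M \<in> CY" if "r \<in> {0..s}" "B \<in> sets borel" for i r B
      proof -
        have "W i r -` B \<inter> space M = cyl (max m (Suc i)) {r} (\<lambda>j q. if j = i then B else UNIV)"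
          by (auto simp: cyl_def)
        moreover have "cyl (max m (Suc i)) {r} (\<lambda>j q. if j = i then B else UNIV) \<in> CY"
          unfolding CY_def using that by (intro CollectI exI conjI refl) auto
        ultimately show ?thesis by simp
      qed
      then show "null_sets M \<union> {W i r -` B \<inter> space M | i r B. r \<in> {0..s} \<and> B \<in> sets borel} \<subseteq> null_sets M \<union> CY"
        by blast
    qed
    finally show ?thesis .
  qed
  ultimately show ?thesis
    unfolding indep_sets2_eq IN_def by blast
qed

end

section \<open>Integrability criteria and Gaussian moments of increments with random
  coefficients\<close>

definition sqsum :: "nat \<Rightarrow> (nat \<Rightarrow> real) \<Rightarrow> real" where
  "sqsum m v = (\<Sum>i<m. (v i)\<^sup>2)"

definition ip :: "nat \<Rightarrow> (nat \<Rightarrow> real) \<Rightarrow> (nat \<Rightarrow> real) \<Rightarrow> real" where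
  "ip m v w = (\<Sum>i<m. v i * w i)"

lemma sqsum_nonneg: "0 \<le> sqsum m v"
  by (auto simp: sqsum_def intro: sum_nonneg)

lemma (in prob_space) integrable_of_square:
  fixes f :: "'a \<Rightarrow> real"
  assumes "f \<in> borel_measurable M" "integrable M (\<lambda>x. (f x)\<^sup>2)"
  shows "integrable M f"
proof (rule Bochner_Integration.integrable_bound[of M "\<lambda>x. 1 + (f x)\<^sup>2"])
  show "AE x in M. norm (f x) \<le> norm (1 + (f x)\<^sup>2)"
  proof (intro AE_I2)
    fix x have "0 \<le> (\<bar>f x\<bar> - 1)\<^sup>2" by simp
    also have "(\<bar>f x\<bar> - 1)\<^sup>2 = (f x)\<^sup>2 - 2 * \<bar>f x\<bar> + 1" by (simp add: power2_diff)
    finally have "\<bar>f x\<bar> \<le> 1 + (f x)\<^sup>2" using abs_ge_zero[of "f x"] by linarith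
    then show "norm (f x) \<le> norm (1 + (f x)\<^sup>2)" by (simp add: abs_of_nonneg)
  qed
qed (use assms in auto)

lemma integrable_mult_of_squares:
  fixes f g :: "'a \<Rightarrow> real"
  assumes "f \<in> borel_measurable M" "g \<in> borel_measurable M"
    "integrable M (\<lambda>x. (f x)\<^sup>2)" "integrable M (\<lambda>x. (g x)\<^sup>2)"
  shows "integrable M (\<lambda>x. f x * g x)"
proof (rule Bochner_Integration.integrable_bound[of M "\<lambda>x. (f x)\<^sup>2 + (g x)\<^sup>2"])
  show "AE x in M. norm (f x * g x) \<le> norm ((f x)\<^sup>2 + (g x)\<^sup>2)"
  proof (intro AE_I2)
    fix x have "0 \<le> (\<bar>f x\<bar> - \<bar>g x\<bar>)\<^sup>2" by simp
    moreover have "(\<bar>f x\<bar> - \<bar>g x\<bar>)\<^sup>2 = (f x)\<^sup>2 - 2 * (\<bar>f x\<bar> * \<bar>g x\<bar>) + (g x)\<^sup>2"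
      by (simp add: power2_diff)
    moreover have "0 \<le> \<bar>f x\<bar> * \<bar>g x\<bar>" by simp
    ultimately have "\<bar>f x\<bar> * \<bar>g x\<bar> \<le> (f x)\<^sup>2 + (g x)\<^sup>2" by linarith
    then show "norm (f x * g x) \<le> norm ((f x)\<^sup>2 + (g x)\<^sup>2)" by (simp add: abs_mult abs_of_nonneg)
  qed
qed (use assms in auto)

lemma integrable_mult_bounded:
  fixes f g :: "'a \<Rightarrow> real"
  assumes "integrable M f" "g \<in> borel_measurable M" "\<And>x. x \<in> space M \<Longrightarrow> \<bar>g x\<bar> \<le> K"
  shows "integrable M (\<lambda>x. f x * g x)"
proof (rule Bochner_Integration.integrable_bound[of M "\<lambda>x. K * f x"])
  show "AE x in M. norm (f x * g x) \<le> norm (K * f x)"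
  proof (intro AE_I2)
    fix x assume "x \<in> space M"
    then have "\<bar>g x\<bar> \<le> \<bar>K\<bar>" using assms(3) by fastforce
    then show "norm (f x * g x) \<le> norm (K * f x)"
      using mult_right_mono[of "\<bar>g x\<bar>" "\<bar>K\<bar>" "\<bar>f x\<bar>"] by (simp add: abs_mult mult.commute)
  qed
qed (use assms in auto)

text \<open>The freezing principle. The events z = v are finitely many and lie in N, so their
  indicators can be moved into the weight H, and on each of them the coefficient is constant. In the
  applications G v is a function of the increment with coefficients v, and g v is its mean.\<close>

lemma (in prob_space) freezing_simple_function:
  fixes G :: "'b \<Rightarrow> 'a \<Rightarrow> real" and H :: "'a \<Rightarrow> real"
  assumes sub: "subalgebra M N" and z: "simple_function N z"
    and H: "H \<in> borel_measurable N" "integrable M H"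
    and G: "\<And>v H. H \<in> borel_measurable N \<Longrightarrow> integrable M H \<Longrightarrow>
       integrable M (\<lambda>\<omega>. H \<omega> * G v \<omega>) \<and> (\<integral>\<omega>. H \<omega> * G v \<omega> \<partial>M) = (\<integral>\<omega>. H \<omega> \<partial>M) * g v"
  shows "integrable M (\<lambda>\<omega>. H \<omega> * G (z \<omega>) \<omega>)"
    and "(\<integral>\<omega>. H \<omega> * G (z \<omega>) \<omega> \<partial>M) = (\<integral>\<omega>. H \<omega> * g (z \<omega>) \<partial>M)"
    and "integrable M (\<lambda>\<omega>. H \<omega> * g (z \<omega>))"
proof -
  have sp: "space N = space M" using sub by (simp add: subalgebra_def)
  define V where "V = z ` space M"
  have fin: "finite V" using z sp by (simp add: simple_function_def V_def)
  define Hv where "Hv v \<omega> = H \<omega> * indicator (z -` {v} \<inter> space M) \<omega>" for v \<omega>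
  have setv: "z -` {v} \<inter> space M \<in> sets N" for v
    using simple_functionD(2)[OF z, of "{v}"] sp by simp
  have setvM: "z -` {v} \<inter> space M \<in> sets M" for v
    using setv[of v] sub by (auto simp: subalgebra_def)
  have Hv1: "Hv v \<in> borel_measurable N" for v
    unfolding Hv_def using H setv by (intro borel_measurable_times borel_measurable_indicator) auto
  have Hv2: "integrable M (Hv v)" for v
    unfolding Hv_def using H setvM by (intro integrable_real_mult_indicator) auto
  have rep: "H \<omega> * K (z \<omega>) = (\<Sum>v\<in>V. Hv v \<omega> * K v)" if "\<omega> \<in> space M" for \<omega> K
  proof -
    have "(\<Sum>v\<in>V. Hv v \<omega> * K v) = (\<Sum>v\<in>V. if v = z \<omega> then H \<omega> * K v else 0)"
      using that by (intro sum.cong) (auto simp: Hv_def)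
    also have "\<dots> = H \<omega> * K (z \<omega>)" using fin that by (simp add: V_def)
    finally show ?thesis by simp
  qed
  have int: "integrable M (\<lambda>\<omega>. \<Sum>v\<in>V. Hv v \<omega> * G v \<omega>)"
    using G[OF Hv1 Hv2] by (intro Bochner_Integration.integrable_sum) auto
  show "integrable M (\<lambda>\<omega>. H \<omega> * G (z \<omega>) \<omega>)"
    using int by (rule Bochner_Integration.integrable_cong[THEN iffD1, OF refl, rotated])
       (metis rep)
  show "integrable M (\<lambda>\<omega>. H \<omega> * g (z \<omega>))"
  proof -
    have "integrable M (\<lambda>\<omega>. \<Sum>v\<in>V. Hv v \<omega> * g v)"
      using Hv2 by (intro Bochner_Integration.integrable_sum) auto
    then show ?thesis
      by (rule Bochner_Integration.integrable_cong[THEN iffD1, OF refl, rotated]) (metis rep)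
  qed
  have "(\<integral>\<omega>. H \<omega> * G (z \<omega>) \<omega> \<partial>M) = (\<integral>\<omega>. (\<Sum>v\<in>V. Hv v \<omega> * G v \<omega>) \<partial>M)"
    by (rule Bochner_Integration.integral_cong[OF refl]) (metis rep)
  also have "\<dots> = (\<Sum>v\<in>V. (\<integral>\<omega>. Hv v \<omega> * G v \<omega> \<partial>M))"
    using G[OF Hv1 Hv2] by (intro Bochner_Integration.integral_sum) auto
  also have "\<dots> = (\<Sum>v\<in>V. (\<integral>\<omega>. Hv v \<omega> * g v \<partial>M))"
    using G[OF Hv1 Hv2] by (intro sum.cong) auto
  also have "\<dots> = (\<integral>\<omega>. (\<Sum>v\<in>V. Hv v \<omega> * g v) \<partial>M)"
    using Hv2 by (intro Bochner_Integration.integral_sum[symmetric]) auto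
  also have "\<dots> = (\<integral>\<omega>. H \<omega> * g (z \<omega>) \<partial>M)"
    by (rule Bochner_Integration.integral_cong[OF refl]) (metis rep)
  finally show "(\<integral>\<omega>. H \<omega> * G (z \<omega>) \<omega> \<partial>M) = (\<integral>\<omega>. H \<omega> * g (z \<omega>) \<partial>M)" .
qed

text \<open>Completing the square: the exponential tilts the density to mean \<sigma>^2 and leaves
  the factor \<open>exp (\<sigma>\<^sup>2 / 2)\<close>.\<close>

lemma integrable_normal_density_exp:
  assumes "0 < \<sigma>"
  shows "has_bochner_integral lborel (\<lambda>x. normal_density 0 \<sigma> x * exp x) (exp (\<sigma>\<^sup>2 / 2))"
proof -
  have *: "normal_density 0 \<sigma> x * exp x = exp (\<sigma>\<^sup>2 / 2) * normal_density (\<sigma>\<^sup>2) \<sigma> x" for x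
  proof -
    have "- x\<^sup>2 / (2 * \<sigma>\<^sup>2) + x = \<sigma>\<^sup>2 / 2 + (- (x - \<sigma>\<^sup>2)\<^sup>2 / (2 * \<sigma>\<^sup>2))"
      using assms by (simp add: field_simps power2_eq_square)
    then have "exp (- x\<^sup>2 / (2 * \<sigma>\<^sup>2)) * exp x = exp (\<sigma>\<^sup>2 / 2) * exp (- (x - \<sigma>\<^sup>2)\<^sup>2 / (2 * \<sigma>\<^sup>2))"
      by (metis exp_add)
    then show ?thesis by (simp add: normal_density_def)
  qed
  have "has_bochner_integral lborel (\<lambda>x. exp (\<sigma>\<^sup>2 / 2) * normal_density (\<sigma>\<^sup>2) \<sigma> x) (exp (\<sigma>\<^sup>2 / 2) * 1)"
    using assms by (intro has_bochner_integral_mult_right)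
       (auto simp: has_bochner_integral_iff)
  then show ?thesis by (simp add: *)
qed

context cylindrical_wiener begin

definition dW :: "nat \<Rightarrow> (nat \<Rightarrow> real) \<Rightarrow> real \<Rightarrow> real \<Rightarrow> 'w \<Rightarrow> real" where
  "dW m v s t \<omega> = (\<Sum>i<m. v i * (W i t \<omega> - W i s \<omega>))"

lemma dW_adapted:
  assumes "0 \<le> s" "s \<le> t" "t \<le> u" "u \<le> Sb"
  shows "dW m v s t \<in> borel_measurable (F u)"
  unfolding dW_def using assms
  by (intro borel_measurable_sum borel_measurable_times borel_measurable_diff W_adapted) auto

lemma dW_meas:
  assumes "0 \<le> s" "s \<le> t" "t \<le> Sb"
  shows "dW m v s t \<in> borel_measurable M"
  using F_meas_M[OF _ dW_adapted[of s t t]] assms by auto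

text \<open>The increment is measurable for the sigma-algebra of the rectangles \<open>inc\<close>,
  which \<open>filtration_indep_increments\<close> separates from F s. The target spaces are general
  because \<open>step_char\<close> multiplies complex weights by complex exponentials.\<close>

lemma dW_indep_map:
  assumes st: "0 \<le> s" "s \<le> t" "t \<le> Sb" and H: "H \<in> F s \<rightarrow>\<^sub>M N" and g: "g \<in> borel \<rightarrow>\<^sub>M N'"
  shows "indep_var N H N' (\<lambda>\<omega>. g (dW m v s t \<omega>))"
proof -
  let ?IN = "{inc m s t D | D. \<forall>i. D i \<in> sets (borel :: real measure)}"
  let ?S = "sigma (space M) ?IN"
  have sub: "?IN \<subseteq> Pow (space M)" by (auto simp: inc_def)
  have c: "(\<lambda>\<omega>. W i t \<omega> - W i s \<omega>) \<in> borel_measurable ?S" if "i < m" for i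
  proof (rule measurableI)
    fix D :: "real set" assume "D \<in> sets borel"
    then have "inc m s t (\<lambda>j. if j = i then D else UNIV) \<in> ?IN" by auto
    moreover have "(\<lambda>\<omega>. W i t \<omega> - W i s \<omega>) -` D \<inter> space ?S = inc m s t (\<lambda>j. if j = i then D else UNIV)"
      using that sub by (auto simp: space_measure_of inc_def)
    ultimately show "(\<lambda>\<omega>. W i t \<omega> - W i s \<omega>) -` D \<inter> space ?S \<in> sets ?S"
      using sub by (auto intro: sigma_sets.Basic)
  qed auto
  have "dW m v s t \<in> borel_measurable ?S"
    unfolding dW_def using c by (intro borel_measurable_sum borel_measurable_times) auto
  from measurable_compose[OF this g] have d: "(\<lambda>\<omega>. g (dW m v s t \<omega>)) \<in> ?S \<rightarrow>\<^sub>M N'" .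
  have HM: "H \<in> M \<rightarrow>\<^sub>M N" using F_meas_M[OF _ H] st by auto
  have ind: "indep_set (sets (F s)) (sigma_sets (space M) ?IN)"
    by (rule filtration_indep_increments[OF st])
  interpret S: sigma_algebra "space M" "sigma_sets (space M) ?IN"
    using sub by (rule sigma_algebra_sigma_sets)
  have spF: "space (F s) = space M" using F_space st by auto
  have "{H -` A \<inter> space M |A. A \<in> sets N} \<subseteq> sets (F s)"
    using measurable_sets[OF H] spF by auto
  from sets.sigma_sets_subset[OF this]
  have "sigma_sets (space M) {H -` A \<inter> space M |A. A \<in> sets N} \<subseteq> sets (F s)"
    by (simp only: spF)
  moreover have "sigma_sets (space M) {(\<lambda>\<omega>. g (dW m v s t \<omega>)) -` A \<inter> space M |A. A \<in> sets N'} \<subseteq> sigma_sets (space M) ?IN"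
    using measurable_sets[OF d] sub by (intro S.sigma_sets_subset) (auto simp: sets_measure_of space_measure_of)
  ultimately have "indep_set (sigma_sets (space M) {H -` A \<inter> space M |A. A \<in> sets N})
      (sigma_sets (space M) {(\<lambda>\<omega>. g (dW m v s t \<omega>)) -` A \<inter> space M |A. A \<in> sets N'})"
    using ind unfolding indep_sets2_eq by (meson subset_trans subsetD)
  then show ?thesis
    using HM measurable_compose[OF dW_meas[OF st, of m v] g] unfolding indep_var_eq by (intro conjI)
qed

lemma dW_indep:
  assumes "0 \<le> s" "s \<le> t" "t \<le> Sb" "H \<in> F s \<rightarrow>\<^sub>M borel"
  shows "indep_var borel H borel (dW m v s t)"
  using dW_indep_map[OF assms, of "\<lambda>x. x" borel m v] by simp

lemma increments_indep:
  assumes st: "0 \<le> s" "s \<le> t" "t \<le> Sb"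
  shows "indep_vars (\<lambda>_. borel) (\<lambda>i \<omega>. W i t \<omega> - W i s \<omega>) UNIV"
proof -
  have "indep_vars (\<lambda>_. borel) (\<lambda>i \<omega>. (\<lambda>x. x t - x s) (\<lambda>t\<in>{0..Sb}. W i t \<omega>)) UNIV"
    using st by (intro indep_vars_compose2[OF wiener_indep] borel_measurable_diff measurable_component_singleton) auto
  then show ?thesis using st by simp
qed

lemma dW_normal:
  assumes st: "0 \<le> s" "s < t" "t \<le> Sb" and v: "0 < sqsum m v"
  shows "distributed M lborel (dW m v s t) (normal_density 0 (sqrt (sqsum m v * (t - s))))"
proof -
  \<comment> \<open>Zero coefficients are dropped, since the sum rule for independent normal
    variables asks for positive standard deviations.\<close>
  let ?I = "{i. i < m \<and> v i \<noteq> 0}"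
  have n2I: "sqsum m v = (\<Sum>i\<in>?I. (v i)\<^sup>2)"
    unfolding sqsum_def by (rule sum.mono_neutral_right) auto
  have ne: "?I \<noteq> {}" using v n2I by fastforce
  have dI: "dW m v s t = (\<lambda>\<omega>. \<Sum>i\<in>?I. v i * (W i t \<omega> - W i s \<omega>))"
    unfolding dW_def by (intro ext sum.mono_neutral_right) auto
  have "distributed M lborel (\<lambda>\<omega>. \<Sum>i\<in>?I. v i * (W i t \<omega> - W i s \<omega>))
      (normal_density (\<Sum>i\<in>?I. 0) (sqrt (\<Sum>i\<in>?I. (\<bar>v i\<bar> * sqrt (t - s))\<^sup>2)))"
  proof (rule sum_indep_normal)
    show "indep_vars (\<lambda>i. borel) (\<lambda>i \<omega>. v i * (W i t \<omega> - W i s \<omega>)) ?I"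
      using st by (intro indep_vars_compose2[OF indep_vars_subset[OF increments_indep, of s t ?I]]) auto
    fix i assume i: "i \<in> ?I"
    then show "0 < \<bar>v i\<bar> * sqrt (t - s)" using st by auto
    have "distributed M lborel (\<lambda>\<omega>. W i t \<omega> - W i s \<omega>) (normal_density 0 (sqrt (t - s)))"
      using wiener[of i] st by (auto simp: standard_wiener_def)
    from normal_density_affine[OF this, of "v i" 0] i st
    show "distributed M lborel (\<lambda>\<omega>. v i * (W i t \<omega> - W i s \<omega>)) (normal_density 0 (\<bar>v i\<bar> * sqrt (t - s)))"
      by simp
  qed (use ne in auto)
  moreover have "(\<Sum>i\<in>?I. (\<bar>v i\<bar> * sqrt (t - s))\<^sup>2) = sqsum m v * (t - s)"
    using st by (simp add: n2I power_mult_distrib sum_distrib_right)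
  ultimately show ?thesis using dI by simp
qed

text \<open>The degenerate increment has no Lebesgue density, so every moment formula treats it
  apart from \<open>dW_normal\<close>; \<open>sqsum_cases\<close> is the case split.\<close>

lemma dW_trivial:
  assumes "s = t \<or> sqsum m v = 0"
  shows "dW m v s t \<omega> = 0"
proof -
  have "sqsum m v = 0 \<Longrightarrow> \<forall>i\<in>{..<m}. v i = 0"
    unfolding sqsum_def by (subst (asm) sum_nonneg_eq_0_iff) auto
  then show ?thesis using assms by (auto simp: dW_def intro!: sum.neutral)
qed

lemma sqsum_cases:
  fixes s t :: real
  assumes "s \<le> t"
  obtains "s = t \<or> sqsum m v = 0" | "s < t" "0 < sqsum m v"
  using assms sqsum_nonneg[of m v] by (metis order_le_less)

lemma dW_mean:
  assumes st: "0 \<le> s" "s \<le> t" "t \<le> Sb"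
  shows "integrable M (dW m v s t)" "(\<integral>\<omega>. dW m v s t \<omega> \<partial>M) = 0"
proof -
  have "integrable M (dW m v s t) \<and> (\<integral>\<omega>. dW m v s t \<omega> \<partial>M) = 0"
  proof (cases rule: sqsum_cases[OF st(2), of m v])
    case 1 then show ?thesis using dW_trivial[of s t m v] by (simp add: fun_eq_iff[symmetric] cong: Bochner_Integration.integrable_cong)
  next
    case 2
    then have D: "distributed M lborel (dW m v s t) (normal_density 0 (sqrt (sqsum m v * (t - s))))" and
      p: "0 < sqrt (sqsum m v * (t - s))" using dW_normal st by auto
    show ?thesis
      using distributed_integrable[OF D, of "\<lambda>x. x"] normal_distributed_expectation[OF p D]
        integrable_normal_moment_nz_1[OF p, of 0] by simp
  qed
  then show "integrable M (dW m v s t)" "(\<integral>\<omega>. dW m v s t \<omega> \<partial>M) = 0" by auto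
qed

lemma dW_square:
  assumes st: "0 \<le> s" "s \<le> t" "t \<le> Sb"
  shows "integrable M (\<lambda>\<omega>. (dW m v s t \<omega>)\<^sup>2)" "(\<integral>\<omega>. (dW m v s t \<omega>)\<^sup>2 \<partial>M) = sqsum m v * (t - s)"
proof -
  have "integrable M (\<lambda>\<omega>. (dW m v s t \<omega>)\<^sup>2) \<and> (\<integral>\<omega>. (dW m v s t \<omega>)\<^sup>2 \<partial>M) = sqsum m v * (t - s)"
  proof (cases rule: sqsum_cases[OF st(2), of m v])
    case 1 then show ?thesis using dW_trivial[of s t m v] by auto
  next
    case 2
    then have D: "distributed M lborel (dW m v s t) (normal_density 0 (sqrt (sqsum m v * (t - s))))" and
      p: "0 < sqrt (sqsum m v * (t - s))" using dW_normal st by auto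
    show ?thesis
      using distributed_integrable[OF D, of "\<lambda>x. x\<^sup>2"] normal_distributed_variance[OF p D]
        integrable_normal_moment[OF p, of 0 2] dW_mean(2)[OF st] 2 by simp
  qed
  then show "integrable M (\<lambda>\<omega>. (dW m v s t \<omega>)\<^sup>2)" "(\<integral>\<omega>. (dW m v s t \<omega>)\<^sup>2 \<partial>M) = sqsum m v * (t - s)" by auto
qed

lemma dW_exp:
  assumes st: "0 \<le> s" "s \<le> t" "t \<le> Sb"
  shows "integrable M (\<lambda>\<omega>. exp (dW m v s t \<omega>))" "(\<integral>\<omega>. exp (dW m v s t \<omega>) \<partial>M) = exp (sqsum m v * (t - s) / 2)"
proof -
  have "integrable M (\<lambda>\<omega>. exp (dW m v s t \<omega>)) \<and> (\<integral>\<omega>. exp (dW m v s t \<omega>) \<partial>M) = exp (sqsum m v * (t - s) / 2)"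
  proof (cases rule: sqsum_cases[OF st(2), of m v])
    case 1 then show ?thesis using dW_trivial[of s t m v] by (auto simp: prob_space)
  next
    case 2
    then have D: "distributed M lborel (dW m v s t) (normal_density 0 (sqrt (sqsum m v * (t - s))))" and
      p: "0 < sqrt (sqsum m v * (t - s))" using dW_normal st by auto
    have q: "(sqrt (sqsum m v * (t - s)))\<^sup>2 = sqsum m v * (t - s)" using 2 by simp
    show ?thesis
      using distributed_integrable[OF D, of "exp"] distributed_integral[OF D, of exp]
        integrable_normal_density_exp[OF p] unfolding q by (simp add: has_bochner_integral_iff)
  qed
  then show "integrable M (\<lambda>\<omega>. exp (dW m v s t \<omega>))" "(\<integral>\<omega>. exp (dW m v s t \<omega>) \<partial>M) = exp (sqsum m v * (t - s) / 2)" by auto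
qed

lemma dW_char:
  assumes st: "0 \<le> s" "s \<le> t" "t \<le> Sb"
  shows "(\<integral>\<omega>. iexp (dW m v s t \<omega>) \<partial>M) = exp (- (sqsum m v * (t - s) / 2))"
proof (cases rule: sqsum_cases[OF st(2), of m v])
  case 1 then show ?thesis using dW_trivial[of s t m v] by (auto simp: prob_space)
next
  case 2
  define \<sigma> where "\<sigma> = sqrt (sqsum m v * (t - s))"
  have D: "distributed M lborel (dW m v s t) (normal_density 0 \<sigma>)" and
      p: "0 < \<sigma>" using 2 dW_normal st by (auto simp: \<sigma>_def)
  have q: "\<sigma>\<^sup>2 = sqsum m v * (t - s)" using 2 by (simp add: \<sigma>_def)
  define Z where "Z \<omega> = (dW m v s t \<omega> - 0) / \<sigma>" for \<omega>
  have DZ: "distributed M lborel Z std_normal_density"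
    using normal_standard_normal_convert[OF p] D unfolding Z_def by blast
  have Zm: "Z \<in> borel_measurable M" unfolding Z_def using dW_meas[OF st] by simp
  have "(\<integral>\<omega>. iexp (dW m v s t \<omega>) \<partial>M) = (\<integral>\<omega>. iexp (\<sigma> * Z \<omega>) \<partial>M)"
    using p by (simp add: Z_def)
  also have "\<dots> = (\<integral>x. iexp (\<sigma> * x) \<partial>distr M lborel Z)"
    using Zm by (subst integral_distr) auto
  also have "distr M lborel Z = std_normal_distribution"
    using DZ by (simp add: distributed_def)
  also have "(\<integral>x. iexp (\<sigma> * x) \<partial>std_normal_distribution) = exp (- (\<sigma>\<^sup>2) / 2)"
    using char_std_normal_distribution by (simp add: char_def fun_eq_iff)
  finally show ?thesis by (simp add: q)
qed

text \<open>For constant coefficients independence factors the expectation and the second factor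
  vanishes; freezing extends this to simple random coefficients.\<close>

lemma step_mean:
  assumes st: "0 \<le> s" "s \<le> t" "t \<le> Sb" and H: "H \<in> borel_measurable (F s)" "integrable M H"
    and z: "simple_function (F s) z"
  shows "integrable M (\<lambda>\<omega>. H \<omega> * dW m (z \<omega>) s t \<omega>)" "(\<integral>\<omega>. H \<omega> * dW m (z \<omega>) s t \<omega> \<partial>M) = 0"
proof -
  have *: "integrable M (\<lambda>\<omega>. H \<omega> * dW m v s t \<omega>) \<and> (\<integral>\<omega>. H \<omega> * dW m v s t \<omega> \<partial>M) = (\<integral>\<omega>. H \<omega> \<partial>M) * 0"
    if "H \<in> borel_measurable (F s)" "integrable M H" for v H
    using indep_var_integrable[OF dW_indep[OF st that(1), of m v] that(2)]
      indep_var_lebesgue_integral[OF dW_indep[OF st that(1), of m v] that(2)] dW_mean[OF st] by simp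
  have sub: "subalgebra M (F s)" using F_subalgebra st by auto
  note fr = freezing_simple_function[where G="\<lambda>v. dW m v s t" and g="\<lambda>_. 0", OF sub z H *]
  show "integrable M (\<lambda>\<omega>. H \<omega> * dW m (z \<omega>) s t \<omega>)" by (rule fr(1))
  show "(\<integral>\<omega>. H \<omega> * dW m (z \<omega>) s t \<omega> \<partial>M) = 0" using fr(2) by (simp only: mult_zero_right Bochner_Integration.integral_zero)
qed

lemma step_square:
  assumes st: "0 \<le> s" "s \<le> t" "t \<le> Sb"
    and z: "simple_function (F s) z"
  shows "integrable M (\<lambda>\<omega>. (dW m (z \<omega>) s t \<omega>)\<^sup>2)"
     "(\<integral>\<omega>. (dW m (z \<omega>) s t \<omega>)\<^sup>2 \<partial>M) = (\<integral>\<omega>. sqsum m (z \<omega>) * (t - s) \<partial>M)"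
     "integrable M (\<lambda>\<omega>. sqsum m (z \<omega>) * (t - s))"
proof -
  have *: "integrable M (\<lambda>\<omega>. H \<omega> * (dW m v s t \<omega>)\<^sup>2) \<and>
      (\<integral>\<omega>. H \<omega> * (dW m v s t \<omega>)\<^sup>2 \<partial>M) = (\<integral>\<omega>. H \<omega> \<partial>M) * (sqsum m v * (t - s))"
    if "H \<in> borel_measurable (F s)" "integrable M H" for v H
  proof -
    have i: "indep_var borel H borel (\<lambda>\<omega>. (dW m v s t \<omega>)\<^sup>2)"
      using indep_var_compose[OF dW_indep[OF st that(1), of m v], of "\<lambda>x. x" borel "\<lambda>x. x\<^sup>2" borel] by (simp add: comp_def)
    show ?thesis
      using indep_var_integrable[OF i that(2)] indep_var_lebesgue_integral[OF i that(2)] dW_square[OF st] by simp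
  qed
  have sub: "subalgebra M (F s)" using F_subalgebra st by auto
  have one: "(\<lambda>_. 1 :: real) \<in> borel_measurable (F s)" "integrable M (\<lambda>_. 1 :: real)" by auto
  note fr = freezing_simple_function[where G="\<lambda>v \<omega>. (dW m v s t \<omega>)\<^sup>2" and g="\<lambda>v. sqsum m v * (t - s)", OF sub z one *]
  show "integrable M (\<lambda>\<omega>. (dW m (z \<omega>) s t \<omega>)\<^sup>2)" using fr(1) by (simp only: mult_1)
  show "(\<integral>\<omega>. (dW m (z \<omega>) s t \<omega>)\<^sup>2 \<partial>M) = (\<integral>\<omega>. sqsum m (z \<omega>) * (t - s) \<partial>M)" using fr(2) by (simp only: mult_1)
  show "integrable M (\<lambda>\<omega>. sqsum m (z \<omega>) * (t - s))" using fr(3) by (simp only: mult_1)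
qed

text \<open>The exponent is compensated by half its conditional variance, so the exponential factor
  has conditional mean one.\<close>

lemma step_exp:
  assumes st: "0 \<le> s" "s \<le> t" "t \<le> Sb" and H: "H \<in> borel_measurable (F s)" "integrable M H"
    and z: "simple_function (F s) z"
  shows "integrable M (\<lambda>\<omega>. H \<omega> * exp (dW m (z \<omega>) s t \<omega> - sqsum m (z \<omega>) * (t - s) / 2))"
    "(\<integral>\<omega>. H \<omega> * exp (dW m (z \<omega>) s t \<omega> - sqsum m (z \<omega>) * (t - s) / 2) \<partial>M) = (\<integral>\<omega>. H \<omega> \<partial>M)"
proof -
  have *: "integrable M (\<lambda>\<omega>. H \<omega> * exp (dW m v s t \<omega> - sqsum m v * (t - s) / 2)) \<and>
     (\<integral>\<omega>. H \<omega> * exp (dW m v s t \<omega> - sqsum m v * (t - s) / 2) \<partial>M) = (\<integral>\<omega>. H \<omega> \<partial>M) * 1"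
    if "H \<in> borel_measurable (F s)" "integrable M H" for v H
  proof -
    have i: "indep_var borel H borel (\<lambda>\<omega>. exp (dW m v s t \<omega> - sqsum m v * (t - s) / 2))"
      using indep_var_compose[OF dW_indep[OF st that(1), of m v], of "\<lambda>x. x" borel "\<lambda>x. exp (x - sqsum m v * (t - s) / 2)" borel] by (simp add: comp_def)
    have e: "exp (dW m v s t \<omega> - sqsum m v * (t - s) / 2) = exp (dW m v s t \<omega>) / exp (sqsum m v * (t - s) / 2)" for \<omega>
      by (rule exp_diff)
    have "integrable M (\<lambda>\<omega>. exp (dW m v s t \<omega> - sqsum m v * (t - s) / 2))"
      "(\<integral>\<omega>. exp (dW m v s t \<omega> - sqsum m v * (t - s) / 2) \<partial>M) = 1"
      unfolding e using dW_exp[OF st, of m v] by auto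
    then show ?thesis
      using indep_var_integrable[OF i that(2)] indep_var_lebesgue_integral[OF i that(2)] by simp
  qed
  have sub: "subalgebra M (F s)" using F_subalgebra st by auto
  note fr = freezing_simple_function[where G="\<lambda>v \<omega>. exp (dW m v s t \<omega> - sqsum m v * (t - s) / 2)" and g="\<lambda>_. 1", OF sub z H *]
  show "integrable M (\<lambda>\<omega>. H \<omega> * exp (dW m (z \<omega>) s t \<omega> - sqsum m (z \<omega>) * (t - s) / 2))" by (rule fr(1))
  show "(\<integral>\<omega>. H \<omega> * exp (dW m (z \<omega>) s t \<omega> - sqsum m (z \<omega>) * (t - s) / 2) \<partial>M) = (\<integral>\<omega>. H \<omega> \<partial>M)"
    using fr(2) by (simp only: mult_1_right)
qed

end

section \<open>Stochastic integrals of simple integrands\<close>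

text \<open>Serves to turn exponential moments of both signs into a fourth moment.\<close>

lemma pow4_le_exp: "(x::real)^4 \<le> 256 * (exp x + exp (- x))"
proof -
  have *: "y^4 \<le> 256 * exp y" if "0 \<le> y" for y :: real
  proof -
    \<comment> \<open>The upper bound \<open>exp y\<close> for \<open>(1 + y / n)^n\<close> with n =
      4; the constant 256 is \<open>4^4\<close>.\<close>
    have "(y / 4)^4 \<le> (1 + y / 4)^4" using that by (intro power_mono) auto
    also have "\<dots> \<le> exp y" using exp_ge_one_plus_x_over_n_power_n[of 4 y] that by simp
    finally show ?thesis by (simp add: power_divide)
  qed
  show ?thesis
  proof (cases "0 \<le> x")
    case True then show ?thesis using *[of x] exp_ge_zero[of "-x"] by (simp add: distrib_left) (meson add_increasing2 exp_ge_zero mult_nonneg_nonneg zero_le_numeral)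
  next
    case False then show ?thesis using *[of "-x"] exp_ge_zero[of x] by (simp add: distrib_left) (meson add_increasing exp_ge_zero mult_nonneg_nonneg zero_le_numeral)
  qed
qed

context cylindrical_wiener begin

definition grid :: "real \<Rightarrow> nat \<Rightarrow> (nat \<Rightarrow> real) \<Rightarrow> bool" where
  "grid S n \<tau> \<longleftrightarrow> 0 \<le> \<tau> 0 \<and> (\<forall>j<n. \<tau> j \<le> \<tau> (Suc j)) \<and> \<tau> n \<le> S \<and> S \<le> Sb"

lemma grid_mono:
  assumes "grid S n \<tau>" "j \<le> k" "k \<le> n"
  shows "\<tau> j \<le> \<tau> k"
  using assms(2,3)
proof (induction k rule: dec_induct)
  case (step k)
  then have "\<tau> k \<le> \<tau> (Suc k)" using assms(1) by (auto simp: grid_def)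
  then show ?case using step by auto
qed simp

lemma grid_range:
  assumes "grid S n \<tau>" "j \<le> n"
  shows "0 \<le> \<tau> j" "\<tau> j \<le> S" "\<tau> j \<le> Sb" "\<tau> j \<in> {0..Sb}"
  using grid_mono[OF assms(1), of 0 j] grid_mono[OF assms(1), of j n] assms by (auto simp: grid_def)

lemma grid_step:
  assumes "grid S n \<tau>" "l < n"
  shows "0 \<le> \<tau> l" "\<tau> l \<le> \<tau> (Suc l)" "\<tau> (Suc l) \<le> Sb"
  using grid_range[OF assms(1), of l] grid_range[OF assms(1), of "Suc l"] assms by (auto simp: grid_def)

definition simple_integrand :: "nat \<Rightarrow> (nat \<Rightarrow> real) \<Rightarrow> (nat \<Rightarrow> 'w \<Rightarrow> nat \<Rightarrow> real) \<Rightarrow> bool" where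
  "simple_integrand n \<tau> z \<longleftrightarrow> (\<forall>l<n. simple_function (F (\<tau> l)) (z l))"

text \<open>Indexed by the number k of completed steps, i.e. the integral at the grid time \<tau> k,
  so that proofs can go by induction on k.\<close>

definition step_integral :: "nat \<Rightarrow> nat \<Rightarrow> (nat \<Rightarrow> real) \<Rightarrow> (nat \<Rightarrow> 'w \<Rightarrow> nat \<Rightarrow> real) \<Rightarrow> 'w \<Rightarrow> real" where
  "step_integral k m \<tau> z \<omega> = (\<Sum>l<k. dW m (z l \<omega>) (\<tau> l) (\<tau> (Suc l)) \<omega>)"

lemma step_integral_Suc: "step_integral (Suc k) m \<tau> z \<omega> = step_integral k m \<tau> z \<omega> + dW m (z k \<omega>) (\<tau> k) (\<tau> (Suc k)) \<omega>"
  by (simp add: step_integral_def)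

lemma simple_integrand_meas:
  assumes "simple_function (F s) z"
  shows "(\<lambda>\<omega>. g (z \<omega>)) \<in> borel_measurable (F s)"
  using borel_measurable_simple_function[OF simple_function_compose1[OF assms, of g]] .

lemma dW_random_adapted:
  assumes st: "0 \<le> s" "s \<le> t" "t \<le> u" "u \<le> Sb" and z: "simple_function (F s) z"
  shows "(\<lambda>\<omega>. dW m (z \<omega>) s t \<omega>) \<in> borel_measurable (F u)"
proof -
  have "(\<lambda>\<omega>. z \<omega> i) \<in> borel_measurable (F u)" for i
    using st by (intro F_meas_mono[OF _ _ _ simple_integrand_meas[OF z]]) auto
  then show ?thesis unfolding dW_def using st
    by (intro borel_measurable_sum borel_measurable_times borel_measurable_diff W_adapted) auto
qed

lemma step_integral_adapted:
  assumes g: "grid S n \<tau>" and z: "simple_integrand n \<tau> z" and k: "k \<le> n"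
  shows "step_integral k m \<tau> z \<in> borel_measurable (F (\<tau> k))"
proof -
  have "(\<lambda>\<omega>. dW m (z l \<omega>) (\<tau> l) (\<tau> (Suc l)) \<omega>) \<in> borel_measurable (F (\<tau> k))" if "l < k" for l
    using that k z grid_step[OF g, of l] grid_range[OF g, of k] grid_mono[OF g, of "Suc l" k]
    by (intro dW_random_adapted) (auto simp: simple_integrand_def)
  then show ?thesis unfolding step_integral_def by (intro borel_measurable_sum) auto
qed

lemma step_integral_meas:
  assumes g: "grid S n \<tau>" and z: "simple_integrand n \<tau> z" and k: "k \<le> n"
  shows "step_integral k m \<tau> z \<in> borel_measurable M"
  using F_meas_M[OF _ step_integral_adapted[OF g z k]] grid_range[OF g k] by auto

text \<open>Induction on the steps: the sum up to \<tau> k is known when the next increment starts,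
  so \<open>step_mean\<close> removes the mixed term.\<close>

lemma step_integral_isometry:
  assumes g: "grid S n \<tau>" and z: "simple_integrand n \<tau> z" and k: "k \<le> n"
  shows "integrable M (\<lambda>\<omega>. (step_integral k m \<tau> z \<omega>)\<^sup>2) \<and>
    (\<integral>\<omega>. (step_integral k m \<tau> z \<omega>)\<^sup>2 \<partial>M) = (\<Sum>l<k. \<integral>\<omega>. sqsum m (z l \<omega>) * (\<tau> (Suc l) - \<tau> l) \<partial>M)"
  using k
proof (induction k)
  case 0 then show ?case by (simp add: step_integral_def)
next
  case (Suc k)
  then have IH: "integrable M (\<lambda>\<omega>. (step_integral k m \<tau> z \<omega>)\<^sup>2)"
     "(\<integral>\<omega>. (step_integral k m \<tau> z \<omega>)\<^sup>2 \<partial>M) = (\<Sum>l<k. \<integral>\<omega>. sqsum m (z l \<omega>) * (\<tau> (Suc l) - \<tau> l) \<partial>M)" and k: "k < n" by auto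
  let ?U = "step_integral k m \<tau> z" and ?D = "\<lambda>\<omega>. dW m (z k \<omega>) (\<tau> k) (\<tau> (Suc k)) \<omega>"
  have zk: "simple_function (F (\<tau> k)) (z k)" using z k by (auto simp: simple_integrand_def)
  have Ua: "?U \<in> borel_measurable (F (\<tau> k))" using step_integral_adapted[OF g z] k by auto
  have Ui: "integrable M ?U" using integrable_of_square[OF step_integral_meas[OF g z] IH(1)] k by auto
  note m = step_mean[OF grid_step[OF g k] Ua Ui zk, of m]
  note q = step_square[OF grid_step[OF g k] zk, of m]
  have e: "(step_integral (Suc k) m \<tau> z \<omega>)\<^sup>2 = (?U \<omega>)\<^sup>2 + 2 * (?U \<omega> * ?D \<omega>) + (?D \<omega>)\<^sup>2" for \<omega>
    by (simp add: step_integral_Suc power2_sum)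
  have i2: "integrable M (\<lambda>\<omega>. 2 * (?U \<omega> * ?D \<omega>))"
    by (rule integrable_mult_right) (use m(1) in auto)
  have i12: "integrable M (\<lambda>\<omega>. (?U \<omega>)\<^sup>2 + 2 * (?U \<omega> * ?D \<omega>))"
    by (rule Bochner_Integration.integrable_add[OF IH(1) i2])
  have "integrable M (\<lambda>\<omega>. (step_integral (Suc k) m \<tau> z \<omega>)\<^sup>2)"
    unfolding e by (rule Bochner_Integration.integrable_add[OF i12 q(1)])
  moreover have "(\<integral>\<omega>. (step_integral (Suc k) m \<tau> z \<omega>)\<^sup>2 \<partial>M) =
     (\<integral>\<omega>. (?U \<omega>)\<^sup>2 \<partial>M) + 2 * (\<integral>\<omega>. ?U \<omega> * ?D \<omega> \<partial>M) + (\<integral>\<omega>. (?D \<omega>)\<^sup>2 \<partial>M)"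
    unfolding e by (simp only: Bochner_Integration.integral_add[OF i12 q(1)]
      Bochner_Integration.integral_add[OF IH(1) i2] integral_mult_right_zero)
  ultimately show ?case using IH m(2) q(2) by simp
qed

lemma dW_add: "dW m (\<lambda>i. v i + w i) s t \<omega> = dW m v s t \<omega> + dW m w s t \<omega>"
  by (simp add: dW_def distrib_right sum.distrib)

lemma dW_scale: "dW m (\<lambda>i. a * v i) s t \<omega> = a * dW m v s t \<omega>"
  by (simp add: dW_def sum_distrib_left mult.assoc)

lemma sqsum_add: "sqsum m (\<lambda>i. v i + w i) = sqsum m v + 2 * ip m v w + sqsum m w"
  by (simp add: sqsum_def ip_def power2_sum sum.distrib sum_distrib_left mult.assoc)

lemma sqsum_scale: "sqsum m (\<lambda>i. a * v i) = a\<^sup>2 * sqsum m v"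
  by (simp add: sqsum_def power_mult_distrib sum_distrib_left)

lemma ip_scale: "ip m v (\<lambda>i. a * w i) = a * ip m v w"
  by (simp add: ip_def sum_distrib_left ac_simps)

text \<open>The isometry applied to the sum of the two integrands, minus the isometries of
  both.\<close>

lemma step_integral_polarization:
  assumes g: "grid S n \<tau>" and z: "simple_integrand n \<tau> z" "simple_integrand n \<tau> z'"
  shows "integrable M (\<lambda>\<omega>. step_integral n m \<tau> z \<omega> * step_integral n m \<tau> z' \<omega>)"
    "(\<integral>\<omega>. step_integral n m \<tau> z \<omega> * step_integral n m \<tau> z' \<omega> \<partial>M) = (\<Sum>l<n. \<integral>\<omega>. ip m (z l \<omega>) (z' l \<omega>) * (\<tau> (Suc l) - \<tau> l) \<partial>M)"
proof -
  let ?s = "\<lambda>l \<omega> i. z l \<omega> i + z' l \<omega> i"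
  have zs: "simple_integrand n \<tau> ?s"
    using z unfolding simple_integrand_def
    by (auto intro!: simple_function_compose2[where h="\<lambda>a b i. a i + b i"])
  have sp: "step_integral n m \<tau> ?s \<omega> = step_integral n m \<tau> z \<omega> + step_integral n m \<tau> z' \<omega>" for \<omega>
    by (simp add: step_integral_def dW_add sum.distrib)
  note I1 = step_integral_isometry[OF g z(1) order_refl, of m] and I2 = step_integral_isometry[OF g z(2) order_refl, of m]
    and Is = step_integral_isometry[OF g zs order_refl, of m]
  have e: "step_integral n m \<tau> z \<omega> * step_integral n m \<tau> z' \<omega> = (1/2) * ((step_integral n m \<tau> ?s \<omega>)\<^sup>2 - (step_integral n m \<tau> z \<omega>)\<^sup>2 - (step_integral n m \<tau> z' \<omega>)\<^sup>2)" for \<omega>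
    by (simp add: sp power2_sum)
  show "integrable M (\<lambda>\<omega>. step_integral n m \<tau> z \<omega> * step_integral n m \<tau> z' \<omega>)"
    unfolding e using I1 I2 Is by (intro integrable_mult_right Bochner_Integration.integrable_diff) auto
  have "(\<integral>\<omega>. step_integral n m \<tau> z \<omega> * step_integral n m \<tau> z' \<omega> \<partial>M) = (1/2) * ((\<integral>\<omega>. (step_integral n m \<tau> ?s \<omega>)\<^sup>2 \<partial>M) - (\<integral>\<omega>. (step_integral n m \<tau> z \<omega>)\<^sup>2 \<partial>M) - (\<integral>\<omega>. (step_integral n m \<tau> z' \<omega>)\<^sup>2 \<partial>M))"
    unfolding e using I1 I2 Is
    by (subst integral_mult_right_zero, subst Bochner_Integration.integral_diff, (auto)[2], subst Bochner_Integration.integral_diff, auto)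
  also have "\<dots> = (\<Sum>l<n. \<integral>\<omega>. ip m (z l \<omega>) (z' l \<omega>) * (\<tau> (Suc l) - \<tau> l) \<partial>M)"
  proof -
    have "(\<integral>\<omega>. sqsum m (?s l \<omega>) * (\<tau> (Suc l) - \<tau> l) \<partial>M) = (\<integral>\<omega>. sqsum m (z l \<omega>) * (\<tau> (Suc l) - \<tau> l) \<partial>M) +
        2 * (\<integral>\<omega>. ip m (z l \<omega>) (z' l \<omega>) * (\<tau> (Suc l) - \<tau> l) \<partial>M) + (\<integral>\<omega>. sqsum m (z' l \<omega>) * (\<tau> (Suc l) - \<tau> l) \<partial>M)"
      if l: "l < n" for l
    proof -
      have z0: "simple_function (F (\<tau> l)) (z l)" "simple_function (F (\<tau> l)) (z' l)" "simple_function (F (\<tau> l)) (?s l)"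
        using z zs l by (auto simp: simple_integrand_def)
      note q = step_square(3)[OF grid_step[OF g l] z0(1), of m] step_square(3)[OF grid_step[OF g l] z0(2), of m]
        step_square(3)[OF grid_step[OF g l] z0(3), of m]
      let ?d = "\<tau> (Suc l) - \<tau> l"
      have ei: "2 * (ip m (z l \<omega>) (z' l \<omega>) * ?d) = sqsum m (?s l \<omega>) * ?d - sqsum m (z l \<omega>) * ?d - sqsum m (z' l \<omega>) * ?d" for \<omega>
        by (simp add: sqsum_add algebra_simps)
      have "2 * (\<integral>\<omega>. ip m (z l \<omega>) (z' l \<omega>) * ?d \<partial>M) = (\<integral>\<omega>. 2 * (ip m (z l \<omega>) (z' l \<omega>) * ?d) \<partial>M)"
        by (rule integral_mult_right_zero[symmetric])
      also have "\<dots> = (\<integral>\<omega>. sqsum m (?s l \<omega>) * ?d \<partial>M) - (\<integral>\<omega>. sqsum m (z l \<omega>) * ?d \<partial>M) - (\<integral>\<omega>. sqsum m (z' l \<omega>) * ?d \<partial>M)"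
        unfolding ei by (simp only: Bochner_Integration.integral_diff Bochner_Integration.integrable_diff q)
      finally show ?thesis by simp
    qed
    then show ?thesis using I1 I2 Is by (simp add: sum.distrib sum_distrib_left[symmetric])
  qed
  finally show "(\<integral>\<omega>. step_integral n m \<tau> z \<omega> * step_integral n m \<tau> z' \<omega> \<partial>M) = (\<Sum>l<n. \<integral>\<omega>. ip m (z l \<omega>) (z' l \<omega>) * (\<tau> (Suc l) - \<tau> l) \<partial>M)" .
qed

definition step_variation :: "nat \<Rightarrow> nat \<Rightarrow> (nat \<Rightarrow> real) \<Rightarrow> (nat \<Rightarrow> 'w \<Rightarrow> nat \<Rightarrow> real) \<Rightarrow> 'w \<Rightarrow> real" where
  "step_variation k m \<tau> z \<omega> = (\<Sum>l<k. sqsum m (z l \<omega>) * (\<tau> (Suc l) - \<tau> l))"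

lemma step_variation_adapted:
  assumes g: "grid S n \<tau>" and z: "simple_integrand n \<tau> z" and k: "k \<le> n"
  shows "step_variation k m \<tau> z \<in> borel_measurable (F (\<tau> k))"
proof -
  have "(\<lambda>\<omega>. sqsum m (z l \<omega>)) \<in> borel_measurable (F (\<tau> k))" if "l < k" for l
    using that k z grid_step[OF g, of l] grid_range[OF g, of k] grid_mono[OF g, of "l" k]
    by (intro F_meas_mono[OF _ _ _ simple_integrand_meas[where g="sqsum m"]]) (auto simp: simple_integrand_def)
  then show ?thesis unfolding step_variation_def by (intro borel_measurable_sum borel_measurable_times) auto
qed

text \<open>Each step multiplies by a factor of conditional mean one. When the variation is below a
  constant C, the compensator can be traded for \<open>exp (C / 2)\<close>, which gives
  \<open>step_integral_exp_bound\<close>.\<close>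

lemma step_integral_exp_martingale:
  assumes g: "grid S n \<tau>" and z: "simple_integrand n \<tau> z" and k: "k \<le> n"
  shows "integrable M (\<lambda>\<omega>. exp (step_integral k m \<tau> z \<omega> - step_variation k m \<tau> z \<omega> / 2)) \<and>
    (\<integral>\<omega>. exp (step_integral k m \<tau> z \<omega> - step_variation k m \<tau> z \<omega> / 2) \<partial>M) = 1"
  using k
proof (induction k)
  case 0 then show ?case by (simp add: step_integral_def step_variation_def prob_space)
next
  case (Suc k)
  let ?H = "\<lambda>\<omega>. exp (step_integral k m \<tau> z \<omega> - step_variation k m \<tau> z \<omega> / 2)"
  have k: "k < n" using Suc by auto
  have zk: "simple_function (F (\<tau> k)) (z k)" using z k by (auto simp: simple_integrand_def)
  have Ha: "?H \<in> borel_measurable (F (\<tau> k))"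
    using step_integral_adapted[OF g z, of k] step_variation_adapted[OF g z, of k] k by auto
  have Hi: "integrable M ?H" using Suc by auto
  have e: "exp (step_integral (Suc k) m \<tau> z \<omega> - step_variation (Suc k) m \<tau> z \<omega> / 2) =
    ?H \<omega> * exp (dW m (z k \<omega>) (\<tau> k) (\<tau> (Suc k)) \<omega> - sqsum m (z k \<omega>) * (\<tau> (Suc k) - \<tau> k) / 2)" for \<omega>
    unfolding exp_add[symmetric] by (simp add: step_integral_Suc step_variation_def field_simps)
  show ?case unfolding e using step_exp[OF grid_step[OF g k] Ha Hi zk, of m] Suc by auto
qed

lemma step_integral_exp_bound:
  assumes g: "grid S n \<tau>" and z: "simple_integrand n \<tau> z" and C: "\<And>\<omega>. step_variation n m \<tau> z \<omega> \<le> C"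
  shows "integrable M (\<lambda>\<omega>. exp (step_integral n m \<tau> z \<omega>))" "(\<integral>\<omega>. exp (step_integral n m \<tau> z \<omega>) \<partial>M) \<le> exp (C / 2)"
proof -
  note E = step_integral_exp_martingale[OF g z order_refl, of m]
  have le: "exp (step_integral n m \<tau> z \<omega>) \<le> exp (C / 2) * exp (step_integral n m \<tau> z \<omega> - step_variation n m \<tau> z \<omega> / 2)" for \<omega>
    unfolding exp_add[symmetric] using C[of \<omega>] by simp
  have i: "integrable M (\<lambda>\<omega>. exp (C / 2) * exp (step_integral n m \<tau> z \<omega> - step_variation n m \<tau> z \<omega> / 2))" using E by auto
  show i2: "integrable M (\<lambda>\<omega>. exp (step_integral n m \<tau> z \<omega>))"
    using step_integral_meas[OF g z order_refl, of m] le by (intro Bochner_Integration.integrable_bound[OF i]) auto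
  have "(\<integral>\<omega>. exp (step_integral n m \<tau> z \<omega>) \<partial>M) \<le> (\<integral>\<omega>. exp (C / 2) * exp (step_integral n m \<tau> z \<omega> - step_variation n m \<tau> z \<omega> / 2) \<partial>M)"
    by (rule integral_mono[OF i2 i le])
  then show "(\<integral>\<omega>. exp (step_integral n m \<tau> z \<omega>) \<partial>M) \<le> exp (C / 2)" using E by simp
qed

text \<open>Exponential bounds for z and for -z, combined by \<open>pow4_le_exp\<close>; hence 512 =
  2 * 256. The bound depends on C only and not on the grid or on the number of Wiener processes, as
  uniform integrability along a sequence of integrands demands.\<close>

lemma step_integral_fourth_moment:
  assumes g: "grid S n \<tau>" and z: "simple_integrand n \<tau> z" and C: "\<And>\<omega>. step_variation n m \<tau> z \<omega> \<le> C"
  shows "integrable M (\<lambda>\<omega>. (step_integral n m \<tau> z \<omega>)^4)" "(\<integral>\<omega>. (step_integral n m \<tau> z \<omega>)^4 \<partial>M) \<le> 512 * exp (C / 2)"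
proof -
  let ?z = "\<lambda>l \<omega> i. (-1) * z l \<omega> i"
  have z': "simple_integrand n \<tau> ?z"
    using z unfolding simple_integrand_def
    by (auto intro!: simple_function_compose1[where g="\<lambda>a i. - a i"])
  have s: "step_integral n m \<tau> ?z \<omega> = - step_integral n m \<tau> z \<omega>" for \<omega>
    unfolding step_integral_def dW_scale by (simp add: sum_negf)
  have q: "step_variation n m \<tau> ?z \<omega> \<le> C" for \<omega> unfolding step_variation_def sqsum_scale using C[of \<omega>] by (simp add: step_variation_def)
  note e1 = step_integral_exp_bound[OF g z C] and e2 = step_integral_exp_bound[OF g z' q, unfolded s]
  have i: "integrable M (\<lambda>\<omega>. 256 * (exp (step_integral n m \<tau> z \<omega>) + exp (- step_integral n m \<tau> z \<omega>)))"
    using e1 e2 by auto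
  show i4: "integrable M (\<lambda>\<omega>. (step_integral n m \<tau> z \<omega>)^4)"
    using step_integral_meas[OF g z order_refl, of m] pow4_le_exp
    by (intro Bochner_Integration.integrable_bound[OF i]) auto
  have "(\<integral>\<omega>. (step_integral n m \<tau> z \<omega>)^4 \<partial>M) \<le> (\<integral>\<omega>. 256 * (exp (step_integral n m \<tau> z \<omega>) + exp (- step_integral n m \<tau> z \<omega>)) \<partial>M)"
    by (rule integral_mono[OF i4 i pow4_le_exp])
  also have "\<dots> = 256 * ((\<integral>\<omega>. exp (step_integral n m \<tau> z \<omega>) \<partial>M) + (\<integral>\<omega>. exp (- step_integral n m \<tau> z \<omega>) \<partial>M))"
    using e1 e2 by simp
  finally show "(\<integral>\<omega>. (step_integral n m \<tau> z \<omega>)^4 \<partial>M) \<le> 512 * exp (C / 2)" using e1 e2 by simp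
qed

section \<open>Stopping along the grid and testing against a bounded martingale\<close>

definition alive :: "real \<Rightarrow> nat \<Rightarrow> (nat \<Rightarrow> real) \<Rightarrow> (nat \<Rightarrow> 'w \<Rightarrow> nat \<Rightarrow> real) \<Rightarrow> nat \<Rightarrow> 'w \<Rightarrow> real" where
  "alive C m \<tau> z l \<omega> = (if step_variation (Suc l) m \<tau> z \<omega> \<le> C then 1 else 0)"

definition stopped :: "real \<Rightarrow> nat \<Rightarrow> (nat \<Rightarrow> real) \<Rightarrow> (nat \<Rightarrow> 'w \<Rightarrow> nat \<Rightarrow> real) \<Rightarrow> nat \<Rightarrow> 'w \<Rightarrow> nat \<Rightarrow> real" where
  "stopped C m \<tau> z l \<omega> = (\<lambda>i. alive C m \<tau> z l \<omega> * z l \<omega> i)"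

text \<open>The variation in the flag includes the coming step (\<open>Suc l\<close>). Its
  coefficient is already known at time \<tau> l, so the flag is measurable there, and stopping
  happens before the bound C could be exceeded.\<close>

lemma alive_meas:
  assumes g: "grid S n \<tau>" and z: "simple_integrand n \<tau> z" and l: "l < n"
  shows "alive C m \<tau> z l \<in> borel_measurable (F (\<tau> l))"
proof -
  have "(\<lambda>\<omega>. sqsum m (z k \<omega>)) \<in> borel_measurable (F (\<tau> l))" if "k < Suc l" for k
    using that l z grid_step[OF g, of k] grid_range[OF g, of l] grid_mono[OF g, of k l]
    by (intro F_meas_mono[OF _ _ _ simple_integrand_meas[where g="sqsum m"]]) (auto simp: simple_integrand_def)
  then have "step_variation (Suc l) m \<tau> z \<in> borel_measurable (F (\<tau> l))"
    unfolding step_variation_def by (intro borel_measurable_sum borel_measurable_times) auto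
  then show ?thesis unfolding alive_def by measurable
qed

lemma alive_simple:
  assumes g: "grid S n \<tau>" and z: "simple_integrand n \<tau> z" and l: "l < n"
  shows "simple_function (F (\<tau> l)) (alive C m \<tau> z l)"
proof (rule simple_function_borel_measurable[OF alive_meas[OF g z l]])
  show "finite (alive C m \<tau> z l ` space (F (\<tau> l)))"
    by (rule finite_subset[of _ "{0, 1}"]) (auto simp: alive_def)
qed

lemma stopped_simple:
  assumes g: "grid S n \<tau>" and z: "simple_integrand n \<tau> z"
  shows "simple_integrand n \<tau> (stopped C m \<tau> z)"
  unfolding simple_integrand_def stopped_def
  using simple_function_compose2[OF alive_simple[OF g z], of _ "z _" "\<lambda>a b i. a * b i"] z
  by (auto simp: simple_integrand_def)

lemma step_variation_mono:
  assumes g: "grid S n \<tau>" "k \<le> l" "l \<le> n"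
  shows "step_variation k m \<tau> z \<omega> \<le> step_variation l m \<tau> z \<omega>"
  unfolding step_variation_def using assms grid_step[OF g(1)]
  by (intro sum_mono2) (auto intro!: mult_nonneg_nonneg sqsum_nonneg)

lemma step_variation_stopped:
  assumes g: "grid S n \<tau>" and C: "0 \<le> C"
  shows "step_variation n m \<tau> (stopped C m \<tau> z) \<omega> \<le> C"
proof -
  \<comment> \<open>The comparison with the unstopped variation is carried along: at a step that is
    taken, the unstopped variation is still at most C and dominates the stopped one.\<close>
  have "step_variation k m \<tau> (stopped C m \<tau> z) \<omega> \<le> C \<and> step_variation k m \<tau> (stopped C m \<tau> z) \<omega> \<le> step_variation k m \<tau> z \<omega>" if "k \<le> n" for k
    using that
  proof (induction k)
    case 0 then show ?case using C by (simp add: step_variation_def)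
  next
    case (Suc k)
    have d: "0 \<le> sqsum m (z k \<omega>) * (\<tau> (Suc k) - \<tau> k)"
      using Suc grid_step[OF g, of k] by (auto intro!: mult_nonneg_nonneg sqsum_nonneg)
    have e: "step_variation (Suc k) m \<tau> (stopped C m \<tau> z) \<omega> = step_variation k m \<tau> (stopped C m \<tau> z) \<omega> +
       (alive C m \<tau> z k \<omega>)\<^sup>2 * (sqsum m (z k \<omega>) * (\<tau> (Suc k) - \<tau> k))"
      by (simp add: step_variation_def stopped_def sqsum_scale)
    have e': "step_variation (Suc k) m \<tau> z \<omega> = step_variation k m \<tau> z \<omega> + sqsum m (z k \<omega>) * (\<tau> (Suc k) - \<tau> k)"
      by (simp add: step_variation_def)
    show ?case using Suc d e e' by (auto simp: alive_def)
  qed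
  then show ?thesis by auto
qed

end

text \<open>Bounded fourth moments make the squares uniformly integrable. The square is cut at a
  level A: the truncated part converges by domination, and the rest is at most
  \<open>(D k \<omega>)^4 / A\<close>.\<close>

lemma (in prob_space) L2_limit_of_AE_limit:
  fixes D :: "nat \<Rightarrow> 'a \<Rightarrow> real"
  assumes D: "\<And>k. D k \<in> borel_measurable M" and lim: "AE \<omega> in M. (\<lambda>k. D k \<omega>) \<longlonglongrightarrow> 0"
    and i4: "\<And>k. integrable M (\<lambda>\<omega>. (D k \<omega>)^4)" and B: "\<And>k. (\<integral>\<omega>. (D k \<omega>)^4 \<partial>M) \<le> B"
  shows "\<And>k. integrable M (\<lambda>\<omega>. (D k \<omega>)\<^sup>2)" "(\<lambda>k. \<integral>\<omega>. (D k \<omega>)\<^sup>2 \<partial>M) \<longlonglongrightarrow> 0"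
proof -
  have i4': "integrable M (\<lambda>\<omega>. ((D k \<omega>)\<^sup>2)\<^sup>2)" for k using i4[of k] by (simp add: power_mult[symmetric])
  show i2: "integrable M (\<lambda>\<omega>. (D k \<omega>)\<^sup>2)" for k
    using integrable_of_square[OF _ i4'[of k]] D by auto
  show "(\<lambda>k. \<integral>\<omega>. (D k \<omega>)\<^sup>2 \<partial>M) \<longlonglongrightarrow> 0"
  proof (rule LIMSEQ_I)
    fix e :: real assume e: "0 < e"
    \<comment> \<open>Large enough that the remainder |B| / A stays below e / 2; the summand 1 keeps
      A positive when B = 0.\<close>
    define A where "A = 2 * \<bar>B\<bar> / e + 1"
    have A: "0 < A" "\<bar>B\<bar> / A < e / 2"
      using e by (auto simp: A_def field_simps add_pos_nonneg)
    let ?T = "\<lambda>k \<omega>. min ((D k \<omega>)\<^sup>2) A"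
    have "(\<lambda>k. \<integral>\<omega>. ?T k \<omega> \<partial>M) \<longlonglongrightarrow> (\<integral>\<omega>. 0 \<partial>M)"
    proof (rule integral_dominated_convergence[where w="\<lambda>_. A"])
      show "AE \<omega> in M. (\<lambda>k. ?T k \<omega>) \<longlonglongrightarrow> 0"
        using lim
      proof eventually_elim
        fix \<omega> assume "(\<lambda>k. D k \<omega>) \<longlonglongrightarrow> 0"
        then have "(\<lambda>k. ?T k \<omega>) \<longlonglongrightarrow> min (0\<^sup>2) A" by (intro tendsto_intros)
        then show "(\<lambda>k. ?T k \<omega>) \<longlonglongrightarrow> 0" using A by simp
      qed
    qed (use D A in auto)
    then obtain k0 where k0: "\<And>k. k \<ge> k0 \<Longrightarrow> \<bar>\<integral>\<omega>. ?T k \<omega> \<partial>M\<bar> < e / 2"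
      using LIMSEQ_D[of _ 0 "e/2"] e by fastforce
    have "norm ((\<integral>\<omega>. (D k \<omega>)\<^sup>2 \<partial>M) - 0) < e" if k: "k \<ge> k0" for k
    proof -
      have le: "(D k \<omega>)\<^sup>2 \<le> ?T k \<omega> + (D k \<omega>)^4 / A" for \<omega>
      proof (cases "(D k \<omega>)\<^sup>2 \<le> A")
        case True then show ?thesis using A by simp
      next
        case False
        then have "(D k \<omega>)\<^sup>2 * A \<le> (D k \<omega>)\<^sup>2 * (D k \<omega>)\<^sup>2" by (intro mult_left_mono) auto
        then have "(D k \<omega>)\<^sup>2 \<le> (D k \<omega>)^4 / A" using A by (simp add: pos_le_divide_eq power_add[symmetric])
        then show ?thesis using A False by auto
      qed
      have iT: "integrable M (?T k)"
        using D A by (intro integrable_const_bound[of _ A]) auto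
      have "(\<integral>\<omega>. (D k \<omega>)\<^sup>2 \<partial>M) \<le> (\<integral>\<omega>. ?T k \<omega> + (D k \<omega>)^4 / A \<partial>M)"
        using iT i4[of k] by (intro integral_mono i2 le) auto
      also have "\<dots> = (\<integral>\<omega>. ?T k \<omega> \<partial>M) + (\<integral>\<omega>. (D k \<omega>)^4 \<partial>M) / A" using iT i4[of k] by simp
      also have "\<dots> < e / 2 + e / 2"
      proof (rule add_strict_mono)
        show "(\<integral>\<omega>. ?T k \<omega> \<partial>M) < e / 2" using k0[OF k] by simp
        have "(\<integral>\<omega>. (D k \<omega>)^4 \<partial>M) / A \<le> \<bar>B\<bar> / A" using B[of k] A by (intro divide_right_mono) auto
        then show "(\<integral>\<omega>. (D k \<omega>)^4 \<partial>M) / A < e / 2" using A(2) by (rule le_less_trans)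
      qed
      finally have "(\<integral>\<omega>. (D k \<omega>)\<^sup>2 \<partial>M) < e" by simp
      moreover have "0 \<le> (\<integral>\<omega>. (D k \<omega>)\<^sup>2 \<partial>M)" by (rule integral_nonneg_AE) auto
      ultimately show ?thesis by simp
    qed
    then show "\<exists>no. \<forall>n\<ge>no. norm ((\<integral>\<omega>. (D n \<omega>)\<^sup>2 \<partial>M) - 0) < e" by blast
  qed
qed

context cylindrical_wiener begin

lemma simple_integrable:
  fixes g :: "'b \<Rightarrow> real"
  assumes s: "s \<in> {0..Sb}" and z: "simple_function (F s) z"
  shows "integrable M (\<lambda>\<omega>. g (z \<omega>))"
proof -
  have sf: "simple_function (F s) (\<lambda>\<omega>. g (z \<omega>))" by (rule simple_function_compose1[OF z])
  have fin: "finite ((\<lambda>\<omega>. g (z \<omega>)) ` space M)" using sf F_space[OF s] by (simp add: simple_function_def)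
  show ?thesis
  proof (rule integrable_const_bound)
    show "AE \<omega> in M. norm (g (z \<omega>)) \<le> Max (norm ` (\<lambda>\<omega>. g (z \<omega>)) ` space M)"
      using fin by (intro AE_I2 Max_ge) auto
    show "(\<lambda>\<omega>. g (z \<omega>)) \<in> borel_measurable M"
      by (rule F_meas_M[OF s borel_measurable_simple_function[OF sf]])
  qed
qed

lemma simple_bounded:
  fixes g :: "'b \<Rightarrow> real"
  assumes s: "s \<in> {0..Sb}" and z: "simple_function (F s) z"
  obtains K where "\<And>\<omega>. \<omega> \<in> space M \<Longrightarrow> \<bar>g (z \<omega>)\<bar> \<le> K"
proof -
  have sf: "simple_function (F s) (\<lambda>\<omega>. g (z \<omega>))" by (rule simple_function_compose1[OF z])
  have fin: "finite ((\<lambda>\<omega>. g (z \<omega>)) ` space M)" using sf F_space[OF s] by (simp add: simple_function_def)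
  have "\<bar>g (z \<omega>)\<bar> \<le> Max (abs ` (\<lambda>\<omega>. g (z \<omega>)) ` space M)" if "\<omega> \<in> space M" for \<omega>
    using fin that by (intro Max_ge) auto
  then show ?thesis using that by blast
qed

text \<open>The stopping rule of z applied to another process Y sampled on the same grid; the
  integral and its limit X are thereby stopped at the same index.\<close>

definition stopped_increments ::
    "real \<Rightarrow> nat \<Rightarrow> (nat \<Rightarrow> real) \<Rightarrow> (nat \<Rightarrow> 'w \<Rightarrow> nat \<Rightarrow> real) \<Rightarrow> (nat \<Rightarrow> 'w \<Rightarrow> real) \<Rightarrow> nat \<Rightarrow> 'w \<Rightarrow> real" where
  "stopped_increments C m \<tau> z Y k \<omega> = (\<Sum>l<k. alive C m \<tau> z l \<omega> * (Y (Suc l) \<omega> - Y l \<omega>))"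

text \<open>Once the variation has passed C it stays above C, so the flags are a run of ones
  followed by zeros and the sum telescopes. J depends on \<omega> but not on Y: this order of
  quantifiers allows two processes to be compared at their common index.\<close>

lemma stopped_increments_telescope:
  assumes g: "grid S n \<tau>"
  shows "\<exists>J\<le>n. \<forall>Y. stopped_increments C m \<tau> z Y n \<omega> = Y J \<omega> - Y 0 \<omega>"
proof -
  \<comment> \<open>Either nothing has been stopped so far, or the step after J is the one at which
    C was exceeded.\<close>
  have "\<exists>J\<le>k. (\<forall>Y. stopped_increments C m \<tau> z Y k \<omega> = Y J \<omega> - Y 0 \<omega>) \<and>
      (J = k \<or> C < step_variation (Suc J) m \<tau> z \<omega>)" if "k \<le> n" for k
    using that
  proof (induction k)
    case 0 then show ?case by (simp add: stopped_increments_def)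
  next
    case (Suc k)
    then obtain J where J: "J \<le> k" "\<And>Y. stopped_increments C m \<tau> z Y k \<omega> = Y J \<omega> - Y 0 \<omega>"
      "J = k \<or> C < step_variation (Suc J) m \<tau> z \<omega>" by auto
    have e: "stopped_increments C m \<tau> z Y (Suc k) \<omega> = stopped_increments C m \<tau> z Y k \<omega> +
      alive C m \<tau> z k \<omega> * (Y (Suc k) \<omega> - Y k \<omega>)" for Y by (simp add: stopped_increments_def)
    show ?case
    proof (cases "C < step_variation (Suc k) m \<tau> z \<omega>")
      case True
      then have "alive C m \<tau> z k \<omega> = 0" by (simp add: alive_def)
      then show ?thesis using J e True by (intro exI[of _ J]) auto
    next
      case False
      have "J = k"
      proof (rule ccontr)
        assume "J \<noteq> k"
        then have "C < step_variation (Suc J) m \<tau> z \<omega>" using J by auto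
        moreover have "step_variation (Suc J) m \<tau> z \<omega> \<le> step_variation (Suc k) m \<tau> z \<omega>"
          using step_variation_mono[OF g, of "Suc J" "Suc k"] J Suc by auto
        ultimately show False using False by auto
      qed
      moreover have "alive C m \<tau> z k \<omega> = 1" using False by (simp add: alive_def)
      ultimately show ?thesis using J e by (intro exI[of _ "Suc k"]) auto
    qed
  qed
  then show ?thesis by blast
qed

lemma step_integral_stopped: "step_integral n m \<tau> (stopped C m \<tau> z) \<omega> = stopped_increments C m \<tau> z (\<lambda>l. step_integral l m \<tau> z) n \<omega>"
  by (simp add: step_integral_def[of n] stopped_increments_def step_integral_Suc stopped_def dW_scale)

definition proj :: "real \<Rightarrow> nat \<Rightarrow> (nat \<Rightarrow> real) \<Rightarrow> (nat \<Rightarrow> 'w \<Rightarrow> nat \<Rightarrow> real) \<Rightarrow> (nat \<Rightarrow> real) \<Rightarrow> nat \<Rightarrow> 'w \<Rightarrow> real" where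
  "proj C m \<tau> z c l \<omega> = ip m c (stopped C m \<tau> z l \<omega>)"

lemma proj_simple:
  assumes g: "grid S n \<tau>" and z: "simple_integrand n \<tau> z" and l: "l < n"
  shows "simple_function (F (\<tau> l)) (proj C m \<tau> z c l)"
  unfolding proj_def
  using simple_function_compose1[of "F (\<tau> l)" "stopped C m \<tau> z l" "ip m c"] stopped_simple[OF g z] l
  by (auto simp: simple_integrand_def)

text \<open>Y is a bounded martingale on the grid with final value N, and N is orthogonal to all
  increments in direction c weighted by the past. V integrates the multiple of c that carries the
  c-component of the stopped integrand. A discrete product rule for the stopped Y and V produces
  terms that all have mean zero.\<close>

lemma stopped_orthogonal:
  fixes C :: real
  assumes g: "grid S n \<tau>" and z: "simple_integrand n \<tau> z"
    and Y: "\<And>j. j \<le> n \<Longrightarrow> Y j \<in> borel_measurable (F (\<tau> j))" "\<And>j \<omega>. \<bar>Y j \<omega>\<bar> \<le> K"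
    and N: "N \<in> borel_measurable M" "\<And>\<omega>. \<omega> \<in> space M \<Longrightarrow> \<bar>N \<omega>\<bar> \<le> K"
    and mart: "\<And>j H. j \<le> n \<Longrightarrow> H \<in> borel_measurable (F (\<tau> j)) \<Longrightarrow> integrable M H \<Longrightarrow>
        (\<integral>\<omega>. H \<omega> * Y j \<omega> \<partial>M) = (\<integral>\<omega>. H \<omega> * N \<omega> \<partial>M)"
    and orth: "\<And>l H. l < n \<Longrightarrow> simple_function (F (\<tau> l)) H \<Longrightarrow>
        (\<integral>\<omega>. H \<omega> * dW m c (\<tau> l) (\<tau> (Suc l)) \<omega> * N \<omega> \<partial>M) = 0"
  defines "V k \<equiv> step_integral k m \<tau> (\<lambda>l \<omega> i. proj C m \<tau> z c l \<omega> * c i)"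
  shows "integrable M (\<lambda>\<omega>. stopped_increments C m \<tau> z Y n \<omega> * V n \<omega>)"
    "(\<integral>\<omega>. stopped_increments C m \<tau> z Y n \<omega> * V n \<omega> \<partial>M) = 0"
proof -
  let ?X = "\<lambda>k. stopped_increments C m \<tau> z Y k"
  have vz: "simple_integrand n \<tau> (\<lambda>l \<omega> i. proj C m \<tau> z c l \<omega> * c i)"
    unfolding simple_integrand_def
    using simple_function_compose1[OF proj_simple[OF g z], of _ "\<lambda>a i. a * c i"] by auto
  have Va: "V k \<in> borel_measurable (F (\<tau> k))" if "k \<le> n" for k
    unfolding V_def by (rule step_integral_adapted[OF g vz that])
  have Vi: "integrable M (V k)" if "k \<le> n" for k
    unfolding V_def using integrable_of_square[OF step_integral_meas[OF g vz that]] step_integral_isometry[OF g vz that, of m] by auto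
  have Xa: "?X k \<in> borel_measurable (F (\<tau> k))" if k: "k \<le> n" for k
    unfolding stopped_increments_def
  proof (intro borel_measurable_sum borel_measurable_times borel_measurable_diff)
    fix l assume "l \<in> {..<k}"
    then have l: "l < n" "Suc l \<le> k" using k by auto
    have le: "\<tau> l \<le> \<tau> k" "\<tau> (Suc l) \<le> \<tau> k" using grid_mono[OF g _ k] l by auto
    note r = grid_range[OF g, of l] grid_range[OF g, of k] grid_range[OF g, of "Suc l"]
    show "alive C m \<tau> z l \<in> borel_measurable (F (\<tau> k))"
      using r l k le by (intro F_meas_mono[OF _ _ _ alive_meas[OF g z]]) auto
    show "Y (Suc l) \<in> borel_measurable (F (\<tau> k))" "Y l \<in> borel_measurable (F (\<tau> k))"
      using r l k le by (auto intro!: F_meas_mono[OF _ _ _ Y(1)])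
  qed
  have Xb: "\<bar>?X k \<omega>\<bar> \<le> (\<Sum>l<k. 2 * K)" for k \<omega>
    unfolding stopped_increments_def
  proof (rule order_trans[OF sum_abs sum_mono])
    fix l
    have "\<bar>Y (Suc l) \<omega> - Y l \<omega>\<bar> \<le> 2 * K" using Y(2)[of "Suc l" \<omega>] Y(2)[of l \<omega>] by linarith
    then show "\<bar>alive C m \<tau> z l \<omega> * (Y (Suc l) \<omega> - Y l \<omega>)\<bar> \<le> 2 * K"
      by (simp add: alive_def abs_mult)
  qed
  have main: "integrable M (\<lambda>\<omega>. ?X k \<omega> * V k \<omega>) \<and> (\<integral>\<omega>. ?X k \<omega> * V k \<omega> \<partial>M) = 0" if "k \<le> n" for k
    using that
  proof (induction k)
    case 0 then show ?case by (simp add: V_def step_integral_def)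
  next
    case (Suc k)
    then have k: "k < n" "k \<le> n" "Suc k \<le> n" and IH: "integrable M (\<lambda>\<omega>. ?X k \<omega> * V k \<omega>)" "(\<integral>\<omega>. ?X k \<omega> * V k \<omega> \<partial>M) = 0" by auto
    let ?a = "alive C m \<tau> z k" and ?p = "proj C m \<tau> z c k" and ?D = "dW m c (\<tau> k) (\<tau> (Suc k))"
    have kr: "\<tau> k \<in> {0..Sb}" "\<tau> (Suc k) \<in> {0..Sb}" using grid_range[OF g] k by auto
    note gs = grid_step[OF g k(1)]
    have ps: "simple_function (F (\<tau> k)) ?p" by (rule proj_simple[OF g z k(1)])
    have as: "simple_function (F (\<tau> k)) ?a" by (rule alive_simple[OF g z k(1)])
    have cs: "simple_function (F (\<tau> k)) (\<lambda>_. c)" by simp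
    have aF: "?a \<in> borel_measurable (F (\<tau> k))" "?p \<in> borel_measurable (F (\<tau> k))"
      using as ps by (auto intro: borel_measurable_simple_function)
    note YF = Y(1)[OF k(2)] and YF1 = Y(1)[OF k(3)]
    have YM: "Y k \<in> borel_measurable M" "Y (Suc k) \<in> borel_measurable M"
      using F_meas_M[OF kr(1) YF] F_meas_M[OF kr(2) YF1] by auto
    have aM: "?a \<in> borel_measurable M" using F_meas_M[OF kr(1) aF(1)] .
    have pi: "integrable M ?p" using simple_integrable[OF kr(1) ps, of "\<lambda>x. x"] .
    obtain P where P: "\<And>\<omega>. \<omega> \<in> space M \<Longrightarrow> \<bar>?p \<omega>\<bar> \<le> P" using simple_bounded[OF kr(1) ps, of "\<lambda>x. x"] by auto
    have V': "V (Suc k) \<omega> = V k \<omega> + ?p \<omega> * ?D \<omega>" for \<omega>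
      by (simp add: V_def step_integral_Suc dW_scale)
    have X': "?X (Suc k) \<omega> = ?X k \<omega> + ?a \<omega> * (Y (Suc k) \<omega> - Y k \<omega>)" for \<omega>
      by (simp add: stopped_increments_def)
    \<comment> \<open>Product of the two updates: the previous product, old X times the increment of
      V, old V times the martingale increment, and the joint increment. The last one is split
      because Y (Suc k) can be replaced by N there, whereas Y k belongs to the past.\<close>
    have e: "?X (Suc k) \<omega> * V (Suc k) \<omega> = ?X k \<omega> * V k \<omega> + (?p \<omega> * ?X k \<omega>) * ?D \<omega> + ((V k \<omega> * ?a \<omega>) * Y (Suc k) \<omega> - (V k \<omega> * ?a \<omega>) * Y k \<omega>)
       + ((?p \<omega> * ?a \<omega> * ?D \<omega>) * Y (Suc k) \<omega> - (?p \<omega> * ?a \<omega> * Y k \<omega>) * ?D \<omega>)" for \<omega>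
      unfolding V' X' by (simp add: algebra_simps)
    have h1: "(\<lambda>\<omega>. ?p \<omega> * ?X k \<omega>) \<in> borel_measurable (F (\<tau> k))" "integrable M (\<lambda>\<omega>. ?p \<omega> * ?X k \<omega>)"
      using aF Xa[OF k(2)] Xb integrable_mult_bounded[OF pi F_meas_M[OF kr(1) Xa[OF k(2)]], of "\<Sum>l<k. 2 * K"] by auto
    note t1 = step_mean[OF gs h1 cs, of m]
    have a1: "\<bar>?a \<omega>\<bar> \<le> 1" for \<omega> by (simp add: alive_def)
    have h2: "(\<lambda>\<omega>. V k \<omega> * ?a \<omega>) \<in> borel_measurable (F (\<tau> k))" "integrable M (\<lambda>\<omega>. V k \<omega> * ?a \<omega>)"
      using aF Va[OF k(2)] integrable_mult_bounded[OF Vi[OF k(2)] aM a1] by auto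
    have h2': "(\<lambda>\<omega>. V k \<omega> * ?a \<omega>) \<in> borel_measurable (F (\<tau> (Suc k)))"
      using gs by (intro F_meas_mono[OF _ _ _ h2(1)]) auto
    have t2: "(\<integral>\<omega>. (V k \<omega> * ?a \<omega>) * Y (Suc k) \<omega> \<partial>M) = (\<integral>\<omega>. (V k \<omega> * ?a \<omega>) * Y k \<omega> \<partial>M)"
      using mart[OF k(3) h2' h2(2)] mart[OF k(2) h2] by simp
    have i2: "integrable M (\<lambda>\<omega>. (V k \<omega> * ?a \<omega>) * Y (Suc k) \<omega>)" "integrable M (\<lambda>\<omega>. (V k \<omega> * ?a \<omega>) * Y k \<omega>)"
      using integrable_mult_bounded[OF h2(2) YM(1) Y(2)] integrable_mult_bounded[OF h2(2) YM(2) Y(2)] by auto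
    have h3: "(\<lambda>\<omega>. ?p \<omega> * ?a \<omega>) \<in> borel_measurable (F (\<tau> k))" "integrable M (\<lambda>\<omega>. ?p \<omega> * ?a \<omega>)"
      using aF integrable_mult_bounded[OF pi aM a1] by auto
    note t3 = step_mean[OF gs h3 cs, of m]
    have s3: "simple_function (F (\<tau> k)) (\<lambda>\<omega>. ?p \<omega> * ?a \<omega>)"
      using simple_function_compose2[OF ps as, of "(*)"] .
    have h3': "(\<lambda>\<omega>. ?p \<omega> * ?a \<omega> * ?D \<omega>) \<in> borel_measurable (F (\<tau> (Suc k)))"
      using gs kr by (intro borel_measurable_times[OF F_meas_mono[OF _ _ _ h3(1)] dW_adapted]) auto
    have t4: "(\<integral>\<omega>. (?p \<omega> * ?a \<omega> * ?D \<omega>) * Y (Suc k) \<omega> \<partial>M) = 0"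
      using mart[OF k(3) h3' t3(1)] orth[OF k(1) s3] by simp
    have i4: "integrable M (\<lambda>\<omega>. (?p \<omega> * ?a \<omega> * ?D \<omega>) * Y (Suc k) \<omega>)"
      by (rule integrable_mult_bounded[OF t3(1) YM(2) Y(2)])
    have h5: "(\<lambda>\<omega>. ?p \<omega> * ?a \<omega> * Y k \<omega>) \<in> borel_measurable (F (\<tau> k))" "integrable M (\<lambda>\<omega>. ?p \<omega> * ?a \<omega> * Y k \<omega>)"
      using h3(1) YF integrable_mult_bounded[OF h3(2) YM(1) Y(2)] by auto
    note t5 = step_mean[OF gs h5 cs, of m]
    note A1 = Bochner_Integration.integrable_add[OF IH(1) t1(1)]
      and A2 = Bochner_Integration.integrable_diff[OF i2(1) i2(2)]
      and A3 = Bochner_Integration.integrable_diff[OF i4 t5(1)]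
    note A4 = Bochner_Integration.integrable_add[OF A1 A2]
    have "integrable M (\<lambda>\<omega>. ?X (Suc k) \<omega> * V (Suc k) \<omega>)"
      unfolding e by (rule Bochner_Integration.integrable_add[OF A4 A3])
    moreover have "(\<integral>\<omega>. ?X (Suc k) \<omega> * V (Suc k) \<omega> \<partial>M) = 0"
      unfolding e
      by (simp only: Bochner_Integration.integral_add[OF A4 A3] Bochner_Integration.integral_add[OF A1 A2]
         Bochner_Integration.integral_add[OF IH(1) t1(1)] Bochner_Integration.integral_diff[OF i2(1) i2(2)]
         Bochner_Integration.integral_diff[OF i4 t5(1)] IH(2) t1(2) t2 t4 t5(2) diff_self add_0_left)
    ultimately show ?case by simp
  qed
  show "integrable M (\<lambda>\<omega>. stopped_increments C m \<tau> z Y n \<omega> * V n \<omega>)"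
    "(\<integral>\<omega>. stopped_increments C m \<tau> z Y n \<omega> * V n \<omega> \<partial>M) = 0" using main[of n] by auto
qed

text \<open>Quadratic variation of the integral V of \<open>stopped_orthogonal\<close> up to the
  factor |c|^2. Its convergence to zero will express that the limit integrand is orthogonal to
  c.\<close>

definition projQV :: "real \<Rightarrow> nat \<Rightarrow> nat \<Rightarrow> (nat \<Rightarrow> real) \<Rightarrow> (nat \<Rightarrow> 'w \<Rightarrow> nat \<Rightarrow> real) \<Rightarrow> (nat \<Rightarrow> real) \<Rightarrow> 'w \<Rightarrow> real" where
  "projQV C n m \<tau> z c \<omega> = (\<Sum>l<n. (proj C m \<tau> z c l \<omega>)\<^sup>2 * (\<tau> (Suc l) - \<tau> l))"

lemma projQV_integrable:
  assumes g: "grid S n \<tau>" and z: "simple_integrand n \<tau> z"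
  shows "integrable M (projQV C n m \<tau> z c)"
  unfolding projQV_def
  using simple_integrable[OF grid_range(4)[OF g] proj_simple[OF g z], of _ "\<lambda>x. x\<^sup>2"]
  by (intro Bochner_Integration.integrable_sum integrable_mult_left) auto

text \<open>With U the stopped integral, X the stopped martingale and V as in
  \<open>stopped_orthogonal\<close>, polarization gives E(U V) = E(R) for R = \<open>projQV\<close>,
  while E(X V) = 0. Hence E(R) = E((U - X) V), and E(V^2) = |c|^2 E(R) lets Young's inequality
  absorb V. The fourth moment of U - X is bounded independently of the grid, in preparation of
  \<open>L2_limit_of_AE_limit\<close>.\<close>

lemma projQV_bound:
  fixes C :: real
  assumes g: "grid S n \<tau>" and z: "simple_integrand n \<tau> z" and C: "0 \<le> C"
    and Y: "\<And>j. j \<le> n \<Longrightarrow> Y j \<in> borel_measurable (F (\<tau> j))" "\<And>j \<omega>. \<bar>Y j \<omega>\<bar> \<le> K"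
    and N: "N \<in> borel_measurable M" "\<And>\<omega>. \<omega> \<in> space M \<Longrightarrow> \<bar>N \<omega>\<bar> \<le> K"
    and mart: "\<And>j H. j \<le> n \<Longrightarrow> H \<in> borel_measurable (F (\<tau> j)) \<Longrightarrow> integrable M H \<Longrightarrow>
        (\<integral>\<omega>. H \<omega> * Y j \<omega> \<partial>M) = (\<integral>\<omega>. H \<omega> * N \<omega> \<partial>M)"
    and orth: "\<And>l H. l < n \<Longrightarrow> simple_function (F (\<tau> l)) H \<Longrightarrow>
        (\<integral>\<omega>. H \<omega> * dW m c (\<tau> l) (\<tau> (Suc l)) \<omega> * N \<omega> \<partial>M) = 0"
  defines "D \<omega> \<equiv> step_integral n m \<tau> (stopped C m \<tau> z) \<omega> - stopped_increments C m \<tau> z Y n \<omega>"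
  shows "D \<in> borel_measurable M" "integrable M (\<lambda>\<omega>. (D \<omega>)^4)"
    "(\<integral>\<omega>. (D \<omega>)^4 \<partial>M) \<le> 8 * (512 * exp (C / 2) + (2 * K)^4)"
    "(\<integral>\<omega>. projQV C n m \<tau> z c \<omega> \<partial>M) \<le> sqsum m c * (\<integral>\<omega>. (D \<omega>)\<^sup>2 \<partial>M)"
proof -
  let ?X = "stopped_increments C m \<tau> z Y n" and ?U = "step_integral n m \<tau> (stopped C m \<tau> z)"
  let ?v = "\<lambda>l \<omega> i. proj C m \<tau> z c l \<omega> * c i"
  let ?V = "step_integral n m \<tau> ?v" and ?R = "projQV C n m \<tau> z c"
  have sz: "simple_integrand n \<tau> (stopped C m \<tau> z)" by (rule stopped_simple[OF g z])
  have vz: "simple_integrand n \<tau> ?v"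
    unfolding simple_integrand_def
    using simple_function_compose1[OF proj_simple[OF g z], of _ "\<lambda>a i. a * c i"] by auto
  \<comment> \<open>Through the telescoping form the bound is 2 K for every grid; summing the
    increments would give a bound growing with n.\<close>
  have Xb: "\<bar>?X \<omega>\<bar> \<le> 2 * K" for \<omega>
  proof -
    obtain J where "?X \<omega> = Y J \<omega> - Y 0 \<omega>" using stopped_increments_telescope[OF g, of C m z \<omega>] by blast
    then show ?thesis using Y(2)[of J \<omega>] Y(2)[of 0 \<omega>] by linarith
  qed
  have Xm: "?X \<in> borel_measurable M"
    unfolding stopped_increments_def
    using F_meas_M[OF grid_range(4)[OF g] Y(1)] F_meas_M[OF grid_range(4)[OF g] alive_meas[OF g z]]
    by (intro borel_measurable_sum borel_measurable_times borel_measurable_diff) auto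
  have Um: "?U \<in> borel_measurable M" using step_integral_meas[OF g sz order_refl] by auto
  show Dm: "D \<in> borel_measurable M" unfolding D_def using Um Xm by measurable
  note U4 = step_integral_fourth_moment[OF g sz step_variation_stopped[OF g C]]
  have D4: "(D \<omega>)^4 \<le> 8 * ((?U \<omega>)^4 + (2 * K)^4)" for \<omega>
  proof -
    have sq: "(a - b)\<^sup>2 \<le> 2 * (a\<^sup>2 + b\<^sup>2)" for a b :: real
      using zero_le_power2[of "a + b"] by (simp add: power2_sum power2_diff)
    have sq': "(a + b)\<^sup>2 \<le> 2 * (a\<^sup>2 + b\<^sup>2)" for a b :: real
      using zero_le_power2[of "a - b"] by (simp add: power2_sum power2_diff)
    have "(D \<omega>)^4 = ((D \<omega>)\<^sup>2)\<^sup>2" by (simp add: power_mult[symmetric])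
    also have "\<dots> \<le> (2 * ((?U \<omega>)\<^sup>2 + (?X \<omega>)\<^sup>2))\<^sup>2" unfolding D_def by (intro power_mono sq) auto
    also have "\<dots> = 4 * ((?U \<omega>)\<^sup>2 + (?X \<omega>)\<^sup>2)\<^sup>2" by (subst power_mult_distrib) simp
    also have "\<dots> \<le> 4 * (2 * (((?U \<omega>)\<^sup>2)\<^sup>2 + ((?X \<omega>)\<^sup>2)\<^sup>2))" by (intro mult_left_mono sq') auto
    also have "\<dots> = 8 * ((?U \<omega>)^4 + \<bar>?X \<omega>\<bar>^4)" by (simp add: power_mult[symmetric])
    also have "\<dots> \<le> 8 * ((?U \<omega>)^4 + (2 * K)^4)"
      using Xb[of \<omega>] by (intro mult_left_mono add_left_mono power_mono) auto
    finally show ?thesis .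
  qed
  have i8: "integrable M (\<lambda>\<omega>. 8 * ((?U \<omega>)^4 + (2 * K)^4))" using U4 by auto
  show i4: "integrable M (\<lambda>\<omega>. (D \<omega>)^4)"
  proof (rule Bochner_Integration.integrable_bound[OF i8])
    show "AE \<omega> in M. norm ((D \<omega>)^4) \<le> norm (8 * ((?U \<omega>)^4 + (2 * K)^4))"
      using D4 by (intro AE_I2) (auto intro: order_trans[OF _ abs_ge_self])
  qed (use Dm in auto)
  have "(\<integral>\<omega>. (D \<omega>)^4 \<partial>M) \<le> (\<integral>\<omega>. 8 * ((?U \<omega>)^4 + (2 * K)^4) \<partial>M)"
    by (rule integral_mono[OF i4 i8 D4])
  also have "\<dots> = 8 * ((\<integral>\<omega>. (?U \<omega>)^4 \<partial>M) + (2 * K)^4)" using U4(1) by (simp add: prob_space)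
  also have "\<dots> \<le> 8 * (512 * exp (C / 2) + (2 * K)^4)" using U4(2) by simp
  finally show "(\<integral>\<omega>. (D \<omega>)^4 \<partial>M) \<le> 8 * (512 * exp (C / 2) + (2 * K)^4)" .
  have "integrable M (\<lambda>\<omega>. ((D \<omega>)\<^sup>2)\<^sup>2)" using i4 by (simp add: power_mult[symmetric])
  then have iD2: "integrable M (\<lambda>\<omega>. (D \<omega>)\<^sup>2)"
    using integrable_of_square[of "\<lambda>\<omega>. (D \<omega>)\<^sup>2"] Dm by auto
  have pR: "(\<Sum>l<n. \<integral>\<omega>. (proj C m \<tau> z c l \<omega>)\<^sup>2 * (\<tau> (Suc l) - \<tau> l) \<partial>M) = (\<integral>\<omega>. ?R \<omega> \<partial>M)"
    unfolding projQV_def using simple_integrable[OF grid_range(4)[OF g] proj_simple[OF g z], of _ "\<lambda>x. x\<^sup>2"]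
    by (intro Bochner_Integration.integral_sum[symmetric] integrable_mult_left) auto
  have ipe: "ip m (stopped C m \<tau> z l \<omega>) (?v l \<omega>) = (proj C m \<tau> z c l \<omega>)\<^sup>2" for l \<omega>
    by (simp add: ip_scale proj_def power2_eq_square) (simp add: ip_def mult.commute)
  have n2e: "sqsum m (?v l \<omega>) = sqsum m c * (proj C m \<tau> z c l \<omega>)\<^sup>2" for l \<omega>
    by (simp add: sqsum_scale)
  have UV: "integrable M (\<lambda>\<omega>. ?U \<omega> * ?V \<omega>)" "(\<integral>\<omega>. ?U \<omega> * ?V \<omega> \<partial>M) = (\<integral>\<omega>. ?R \<omega> \<partial>M)"
    using step_integral_polarization[OF g sz vz, of m] pR unfolding ipe by auto
  have V2: "integrable M (\<lambda>\<omega>. (?V \<omega>)\<^sup>2)" "(\<integral>\<omega>. (?V \<omega>)\<^sup>2 \<partial>M) = sqsum m c * (\<integral>\<omega>. ?R \<omega> \<partial>M)"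
    using step_integral_isometry[OF g vz order_refl, of m] pR unfolding n2e mult.assoc integral_mult_right_zero sum_distrib_left[symmetric]
    by simp_all
  note XV = stopped_orthogonal[OF g z Y N mart orth, of C]
  have DV: "integrable M (\<lambda>\<omega>. D \<omega> * ?V \<omega>)" "(\<integral>\<omega>. D \<omega> * ?V \<omega> \<partial>M) = (\<integral>\<omega>. ?R \<omega> \<partial>M)"
    unfolding D_def left_diff_distrib using UV XV
    by (simp_all only: Bochner_Integration.integrable_diff Bochner_Integration.integral_diff diff_0_right)
  let ?a = "sqsum m c"
  show "(\<integral>\<omega>. ?R \<omega> \<partial>M) \<le> ?a * (\<integral>\<omega>. (D \<omega>)\<^sup>2 \<partial>M)"
  proof (cases "?a = 0")
    case True
    then have "(\<integral>\<omega>. (?V \<omega>)\<^sup>2 \<partial>M) = 0" using V2 by simp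
    then have "AE \<omega> in M. (?V \<omega>)\<^sup>2 = 0"
      using integral_nonneg_eq_0_iff_AE[OF V2(1)] by simp
    then have "(\<integral>\<omega>. D \<omega> * ?V \<omega> \<partial>M) = 0" by (intro integral_eq_zero_AE) auto
    then show ?thesis using DV True by simp
  next
    case False
    then have a: "0 < ?a" using sqsum_nonneg[of m c] by simp
    \<comment> \<open>The weights are chosen so that the term with V^2 integrates to exactly half of
      E(R).\<close>
    have le: "D \<omega> * ?V \<omega> \<le> (?a / 2) * (D \<omega>)\<^sup>2 + (1 / (2 * ?a)) * (?V \<omega>)\<^sup>2" for \<omega>
    proof -
      have "0 \<le> (?a * D \<omega> - ?V \<omega>)\<^sup>2 / (2 * ?a)" using a by simp
      also have "\<dots> = (?a / 2) * (D \<omega>)\<^sup>2 + (1 / (2 * ?a)) * (?V \<omega>)\<^sup>2 - D \<omega> * ?V \<omega>"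
        using a by (simp add: power2_diff field_simps power2_eq_square)
      finally show ?thesis by simp
    qed
    have "(\<integral>\<omega>. D \<omega> * ?V \<omega> \<partial>M) \<le> (\<integral>\<omega>. (?a / 2) * (D \<omega>)\<^sup>2 + (1 / (2 * ?a)) * (?V \<omega>)\<^sup>2 \<partial>M)"
      using iD2 V2(1) by (intro integral_mono DV(1) le) auto
    also have "\<dots> = (?a / 2) * (\<integral>\<omega>. (D \<omega>)\<^sup>2 \<partial>M) + (1 / (2 * ?a)) * (\<integral>\<omega>. (?V \<omega>)\<^sup>2 \<partial>M)"
      using iD2 V2(1) by simp
    also have "\<dots> = (?a / 2) * (\<integral>\<omega>. (D \<omega>)\<^sup>2 \<partial>M) + (\<integral>\<omega>. ?R \<omega> \<partial>M) / 2" using V2(2) a by simp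
    finally show ?thesis using DV(2) by simp
  qed
qed


lemma cond_exp_bounded:
  assumes t: "t \<in> {0..Sb}" and N: "N \<in> borel_measurable M" "\<And>\<omega>. \<omega> \<in> space M \<Longrightarrow> \<bar>N \<omega>\<bar> \<le> K"
    and X: "AE \<omega> in M. real_cond_exp M (F t) N \<omega> = X \<omega>"
  shows "AE \<omega> in M. \<bar>X \<omega>\<bar> \<le> K"
proof -
  interpret finite_measure_subalgebra M "F t"
    by unfold_locales (rule F_subalgebra[OF t])
  have Ni: "integrable M N" using N by (intro integrable_const_bound[of _ K]) auto
  have 1: "AE \<omega> in M. real_cond_exp M (F t) N \<omega> \<le> K"
    using N by (intro real_cond_exp_le_c Ni AE_I2) (auto simp: abs_le_iff)
  have 2: "AE \<omega> in M. real_cond_exp M (F t) N \<omega> \<ge> - K"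
  proof (intro real_cond_exp_ge_c Ni AE_I2)
    fix \<omega> assume "\<omega> \<in> space M"
    then show "- K \<le> N \<omega>" using N(2) by (fastforce simp: abs_le_iff)
  qed
  show ?thesis using 1 2 X by eventually_elim (auto simp: abs_le_iff)
qed

lemma cond_exp_pairing:
  assumes t: "t \<in> {0..Sb}" and N: "N \<in> borel_measurable M" "\<And>\<omega>. \<omega> \<in> space M \<Longrightarrow> \<bar>N \<omega>\<bar> \<le> K"
    and H: "H \<in> borel_measurable (F t)" "integrable M H"
  shows "(\<integral>\<omega>. H \<omega> * real_cond_exp M (F t) N \<omega> \<partial>M) = (\<integral>\<omega>. H \<omega> * N \<omega> \<partial>M)"
proof -
  interpret finite_measure_subalgebra M "F t"
    by unfold_locales (rule F_subalgebra[OF t])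
  show ?thesis
    by (rule real_cond_exp_intg(2)[OF integrable_mult_bounded[OF H(2) N] H(1) N(1)])
qed

text \<open>X t is the conditional expectation of the bounded N, hence bounded almost surely. The
  elementary integrals are close to X at all grid times, so the stopped integral and the stopped X
  differ by a quantity that tends to zero almost surely and, by the fourth moments, also in L2;
  \<open>projQV_bound\<close> then applies.\<close>

lemma projQV_tendsto_0:
  fixes C :: real
  assumes g: "\<And>k. grid S (n k) (\<tau> k)" and z: "\<And>k. simple_integrand (n k) (\<tau> k) (z k)" and C: "0 \<le> C"
    and N: "N \<in> borel_measurable M" "\<And>\<omega>. \<omega> \<in> space M \<Longrightarrow> \<bar>N \<omega>\<bar> \<le> K" and K: "0 \<le> K"
    and X: "\<And>t. t \<in> {0..S} \<Longrightarrow> X t \<in> borel_measurable (F t)"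
      "\<And>t. t \<in> {0..S} \<Longrightarrow> AE \<omega> in M. real_cond_exp M (F t) N \<omega> = X t \<omega>"
    and conv: "AE \<omega> in M. \<exists>d. d \<longlonglongrightarrow> 0 \<and> (\<forall>k. \<forall>j\<le>n k. \<bar>step_integral j (m k) (\<tau> k) (z k) \<omega> - X (\<tau> k j) \<omega>\<bar> \<le> d k)"
    and c: "\<And>k. sqsum (m k) c \<le> B"
    and orth: "\<And>k s t H. 0 \<le> s \<Longrightarrow> s \<le> t \<Longrightarrow> t \<le> S \<Longrightarrow> simple_function (F s) H \<Longrightarrow>
        (\<integral>\<omega>. H \<omega> * dW (m k) c s t \<omega> * N \<omega> \<partial>M) = 0"
  shows "(\<lambda>k. \<integral>\<omega>. projQV C (n k) (m k) (\<tau> k) (z k) c \<omega> \<partial>M) \<longlonglongrightarrow> 0"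
proof -
  \<comment> \<open>X is clipped to [-K, K]: it obeys the bound only almost surely, with an
    exceptional set depending on the time, while the discrete estimates ask for a bound
    everywhere.\<close>
  define Y where "Y k j \<omega> = max (- K) (min K (X (\<tau> k j) \<omega>))" for k j \<omega>
  have tS: "\<tau> k j \<in> {0..S}" if "j \<le> n k" for k j using grid_range[OF g that] by auto
  have S: "S \<le> Sb" using g[of 0] by (simp add: grid_def)
  have Ym: "Y k j \<in> borel_measurable (F (\<tau> k j))" if "j \<le> n k" for k j
    unfolding Y_def using X(1)[OF tS[OF that]] by measurable
  have Yb: "\<bar>Y k j \<omega>\<bar> \<le> K" for k j \<omega> unfolding Y_def using K by auto
  have YX: "AE \<omega> in M. Y k j \<omega> = X (\<tau> k j) \<omega>" if "j \<le> n k" for k j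
  proof -
    have "AE \<omega> in M. \<bar>X (\<tau> k j) \<omega>\<bar> \<le> K"
      using cond_exp_bounded[OF _ N X(2)[OF tS[OF that]]] tS[OF that] S by auto
    then show ?thesis by eventually_elim (auto simp: Y_def)
  qed
  have mart: "(\<integral>\<omega>. H \<omega> * Y k j \<omega> \<partial>M) = (\<integral>\<omega>. H \<omega> * N \<omega> \<partial>M)"
    if j: "j \<le> n k" and H: "H \<in> borel_measurable (F (\<tau> k j))" "integrable M H" for k j H
  proof -
    have ts: "\<tau> k j \<in> {0..Sb}" using tS[OF j] S by auto
    have "AE \<omega> in M. H \<omega> * Y k j \<omega> = H \<omega> * real_cond_exp M (F (\<tau> k j)) N \<omega>"
      using YX[OF j] X(2)[OF tS[OF j]] by eventually_elim simp
    then have "(\<integral>\<omega>. H \<omega> * Y k j \<omega> \<partial>M) = (\<integral>\<omega>. H \<omega> * real_cond_exp M (F (\<tau> k j)) N \<omega> \<partial>M)"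
      using F_meas_M[OF ts H(1)] F_meas_M[OF ts Ym[OF j]] by (intro integral_cong_AE) auto
    then show ?thesis using cond_exp_pairing[OF ts N H] by simp
  qed
  have orth': "(\<integral>\<omega>. H \<omega> * dW (m k) c (\<tau> k l) (\<tau> k (Suc l)) \<omega> * N \<omega> \<partial>M) = 0"
    if "l < n k" "simple_function (F (\<tau> k l)) H" for k l H
    using orth[OF _ _ _ that(2)] grid_step[OF g that(1)] tS[of "Suc l" k] that by auto
  define D where "D k \<omega> = step_integral (n k) (m k) (\<tau> k) (stopped C (m k) (\<tau> k) (z k)) \<omega> -
      stopped_increments C (m k) (\<tau> k) (z k) (Y k) (n k) \<omega>" for k \<omega>
  note PB = projQV_bound[OF g z C Ym Yb N mart orth']
  have D1: "D k \<in> borel_measurable M" for k unfolding D_def by (rule PB(1))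
  have D2: "integrable M (\<lambda>\<omega>. (D k \<omega>)^4)" for k unfolding D_def by (rule PB(2))
  have D3: "(\<integral>\<omega>. (D k \<omega>)^4 \<partial>M) \<le> 8 * (512 * exp (C / 2) + (2 * K)^4)" for k unfolding D_def by (rule PB(3))
  have D4: "(\<integral>\<omega>. projQV C (n k) (m k) (\<tau> k) (z k) c \<omega> \<partial>M) \<le> sqsum (m k) c * (\<integral>\<omega>. (D k \<omega>)\<^sup>2 \<partial>M)" for k
    unfolding D_def by (rule PB(4))
  have Dlim: "AE \<omega> in M. (\<lambda>k. D k \<omega>) \<longlonglongrightarrow> 0"
  proof -
    have "AE \<omega> in M. \<forall>k. \<forall>j\<in>{..n k}. Y k j \<omega> = X (\<tau> k j) \<omega>"
      unfolding AE_all_countable using YX by (intro allI AE_finite_allI) auto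
    then show ?thesis using conv
    proof eventually_elim
      fix \<omega> assume YX: "\<forall>k. \<forall>j\<in>{..n k}. Y k j \<omega> = X (\<tau> k j) \<omega>"
       and "\<exists>d. d \<longlonglongrightarrow> 0 \<and> (\<forall>k. \<forall>j\<le>n k. \<bar>step_integral j (m k) (\<tau> k) (z k) \<omega> - X (\<tau> k j) \<omega>\<bar> \<le> d k)"
      then obtain d where d: "d \<longlonglongrightarrow> 0" "\<And>k j. j \<le> n k \<Longrightarrow> \<bar>step_integral j (m k) (\<tau> k) (z k) \<omega> - X (\<tau> k j) \<omega>\<bar> \<le> d k" by blast
      \<comment> \<open>Both stopped quantities telescope to the same index J, so only the errors at
        J and at 0 remain.\<close>
      have Dd: "\<bar>D k \<omega>\<bar> \<le> 2 * d k" for k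
      proof -
        obtain J where J: "J \<le> n k" "\<And>Y. stopped_increments C (m k) (\<tau> k) (z k) Y (n k) \<omega> = Y J \<omega> - Y 0 \<omega>"
          using stopped_increments_telescope[OF g[of k]] by blast
        have "D k \<omega> = (step_integral J (m k) (\<tau> k) (z k) \<omega> - Y k J \<omega>) - (step_integral 0 (m k) (\<tau> k) (z k) \<omega> - Y k 0 \<omega>)"
          unfolding D_def step_integral_stopped J(2) by simp
        then show ?thesis using d(2)[of J k] d(2)[of 0 k] J(1) YX by auto
      qed
      have "\<forall>\<^sub>F k in sequentially. norm (D k \<omega>) \<le> 2 * d k" using Dd by (intro always_eventually) simp
      then show "(\<lambda>k. D k \<omega>) \<longlonglongrightarrow> 0"
        by (rule Lim_null_comparison) (rule tendsto_mult_right_zero[OF d(1)])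
    qed
  qed
  have lim: "(\<lambda>k. \<integral>\<omega>. (D k \<omega>)\<^sup>2 \<partial>M) \<longlonglongrightarrow> 0"
    by (rule L2_limit_of_AE_limit(2)[OF D1 Dlim D2 D3])
  have le: "(\<integral>\<omega>. projQV C (n k) (m k) (\<tau> k) (z k) c \<omega> \<partial>M) \<le> B * (\<integral>\<omega>. (D k \<omega>)\<^sup>2 \<partial>M)" for k
    by (rule order_trans[OF D4 mult_right_mono[OF c]]) (auto intro: integral_nonneg_AE)
  have ge: "0 \<le> (\<integral>\<omega>. projQV C (n k) (m k) (\<tau> k) (z k) c \<omega> \<partial>M)" for k
    unfolding projQV_def using grid_step[OF g] by (intro integral_nonneg_AE AE_I2 sum_nonneg mult_nonneg_nonneg) auto
  show ?thesis
  proof (rule real_tendsto_sandwich[of "\<lambda>_. 0" _ _ "\<lambda>k. B * (\<integral>\<omega>. (D k \<omega>)\<^sup>2 \<partial>M)"])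
    show "(\<lambda>k. B * (\<integral>\<omega>. (D k \<omega>)\<^sup>2 \<partial>M)) \<longlonglongrightarrow> 0" using tendsto_mult_right_zero[OF lim] by simp
  qed (use le ge in auto)
qed

lemma alive_eq_1:
  assumes g: "grid S n \<tau>" and Q: "step_variation n m \<tau> z \<omega> \<le> C" and l: "l < n"
  shows "alive C m \<tau> z l \<omega> = 1"
  using step_variation_mono[OF g, of "Suc l" n m z \<omega>] Q l by (auto simp: alive_def)

text \<open>Stopping at level 1 keeps the variations bounded, so their means tend to zero by
  domination, and the isometry carries this over to the second moments of the stopped integrals.
  Along a subsequence these integrals tend to zero almost surely, and on almost every path the
  stopping is eventually inactive.\<close>

lemma stopped_integral_limit_0:
  assumes g: "\<And>k. grid S (n k) (\<tau> k)" and z: "\<And>k. simple_integrand (n k) (\<tau> k) (z k)"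
    and QV0: "AE \<omega> in M. (\<lambda>k. step_variation (n k) (m k) (\<tau> k) (z k) \<omega>) \<longlonglongrightarrow> 0"
    and lim: "AE \<omega> in M. (\<lambda>k. step_integral (n k) (m k) (\<tau> k) (z k) \<omega>) \<longlonglongrightarrow> X \<omega>"
  shows "AE \<omega> in M. X \<omega> = 0"
proof -
  let ?s = "\<lambda>k. stopped 1 (m k) (\<tau> k) (z k)"
  let ?U = "\<lambda>k. step_integral (n k) (m k) (\<tau> k) (?s k)" and ?Q = "\<lambda>k. step_variation (n k) (m k) (\<tau> k) (?s k)"
  have sz: "simple_integrand (n k) (\<tau> k) (?s k)" for k by (rule stopped_simple[OF g z])
  have eqs: "stopped 1 (m k) (\<tau> k) (z k) l \<omega> = z k l \<omega>" if "step_variation (n k) (m k) (\<tau> k) (z k) \<omega> \<le> 1" "l < n k" for k l \<omega>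
    using alive_eq_1[OF g that] by (simp add: stopped_def)
  have QM: "?Q k \<in> borel_measurable M" for k
    using F_meas_M[OF grid_range(4)[OF g order_refl] step_variation_adapted[OF g sz order_refl]] .
  have Q01: "0 \<le> ?Q k \<omega>" "?Q k \<omega> \<le> 1" for k \<omega>
  proof -
    show "0 \<le> ?Q k \<omega>" using step_variation_mono[OF g[of k], of 0 "n k"] by (simp add: step_variation_def[of 0])
    show "?Q k \<omega> \<le> 1" by (rule step_variation_stopped[OF g]) simp
  qed
  have ev: "AE \<omega> in M. \<forall>\<^sub>F k in sequentially. step_variation (n k) (m k) (\<tau> k) (z k) \<omega> \<le> 1"
    using QV0
  proof eventually_elim
    fix \<omega> assume "(\<lambda>k. step_variation (n k) (m k) (\<tau> k) (z k) \<omega>) \<longlonglongrightarrow> 0"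
    from order_tendstoD(2)[OF this, of 1]
    show "\<forall>\<^sub>F k in sequentially. step_variation (n k) (m k) (\<tau> k) (z k) \<omega> \<le> 1"
      by (auto elim!: eventually_mono)
  qed
  have "(\<lambda>k. \<integral>\<omega>. ?Q k \<omega> \<partial>M) \<longlonglongrightarrow> (\<integral>\<omega>. 0 \<partial>M)"
  proof (rule integral_dominated_convergence[where w="\<lambda>_. 1"])
    show "AE \<omega> in M. (\<lambda>k. ?Q k \<omega>) \<longlonglongrightarrow> 0"
      using QV0 ev
    proof eventually_elim
      fix \<omega> assume q: "(\<lambda>k. step_variation (n k) (m k) (\<tau> k) (z k) \<omega>) \<longlonglongrightarrow> 0"
        and e: "\<forall>\<^sub>F k in sequentially. step_variation (n k) (m k) (\<tau> k) (z k) \<omega> \<le> 1"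
      have "\<forall>\<^sub>F k in sequentially. ?Q k \<omega> = step_variation (n k) (m k) (\<tau> k) (z k) \<omega>"
        using e by eventually_elim (simp add: step_variation_def eqs)
      then show "(\<lambda>k. ?Q k \<omega>) \<longlonglongrightarrow> 0" using q tendsto_cong by fastforce
    qed
  qed (use QM Q01 in auto)
  then have Q0: "(\<lambda>k. \<integral>\<omega>. ?Q k \<omega> \<partial>M) \<longlonglongrightarrow> 0" by simp
  note I = step_integral_isometry[OF g sz order_refl]
  have "(\<integral>\<omega>. (?U k \<omega>)\<^sup>2 \<partial>M) = (\<integral>\<omega>. ?Q k \<omega> \<partial>M)" for k
  proof -
    have "(\<integral>\<omega>. ?Q k \<omega> \<partial>M) = (\<Sum>l<n k. \<integral>\<omega>. sqsum (m k) (?s k l \<omega>) * (\<tau> k (Suc l) - \<tau> k l) \<partial>M)"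
      unfolding step_variation_def using sz[of k] step_square(3)[OF grid_step[OF g]]
      by (intro Bochner_Integration.integral_sum) (auto simp: simple_integrand_def)
    then show ?thesis using I by simp
  qed
  then have "(\<lambda>k. \<integral>\<omega>. norm ((?U k \<omega>)\<^sup>2) \<partial>M) \<longlonglongrightarrow> 0" using Q0 by simp
  then obtain r :: "nat \<Rightarrow> nat" where r: "strict_mono r" "AE \<omega> in M. (\<lambda>k. (?U (r k) \<omega>)\<^sup>2) \<longlonglongrightarrow> 0"
    using tendsto_L1_AE_subseq[of M "\<lambda>k \<omega>. (?U k \<omega>)\<^sup>2"] I by blast
  show ?thesis using r(2) lim ev
  proof eventually_elim
    fix \<omega> assume 1: "(\<lambda>k. (?U (r k) \<omega>)\<^sup>2) \<longlonglongrightarrow> 0" and 2: "(\<lambda>k. step_integral (n k) (m k) (\<tau> k) (z k) \<omega>) \<longlonglongrightarrow> X \<omega>"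
      and 3: "\<forall>\<^sub>F k in sequentially. step_variation (n k) (m k) (\<tau> k) (z k) \<omega> \<le> 1"
    have "\<forall>\<^sub>F k in sequentially. ?U k \<omega> = step_integral (n k) (m k) (\<tau> k) (z k) \<omega>"
      using 3 by eventually_elim (simp add: step_integral_def eqs)
    then have "(\<lambda>k. ?U k \<omega>) \<longlonglongrightarrow> X \<omega>" using 2 tendsto_cong by fastforce
    then have "(\<lambda>k. (?U (r k) \<omega>)\<^sup>2) \<longlonglongrightarrow> (X \<omega>)\<^sup>2"
      using LIMSEQ_subseq_LIMSEQ[OF _ r(1)] by (intro tendsto_power) (auto simp: o_def)
    then have "(X \<omega>)\<^sup>2 = 0" using 1 LIMSEQ_unique by blast
    then show "X \<omega> = 0" by simp
  qed
qed

end

section \<open>Representations by stochastic integrals\<close>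

lemma mono_grid:
  assumes "\<forall>j<n. \<tau> j \<le> \<tau> (Suc j)" "j \<le> k" "k \<le> (n::nat)"
  shows "(\<tau> j :: real) \<le> \<tau> k"
  using assms(2,3)
proof (induction k rule: dec_induct)
  case (step k)
  then have "\<tau> k \<le> \<tau> (Suc k)" using assms(1) by auto
  then show ?case using step by auto
qed simp

lemma elementary_process_eq:
  fixes \<xi> :: "nat \<Rightarrow> 'w \<Rightarrow> nat \<Rightarrow> 'v::real_vector"
  assumes mono: "\<forall>j<n. \<tau> j \<le> \<tau> (Suc j)" and l: "l < n" "t \<in> {\<tau> l<..\<tau> (Suc l)}"
  shows "elementary_process n \<tau> \<xi> t \<omega> = \<xi> l \<omega>"
proof -
  have "elementary_process n \<tau> \<xi> t \<omega> = (\<Sum>j<n. if j = l then \<xi> l \<omega> else 0)"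
    unfolding elementary_process_def
  proof (rule sum.cong[OF refl])
    fix j assume j: "j \<in> {..<n}"
    show "indicator {\<tau> j<..\<tau> (Suc j)} t *\<^sub>R \<xi> j \<omega> = (if j = l then \<xi> l \<omega> else 0)"
    proof (cases j l rule: linorder_cases)
      case less then show ?thesis using mono_grid[OF mono, of "Suc j" l] l by (auto simp: indicator_def)
    next
      case greater then show ?thesis using mono_grid[OF mono, of "Suc l" j] l j by (auto simp: indicator_def)
    qed (use l in auto)
  qed
  then show ?thesis using l by simp
qed

lemma elementary_process_eq_0:
  fixes \<xi> :: "nat \<Rightarrow> 'w \<Rightarrow> nat \<Rightarrow> 'v::real_vector"
  assumes "\<And>l. l < n \<Longrightarrow> t \<notin> {\<tau> l<..\<tau> (Suc l)}"
  shows "elementary_process n \<tau> \<xi> t \<omega> = 0"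
  unfolding elementary_process_def using assms by (intro sum.neutral) (auto simp: indicator_def)

text \<open>The steps are disjoint, so at most one coefficient is seen at a time;
  \<open>g 0 = 0\<close> accounts for times outside all steps. The functional g is general because
  both the full norm and the square of one component will be integrated.\<close>

lemma elementary_process_functional:
  fixes \<xi> :: "nat \<Rightarrow> 'w \<Rightarrow> nat \<Rightarrow> 'v::real_vector" and g :: "(nat \<Rightarrow> 'v) \<Rightarrow> ennreal"
  assumes mono: "\<forall>j<n. \<tau> j \<le> \<tau> (Suc j)" and g0: "g 0 = 0"
  shows "g (elementary_process n \<tau> \<xi> t \<omega>) = (\<Sum>l<n. g (\<xi> l \<omega>) * indicator {\<tau> l<..\<tau> (Suc l)} t)"
proof (cases "\<exists>l<n. t \<in> {\<tau> l<..\<tau> (Suc l)}")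
  case True
  then obtain l where l: "l < n" "t \<in> {\<tau> l<..\<tau> (Suc l)}" by blast
  have "(\<Sum>j<n. g (\<xi> j \<omega>) * indicator {\<tau> j<..\<tau> (Suc j)} t) = (\<Sum>j<n. if j = l then g (\<xi> l \<omega>) else 0)"
  proof (rule sum.cong[OF refl])
    fix j assume j: "j \<in> {..<n}"
    show "g (\<xi> j \<omega>) * indicator {\<tau> j<..\<tau> (Suc j)} t = (if j = l then g (\<xi> l \<omega>) else 0)"
    proof (cases j l rule: linorder_cases)
      case less then show ?thesis using mono_grid[OF mono, of "Suc j" l] l by (auto simp: indicator_def)
    next
      case greater then show ?thesis using mono_grid[OF mono, of "Suc l" j] l j by (auto simp: indicator_def)
    qed (use l in auto)
  qed
  then show ?thesis using elementary_process_eq[OF mono l, of \<xi> \<omega>] l by simp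
next
  case False
  then show ?thesis using elementary_process_eq_0[of n t \<tau> \<xi> \<omega>] g0
    by (auto intro!: sum.neutral[symmetric] simp: indicator_def)
qed

lemma elementary_process_nn_integral:
  fixes \<xi> :: "nat \<Rightarrow> 'w \<Rightarrow> nat \<Rightarrow> 'v::real_vector" and g :: "(nat \<Rightarrow> 'v) \<Rightarrow> ennreal"
  assumes mono: "\<forall>j<n. \<tau> j \<le> \<tau> (Suc j)" and 0: "0 \<le> \<tau> 0" "0 \<le> S" and g0: "g 0 = 0"
  shows "(\<integral>\<^sup>+t\<in>{0..S}. g (elementary_process n \<tau> \<xi> t \<omega>) \<partial>lborel) =
    (\<Sum>l<n. g (\<xi> l \<omega>) * ennreal (min S (\<tau> (Suc l)) - min S (\<tau> l)))"
proof -
  have em: "emeasure lborel ({\<tau> l<..\<tau> (Suc l)} \<inter> {0..S}) = ennreal (min S (\<tau> (Suc l)) - min S (\<tau> l))" if l: "l < n" for l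
  proof -
    have a: "0 \<le> \<tau> l" "\<tau> l \<le> \<tau> (Suc l)" using mono_grid[OF mono, of 0 l] 0 l mono by auto
    have "{\<tau> l<..\<tau> (Suc l)} \<inter> {0..S} = {min S (\<tau> l)<..min S (\<tau> (Suc l))}" using a by auto
    then show ?thesis using a by simp
  qed
  have "(\<integral>\<^sup>+t\<in>{0..S}. g (elementary_process n \<tau> \<xi> t \<omega>) \<partial>lborel) =
     (\<integral>\<^sup>+t. (\<Sum>l<n. g (\<xi> l \<omega>) * indicator ({\<tau> l<..\<tau> (Suc l)} \<inter> {0..S}) t) \<partial>lborel)"
    unfolding elementary_process_functional[where g=g, OF mono g0]
    by (rule nn_integral_cong) (simp only: sum_distrib_right indicator_inter_arith mult.assoc)
  also have "\<dots> = (\<Sum>l<n. \<integral>\<^sup>+t. g (\<xi> l \<omega>) * indicator ({\<tau> l<..\<tau> (Suc l)} \<inter> {0..S}) t \<partial>lborel)"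
    by (rule nn_integral_sum) auto
  also have "\<dots> = (\<Sum>l<n. g (\<xi> l \<omega>) * ennreal (min S (\<tau> (Suc l)) - min S (\<tau> l)))"
    using em by (intro sum.cong refl) (simp add: nn_integral_cmult)
  finally show ?thesis .
qed

text \<open>From S on the clipped grid stands still at S, where the later coefficients may fail to
  be measurable. They are replaced by zero; their clipped steps have length zero.\<close>

definition cut_integrand :: "real \<Rightarrow> (nat \<Rightarrow> real) \<Rightarrow> (nat \<Rightarrow> 'w \<Rightarrow> nat \<Rightarrow> real) \<Rightarrow> nat \<Rightarrow> 'w \<Rightarrow> nat \<Rightarrow> real" where
  "cut_integrand S \<tau> \<xi> l \<omega> = (if \<tau> l < S then \<xi> l \<omega> else (\<lambda>_. 0))"

context cylindrical_wiener begin

lemma cut_grid: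
  assumes e: "elementary_integrand Sb F q n m \<tau> \<xi>" and S: "0 \<le> S" "S \<le> Sb"
  shows "grid S n (\<lambda>j. min S (\<tau> j))"
  using e S by (auto simp: grid_def elementary_integrand_def min_def intro: order_trans)

lemma cut_simple:
  assumes e: "elementary_integrand Sb F q n m \<tau> \<xi>"
  shows "simple_integrand n (\<lambda>j. min S (\<tau> j)) (cut_integrand S \<tau> \<xi>)"
  unfolding simple_integrand_def
proof (intro allI impI)
  fix l assume l: "l < n"
  show "simple_function (F (min S (\<tau> l))) (cut_integrand S \<tau> \<xi> l)"
  proof (cases "\<tau> l < S")
    case True
    then have "cut_integrand S \<tau> \<xi> l = \<xi> l" "min S (\<tau> l) = \<tau> l" by (auto simp: cut_integrand_def)
    then show ?thesis using e l by (auto simp: elementary_integrand_def)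
  next
    case False
    then have "cut_integrand S \<tau> \<xi> l = (\<lambda>_ _. 0)" by (simp add: cut_integrand_def fun_eq_iff)
    then show ?thesis by simp
  qed
qed

lemma elementary_integrand_vanishes:
  assumes e: "elementary_integrand Sb F q n m \<tau> \<xi>" and l: "l < n" and "\<omega> \<in> space M" "m \<le> i"
  shows "\<xi> l \<omega> i = 0"
proof -
  have "0 \<le> \<tau> 0" "\<forall>j<n. \<tau> j \<le> \<tau> (Suc j)" "\<tau> n \<le> Sb" using e by (auto simp: elementary_integrand_def)
  then have "\<tau> l \<in> {0..Sb}" using mono_grid[of n \<tau> 0 l] mono_grid[of n \<tau> l n] l by auto
  then show ?thesis using e l assms(3,4) F_space[of "\<tau> l"] by (auto simp: elementary_integrand_def)
qed

text \<open>Clipping the grid at S and clipping the time at S have the same effect on each step. The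
  second alternative for t covers grids that end before S: the integral is constant from their last
  point on. Coefficients beyond m vanish, so the larger m' changes nothing.\<close>

lemma elementary_integral_eq_step_integral:
  assumes e: "elementary_integrand Sb F q n m \<tau> \<xi>" and S: "0 \<le> S" "S \<le> Sb" and \<omega>: "\<omega> \<in> space M"
    and m: "m \<le> m'" and j: "j \<le> n" and t: "t = min S (\<tau> j) \<or> j = n \<and> t = S"
  shows "elementary_integral W n m \<tau> \<xi> t \<omega> = step_integral j m' (\<lambda>j. min S (\<tau> j)) (cut_integrand S \<tau> \<xi>) \<omega>"
proof -
  have mono: "\<forall>j<n. \<tau> j \<le> \<tau> (Suc j)" using e by (auto simp: elementary_integrand_def)
  define d where "d l i = W i (min S (\<tau> (Suc l))) \<omega> - W i (min S (\<tau> l)) \<omega>" for l i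
  have tm: "(\<Sum>i<m. (W i (min t (\<tau> (Suc l))) \<omega> - W i (min t (\<tau> l)) \<omega>) *\<^sub>R \<xi> l \<omega> i) =
     (if l < j then dW m' (cut_integrand S \<tau> \<xi> l \<omega>) (min S (\<tau> l)) (min S (\<tau> (Suc l))) \<omega> else 0)" if l: "l < n" for l
  proof (cases "l < j")
    case True
    have "\<tau> l \<le> \<tau> j" "\<tau> (Suc l) \<le> \<tau> j" using mono_grid[OF mono] True j by auto
    then have mt: "min t (\<tau> (Suc l)) = min S (\<tau> (Suc l))" "min t (\<tau> l) = min S (\<tau> l)" using t by auto
    have "(\<Sum>i<m. d l i * \<xi> l \<omega> i) = (\<Sum>i<m'. d l i * \<xi> l \<omega> i)"
      using m elementary_integrand_vanishes[OF e l \<omega>] by (intro sum.mono_neutral_left) auto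
    also have "\<dots> = (\<Sum>i<m'. cut_integrand S \<tau> \<xi> l \<omega> i * d l i)"
      using mono l by (intro sum.cong refl) (auto simp: cut_integrand_def d_def min_absorb1)
    finally show ?thesis using True unfolding mt by (simp add: dW_def d_def)
  next
    case False
    then have "\<tau> j \<le> \<tau> l" "\<tau> l \<le> \<tau> (Suc l)" using mono_grid[OF mono, of j l] mono l by auto
    then have "min t (\<tau> (Suc l)) = t" "min t (\<tau> l) = t" using t False l by auto
    then show ?thesis using False by simp
  qed
  have "elementary_integral W n m \<tau> \<xi> t \<omega> = (\<Sum>l<n. if l < j then dW m' (cut_integrand S \<tau> \<xi> l \<omega>) (min S (\<tau> l)) (min S (\<tau> (Suc l))) \<omega> else 0)"
    unfolding elementary_integral_def using tm by (intro sum.cong) auto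
  also have "\<dots> = step_integral j m' (\<lambda>j. min S (\<tau> j)) (cut_integrand S \<tau> \<xi>) \<omega>"
    unfolding step_integral_def using j by (intro sum.mono_neutral_cong_right) auto
  finally show ?thesis .
qed

end

lemma sum_fun_apply: "(\<Sum>j\<in>A. f j) x = (\<Sum>j\<in>A. f j x)"
  for f :: "'a \<Rightarrow> 'b \<Rightarrow> 'c::comm_monoid_add"
  by (induction A rule: infinite_finite_induct) auto

lemma sqnorm_HS_real_finite:
  assumes "\<And>i. m \<le> i \<Longrightarrow> v i = 0"
  shows "sqnorm_HS sqnorm_real v = ennreal (sqsum m v)"
proof -
  have "sqnorm_HS sqnorm_real v = (\<Sum>i<m. ennreal ((v i)\<^sup>2))"
    unfolding sqnorm_HS_def sqnorm_real_def using assms by (intro suminf_finite) auto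
  then show ?thesis by (simp add: sqsum_def sum_ennreal)
qed

lemma sqnorm_HS_real_ge: "ennreal (sqsum m v) \<le> sqnorm_HS sqnorm_real v"
proof -
  have "ennreal (sqsum m v) = (\<Sum>i<m. ennreal ((v i)\<^sup>2))" by (simp add: sqsum_def sum_ennreal)
  also have "\<dots> \<le> sqnorm_HS sqnorm_real v"
    unfolding sqnorm_HS_def sqnorm_real_def by (intro sum_le_suminf) auto
  finally show ?thesis .
qed

lemma sqnorm_HS_real_triangle:
  "sqnorm_HS sqnorm_real v \<le> 2 * sqnorm_HS sqnorm_real (v - w) + 2 * sqnorm_HS sqnorm_real w"
proof -
  have "ennreal ((v i)\<^sup>2) \<le> 2 * ennreal ((v i - w i)\<^sup>2) + 2 * ennreal ((w i)\<^sup>2)" for i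
  proof -
    have "(v i)\<^sup>2 \<le> 2 * (v i - w i)\<^sup>2 + 2 * (w i)\<^sup>2"
      using zero_le_power2[of "v i - 2 * w i"] by (simp add: power2_diff power_mult_distrib)
    then have "ennreal ((v i)\<^sup>2) \<le> ennreal (2 * (v i - w i)\<^sup>2 + 2 * (w i)\<^sup>2)" by (rule ennreal_leI)
    then show ?thesis by (simp add: ennreal_plus ennreal_mult)
  qed
  then have "sqnorm_HS sqnorm_real v \<le> (\<Sum>i. 2 * ennreal ((v i - w i)\<^sup>2) + 2 * ennreal ((w i)\<^sup>2))"
    unfolding sqnorm_HS_def sqnorm_real_def by (intro suminf_le) auto
  also have "\<dots> = 2 * sqnorm_HS sqnorm_real (v - w) + 2 * sqnorm_HS sqnorm_real w"
    unfolding sqnorm_HS_def sqnorm_real_def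
    by (subst suminf_add[symmetric]) (auto simp: ennreal_suminf_cmult)
  finally show ?thesis .
qed

lemma ip_square_le: "(ip m c v)\<^sup>2 \<le> sqsum m c * sqsum m v"
  unfolding ip_def sqsum_def by (rule Cauchy_Schwarz_ineq_sum)

lemma ip_support:
  assumes "\<And>i. m0 \<le> i \<Longrightarrow> c i = 0" "m0 \<le> m"
  shows "ip m c v = ip m0 c v"
  unfolding ip_def using assms by (intro sum.mono_neutral_right) auto

lemma sqsum_support:
  assumes "\<And>i. m0 \<le> i \<Longrightarrow> c i = 0" "m0 \<le> m"
  shows "sqsum m c = sqsum m0 c"
  unfolding sqsum_def using assms by (intro sum.mono_neutral_right) auto

lemma ip_diff: "ip m c (v - w) = ip m c v - ip m c w"
  by (simp add: ip_def right_diff_distrib sum_subtractf)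

context cylindrical_wiener begin

text \<open>What the definition of the integral yields up to S, in the language of grids and simple
  integrands. \<Phi> is the underlying step process, recorded through its time integrals. The error
  bound d may depend on \<omega>, and \<open>m0 \<le> m k\<close> ensures that a vector supported
  below m0 is seen completely.\<close>

definition approximates :: "real \<Rightarrow> nat \<Rightarrow> (real \<Rightarrow> 'w \<Rightarrow> nat \<Rightarrow> real) \<Rightarrow> (real \<Rightarrow> 'w \<Rightarrow> real) \<Rightarrow>
    (nat \<Rightarrow> nat) \<Rightarrow> (nat \<Rightarrow> nat) \<Rightarrow> (nat \<Rightarrow> nat \<Rightarrow> real) \<Rightarrow> (nat \<Rightarrow> nat \<Rightarrow> 'w \<Rightarrow> nat \<Rightarrow> real) \<Rightarrow>
    (nat \<Rightarrow> real \<Rightarrow> 'w \<Rightarrow> nat \<Rightarrow> real) \<Rightarrow> bool" where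
  "approximates S m0 y X n m \<tau> z \<Phi> \<longleftrightarrow>
    (\<forall>k. grid S (n k) (\<tau> k)) \<and>
    (\<forall>k. simple_integrand (n k) (\<tau> k) (z k)) \<and>
    (\<forall>k. m0 \<le> m k) \<and>
    (\<forall>k l \<omega> i. l < n k \<longrightarrow> \<omega> \<in> space M \<longrightarrow> m k \<le> i \<longrightarrow> z k l \<omega> i = 0) \<and>
    (\<forall>k \<omega> g. g 0 = 0 \<longrightarrow> (\<integral>\<^sup>+t\<in>{0..S}. g (\<Phi> k t \<omega>) \<partial>lborel) =
        (\<Sum>l<n k. g (z k l \<omega>) * ennreal (\<tau> k (Suc l) - \<tau> k l))) \<and>
    (\<forall>k \<omega> i. (\<lambda>t. \<Phi> k t \<omega> i) \<in> borel_measurable lborel) \<and>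
    (AE \<omega> in M. (\<lambda>k. \<integral>\<^sup>+t\<in>{0..Sb}. sqnorm_HS sqnorm_real (\<Phi> k t \<omega> - y t \<omega>) \<partial>lborel) \<longlonglongrightarrow> 0) \<and>
    (AE \<omega> in M. \<exists>d. d \<longlonglongrightarrow> 0 \<and> (\<forall>k. \<forall>j\<le>n k. \<bar>step_integral j (m k) (\<tau> k) (z k) \<omega> - X (\<tau> k j) \<omega>\<bar> \<le> d k)) \<and>
    (AE \<omega> in M. (\<lambda>k. step_integral (n k) (m k) (\<tau> k) (z k) \<omega>) \<longlonglongrightarrow> X S \<omega>)"

lemma cut_sequence:
  assumes S: "0 \<le> S" "S \<le> Sb" and si: "has_stochastic_integral M Sb F W sqnorm_real y X"
  shows "\<exists>n m \<tau> z \<Phi>. approximates S m0 y X n m \<tau> z \<Phi>"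
proof -
  from si obtain n m \<tau> \<xi> where e: "\<And>k. elementary_integrand Sb F sqnorm_real (n k) (m k) (\<tau> k) (\<xi> k)"
    and E1: "AE \<omega> in M. (\<lambda>k. \<integral>\<^sup>+t\<in>{0..Sb}. sqnorm_HS sqnorm_real (elementary_process (n k) (\<tau> k) (\<xi> k) t \<omega> - y t \<omega>) \<partial>lborel) \<longlonglongrightarrow> 0"
    and E2: "AE \<omega> in M. (\<lambda>k. SUP t\<in>{0..Sb}. sqnorm_real (elementary_integral W (n k) (m k) (\<tau> k) (\<xi> k) t \<omega> - X t \<omega>)) \<longlonglongrightarrow> 0"
    unfolding has_stochastic_integral_def by blast
  define m' where "m' k = max (m k) m0" for k
  define \<tau>' where "\<tau>' k j = min S (\<tau> k j)" for k j
  define z where "z k = cut_integrand S (\<tau> k) (\<xi> k)" for k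
  have m': "m k \<le> m' k" for k by (simp add: m'_def)
  have mono: "\<forall>j<n k. \<tau> k j \<le> \<tau> k (Suc j)" "0 \<le> \<tau> k 0" for k using e[of k] by (auto simp: elementary_integrand_def)
  have g: "grid S (n k) (\<tau>' k)" for k
    unfolding \<tau>'_def using cut_grid[OF e S] by simp
  have SIeq: "step_integral j (m' k) (\<tau>' k) (z k) \<omega> = elementary_integral W (n k) (m k) (\<tau> k) (\<xi> k) (\<tau>' k j) \<omega>"
    if "\<omega> \<in> space M" "j \<le> n k" for j k \<omega>
    unfolding \<tau>'_def z_def by (rule elementary_integral_eq_step_integral[OF e S that(1) m' that(2), symmetric]) simp
  have SIeqS: "step_integral (n k) (m' k) (\<tau>' k) (z k) \<omega> = elementary_integral W (n k) (m k) (\<tau> k) (\<xi> k) S \<omega>"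
    if "\<omega> \<in> space M" for k \<omega>
    unfolding \<tau>'_def z_def by (rule elementary_integral_eq_step_integral[OF e S that(1) m' order_refl, symmetric]) simp
  have sup: "ennreal ((elementary_integral W (n k) (m k) (\<tau> k) (\<xi> k) t \<omega> - X t \<omega>)\<^sup>2) \<le>
     (SUP t\<in>{0..Sb}. sqnorm_real (elementary_integral W (n k) (m k) (\<tau> k) (\<xi> k) t \<omega> - X t \<omega>))" if "t \<in> {0..Sb}" for k t \<omega>
    using that unfolding sqnorm_real_def by (intro SUP_upper)
  \<comment> \<open>The supremum of the squared errors controls any selection of error values, in
    particular the largest error on the k-th grid and the error at S.\<close>
  have from_sup: "d \<longlonglongrightarrow> 0" if lim: "(\<lambda>k. SUP t\<in>{0..Sb}. sqnorm_real (elementary_integral W (n k) (m k) (\<tau> k) (\<xi> k) t \<omega> - X t \<omega>)) \<longlonglongrightarrow> 0"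
    and ex: "\<And>k. \<exists>t\<in>{0..Sb}. d k = \<bar>elementary_integral W (n k) (m k) (\<tau> k) (\<xi> k) t \<omega> - X t \<omega>\<bar>" for d \<omega>
  proof -
    have le: "ennreal ((d k)\<^sup>2) \<le> (SUP t\<in>{0..Sb}. sqnorm_real (elementary_integral W (n k) (m k) (\<tau> k) (\<xi> k) t \<omega> - X t \<omega>))" for k
    proof -
      obtain t where t: "t \<in> {0..Sb}" "d k = \<bar>elementary_integral W (n k) (m k) (\<tau> k) (\<xi> k) t \<omega> - X t \<omega>\<bar>" using ex[of k] by blast
      show ?thesis unfolding t(2) power2_abs by (rule sup[OF t(1)])
    qed
    have "(\<lambda>k. ennreal ((d k)\<^sup>2)) \<longlonglongrightarrow> 0"
      by (rule tendsto_sandwich[OF _ _ tendsto_const lim]) (auto intro!: always_eventually le)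
    then have "(\<lambda>k. (d k)\<^sup>2) \<longlonglongrightarrow> 0" by (subst (asm) ennreal_tendsto_0_iff) auto
    then have "(\<lambda>k. sqrt ((d k)\<^sup>2)) \<longlonglongrightarrow> sqrt 0" by (rule tendsto_real_sqrt)
    then show "d \<longlonglongrightarrow> 0" by (simp add: tendsto_rabs_zero_iff)
  qed
  have "approximates S m0 y X n m' \<tau>' z (\<lambda>k. elementary_process (n k) (\<tau> k) (\<xi> k))"
    unfolding approximates_def
  proof (intro conjI allI impI)
    show "grid S (n k) (\<tau>' k)" for k by (rule g)
    show "simple_integrand (n k) (\<tau>' k) (z k)" for k
      unfolding \<tau>'_def z_def by (rule cut_simple[OF e])
    show "m0 \<le> m' k" for k by (simp add: m'_def)
    show "z k l \<omega> i = 0" if "l < n k" "\<omega> \<in> space M" "m' k \<le> i" for k l \<omega> i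
      using elementary_integrand_vanishes[OF e that(1,2), of i] that(3) m'[of k] by (auto simp: z_def cut_integrand_def)
    show "(\<integral>\<^sup>+t\<in>{0..S}. g (elementary_process (n k) (\<tau> k) (\<xi> k) t \<omega>) \<partial>lborel) =
        (\<Sum>l<n k. g (z k l \<omega>) * ennreal (\<tau>' k (Suc l) - \<tau>' k l))" if g0: "g 0 = 0" for k \<omega> g
      unfolding elementary_process_nn_integral[where g=g, OF mono(1) mono(2) S(1) g0]
    proof (rule sum.cong[OF refl])
      fix l assume "l \<in> {..<n k}"
      then have le: "\<tau> k l \<le> \<tau> k (Suc l)" using mono by auto
      show "g (\<xi> k l \<omega>) * ennreal (min S (\<tau> k (Suc l)) - min S (\<tau> k l)) = g (z k l \<omega>) * ennreal (\<tau>' k (Suc l) - \<tau>' k l)"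
        using le by (cases "\<tau> k l < S") (auto simp: z_def cut_integrand_def \<tau>'_def)
    qed
    show "(\<lambda>t. elementary_process (n k) (\<tau> k) (\<xi> k) t \<omega> i) \<in> borel_measurable lborel" for k \<omega> i
      unfolding elementary_process_def sum_fun_apply scaleR_fun_def by measurable
    show "AE \<omega> in M. (\<lambda>k. \<integral>\<^sup>+t\<in>{0..Sb}. sqnorm_HS sqnorm_real (elementary_process (n k) (\<tau> k) (\<xi> k) t \<omega> - y t \<omega>) \<partial>lborel) \<longlonglongrightarrow> 0"
      by (rule E1)
    show "AE \<omega> in M. \<exists>d. d \<longlonglongrightarrow> 0 \<and> (\<forall>k. \<forall>j\<le>n k. \<bar>step_integral j (m' k) (\<tau>' k) (z k) \<omega> - X (\<tau>' k j) \<omega>\<bar> \<le> d k)"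
      using E2 AE_space
    proof eventually_elim
      fix \<omega> assume E: "(\<lambda>k. SUP t\<in>{0..Sb}. sqnorm_real (elementary_integral W (n k) (m k) (\<tau> k) (\<xi> k) t \<omega> - X t \<omega>)) \<longlonglongrightarrow> 0"
        and \<omega>: "\<omega> \<in> space M"
      let ?D = "\<lambda>k j. \<bar>step_integral j (m' k) (\<tau>' k) (z k) \<omega> - X (\<tau>' k j) \<omega>\<bar>"
      define d where "d k = Max (?D k ` {..n k})" for k
      have "d \<longlonglongrightarrow> 0"
      proof (rule from_sup[OF E])
        fix k
        have "d k \<in> ?D k ` {..n k}" unfolding d_def by (rule Max_in) auto
        then obtain j where j: "j \<le> n k" "d k = ?D k j" by auto
        then show "\<exists>t\<in>{0..Sb}. d k = \<bar>elementary_integral W (n k) (m k) (\<tau> k) (\<xi> k) t \<omega> - X t \<omega>\<bar>"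
          using SIeq[OF \<omega> j(1)] grid_range(4)[OF g j(1)] by (intro bexI[of _ "\<tau>' k j"]) auto
      qed
      moreover have "\<forall>k. \<forall>j\<le>n k. ?D k j \<le> d k" unfolding d_def by (auto intro!: Max_ge)
      ultimately show "\<exists>d. d \<longlonglongrightarrow> 0 \<and> (\<forall>k. \<forall>j\<le>n k. ?D k j \<le> d k)" by blast
    qed
    show "AE \<omega> in M. (\<lambda>k. step_integral (n k) (m' k) (\<tau>' k) (z k) \<omega>) \<longlonglongrightarrow> X S \<omega>"
      using E2 AE_space
    proof eventually_elim
      fix \<omega> assume E: "(\<lambda>k. SUP t\<in>{0..Sb}. sqnorm_real (elementary_integral W (n k) (m k) (\<tau> k) (\<xi> k) t \<omega> - X t \<omega>)) \<longlonglongrightarrow> 0"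
        and \<omega>: "\<omega> \<in> space M"
      have "(\<lambda>k. \<bar>step_integral (n k) (m' k) (\<tau>' k) (z k) \<omega> - X S \<omega>\<bar>) \<longlonglongrightarrow> 0"
        using SIeqS[OF \<omega>] S by (intro from_sup[OF E] bexI[of _ S]) auto
      then show "(\<lambda>k. step_integral (n k) (m' k) (\<tau>' k) (z k) \<omega>) \<longlonglongrightarrow> X S \<omega>"
        by (simp add: tendsto_rabs_zero_iff LIM_zero_cancel)
    qed
  qed
  then show ?thesis by blast
qed

lemma step_variation_eq_nn_integral:
  assumes g: "grid S n \<tau>" and v: "\<And>l i. l < n \<Longrightarrow> m \<le> i \<Longrightarrow> z l \<omega> i = 0"
  shows "ennreal (step_variation n m \<tau> z \<omega>) = (\<Sum>l<n. sqnorm_HS sqnorm_real (z l \<omega>) * ennreal (\<tau> (Suc l) - \<tau> l))"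
proof -
  have "(\<Sum>l<n. sqnorm_HS sqnorm_real (z l \<omega>) * ennreal (\<tau> (Suc l) - \<tau> l)) =
     (\<Sum>l<n. ennreal (sqsum m (z l \<omega>) * (\<tau> (Suc l) - \<tau> l)))"
    using sqnorm_HS_real_finite[OF v] grid_step[OF g]
    by (intro sum.cong refl) (auto simp: ennreal_mult sqsum_nonneg)
  also have "\<dots> = ennreal (step_variation n m \<tau> z \<omega>)"
    unfolding step_variation_def using grid_step[OF g] by (intro sum_ennreal mult_nonneg_nonneg sqsum_nonneg) auto
  finally show ?thesis by simp
qed

text \<open>On [0, S] the elementary integrands then approximate zero, so their variations tend to
  zero and \<open>stopped_integral_limit_0\<close> forces the limit to vanish.\<close>

lemma integral_0_of_integrand_0:
  assumes S: "0 \<le> S" "S \<le> Sb" and si: "has_stochastic_integral M Sb F W sqnorm_real y X"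
    and y0: "AE \<omega> in M. AE t in lborel. t \<in> {0..S} \<longrightarrow> y t \<omega> = 0"
  shows "AE \<omega> in M. X S \<omega> = 0"
proof -
  obtain n m \<tau> z \<Phi> where A: "approximates S 0 y X n m \<tau> z \<Phi>"
    using cut_sequence[OF S si, of 0] by blast
  have g: "\<And>k. grid S (n k) (\<tau> k)"
    and z: "\<And>k. simple_integrand (n k) (\<tau> k) (z k)"
    and v: "\<And>k l \<omega> i. l < n k \<Longrightarrow> \<omega> \<in> space M \<Longrightarrow> m k \<le> i \<Longrightarrow> z k l \<omega> i = 0"
    and \<Phi>: "\<And>k \<omega> g. g 0 = 0 \<Longrightarrow> (\<integral>\<^sup>+t\<in>{0..S}. g (\<Phi> k t \<omega>) \<partial>lborel) =
        (\<Sum>l<n k. g (z k l \<omega>) * ennreal (\<tau> k (Suc l) - \<tau> k l))"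
    and E1: "AE \<omega> in M. (\<lambda>k. \<integral>\<^sup>+t\<in>{0..Sb}. sqnorm_HS sqnorm_real (\<Phi> k t \<omega> - y t \<omega>) \<partial>lborel) \<longlonglongrightarrow> 0"
    and E3: "AE \<omega> in M. (\<lambda>k. step_integral (n k) (m k) (\<tau> k) (z k) \<omega>) \<longlonglongrightarrow> X S \<omega>"
    using A unfolding approximates_def by iprover+
  have HS0: "sqnorm_HS sqnorm_real 0 = 0" by (simp add: sqnorm_HS_def sqnorm_real_def)
  show ?thesis
  proof (rule stopped_integral_limit_0[OF g z _ E3])
    show "AE \<omega> in M. (\<lambda>k. step_variation (n k) (m k) (\<tau> k) (z k) \<omega>) \<longlonglongrightarrow> 0"
      using E1 y0 AE_space
    proof eventually_elim
      fix \<omega> assume E: "(\<lambda>k. \<integral>\<^sup>+t\<in>{0..Sb}. sqnorm_HS sqnorm_real (\<Phi> k t \<omega> - y t \<omega>) \<partial>lborel) \<longlonglongrightarrow> 0"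
        and y0: "AE t in lborel. t \<in> {0..S} \<longrightarrow> y t \<omega> = 0" and \<omega>: "\<omega> \<in> space M"
      have QVe: "ennreal (step_variation (n k) (m k) (\<tau> k) (z k) \<omega>) = (\<Sum>l<n k. sqnorm_HS sqnorm_real (z k l \<omega>) * ennreal (\<tau> k (Suc l) - \<tau> k l))" for k
        by (rule step_variation_eq_nn_integral[OF g]) (rule v[OF _ \<omega>])
      have "ennreal (step_variation (n k) (m k) (\<tau> k) (z k) \<omega>) \<le> (\<integral>\<^sup>+t\<in>{0..Sb}. sqnorm_HS sqnorm_real (\<Phi> k t \<omega> - y t \<omega>) \<partial>lborel)" for k
      proof -
        have "ennreal (step_variation (n k) (m k) (\<tau> k) (z k) \<omega>) = (\<integral>\<^sup>+t\<in>{0..S}. sqnorm_HS sqnorm_real (\<Phi> k t \<omega>) \<partial>lborel)"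
          using QVe \<Phi>[of "sqnorm_HS sqnorm_real", OF HS0] by simp
        also have "\<dots> \<le> (\<integral>\<^sup>+t\<in>{0..Sb}. sqnorm_HS sqnorm_real (\<Phi> k t \<omega> - y t \<omega>) \<partial>lborel)"
          using y0 S by (intro nn_integral_mono_AE) (auto elim!: eventually_mono simp: indicator_def)
        finally show ?thesis .
      qed
      then have "(\<lambda>k. ennreal (step_variation (n k) (m k) (\<tau> k) (z k) \<omega>)) \<longlonglongrightarrow> 0"
        by (intro tendsto_sandwich[OF _ _ tendsto_const E]) (auto intro!: always_eventually)
      moreover have "0 \<le> step_variation (n k) (m k) (\<tau> k) (z k) \<omega>" for k
        using step_variation_mono[OF g[of k], of 0 "n k"] by (simp add: step_variation_def[of 0])
      ultimately show "(\<lambda>k. step_variation (n k) (m k) (\<tau> k) (z k) \<omega>) \<longlonglongrightarrow> 0"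
        by (subst (asm) ennreal_tendsto_0_iff) auto
    qed
  qed
qed

text \<open>For each level C the squared c-component of the stopped integrands tends to zero in
  mean, hence almost surely along a subsequence. A path with square integrable y has eventually
  bounded variations, so some level leaves it unstopped, and the limit of the approximating
  components is the component of y. The function y' replaces y in time integrals, where additivity
  requires measurability.\<close>

lemma integrand_orthogonal:
  assumes S: "0 \<le> S" "S \<le> Sb" and si: "has_stochastic_integral M Sb F W sqnorm_real y X"
    and mart: "martingale_on M Sb F X"
    and N: "N \<in> borel_measurable M" "\<And>\<omega>. \<omega> \<in> space M \<Longrightarrow> \<bar>N \<omega>\<bar> \<le> K" "AE \<omega> in M. N \<omega> = X S \<omega>"
    and c: "\<And>i. m0 \<le> i \<Longrightarrow> c i = 0"
    and orth: "\<And>m s t H. m0 \<le> m \<Longrightarrow> 0 \<le> s \<Longrightarrow> s \<le> t \<Longrightarrow> t \<le> S \<Longrightarrow> simple_function (F s) H \<Longrightarrow>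
        (\<integral>\<omega>. H \<omega> * dW m c s t \<omega> * N \<omega> \<partial>M) = 0"
    and meas: "AE \<omega> in M. \<exists>y'. (\<forall>i. (\<lambda>t. y' t i) \<in> borel_measurable lborel) \<and>
        (AE t in lborel. t \<in> {0..Sb} \<longrightarrow> y t \<omega> = y' t)"
    and fin: "AE \<omega> in M. (\<integral>\<^sup>+t\<in>{0..Sb}. sqnorm_HS sqnorm_real (y t \<omega>) \<partial>lborel) < \<infinity>"
  shows "AE \<omega> in M. AE t in lborel. t \<in> {0..S} \<longrightarrow> ip m0 c (y t \<omega>) = 0"
proof -
  obtain n m \<tau> z \<Phi> where A: "approximates S m0 y X n m \<tau> z \<Phi>"
    using cut_sequence[OF S si, of m0] by blast
  have g: "\<And>k. grid S (n k) (\<tau> k)"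
    and z: "\<And>k. simple_integrand (n k) (\<tau> k) (z k)"
    and m: "\<And>k. m0 \<le> m k"
    and v: "\<And>k l \<omega> i. l < n k \<Longrightarrow> \<omega> \<in> space M \<Longrightarrow> m k \<le> i \<Longrightarrow> z k l \<omega> i = 0"
    and \<Phi>: "\<And>k \<omega> g. g 0 = 0 \<Longrightarrow> (\<integral>\<^sup>+t\<in>{0..S}. g (\<Phi> k t \<omega>) \<partial>lborel) =
        (\<Sum>l<n k. g (z k l \<omega>) * ennreal (\<tau> k (Suc l) - \<tau> k l))"
    and \<Phi>m: "\<And>k \<omega> i. (\<lambda>t. \<Phi> k t \<omega> i) \<in> borel_measurable lborel"
    and E1: "AE \<omega> in M. (\<lambda>k. \<integral>\<^sup>+t\<in>{0..Sb}. sqnorm_HS sqnorm_real (\<Phi> k t \<omega> - y t \<omega>) \<partial>lborel) \<longlonglongrightarrow> 0"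
    and E2: "AE \<omega> in M. \<exists>d. d \<longlonglongrightarrow> 0 \<and> (\<forall>k. \<forall>j\<le>n k. \<bar>step_integral j (m k) (\<tau> k) (z k) \<omega> - X (\<tau> k j) \<omega>\<bar> \<le> d k)"
    and E3: "AE \<omega> in M. (\<lambda>k. step_integral (n k) (m k) (\<tau> k) (z k) \<omega>) \<longlonglongrightarrow> X S \<omega>"
    using A unfolding approximates_def by iprover+
  have K: "0 \<le> K" using N(2) not_empty by (metis abs_ge_zero ex_in_conv order_trans)
  have Xm: "X t \<in> borel_measurable (F t)" if "t \<in> {0..S}" for t
    using mart that S by (auto simp: martingale_on_def)
  have Xc: "AE \<omega> in M. real_cond_exp M (F t) N \<omega> = X t \<omega>" if t: "t \<in> {0..S}" for t
  proof -
    have tb: "t \<in> {0..Sb}" using t S by auto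
    interpret s: finite_measure_subalgebra M "F t"
      by unfold_locales (rule F_subalgebra[OF tb])
    have "AE \<omega> in M. real_cond_exp M (F t) (X S) \<omega> = X t \<omega>"
      using mart t S by (auto simp: martingale_on_def)
    moreover have "AE \<omega> in M. real_cond_exp M (F t) N \<omega> = real_cond_exp M (F t) (X S) \<omega>"
      using N(3) N(1) F_meas_M[OF _ Xm[of S]] S by (intro s.real_cond_exp_cong) auto
    ultimately show ?thesis by eventually_elim simp
  qed
  \<comment> \<open>Natural numbers as levels: the exceptional sets of all levels together are still
    null, so the level may be picked afterwards for each path.\<close>
  have P: "AE \<omega> in M. \<exists>r :: nat \<Rightarrow> nat. strict_mono r \<and> (\<lambda>k. projQV (real C) (n (r k)) (m (r k)) (\<tau> (r k)) (z (r k)) c \<omega>) \<longlonglongrightarrow> 0" for C :: nat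
  proof -
    have L: "(\<lambda>k. \<integral>\<omega>. projQV (real C) (n k) (m k) (\<tau> k) (z k) c \<omega> \<partial>M) \<longlonglongrightarrow> 0"
      by (rule projQV_tendsto_0[OF g z _ N(1,2) K Xm Xc E2 _ orth[OF m], where B="sqsum m0 c"])
         (auto simp: sqsum_support[OF c m])
    have nn: "norm (projQV (real C) (n k) (m k) (\<tau> k) (z k) c \<omega>) = projQV (real C) (n k) (m k) (\<tau> k) (z k) c \<omega>" for k \<omega>
      unfolding projQV_def real_norm_def using grid_step[OF g] by (intro abs_of_nonneg sum_nonneg mult_nonneg_nonneg) auto
    obtain r :: "nat \<Rightarrow> nat" where r: "strict_mono r"
      "AE \<omega> in M. (\<lambda>k. projQV (real C) (n (r k)) (m (r k)) (\<tau> (r k)) (z (r k)) c \<omega>) \<longlonglongrightarrow> 0"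
      using tendsto_L1_AE_subseq[of M "\<lambda>k. projQV (real C) (n k) (m k) (\<tau> k) (z k) c", OF projQV_integrable[OF g z]] L unfolding nn by blast
    show ?thesis using r(2) by eventually_elim (use r(1) in blast)
  qed
  have P': "AE \<omega> in M. \<forall>C. \<exists>r :: nat \<Rightarrow> nat. strict_mono r \<and> (\<lambda>k. projQV (real C) (n (r k)) (m (r k)) (\<tau> (r k)) (z (r k)) c \<omega>) \<longlonglongrightarrow> 0"
    unfolding AE_all_countable using P by blast
  show ?thesis
    using P' E1 meas fin AE_space
  proof eventually_elim
    fix \<omega> assume P: "\<forall>C. \<exists>r :: nat \<Rightarrow> nat. strict_mono r \<and> (\<lambda>k. projQV (real C) (n (r k)) (m (r k)) (\<tau> (r k)) (z (r k)) c \<omega>) \<longlonglongrightarrow> 0"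
      and E: "(\<lambda>k. \<integral>\<^sup>+t\<in>{0..Sb}. sqnorm_HS sqnorm_real (\<Phi> k t \<omega> - y t \<omega>) \<partial>lborel) \<longlonglongrightarrow> 0"
      and meas: "\<exists>y'. (\<forall>i. (\<lambda>t. y' t i) \<in> borel_measurable lborel) \<and> (AE t in lborel. t \<in> {0..Sb} \<longrightarrow> y t \<omega> = y' t)"
      and fin: "(\<integral>\<^sup>+t\<in>{0..Sb}. sqnorm_HS sqnorm_real (y t \<omega>) \<partial>lborel) < \<infinity>" and \<omega>: "\<omega> \<in> space M"
    from meas obtain y' where y'm[measurable]: "\<And>i. (\<lambda>t. y' t i) \<in> borel_measurable lborel"
      and y': "AE t in lborel. t \<in> {0..Sb} \<longrightarrow> y t \<omega> = y' t" by blast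
    note \<Phi>m[measurable]
    define h where "h = sqnorm_HS sqnorm_real"
    have h0: "h 0 = 0" by (simp add: h_def sqnorm_HS_def sqnorm_real_def)
    have hy[measurable]: "(\<lambda>t. h (y' t)) \<in> borel_measurable lborel"
      unfolding h_def sqnorm_HS_def sqnorm_real_def by measurable
    have hd[measurable]: "(\<lambda>t. h (\<Phi> k t \<omega> - y' t)) \<in> borel_measurable lborel" for k
      unfolding h_def sqnorm_HS_def sqnorm_real_def by simp
    define Ek where "Ek k = (\<integral>\<^sup>+t\<in>{0..Sb}. h (\<Phi> k t \<omega> - y' t) \<partial>lborel)" for k
    define Q where "Q = (\<integral>\<^sup>+t\<in>{0..Sb}. h (y' t) \<partial>lborel)"
    have Ek0: "Ek \<longlonglongrightarrow> 0"
    proof -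
      have "Ek k = (\<integral>\<^sup>+t\<in>{0..Sb}. sqnorm_HS sqnorm_real (\<Phi> k t \<omega> - y t \<omega>) \<partial>lborel)" for k
        unfolding Ek_def h_def using y' by (intro nn_integral_cong_AE) (auto elim!: eventually_mono simp: indicator_def)
      then have "Ek = (\<lambda>k. \<integral>\<^sup>+t\<in>{0..Sb}. sqnorm_HS sqnorm_real (\<Phi> k t \<omega> - y t \<omega>) \<partial>lborel)" by (rule ext)
      then show ?thesis using E by simp
    qed
    have Qfin: "Q < \<infinity>"
    proof -
      have "Q = (\<integral>\<^sup>+t\<in>{0..Sb}. sqnorm_HS sqnorm_real (y t \<omega>) \<partial>lborel)"
        unfolding Q_def h_def using y' by (intro nn_integral_cong_AE) (auto elim!: eventually_mono simp: indicator_def)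
      then show ?thesis using fin by simp
    qed
    have QVe: "ennreal (step_variation (n k) (m k) (\<tau> k) (z k) \<omega>) = (\<Sum>l<n k. sqnorm_HS sqnorm_real (z k l \<omega>) * ennreal (\<tau> k (Suc l) - \<tau> k l))" for k
        by (rule step_variation_eq_nn_integral[OF g]) (rule v[OF _ \<omega>])
      have QVle: "ennreal (step_variation (n k) (m k) (\<tau> k) (z k) \<omega>) \<le> 2 * Ek k + 2 * Q" for k
    proof -
      have "ennreal (step_variation (n k) (m k) (\<tau> k) (z k) \<omega>) = (\<integral>\<^sup>+t\<in>{0..S}. h (\<Phi> k t \<omega>) \<partial>lborel)"
        using QVe \<Phi>[of h, OF h0] by (simp add: h_def)
      also have "\<dots> \<le> (\<integral>\<^sup>+t. 2 * (h (\<Phi> k t \<omega> - y' t) * indicator {0..Sb} t) + 2 * (h (y' t) * indicator {0..Sb} t) \<partial>lborel)"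
        using S sqnorm_HS_real_triangle unfolding h_def by (intro nn_integral_mono) (auto simp: indicator_def)
      also have "\<dots> = 2 * Ek k + 2 * Q"
        unfolding Ek_def Q_def by (subst nn_integral_add) (auto simp: nn_integral_cmult)
      finally show ?thesis .
    qed
    \<comment> \<open>Once the error \<open>Ek k\<close> is below 1, the variation is at most 2 + 2
      Q.\<close>
    obtain C :: nat where C: "2 + 2 * Q \<le> of_nat C"
    proof -
      have "2 + 2 * Q < top" using Qfin by (simp add: ennreal_add_eq_top ennreal_mult_eq_top_iff less_top[symmetric])
      from ennreal_Ex_less_of_nat[OF this] obtain C :: nat where "2 + 2 * Q < of_nat C" by blast
      then show thesis using that by (auto intro: less_imp_le)
    qed
    have evQ: "\<forall>\<^sub>F k in sequentially. step_variation (n k) (m k) (\<tau> k) (z k) \<omega> \<le> real C"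
      using order_tendstoD(2)[OF Ek0, of 1]
    proof (rule eventually_mono)
      fix k assume "Ek k < 1"
      then have "2 * Ek k \<le> 2 * 1" by (intro mult_left_mono) auto
      then have "2 * Ek k + 2 * Q \<le> 2 + 2 * Q" by (intro add_right_mono) simp
      then have "2 * Ek k + 2 * Q \<le> of_nat C" using C by (rule order_trans)
      from order_trans[OF QVle this]
      have "ennreal (step_variation (n k) (m k) (\<tau> k) (z k) \<omega>) \<le> ennreal (real C)"
        by (simp only: ennreal_of_nat_eq_real_of_nat)
      then show "step_variation (n k) (m k) (\<tau> k) (z k) \<omega> \<le> real C" by (subst (asm) ennreal_le_iff) auto
    qed simp
    from P obtain r :: "nat \<Rightarrow> nat" where r: "strict_mono r"
      "(\<lambda>k. projQV (real C) (n (r k)) (m (r k)) (\<tau> (r k)) (z (r k)) c \<omega>) \<longlonglongrightarrow> 0" by blast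
    define G where "G v = ennreal ((ip m0 c v)\<^sup>2)" for v
    have G0: "G 0 = 0" by (simp add: G_def ip_def)
    have Gy[measurable]: "(\<lambda>t. G (y' t)) \<in> borel_measurable lborel"
      unfolding G_def ip_def by measurable
    have G\<Phi>[measurable]: "(\<lambda>t. G (\<Phi> k t \<omega>)) \<in> borel_measurable lborel" for k
      unfolding G_def ip_def by measurable
    define I where "I = (\<integral>\<^sup>+t\<in>{0..S}. G (y' t) \<partial>lborel)"
    \<comment> \<open>The squared component of y' is bounded by the approximation error, through
      Cauchy-Schwarz, and by the squared component of the approximation; the factors 2 come from
      squaring a sum.\<close>
    have Gle: "G y1 \<le> 2 * ennreal (sqsum m0 c) * h (x - y1) + 2 * G x" for x y1
    proof -
      have "(ip m0 c y1)\<^sup>2 \<le> 2 * (ip m0 c (x - y1))\<^sup>2 + 2 * (ip m0 c x)\<^sup>2"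
        unfolding ip_diff using zero_le_power2[of "2 * ip m0 c x - ip m0 c y1"] by (simp add: power2_diff power_mult_distrib)
      also have "\<dots> \<le> 2 * (sqsum m0 c * sqsum m0 (x - y1)) + 2 * (ip m0 c x)\<^sup>2" using ip_square_le by simp
      finally have "G y1 \<le> ennreal (2 * (sqsum m0 c * sqsum m0 (x - y1)) + 2 * (ip m0 c x)\<^sup>2)"
        unfolding G_def by (rule ennreal_leI)
      also have "\<dots> = 2 * ennreal (sqsum m0 c) * ennreal (sqsum m0 (x - y1)) + 2 * G x"
        unfolding G_def by (simp add: ennreal_plus ennreal_mult sqsum_nonneg mult.assoc)
      also have "\<dots> \<le> 2 * ennreal (sqsum m0 c) * h (x - y1) + 2 * G x"
        unfolding h_def by (intro add_right_mono mult_left_mono sqnorm_HS_real_ge) auto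
      finally show ?thesis .
    qed
    have "I \<le> 2 * ennreal (sqsum m0 c) * Ek k + 2 * ennreal (projQV (real C) (n k) (m k) (\<tau> k) (z k) c \<omega>)"
      if q: "step_variation (n k) (m k) (\<tau> k) (z k) \<omega> \<le> real C" for k
    proof -
      have "ennreal (projQV (real C) (n k) (m k) (\<tau> k) (z k) c \<omega>) = (\<Sum>l<n k. G (z k l \<omega>) * ennreal (\<tau> k (Suc l) - \<tau> k l))"
      proof -
        have "projQV (real C) (n k) (m k) (\<tau> k) (z k) c \<omega> = (\<Sum>l<n k. (ip m0 c (z k l \<omega>))\<^sup>2 * (\<tau> k (Suc l) - \<tau> k l))"
          unfolding projQV_def proj_def stopped_def using alive_eq_1[OF g q] ip_support[OF c m]
          by (intro sum.cong) auto
        moreover have "ennreal (\<Sum>l<n k. (ip m0 c (z k l \<omega>))\<^sup>2 * (\<tau> k (Suc l) - \<tau> k l)) =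
            (\<Sum>l<n k. G (z k l \<omega>) * ennreal (\<tau> k (Suc l) - \<tau> k l))"
          unfolding G_def using grid_step[OF g, of _ k]
          by (subst sum_ennreal[symmetric]) (auto simp: ennreal_mult)
        ultimately show ?thesis by simp
      qed
      also have "\<dots> = (\<integral>\<^sup>+t\<in>{0..S}. G (\<Phi> k t \<omega>) \<partial>lborel)" using \<Phi>[of G, OF G0] by simp
      finally have p: "ennreal (projQV (real C) (n k) (m k) (\<tau> k) (z k) c \<omega>) = (\<integral>\<^sup>+t\<in>{0..S}. G (\<Phi> k t \<omega>) \<partial>lborel)" .
      have "I \<le> (\<integral>\<^sup>+t. 2 * ennreal (sqsum m0 c) * (h (\<Phi> k t \<omega> - y' t) * indicator {0..Sb} t) + 2 * (G (\<Phi> k t \<omega>) * indicator {0..S} t) \<partial>lborel)"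
        unfolding I_def using S Gle by (intro nn_integral_mono) (auto simp: indicator_def)
      also have "\<dots> = 2 * ennreal (sqsum m0 c) * Ek k + 2 * (\<integral>\<^sup>+t\<in>{0..S}. G (\<Phi> k t \<omega>) \<partial>lborel)"
        unfolding Ek_def by (subst nn_integral_add) (auto simp: nn_integral_cmult)
      finally show ?thesis unfolding p .
    qed
    then have "\<forall>\<^sub>F k in sequentially. I \<le> 2 * ennreal (sqsum m0 c) * Ek (r k) + 2 * ennreal (projQV (real C) (n (r k)) (m (r k)) (\<tau> (r k)) (z (r k)) c \<omega>)"
      using eventually_subseq[OF r(1) evQ] by (auto elim!: eventually_mono)
    moreover have "(\<lambda>k. 2 * ennreal (sqsum m0 c) * Ek (r k) + 2 * ennreal (projQV (real C) (n (r k)) (m (r k)) (\<tau> (r k)) (z (r k)) c \<omega>)) \<longlonglongrightarrow> 2 * ennreal (sqsum m0 c) * 0 + 2 * ennreal 0"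
      using LIMSEQ_subseq_LIMSEQ[OF Ek0 r(1)] r(2)
      by (intro tendsto_add ennreal_tendsto_cmult tendsto_ennrealI) (auto simp: o_def ennreal_mult_less_top)
    ultimately have "I \<le> 2 * ennreal (sqsum m0 c) * 0 + 2 * ennreal 0"
      by (intro tendsto_lowerbound) auto
    then have "I = 0" by simp
    then have "AE t in lborel. G (y' t) * indicator {0..S} t = 0"
      unfolding I_def by (subst (asm) nn_integral_0_iff_AE) auto
    then show "AE t in lborel. t \<in> {0..S} \<longrightarrow> ip m0 c (y t \<omega>) = 0"
      using y'
    proof eventually_elim
      fix t assume a: "G (y' t) * indicator {0..S} t = 0" "t \<in> {0..Sb} \<longrightarrow> y t \<omega> = y' t"
      show "t \<in> {0..S} \<longrightarrow> ip m0 c (y t \<omega>) = 0"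
      proof
        assume t: "t \<in> {0..S}"
        then have "y t \<omega> = y' t" using a(2) S by auto
        then show "ip m0 c (y t \<omega>) = 0" using a(1) t by (simp add: G_def indicator_def)
      qed
    qed
  qed
qed


section \<open>The claim and its orthogonality relations, by characteristic functions\<close>

lemma step_char:
  fixes G :: "'w \<Rightarrow> complex"
  assumes st: "0 \<le> s" "s \<le> t" "t \<le> Sb" and G: "G \<in> borel_measurable (F s)" "integrable M G"
  shows "integrable M (\<lambda>\<omega>. G \<omega> * iexp (dW m v s t \<omega>))"
    "(\<integral>\<omega>. G \<omega> * iexp (dW m v s t \<omega>) \<partial>M) = (\<integral>\<omega>. G \<omega> \<partial>M) * exp (- (sqsum m v * (t - s) / 2))"
proof -
  have i: "indep_var borel G borel (\<lambda>\<omega>. iexp (dW m v s t \<omega>))"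
    by (rule dW_indep_map[OF st G(1)]) simp
  have e: "integrable M (\<lambda>\<omega>. iexp (dW m v s t \<omega>))"
    using dW_meas[OF st, of m v] by (intro integrable_const_bound[of _ 1]) auto
  show "integrable M (\<lambda>\<omega>. G \<omega> * iexp (dW m v s t \<omega>))" by (rule indep_var_integrable[OF i G(2) e])
  show "(\<integral>\<omega>. G \<omega> * iexp (dW m v s t \<omega>) \<partial>M) = (\<integral>\<omega>. G \<omega> \<partial>M) * exp (- (sqsum m v * (t - s) / 2))"
    using indep_var_lebesgue_integral[OF i G(2) e] dW_char[OF st, of m v] by simp
qed

lemma dW_split: "dW m v r t \<omega> = dW m v r s \<omega> + dW m v s t \<omega>"
  by (simp add: dW_def sum.distrib[symmetric] distrib_left[symmetric])

text \<open>Let R h be the mean of H exp(i (Z + h D)), with Z the Gaussian sum and D the increment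
  in direction c. Over (s, t] the coefficient is Y + h c, of squared length |Y|^2 + h^2 |c|^2 by
  orthogonality, so R is even in h. Comparing real parts at h and -h shows that the mean of H sin(h
  D) sin Z is zero; dividing by h and letting h tend to 0 gives the result.\<close>

lemma sin_orthogonal_finite:
  assumes st: "0 \<le> s" "s \<le> t" "t \<le> S" "S \<le> Sb" and H: "simple_function (F s) H"
    and c: "ip k Y c = 0"
  shows "(\<integral>\<omega>. H \<omega> * dW k c s t \<omega> * sin (dW k Y 0 S \<omega>) \<partial>M) = 0"
proof -
  let ?Z = "dW k Y 0 S" and ?D = "dW k c s t"
  have st': "0 \<le> s" "s \<le> t" "t \<le> Sb" and tS: "0 \<le> t" "t \<le> S" "S \<le> Sb" and S0: "0 \<le> S" using st by auto
  have Hi: "integrable M H" using simple_integrable[of s H "\<lambda>x. x"] H st by auto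
  have HF: "H \<in> borel_measurable (F s)" using H by (rule borel_measurable_simple_function)
  have HM: "H \<in> borel_measurable M" using Hi by auto
  have ZM: "?Z \<in> borel_measurable M" using dW_meas[of 0 S k Y] st S0 by auto
  have DM: "?D \<in> borel_measurable M" using dW_meas[OF st'] by auto
  define R where "R h = (\<integral>\<omega>. of_real (H \<omega>) * iexp (?Z \<omega> + h * ?D \<omega>) \<partial>M)" for h
  have Re: "R h = R (- h)" for h
  proof -
    have "R h = (\<integral>\<omega>. of_real (H \<omega>) * iexp (dW k Y 0 s \<omega>) \<partial>M) * exp (- ((sqsum k Y + h\<^sup>2 * sqsum k c) * (t - s) / 2)) * exp (- (sqsum k Y * (S - t) / 2))" for h
    proof -
      \<comment> \<open>The perturbation acts on (s, t] only; before s and after t the coefficient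
        is still Y, and the last two pieces are integrated out one after the other.\<close>
      let ?v = "\<lambda>i. Y i + h * c i"
      have n2v: "sqsum k ?v = sqsum k Y + h\<^sup>2 * sqsum k c"
        using c by (simp add: sqsum_add[of k Y "\<lambda>i. h * c i"] ip_scale sqsum_scale)
      let ?G1 = "\<lambda>\<omega>. of_real (H \<omega>) * iexp (dW k Y 0 s \<omega>)"
      let ?G2 = "\<lambda>\<omega>. ?G1 \<omega> * iexp (dW k ?v s t \<omega>)"
      have G1: "?G1 \<in> borel_measurable (F s)"
        using HF dW_adapted[of 0 s s k Y] st by auto
      have G1i: "integrable M ?G1"
      proof (rule Bochner_Integration.integrable_bound[OF Hi])
        show "?G1 \<in> borel_measurable M" using F_meas_M[OF _ G1] st by auto
      qed (auto simp: norm_mult)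
      note 1 = step_char[OF st' G1 G1i, of k ?v]
      have G2: "?G2 \<in> borel_measurable (F t)"
        using F_meas_mono[OF st' G1] dW_adapted[of s t t k ?v] st by auto
      note 2 = step_char[OF tS G2 1(1), of k Y]
      have "of_real (H \<omega>) * iexp (?Z \<omega> + h * ?D \<omega>) = ?G2 \<omega> * iexp (dW k Y t S \<omega>)" for \<omega>
      proof -
        have "?Z \<omega> + h * ?D \<omega> = dW k Y 0 s \<omega> + dW k ?v s t \<omega> + dW k Y t S \<omega>"
          using dW_split[of k Y 0 S \<omega> s] dW_split[of k Y s S \<omega> t] dW_add[of k Y "\<lambda>i. h * c i" s t \<omega>]
          by (simp add: dW_scale)
        then have "iexp (?Z \<omega> + h * ?D \<omega>) = iexp (dW k Y 0 s \<omega>) * iexp (dW k ?v s t \<omega>) * iexp (dW k Y t S \<omega>)"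
          by (simp add: distrib_left exp_add)
        then show ?thesis by (simp only: mult.assoc)
      qed
      then have "R h = (\<integral>\<omega>. ?G2 \<omega> * iexp (dW k Y t S \<omega>) \<partial>M)"
        unfolding R_def by (intro Bochner_Integration.integral_cong refl)
      then show ?thesis by (simp only: 2(2) 1(2) n2v)
    qed
    then show ?thesis by simp
  qed
  have z: "(\<integral>\<omega>. H \<omega> * sin (h * ?D \<omega>) * sin (?Z \<omega>) \<partial>M) = 0" for h
  proof -
    have i: "integrable M (\<lambda>\<omega>. of_real (H \<omega>) * iexp (?Z \<omega> + h * ?D \<omega>))" for h
    proof (rule Bochner_Integration.integrable_bound[OF Hi])
      show "(\<lambda>\<omega>. of_real (H \<omega>) * iexp (?Z \<omega> + h * ?D \<omega>)) \<in> borel_measurable M"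
        using HM ZM DM by measurable
      show "AE \<omega> in M. norm (of_real (H \<omega>) * iexp (?Z \<omega> + h * ?D \<omega>)) \<le> norm (H \<omega>)"
        by (intro AE_I2) (simp only: norm_mult norm_of_real norm_exp_i_times mult_1_right real_norm_def order_refl)
    qed
    have r: "Re (R h) = (\<integral>\<omega>. H \<omega> * cos (?Z \<omega> + h * ?D \<omega>) \<partial>M)" for h
    proof -
      have "Re (R h) = (\<integral>\<omega>. Re (of_real (H \<omega>) * iexp (?Z \<omega> + h * ?D \<omega>)) \<partial>M)"
        unfolding R_def by (rule integral_Re[OF i, symmetric])
      also have "\<dots> = (\<integral>\<omega>. H \<omega> * cos (?Z \<omega> + h * ?D \<omega>) \<partial>M)"
        by (rule Bochner_Integration.integral_cong[OF refl]) (simp only: cis_conv_exp[symmetric] Re_complex_of_real Im_complex_of_real mult_zero_left times_complex.simps cis.simps diff_zero)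
      finally show ?thesis .
    qed
    have ic: "integrable M (\<lambda>\<omega>. H \<omega> * cos (?Z \<omega> + h * ?D \<omega>))" for h
      using HM ZM DM by (intro integrable_mult_bounded[OF Hi, of _ 1]) auto
    have "0 = Re (R h) - Re (R (- h))" using Re[of h] by simp
    also have "\<dots> = (\<integral>\<omega>. H \<omega> * cos (?Z \<omega> + h * ?D \<omega>) - H \<omega> * cos (?Z \<omega> + (- h) * ?D \<omega>) \<partial>M)"
      unfolding r by (rule Bochner_Integration.integral_diff[OF ic ic, symmetric])
    also have "\<dots> = (\<integral>\<omega>. (- 2) * (H \<omega> * sin (h * ?D \<omega>) * sin (?Z \<omega>)) \<partial>M)"
      by (rule Bochner_Integration.integral_cong[OF refl]) (simp add: cos_add cos_diff algebra_simps)
    also have "\<dots> = (- 2) * (\<integral>\<omega>. H \<omega> * sin (h * ?D \<omega>) * sin (?Z \<omega>) \<partial>M)"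
      by (rule integral_mult_right_zero)
    finally show ?thesis by simp
  qed
  have iD: "integrable M (\<lambda>\<omega>. H \<omega> * ?D \<omega>)"
    using step_mean(1)[OF st' HF Hi, of "\<lambda>_. c" k] by simp
  \<comment> \<open>Difference quotients with h = 1 / Suc j, dominated by |H D| since |sin x| \<le>
    |x|.\<close>
  define f where "f j \<omega> = H \<omega> * (real (Suc j) * sin (?D \<omega> / real (Suc j))) * sin (?Z \<omega>)" for j \<omega>
  have "(\<lambda>j. \<integral>\<omega>. f j \<omega> \<partial>M) \<longlonglongrightarrow> (\<integral>\<omega>. H \<omega> * ?D \<omega> * sin (?Z \<omega>) \<partial>M)"
  proof (rule integral_dominated_convergence[where w="\<lambda>\<omega>. \<bar>H \<omega> * ?D \<omega>\<bar>"])
    have lim: "(\<lambda>j. real (Suc j) * sin (x / real (Suc j))) \<longlonglongrightarrow> x" for x :: real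
    proof (cases "x = 0")
      case False
      have "(\<lambda>j. x / real (Suc j)) \<longlonglongrightarrow> 0"
        using tendsto_mult_right_zero[OF LIMSEQ_inverse_real_of_nat, of x] by (simp add: divide_inverse)
      moreover have "\<forall>\<^sub>F j in sequentially. x / real (Suc j) \<noteq> 0" using False by simp
      ultimately have "filterlim (\<lambda>j. x / real (Suc j)) (at 0) sequentially" by (rule filterlim_atI)
      from filterlim_compose[OF _ this, of "\<lambda>y. sin y / y" "nhds 1"]
      have "(\<lambda>j. sin (x / real (Suc j)) / (x / real (Suc j))) \<longlonglongrightarrow> 1"
        using DERIV_sin[of 0] by (auto simp: DERIV_def o_def)
      from tendsto_mult_left[OF this, of x]
      have "(\<lambda>j. x * (sin (x / real (Suc j)) / (x / real (Suc j)))) \<longlonglongrightarrow> x" by simp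
      moreover have "(\<lambda>j. x * (sin (x / real (Suc j)) / (x / real (Suc j)))) = (\<lambda>j. real (Suc j) * sin (x / real (Suc j)))"
        using False by (simp add: fun_eq_iff del: of_nat_Suc)
      ultimately show ?thesis by simp
    qed simp
    show "AE \<omega> in M. (\<lambda>j. f j \<omega>) \<longlonglongrightarrow> H \<omega> * ?D \<omega> * sin (?Z \<omega>)"
      unfolding f_def by (intro AE_I2 tendsto_intros lim)
    show "AE \<omega> in M. norm (f j \<omega>) \<le> \<bar>H \<omega> * ?D \<omega>\<bar>" for j
    proof (intro AE_I2)
      fix \<omega>
      have "\<bar>real (Suc j) * sin (?D \<omega> / real (Suc j))\<bar> \<le> real (Suc j) * \<bar>?D \<omega> / real (Suc j)\<bar>"
        unfolding abs_mult using abs_sin_x_le_abs_x[of "?D \<omega> / real (Suc j)"] by (intro mult_mono) auto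
      also have "\<dots> = \<bar>?D \<omega>\<bar>" by simp
      finally have 1: "\<bar>real (Suc j) * sin (?D \<omega> / real (Suc j))\<bar> \<le> \<bar>?D \<omega>\<bar>" .
      have "norm (f j \<omega>) = \<bar>H \<omega>\<bar> * \<bar>real (Suc j) * sin (?D \<omega> / real (Suc j))\<bar> * \<bar>sin (?Z \<omega>)\<bar>"
        unfolding f_def by (simp only: real_norm_def abs_mult)
      also have "\<dots> \<le> \<bar>H \<omega>\<bar> * \<bar>?D \<omega>\<bar> * 1" using 1 by (intro mult_mono mult_nonneg_nonneg) auto
      finally show "norm (f j \<omega>) \<le> \<bar>H \<omega> * ?D \<omega>\<bar>" by (simp add: abs_mult)
    qed
    show "f j \<in> borel_measurable M" for j unfolding f_def using HM DM ZM by measurable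
  qed (use iD HM DM ZM in auto)
  moreover have "(\<integral>\<omega>. f j \<omega> \<partial>M) = 0" for j
  proof -
    have "(\<integral>\<omega>. f j \<omega> \<partial>M) = (\<integral>\<omega>. real (Suc j) * (H \<omega> * sin ((1 / real (Suc j)) * ?D \<omega>) * sin (?Z \<omega>)) \<partial>M)"
      unfolding f_def by (rule Bochner_Integration.integral_cong[OF refl]) (simp add: ac_simps)
    also have "\<dots> = real (Suc j) * (\<integral>\<omega>. H \<omega> * sin ((1 / real (Suc j)) * ?D \<omega>) * sin (?Z \<omega>) \<partial>M)"
      by (rule integral_mult_right_zero)
    also have "\<dots> = 0" unfolding z by simp
    finally show ?thesis .
  qed
  ultimately show ?thesis by (simp add: LIMSEQ_const_iff)
qed

text \<open>Increments from time 0, so that the partial sums are exactly \<open>dW k Y 0 S\<close>.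
  Where the series diverges the value is a default one; for absolutely summable Y this concerns a
  null set only.\<close>

definition Zlim :: "(nat \<Rightarrow> real) \<Rightarrow> real \<Rightarrow> 'w \<Rightarrow> real" where
  "Zlim Y S \<omega> = (\<Sum>i. Y i * (W i S \<omega> - W i 0 \<omega>))"

lemma Zlim_adapted:
  assumes "0 \<le> S" "S \<le> Sb"
  shows "Zlim Y S \<in> borel_measurable (F S)"
  unfolding Zlim_def using assms
  by (intro borel_measurable_suminf borel_measurable_times borel_measurable_diff W_adapted) auto

text \<open>The first absolute moments of the increments are bounded by 1 + S, so absolute
  summability of Y makes the series of absolute values integrable, hence finite almost
  surely.\<close>

lemma Zlim_converges:
  assumes S: "0 \<le> S" "S \<le> Sb" and Y: "summable (\<lambda>i. \<bar>Y i\<bar>)"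
  shows "AE \<omega> in M. (\<lambda>k. dW k Y 0 S \<omega>) \<longlonglongrightarrow> Zlim Y S \<omega>"
proof -
  let ?D = "\<lambda>i \<omega>. W i S \<omega> - W i 0 \<omega>"
  have Dm: "?D i \<in> borel_measurable M" for i using S by (intro borel_measurable_diff W_meas) auto
  have D1: "(\<integral>\<^sup>+\<omega>. ennreal \<bar>?D i \<omega>\<bar> \<partial>M) \<le> ennreal (1 + S)" for i
  proof -
    \<comment> \<open>A single coordinate as the increment along a unit vector, to reuse its second
      moment.\<close>
    have e: "dW (Suc i) (\<lambda>j. if j = i then 1 else 0) 0 S \<omega> = ?D i \<omega>" for \<omega>
      unfolding dW_def by (subst sum.mono_neutral_right[of _ "{i}"]) auto
    have n: "sqsum (Suc i) (\<lambda>j. if j = i then 1 else 0) = 1"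
      unfolding sqsum_def by (subst sum.mono_neutral_right[of _ "{i}"]) auto
    note sq = dW_square[of 0 S "Suc i" "\<lambda>j. if j = i then 1 else 0", unfolded e n]
    have le: "\<bar>x\<bar> \<le> 1 + x\<^sup>2" for x :: real
    proof -
      have "0 \<le> (\<bar>x\<bar> - 1)\<^sup>2" by simp
      also have "(\<bar>x\<bar> - 1)\<^sup>2 = x\<^sup>2 - 2 * \<bar>x\<bar> + 1" by (simp add: power2_diff)
      finally show ?thesis using abs_ge_zero[of x] by linarith
    qed
    have "(\<integral>\<^sup>+\<omega>. ennreal \<bar>?D i \<omega>\<bar> \<partial>M) \<le> (\<integral>\<^sup>+\<omega>. ennreal (1 + (?D i \<omega>)\<^sup>2) \<partial>M)"
      by (intro nn_integral_mono ennreal_leI le)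
    also have "\<dots> = ennreal (\<integral>\<omega>. 1 + (?D i \<omega>)\<^sup>2 \<partial>M)"
      using sq(1) S by (intro nn_integral_eq_integral) auto
    also have "(\<integral>\<omega>. 1 + (?D i \<omega>)\<^sup>2 \<partial>M) = 1 + S" using sq S by (simp add: prob_space)
    finally show ?thesis .
  qed
  have "(\<integral>\<^sup>+\<omega>. (\<Sum>i. ennreal \<bar>Y i * ?D i \<omega>\<bar>) \<partial>M) = (\<Sum>i. \<integral>\<^sup>+\<omega>. ennreal \<bar>Y i * ?D i \<omega>\<bar> \<partial>M)"
    using Dm by (intro nn_integral_suminf) auto
  also have "\<dots> \<le> (\<Sum>i. ennreal (\<bar>Y i\<bar> * (1 + S)))"
  proof (rule suminf_le)
    fix i
    have "(\<integral>\<^sup>+\<omega>. ennreal \<bar>Y i * ?D i \<omega>\<bar> \<partial>M) = ennreal \<bar>Y i\<bar> * (\<integral>\<^sup>+\<omega>. ennreal \<bar>?D i \<omega>\<bar> \<partial>M)"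
      using Dm by (subst nn_integral_cmult[symmetric]) (auto simp: abs_mult ennreal_mult)
    also have "\<dots> \<le> ennreal \<bar>Y i\<bar> * ennreal (1 + S)" by (intro mult_left_mono D1) auto
    finally show "(\<integral>\<^sup>+\<omega>. ennreal \<bar>Y i * ?D i \<omega>\<bar> \<partial>M) \<le> ennreal (\<bar>Y i\<bar> * (1 + S))"
      using S by (simp add: ennreal_mult)
  qed auto
  also have "\<dots> < \<infinity>"
    using S summable_mult2[OF Y, of "1 + S"] by (subst suminf_ennreal2) auto
  finally have "AE \<omega> in M. (\<Sum>i. ennreal \<bar>Y i * ?D i \<omega>\<bar>) \<noteq> \<infinity>"
    using Dm by (intro nn_integral_PInf_AE) auto
  then show ?thesis
  proof eventually_elim
    fix \<omega> assume "(\<Sum>i. ennreal \<bar>Y i * ?D i \<omega>\<bar>) \<noteq> \<infinity>"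
    then have "summable (\<lambda>i. \<bar>Y i * ?D i \<omega>\<bar>)" by (intro summable_suminf_not_top) auto
    then have "summable (\<lambda>i. Y i * ?D i \<omega>)" by (rule summable_rabs_cancel)
    then show "(\<lambda>k. dW k Y 0 S \<omega>) \<longlonglongrightarrow> Zlim Y S \<omega>"
      unfolding dW_def Zlim_def by (rule summable_LIMSEQ)
  qed
qed

lemma sin_Zlim_orthogonal:
  assumes st: "0 \<le> s" "s \<le> t" "t \<le> S" "S \<le> Sb" and H: "simple_function (F s) H"
    and Y: "summable (\<lambda>i. \<bar>Y i\<bar>)"
    and c: "\<And>i. m0 \<le> i \<Longrightarrow> c i = 0" "ip m0 Y c = 0" and m: "m0 \<le> m"
  shows "(\<integral>\<omega>. H \<omega> * dW m c s t \<omega> * sin (Zlim Y S \<omega>) \<partial>M) = 0"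
proof -
  have st': "0 \<le> s" "s \<le> t" "t \<le> Sb" and S: "0 \<le> S" using st by auto
  have Hi: "integrable M H" using simple_integrable[of s H "\<lambda>x. x"] H st by auto
  have HF: "H \<in> borel_measurable (F s)" using H by (rule borel_measurable_simple_function)
  have HM: "H \<in> borel_measurable M" using Hi by auto
  have dWm: "dW k c s t \<omega> = dW m0 c s t \<omega>" if "m0 \<le> k" for k \<omega>
    unfolding dW_def using c that by (intro sum.mono_neutral_right) auto
  let ?D = "dW m0 c s t"
  have DM: "?D \<in> borel_measurable M" using dW_meas[OF st'] by auto
  have ZkM: "dW k Y 0 S \<in> borel_measurable M" for k using dW_meas[of 0 S k Y] st S by auto
  have ZM: "Zlim Y S \<in> borel_measurable M" using F_meas_M[OF _ Zlim_adapted[OF S st(4)]] S st by auto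
  have iD: "integrable M (\<lambda>\<omega>. H \<omega> * ?D \<omega>)"
    using step_mean(1)[OF st' HF Hi, of "\<lambda>_. c" m0] by simp
  have "(\<lambda>k. \<integral>\<omega>. H \<omega> * ?D \<omega> * sin (dW k Y 0 S \<omega>) \<partial>M) \<longlonglongrightarrow> (\<integral>\<omega>. H \<omega> * ?D \<omega> * sin (Zlim Y S \<omega>) \<partial>M)"
  proof (rule integral_dominated_convergence[where w="\<lambda>\<omega>. \<bar>H \<omega> * ?D \<omega>\<bar>"])
    show "AE \<omega> in M. (\<lambda>k. H \<omega> * ?D \<omega> * sin (dW k Y 0 S \<omega>)) \<longlonglongrightarrow> H \<omega> * ?D \<omega> * sin (Zlim Y S \<omega>)"
      using Zlim_converges[OF S st(4) Y] by eventually_elim (intro tendsto_intros)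
    show "AE \<omega> in M. norm (H \<omega> * ?D \<omega> * sin (dW k Y 0 S \<omega>)) \<le> \<bar>H \<omega> * ?D \<omega>\<bar>" for k
      by (intro AE_I2) (simp add: abs_mult mult_left_le)
  qed (use iD HM DM ZM ZkM in auto)
  note lim = this
  have "\<forall>\<^sub>F k in sequentially. (\<integral>\<omega>. H \<omega> * ?D \<omega> * sin (dW k Y 0 S \<omega>) \<partial>M) = 0"
    using eventually_ge_at_top[of m0]
  proof eventually_elim
    fix k assume k: "m0 \<le> k"
    have "ip k Y c = ip m0 Y c" unfolding ip_def using c(1) k by (intro sum.mono_neutral_right) auto
    then have "(\<integral>\<omega>. H \<omega> * dW k c s t \<omega> * sin (dW k Y 0 S \<omega>) \<partial>M) = 0"
      using sin_orthogonal_finite[OF st H, of k Y c] c(2) by simp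
    then show "(\<integral>\<omega>. H \<omega> * ?D \<omega> * sin (dW k Y 0 S \<omega>) \<partial>M) = 0" by (simp only: dWm[OF k])
  qed
  from LIMSEQ_unique[OF lim tendsto_eventually[OF this]]
  have "(\<integral>\<omega>. H \<omega> * ?D \<omega> * sin (Zlim Y S \<omega>) \<partial>M) = 0" .
  then show ?thesis by (simp only: dWm[OF m])
qed

text \<open>By symmetry the mean of the sine is 0, which is then the only possible constant. But sin
  Z = 0 means cos(2 Z) = 1, whereas the mean of cos(2 Z) is at most exp(-2 S): the variance of Z is
  at least S because Y p = 1.\<close>

lemma sin_Zlim_not_constant:
  assumes S: "0 < S" "S \<le> Sb" and Y: "summable (\<lambda>i. \<bar>Y i\<bar>)" "Y p = 1"
  shows "\<not> (AE \<omega> in M. sin (Zlim Y S \<omega>) = a)"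
proof
  assume a: "AE \<omega> in M. sin (Zlim Y S \<omega>) = a"
  have S': "0 \<le> S" using S by simp
  have ZkM: "dW k Y 0 S \<in> borel_measurable M" for k using dW_meas[of 0 S k Y] S by auto
  have ZM: "Zlim Y S \<in> borel_measurable M" using F_meas_M[OF _ Zlim_adapted[OF S' S(2)]] S by auto
  have ch: "(\<integral>\<omega>. iexp (x * dW k Y 0 S \<omega>) \<partial>M) = exp (- (x\<^sup>2 * sqsum k Y * S / 2))" for k x
    using dW_char[of 0 S k "\<lambda>i. x * Y i"] S by (simp add: dW_scale sqsum_scale)
  have ii: "integrable M (\<lambda>\<omega>. iexp (x * dW k Y 0 S \<omega>))" for k x
    using ZkM[of k] by (intro integrable_const_bound[of _ 1]) auto
  have sin0: "(\<integral>\<omega>. sin (dW k Y 0 S \<omega>) \<partial>M) = 0" for k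
    using integral_Im[OF ii[of 1 k]] ch[of 1 k] by (simp add: Im_exp)
  have cos2: "(\<integral>\<omega>. cos (2 * dW k Y 0 S \<omega>) \<partial>M) = exp (- (4 * sqsum k Y * S / 2))" for k
    using integral_Re[OF ii[of 2 k]] ch[of 2 k] by (simp add: Re_exp)
  have lim: "AE \<omega> in M. (\<lambda>k. dW k Y 0 S \<omega>) \<longlonglongrightarrow> Zlim Y S \<omega>" by (rule Zlim_converges[OF S' S(2) Y(1)])
  have "(\<lambda>k. \<integral>\<omega>. sin (dW k Y 0 S \<omega>) \<partial>M) \<longlonglongrightarrow> (\<integral>\<omega>. sin (Zlim Y S \<omega>) \<partial>M)"
  proof (rule integral_dominated_convergence[where w="\<lambda>_. 1"])
    show "AE \<omega> in M. (\<lambda>k. sin (dW k Y 0 S \<omega>)) \<longlonglongrightarrow> sin (Zlim Y S \<omega>)"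
      using lim by eventually_elim (intro tendsto_intros)
  qed (use ZM ZkM in auto)
  then have s0: "(\<integral>\<omega>. sin (Zlim Y S \<omega>) \<partial>M) = 0" by (simp add: sin0 LIMSEQ_const_iff)
  have "(\<integral>\<omega>. sin (Zlim Y S \<omega>) \<partial>M) = (\<integral>\<omega>. a \<partial>M)" using a ZM by (intro integral_cong_AE) auto
  then have a0: "a = 0" using s0 by (simp add: prob_space)
  have "(\<lambda>k. \<integral>\<omega>. cos (2 * dW k Y 0 S \<omega>) \<partial>M) \<longlonglongrightarrow> (\<integral>\<omega>. cos (2 * Zlim Y S \<omega>) \<partial>M)"
  proof (rule integral_dominated_convergence[where w="\<lambda>_. 1"])
    show "AE \<omega> in M. (\<lambda>k. cos (2 * dW k Y 0 S \<omega>)) \<longlonglongrightarrow> cos (2 * Zlim Y S \<omega>)"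
      using lim by eventually_elim (intro tendsto_intros)
  qed (use ZM ZkM in auto)
  moreover have "\<forall>\<^sub>F k in sequentially. (\<integral>\<omega>. cos (2 * dW k Y 0 S \<omega>) \<partial>M) \<le> exp (- (2 * S))"
    using eventually_gt_at_top[of p]
  proof eventually_elim
    fix k assume k: "p < k"
    have "(Y p)\<^sup>2 \<le> sqsum k Y" unfolding sqsum_def using k by (intro member_le_sum) auto
    then have "1 * S \<le> sqsum k Y * S" using Y S by (intro mult_right_mono) auto
    then show "(\<integral>\<omega>. cos (2 * dW k Y 0 S \<omega>) \<partial>M) \<le> exp (- (2 * S))" unfolding cos2 by (simp add: mult.commute)
  qed
  ultimately have "(\<integral>\<omega>. cos (2 * Zlim Y S \<omega>) \<partial>M) \<le> exp (- (2 * S))"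
    by (intro tendsto_upperbound) auto
  moreover have "(\<integral>\<omega>. cos (2 * Zlim Y S \<omega>) \<partial>M) = (\<integral>\<omega>. 1 \<partial>M)"
    using a ZM by (intro integral_cong_AE) (auto elim!: eventually_mono simp: cos_double_sin a0)
  ultimately show False using S by (simp add: prob_space)
qed

end

section \<open>Products and exponentials of indefinite integrals\<close>

definition primitive :: "(real \<Rightarrow> real) \<Rightarrow> real \<Rightarrow> real" where
  "primitive h T = (LINT u:{0..T}|lborel. h u)"

text \<open>On a fine grid uniform continuity makes each increment of \<Phi> smaller than e, so its
  square is at most e times the increment, and the sum telescopes to e K. This takes the place of
  differentiation, as the integrands in question are merely integrable.\<close>

lemma constant_of_quadratic_increments:
  fixes D \<Phi> :: "real \<Rightarrow> real"
  assumes b: "0 \<le> b" and cont: "continuous_on {0..b} \<Phi>"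
    and mono: "\<And>s t. 0 \<le> s \<Longrightarrow> s \<le> t \<Longrightarrow> t \<le> b \<Longrightarrow> \<Phi> s \<le> \<Phi> t"
    and D: "\<And>s t. 0 \<le> s \<Longrightarrow> s \<le> t \<Longrightarrow> t \<le> b \<Longrightarrow> \<bar>D t - D s\<bar> \<le> (\<Phi> t - \<Phi> s)\<^sup>2"
  shows "D b = D 0"
proof -
  have uc: "uniformly_continuous_on {0..b} \<Phi>"
    using cont by (intro compact_uniformly_continuous) auto
  define K where "K = \<Phi> b - \<Phi> 0"
  have K: "0 \<le> K" using mono[of 0 b] b by (simp add: K_def)
  have bound: "\<bar>D b - D 0\<bar> \<le> e * K" if e: "0 < e" for e
  proof -
    from uc e obtain d where d: "0 < d" "\<And>x y. x \<in> {0..b} \<Longrightarrow> y \<in> {0..b} \<Longrightarrow> dist y x < d \<Longrightarrow> dist (\<Phi> y) (\<Phi> x) < e"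
      unfolding uniformly_continuous_on_def by meson
    obtain n :: nat where n: "b / d < real n" using reals_Archimedean2 by blast
    have "0 \<le> b / d" using b d by simp
    then have n0: "0 < n" using n by (cases n) auto
    define x where "x j = real j * b / real n" for j :: nat
    have xr: "x j \<in> {0..b}" if "j \<le> n" for j
    proof -
      have "real j * b \<le> real n * b" using that b by (intro mult_right_mono) auto
      then show ?thesis using b n0 by (auto simp: x_def field_simps)
    qed
    have xs: "x j \<le> x (Suc j)" "x (Suc j) - x j < d" for j
    proof -
      have "x (Suc j) - x j = b / real n" using n0 by (simp add: x_def field_simps)
      moreover have "b / real n < d" using n n0 d by (simp add: field_simps)
      moreover have "0 \<le> b / real n" using b by simp
      ultimately show "x j \<le> x (Suc j)" "x (Suc j) - x j < d" by linarith+
    qed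
    have step: "\<bar>D (x (Suc j)) - D (x j)\<bar> \<le> e * (\<Phi> (x (Suc j)) - \<Phi> (x j))" if j: "j < n" for j
    proof -
      let ?d = "\<Phi> (x (Suc j)) - \<Phi> (x j)"
      have r: "x j \<in> {0..b}" "x (Suc j) \<in> {0..b}" using xr j by auto
      have "dist (x (Suc j)) (x j) < d" using xs[of j] by (simp add: dist_real_def)
      then have l: "?d < e" using d(2)[OF r] by (simp add: dist_real_def)
      have g: "0 \<le> ?d" using mono[of "x j" "x (Suc j)"] r xs(1)[of j] by auto
      have "\<bar>D (x (Suc j)) - D (x j)\<bar> \<le> ?d\<^sup>2" using D[of "x j" "x (Suc j)"] r xs(1)[of j] by auto
      also have "\<dots> \<le> e * ?d" using l g by (simp add: power2_eq_square mult_right_mono)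
      finally show ?thesis .
    qed
    have "D b - D 0 = (\<Sum>j<n. D (x (Suc j)) - D (x j))"
      using n0 by (subst sum_lessThan_telescope) (simp add: x_def)
    then have "\<bar>D b - D 0\<bar> \<le> (\<Sum>j<n. \<bar>D (x (Suc j)) - D (x j)\<bar>)" by simp
    also have "\<dots> \<le> (\<Sum>j<n. e * (\<Phi> (x (Suc j)) - \<Phi> (x j)))" using step by (intro sum_mono) auto
    also have "\<dots> = e * (\<Phi> (x n) - \<Phi> (x 0))"
      by (simp add: sum_distrib_left[symmetric] sum_lessThan_telescope[of "\<lambda>j. \<Phi> (x j)"])
    also have "\<dots> = e * K" using n0 by (simp add: x_def K_def)
    finally show ?thesis .
  qed
  show ?thesis
  proof (rule ccontr)
    assume "D b \<noteq> D 0"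
    then have p: "0 < \<bar>D b - D 0\<bar>" by simp
    \<comment> \<open>The bound for e = |D b - D 0| / (2 (K + 1)), where K + 1 avoids a division by
      zero.\<close>
    have "\<bar>D b - D 0\<bar> \<le> (\<bar>D b - D 0\<bar> / (2 * (K + 1))) * K"
      using p K by (intro bound) auto
    also have "\<dots> \<le> \<bar>D b - D 0\<bar> / 2" using p K by (simp add: field_simps)
    finally show False using p by simp
  qed
qed

lemma set_integrable_sub:
  fixes h :: "real \<Rightarrow> real"
  assumes "set_integrable lborel {0..b} h" "0 \<le> s" "t \<le> b"
  shows "set_integrable lborel {s<..t} h" "set_integrable lborel {0..t} h"
  using assms by (auto intro!: set_integrable_subset[OF assms(1)])

lemma primitive_diff:
  assumes h: "set_integrable lborel {0..b} h" and st: "0 \<le> s" "s \<le> t" "t \<le> b"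
  shows "primitive h t - primitive h s = (LINT u:{s<..t}|lborel. h u)"
proof -
  have "{0..t} = {0..s} \<union> {s<..t}" using st by auto
  moreover have "{0..s} \<inter> {s<..t} = {}" by auto
  ultimately have "primitive h t = primitive h s + (LINT u:{s<..t}|lborel. h u)"
    unfolding primitive_def using set_integrable_sub[OF h, of 0 s] set_integrable_sub[OF h, of s t] st
    by (simp add: set_integral_Un)
  then show ?thesis by simp
qed

lemma primitive_0 [simp]: "primitive h 0 = 0"
proof -
  have "AE u in lborel. indicator {0::real..0} u *\<^sub>R h u = 0"
    using AE_lborel_singleton[of "0::real"] by eventually_elim auto
  then show ?thesis unfolding primitive_def set_lebesgue_integral_def by (rule integral_eq_zero_AE)
qed

lemma primitive_continuous:
  assumes h: "set_integrable lborel {0..b} h"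
  shows "continuous_on {0..b} (primitive h)"
proof -
  have e: "primitive h t = integral {0..t} h" if "t \<in> {0..b}" for t
    unfolding primitive_def using set_integrable_sub[OF h, of 0 t] that by (intro set_borel_integral_eq_integral(2)) auto
  have "continuous_on {0..b} (\<lambda>t. integral {0..t} h)"
    by (rule indefinite_integral_continuous_1[OF set_borel_integral_eq_integral(1)[OF h]])
  then show ?thesis using e by (subst continuous_on_cong[OF refl]) auto
qed

lemma primitive_bound:
  assumes h: "set_integrable lborel {0..b} h" and t: "t \<in> {0..b}"
  shows "\<bar>primitive h t\<bar> \<le> primitive (\<lambda>u. \<bar>h u\<bar>) b"
proof -
  have "\<bar>primitive h t\<bar> \<le> primitive (\<lambda>u. \<bar>h u\<bar>) t"
    unfolding primitive_def using set_integrable_sub[OF h, of 0 t] t set_integral_norm_bound[of lborel "{0..t}" h] by auto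
  also have "\<dots> \<le> primitive (\<lambda>u. \<bar>h u\<bar>) b"
    unfolding primitive_def set_lebesgue_integral_def
    using set_integrable_abs[OF set_integrable_sub(2)[OF h, of 0 t]] set_integrable_abs[OF h] t
    by (intro integral_mono) (auto simp: set_integrable_def indicator_def)
  finally show ?thesis .
qed

lemma set_integrable_mult_continuous:
  fixes h k :: "real \<Rightarrow> real"
  assumes h: "set_integrable lborel {0..b} h" and k: "continuous_on {0..b} k"
  shows "set_integrable lborel {0..b} (\<lambda>u. h u * k u)"
proof -
  have km: "(\<lambda>u. indicator {0..b} u *\<^sub>R k u) \<in> borel_measurable lborel"
    using borel_measurable_continuous_on_indicator[OF _ k] by simp
  have "compact (k ` {0..b})" using k by (intro compact_continuous_image) auto
  then obtain K where K: "\<And>u. u \<in> {0..b} \<Longrightarrow> norm (k u) \<le> K"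
    by (meson bounded_iff compact_imp_bounded imageI)
  have hm: "(\<lambda>u. indicator {0..b} u *\<^sub>R h u) \<in> borel_measurable lborel"
    using h by (auto simp: set_integrable_def)
  show ?thesis
    unfolding set_integrable_def
  proof (rule Bochner_Integration.integrable_bound[of _ "\<lambda>u. K * (indicator {0..b} u *\<^sub>R h u)"])
    show "integrable lborel (\<lambda>u. K * (indicator {0..b} u *\<^sub>R h u))"
      using h by (auto simp: set_integrable_def)
    have "(\<lambda>u. (indicator {0..b} u *\<^sub>R h u) * (indicator {0..b} u *\<^sub>R k u)) \<in> borel_measurable lborel"
      using hm km by (rule borel_measurable_times)
    then show "(\<lambda>u. indicator {0..b} u *\<^sub>R (h u * k u)) \<in> borel_measurable lborel"
      by (rule measurable_cong[THEN iffD1, rotated]) (auto simp: indicator_def)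
    show "AE u in lborel. norm (indicator {0..b} u *\<^sub>R (h u * k u)) \<le> norm (K * (indicator {0..b} u *\<^sub>R h u))"
    proof (intro AE_I2)
      fix u
      have "u \<in> {0..b} \<Longrightarrow> \<bar>k u\<bar> \<le> \<bar>K\<bar>" using K[of u] by simp
      then show "norm (indicator {0..b} u *\<^sub>R (h u * k u)) \<le> norm (K * (indicator {0..b} u *\<^sub>R h u))"
        using mult_right_mono[of "\<bar>k u\<bar>" "\<bar>K\<bar>" "\<bar>h u\<bar>"] by (auto simp: indicator_def abs_mult mult.commute)
    qed
  qed
qed

lemma set_integral_mult_small:
  fixes h k :: "real \<Rightarrow> real"
  assumes h: "set_integrable lborel A h" and hk: "set_integrable lborel A (\<lambda>u. h u * k u)"
    and k: "\<And>u. u \<in> A \<Longrightarrow> \<bar>k u\<bar> \<le> c"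
  shows "\<bar>LINT u:A|lborel. h u * k u\<bar> \<le> (LINT u:A|lborel. \<bar>h u\<bar>) * c"
proof -
  have "\<bar>LINT u:A|lborel. h u * k u\<bar> \<le> (LINT u:A|lborel. \<bar>h u * k u\<bar>)"
    using set_integral_norm_bound[OF hk] by simp
  also have "\<dots> \<le> (LINT u:A|lborel. \<bar>h u\<bar> * c)"
    using set_integrable_abs[OF hk] set_integrable_abs[OF h] k
    by (intro set_integral_mono set_integrable_mult_left) (auto simp: abs_mult intro!: mult_left_mono)
  also have "\<dots> = (LINT u:A|lborel. \<bar>h u\<bar>) * c" by simp
  finally show ?thesis .
qed

text \<open>The product and the exponential of indefinite integrals are again indefinite integrals:
  by \<open>constant_of_quadratic_increments\<close> it suffices that the defect is quadratically small on short intervals.\<close>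

lemma primitive_product:
  fixes a0 b0 :: real
  assumes b: "0 \<le> b" and a: "set_integrable lborel {0..b} a" and s: "set_integrable lborel {0..b} s"
  defines "A t \<equiv> a0 + primitive a t" and "B t \<equiv> b0 + primitive s t"
  shows "A b * B b = a0 * b0 + primitive (\<lambda>u. a u * B u + s u * A u) b"
proof -
  let ?w = "\<lambda>u. a u * B u + s u * A u"
  have cA: "continuous_on {0..b} A" and cB: "continuous_on {0..b} B"
    unfolding A_def B_def using primitive_continuous[OF a] primitive_continuous[OF s] by (auto intro!: continuous_intros)
  have aB: "set_integrable lborel {0..b} (\<lambda>u. a u * B u)" and sA: "set_integrable lborel {0..b} (\<lambda>u. s u * A u)"
    by (rule set_integrable_mult_continuous[OF a cB], rule set_integrable_mult_continuous[OF s cA])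
  have w: "set_integrable lborel {0..b} ?w" using aB sA by (rule set_integral_add)
  define D where "D t = A t * B t - primitive ?w t" for t
  \<comment> \<open>The integrand of the comparison function; the factor 2 leaves ample room for
    three error terms of size \<alpha> \<beta>.\<close>
  define h where "h u = 2 * (\<bar>a u\<bar> + \<bar>s u\<bar>)" for u
  have hi: "set_integrable lborel {0..b} h"
    unfolding h_def by (intro set_integrable_mult_right set_integral_add set_integrable_abs a s)
  have "D b = D 0"
  proof (rule constant_of_quadratic_increments[OF b primitive_continuous[OF hi]])
    fix x y assume xy: "0 \<le> x" "x \<le> y" "y \<le> b"
    let ?I = "{x<..y}"
    note sub = set_integrable_sub(1)[OF _ xy(1,3)]
    define \<alpha> where "\<alpha> = (LINT u:?I|lborel. \<bar>a u\<bar>)"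
    define \<beta> where "\<beta> = (LINT u:?I|lborel. \<bar>s u\<bar>)"
    have nn: "0 \<le> \<alpha>" "0 \<le> \<beta>" unfolding \<alpha>_def \<beta>_def set_lebesgue_integral_def by (auto intro!: integral_nonneg_AE)
    have hd: "primitive h y - primitive h x = 2 * (\<alpha> + \<beta>)"
      unfolding primitive_diff[OF hi xy] h_def \<alpha>_def \<beta>_def using sub[OF a] sub[OF s]
      by (simp add: set_integral_add set_integrable_abs)
    then show "primitive h x \<le> primitive h y" using nn by simp
    have dA: "A u - A x = (LINT v:{x<..u}|lborel. a v)" "B u - B x = (LINT v:{x<..u}|lborel. s v)" if "u \<in> {x..y}" for u
      unfolding A_def B_def using primitive_diff[OF a, of x u] primitive_diff[OF s, of x u] xy that by auto
    have le: "\<bar>LINT v:{x<..u}|lborel. f v\<bar> \<le> (LINT v:?I|lborel. \<bar>f v\<bar>)"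
      if f: "set_integrable lborel {0..b} f" and u: "u \<in> {x..y}" for f :: "real \<Rightarrow> real" and u
    proof -
      have i1: "set_integrable lborel {x<..u} f" using set_integrable_sub(1)[OF f] xy u by auto
      have "\<bar>LINT v:{x<..u}|lborel. f v\<bar> \<le> (LINT v:{x<..u}|lborel. \<bar>f v\<bar>)"
        using set_integral_norm_bound[OF i1] by simp
      also have "\<dots> \<le> (LINT v:?I|lborel. \<bar>f v\<bar>)"
        unfolding set_lebesgue_integral_def
        using set_integrable_abs[OF i1] set_integrable_abs[OF sub[OF f]] u
        by (intro integral_mono) (auto simp: set_integrable_def indicator_def)
      finally show ?thesis .
    qed
    have bA: "\<bar>A u - A x\<bar> \<le> \<alpha>" "\<bar>B u - B x\<bar> \<le> \<beta>" if "u \<in> {x..y}" for u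
      unfolding dA[OF that] \<alpha>_def \<beta>_def using le[OF a that] le[OF s that] by auto
    have iB: "set_integrable lborel ?I (\<lambda>u. a u * (B u - B x))" "set_integrable lborel ?I (\<lambda>u. s u * (A u - A x))"
      using cA cB by (auto intro!: sub set_integrable_mult_continuous[OF a] set_integrable_mult_continuous[OF s] continuous_intros)
    have r1: "\<bar>LINT u:?I|lborel. a u * (B u - B x)\<bar> \<le> \<alpha> * \<beta>"
      unfolding \<alpha>_def by (rule set_integral_mult_small[OF sub[OF a] iB(1)]) (use bA(2) in auto)
    have r2: "\<bar>LINT u:?I|lborel. s u * (A u - A x)\<bar> \<le> \<beta> * \<alpha>"
      unfolding \<beta>_def by (rule set_integral_mult_small[OF sub[OF s] iB(2)]) (use bA(1) in auto)
    have "primitive ?w y - primitive ?w x = (LINT u:?I|lborel. (a u * (B u - B x) + s u * (A u - A x)) + (a u * B x + s u * A x))"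
      unfolding primitive_diff[OF w xy] by (rule set_lebesgue_integral_cong) (auto simp: algebra_simps)
    also have "\<dots> = (LINT u:?I|lborel. a u * (B u - B x)) + (LINT u:?I|lborel. s u * (A u - A x))
        + ((LINT u:?I|lborel. a u) * B x + (LINT u:?I|lborel. s u) * A x)"
      using iB sub[OF a] sub[OF s] by (simp add: set_integral_add)
    finally have pw: "primitive ?w y - primitive ?w x = (LINT u:?I|lborel. a u * (B u - B x)) + (LINT u:?I|lborel. s u * (A u - A x))
        + ((A y - A x) * B x + (B y - B x) * A x)" using dA[of y] xy by simp
    \<comment> \<open>With A and B frozen at the left end x the linear parts cancel, and only
      products of increments are left.\<close>
    have "D y - D x = (A y - A x) * (B y - B x) - (LINT u:?I|lborel. a u * (B u - B x)) - (LINT u:?I|lborel. s u * (A u - A x))"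
      using pw unfolding D_def by (simp add: algebra_simps)
    moreover have "\<bar>(A y - A x) * (B y - B x)\<bar> \<le> \<alpha> * \<beta>"
      unfolding abs_mult using bA[of y] xy nn by (intro mult_mono) auto
    ultimately have "\<bar>D y - D x\<bar> \<le> 3 * (\<alpha> * \<beta>)" using r1 r2 by (simp add: mult.commute)
    also have "\<dots> \<le> (2 * (\<alpha> + \<beta>))\<^sup>2"
    proof -
      have "0 \<le> \<alpha> * \<beta>" using nn by simp
      then show ?thesis using zero_le_power2[of \<alpha>] zero_le_power2[of \<beta>] by (simp add: power2_eq_square algebra_simps)
    qed
    finally show "\<bar>D y - D x\<bar> \<le> (primitive h y - primitive h x)\<^sup>2" unfolding hd .
  qed
  then show ?thesis by (simp add: D_def A_def B_def)
qed

lemma abs_exp_diff_le: "\<bar>exp x - exp y\<bar> \<le> exp (max x y) * \<bar>x - y\<bar>" for x y :: real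
proof -
  have *: "exp u - exp v \<le> exp u * (u - v)" "0 \<le> exp u - exp v" if "v \<le> u" for u v :: real
  proof -
    have "1 + (v - u) \<le> exp (v - u)" by (rule exp_ge_add_one_self)
    then have "exp u * (1 + (v - u)) \<le> exp u * exp (v - u)" by (intro mult_left_mono) auto
    also have "\<dots> = exp v" by (simp add: exp_add[symmetric])
    finally show "exp u - exp v \<le> exp u * (u - v)" by (simp add: algebra_simps)
    show "0 \<le> exp u - exp v" using that by simp
  qed
  show ?thesis using *[of x y] *[of y x] by (cases "x \<le> y") (auto simp: max_def abs_if)
qed

text \<open>From exp x (1 - x) \<le> 1 the remainder is at most x (exp x - 1), and the Lipschitz
  bound supplies the second factor |x|.\<close>

lemma abs_exp_remainder: "\<bar>exp x - 1 - x\<bar> \<le> exp \<bar>x\<bar> * x\<^sup>2" for x :: real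
proof -
  have 0: "1 + x \<le> exp x" by (rule exp_ge_add_one_self)
  have "1 - x \<le> exp (- x)" using exp_ge_add_one_self[of "- x"] by simp
  then have "exp x * (1 - x) \<le> exp x * exp (- x)" by (intro mult_left_mono) auto
  then have "exp x * (1 - x) \<le> 1" by (simp add: exp_add[symmetric])
  then have "exp x - 1 - x \<le> x * (exp x - 1)" by (simp add: algebra_simps)
  also have "\<dots> \<le> \<bar>x\<bar> * \<bar>exp x - exp 0\<bar>" by (metis abs_ge_self abs_mult exp_zero)
  also have "\<dots> \<le> \<bar>x\<bar> * (exp (max x 0) * \<bar>x - 0\<bar>)" by (intro mult_left_mono abs_exp_diff_le) auto
  also have "\<dots> \<le> exp \<bar>x\<bar> * x\<^sup>2"
  proof -
    have "exp (max x 0) \<le> exp \<bar>x\<bar>" by simp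
    then have "exp (max x 0) * (\<bar>x\<bar> * \<bar>x\<bar>) \<le> exp \<bar>x\<bar> * (\<bar>x\<bar> * \<bar>x\<bar>)" by (intro mult_right_mono) auto
    then show ?thesis by (simp add: power2_eq_square ac_simps)
  qed
  finally have "exp x - 1 - x \<le> exp \<bar>x\<bar> * x\<^sup>2" .
  moreover have "\<bar>exp x - 1 - x\<bar> = exp x - 1 - x" using 0 by (intro abs_of_nonneg) linarith
  ultimately show ?thesis by simp
qed

lemma primitive_exp:
  assumes b: "0 \<le> b" and a: "set_integrable lborel {0..b} a"
  shows "exp (- primitive a b) = 1 + primitive (\<lambda>u. - (a u * exp (- primitive a u))) b"
proof -
  define e where "e t = exp (- primitive a t)" for t
  let ?w = "\<lambda>u. a u * e u"
  have ce: "continuous_on {0..b} e" unfolding e_def using primitive_continuous[OF a] by (auto intro!: continuous_intros)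
  have w: "set_integrable lborel {0..b} ?w" by (rule set_integrable_mult_continuous[OF a ce])
  define D where "D t = e t + primitive ?w t" for t
  define N where "N = primitive (\<lambda>u. \<bar>a u\<bar>) b"
  have N: "\<bar>primitive a t\<bar> \<le> N" if "t \<in> {0..b}" for t unfolding N_def by (rule primitive_bound[OF a that])
  have N0: "0 \<le> N" using N[of 0] b by simp
  define K where "K = 2 * exp (3 * N)"
  have K: "1 \<le> K" unfolding K_def using N0 one_le_exp_iff[of "3 * N"] by linarith
  define h where "h u = K * \<bar>a u\<bar>" for u
  have hi: "set_integrable lborel {0..b} h"
    unfolding h_def by (intro set_integrable_mult_right set_integrable_abs a)
  have "D b = D 0"
  proof (rule constant_of_quadratic_increments[OF b primitive_continuous[OF hi]])
    fix x y assume xy: "0 \<le> x" "x \<le> y" "y \<le> b"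
    let ?I = "{x<..y}"
    note sub = set_integrable_sub(1)[OF _ xy(1,3)]
    define \<alpha> where "\<alpha> = (LINT u:?I|lborel. \<bar>a u\<bar>)"
    have nn: "0 \<le> \<alpha>" unfolding \<alpha>_def set_lebesgue_integral_def by (auto intro!: integral_nonneg_AE)
    have hd: "primitive h y - primitive h x = K * \<alpha>"
      unfolding primitive_diff[OF hi xy] h_def \<alpha>_def by simp
    moreover have "0 \<le> K * \<alpha>" using nn K by simp
    ultimately show "primitive h x \<le> primitive h y" by linarith
    have le: "\<bar>primitive a u - primitive a x\<bar> \<le> \<alpha>" if u: "u \<in> {x..y}" for u
    proof -
      have i1: "set_integrable lborel {x<..u} a" using set_integrable_sub(1)[OF a] xy u by auto
      have "\<bar>primitive a u - primitive a x\<bar> \<le> (LINT v:{x<..u}|lborel. \<bar>a v\<bar>)"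
        using set_integral_norm_bound[OF i1] primitive_diff[OF a, of x u] xy u by auto
      also have "\<dots> \<le> \<alpha>"
        unfolding \<alpha>_def set_lebesgue_integral_def
        using set_integrable_abs[OF i1] set_integrable_abs[OF sub[OF a]] u
        by (intro integral_mono) (auto simp: set_integrable_def indicator_def)
      finally show ?thesis .
    qed
    have lip: "\<bar>e u - e x\<bar> \<le> exp N * \<alpha>" if u: "u \<in> {x..y}" for u
    proof -
      have "\<bar>e u - e x\<bar> \<le> exp (max (- primitive a u) (- primitive a x)) * \<bar>- primitive a u - - primitive a x\<bar>"
        unfolding e_def by (rule abs_exp_diff_le)
      also have "\<dots> \<le> exp N * \<alpha>"
        using N[of u] N[of x] le[OF u] u xy by (intro mult_mono) auto
      finally show ?thesis .
    qed
    let ?d = "primitive a y - primitive a x"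
    have i: "set_integrable lborel ?I (\<lambda>u. a u * (e u - e x))"
      using ce by (auto intro!: sub set_integrable_mult_continuous[OF a] continuous_intros)
    have r: "\<bar>LINT u:?I|lborel. a u * (e u - e x)\<bar> \<le> \<alpha> * (exp N * \<alpha>)"
      unfolding \<alpha>_def by (rule set_integral_mult_small[OF sub[OF a] i]) (use lip in \<open>auto simp: \<alpha>_def\<close>)
    have "primitive ?w y - primitive ?w x = (LINT u:?I|lborel. a u * (e u - e x) + a u * e x)"
      unfolding primitive_diff[OF w xy] by (rule set_lebesgue_integral_cong) (auto simp: algebra_simps)
    also have "\<dots> = (LINT u:?I|lborel. a u * (e u - e x)) + ?d * e x"
      using i sub[OF a] primitive_diff[OF a xy] by (simp add: set_integral_add)
    finally have pw: "primitive ?w y - primitive ?w x = (LINT u:?I|lborel. a u * (e u - e x)) + ?d * e x" .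
    have ey: "e y = e x * exp (- ?d)" unfolding e_def by (simp add: exp_add[symmetric])
    have "D y - D x = e x * (exp (- ?d) - 1 - (- ?d)) + (LINT u:?I|lborel. a u * (e u - e x))"
      using pw unfolding D_def ey by (simp add: algebra_simps)
    moreover have "\<bar>e x * (exp (- ?d) - 1 - (- ?d))\<bar> \<le> exp (3 * N) * \<alpha>\<^sup>2"
    proof -
      have d2: "\<bar>- ?d\<bar> \<le> 2 * N" using N[of x] N[of y] xy by auto
      have "\<bar>exp (- ?d) - 1 - (- ?d)\<bar> \<le> exp \<bar>- ?d\<bar> * (- ?d)\<^sup>2" by (rule abs_exp_remainder)
      also have "\<dots> \<le> exp (2 * N) * \<alpha>\<^sup>2"
        using d2 le[of y] xy nn by (intro mult_mono) (auto simp: power2_le_iff_abs_le abs_le_iff)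
      finally have "\<bar>exp (- ?d) - 1 - (- ?d)\<bar> \<le> exp (2 * N) * \<alpha>\<^sup>2" .
      moreover have "\<bar>e x\<bar> \<le> exp N" unfolding e_def using N[of x] xy by auto
      ultimately have "\<bar>e x * (exp (- ?d) - 1 - (- ?d))\<bar> \<le> exp N * (exp (2 * N) * \<alpha>\<^sup>2)"
        unfolding abs_mult by (intro mult_mono) auto
      also have "\<dots> = exp (3 * N) * \<alpha>\<^sup>2" by (simp add: mult.assoc[symmetric] exp_add[symmetric])
      finally show ?thesis .
    qed
    ultimately have "\<bar>D y - D x\<bar> \<le> exp (3 * N) * \<alpha>\<^sup>2 + exp N * \<alpha>\<^sup>2"
      using r by (simp add: power2_eq_square ac_simps)
    also have "\<dots> \<le> K * \<alpha>\<^sup>2"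
    proof -
      have "exp N \<le> exp (3 * N)" using N0 by simp
      then have "exp N * \<alpha>\<^sup>2 \<le> exp (3 * N) * \<alpha>\<^sup>2" by (intro mult_right_mono) auto
      then show ?thesis by (simp add: K_def mult.commute)
    qed
    also have "\<dots> \<le> K * K * \<alpha>\<^sup>2" using K by (intro mult_right_mono) auto
    also have "\<dots> = (K * \<alpha>)\<^sup>2" by (simp add: power2_eq_square ac_simps)
    finally show "\<bar>D y - D x\<bar> \<le> (primitive h y - primitive h x)\<^sup>2" unfolding hd .
  qed
  moreover have "primitive (\<lambda>u. - ?w u) b = - primitive ?w b"
    unfolding primitive_def set_lebesgue_integral_def by simp
  ultimately show ?thesis by (simp add: D_def e_def)
qed

lemma Cauchy_Schwarz_integral:
  fixes a b :: "'a \<Rightarrow> real"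
  assumes m: "a \<in> borel_measurable M" "b \<in> borel_measurable M"
    and i: "integrable M (\<lambda>x. (a x)\<^sup>2)" "integrable M (\<lambda>x. (b x)\<^sup>2)"
  shows "integrable M (\<lambda>x. \<bar>a x * b x\<bar>)"
    "(\<integral>x. \<bar>a x * b x\<bar> \<partial>M) \<le> sqrt (\<integral>x. (a x)\<^sup>2 \<partial>M) * sqrt (\<integral>x. (b x)\<^sup>2 \<partial>M)"
proof -
  show ab: "integrable M (\<lambda>x. \<bar>a x * b x\<bar>)" using integrable_mult_of_squares[OF m i] by auto
  have nn: "0 \<le> (\<integral>x. (a x)\<^sup>2 \<partial>M)" "0 \<le> (\<integral>x. (b x)\<^sup>2 \<partial>M)" "0 \<le> (\<integral>x. \<bar>a x * b x\<bar> \<partial>M)"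
    by (auto intro!: integral_nonneg_AE)
  have sq: "(ennreal \<bar>x\<bar>)\<^sup>2 = ennreal (x\<^sup>2)" for x by (simp add: ennreal_power)
  have "(\<integral>\<^sup>+x. ennreal \<bar>a x\<bar> * ennreal \<bar>b x\<bar> \<partial>M)\<^sup>2 \<le> (\<integral>\<^sup>+x. (ennreal \<bar>a x\<bar>)\<^sup>2 \<partial>M) * (\<integral>\<^sup>+x. (ennreal \<bar>b x\<bar>)\<^sup>2 \<partial>M)"
    using m by (intro Cauchy_Schwarz_nn_integral) auto
  then have "(\<integral>\<^sup>+x. ennreal \<bar>a x * b x\<bar> \<partial>M)\<^sup>2 \<le> (\<integral>\<^sup>+x. ennreal ((a x)\<^sup>2) \<partial>M) * (\<integral>\<^sup>+x. ennreal ((b x)\<^sup>2) \<partial>M)"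
    by (simp only: sq ennreal_mult[symmetric] abs_ge_zero abs_mult)
  then have "ennreal ((\<integral>x. \<bar>a x * b x\<bar> \<partial>M)\<^sup>2) \<le> ennreal ((\<integral>x. (a x)\<^sup>2 \<partial>M) * (\<integral>x. (b x)\<^sup>2 \<partial>M))"
    using i ab nn by (simp add: nn_integral_eq_integral ennreal_power ennreal_mult)
  then have "(\<integral>x. \<bar>a x * b x\<bar> \<partial>M)\<^sup>2 \<le> (\<integral>x. (a x)\<^sup>2 \<partial>M) * (\<integral>x. (b x)\<^sup>2 \<partial>M)"
    using nn by (subst (asm) ennreal_le_iff) auto
  then show "(\<integral>x. \<bar>a x * b x\<bar> \<partial>M) \<le> sqrt (\<integral>x. (a x)\<^sup>2 \<partial>M) * sqrt (\<integral>x. (b x)\<^sup>2 \<partial>M)"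
    unfolding real_sqrt_mult[symmetric] by (rule real_le_rsqrt)
qed

section \<open>Square integrable functions on an interval\<close>

text \<open>Elements of H matter on [0, Sb] only; extension by zero moves measurability and
  integration to the whole line.\<close>

definition cutoff :: "real \<Rightarrow> (real \<Rightarrow> real) \<Rightarrow> real \<Rightarrow> real" where
  "cutoff Sb h T = indicator {0..Sb} T * h T"

definition in_H :: "real \<Rightarrow> (real \<Rightarrow> real) \<Rightarrow> bool" where
  "in_H Sb h \<longleftrightarrow> sqnorm_H Sb h < \<infinity>"

text \<open>The norm of H for functions with \<open>in_H\<close>; for a square that is not
  integrable the integral has its default value, so the estimates carry \<open>in_H\<close>
  along.\<close>

definition H_norm :: "real \<Rightarrow> (real \<Rightarrow> real) \<Rightarrow> real" where
  "H_norm Sb h = sqrt (\<integral>T. (cutoff Sb h T)\<^sup>2 \<partial>lborel)"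

lemma sqnorm_H_cutoff:
  "sqnorm_H Sb h = (if cutoff Sb h \<in> borel_measurable lborel then \<integral>\<^sup>+T. ennreal ((cutoff Sb h T)\<^sup>2) \<partial>lborel else \<infinity>)"
proof -
  have "set_borel_measurable lborel {0..Sb} h \<longleftrightarrow> cutoff Sb h \<in> borel_measurable lborel"
    by (simp add: set_borel_measurable_def cutoff_def[abs_def])
  moreover have "(\<integral>\<^sup>+T\<in>{0..Sb}. ennreal ((h T)\<^sup>2) \<partial>lborel) = (\<integral>\<^sup>+T. ennreal ((cutoff Sb h T)\<^sup>2) \<partial>lborel)"
    by (intro nn_integral_cong) (auto simp: cutoff_def indicator_def)
  ultimately show ?thesis by (simp add: sqnorm_H_def)
qed

lemma in_H_iff: "in_H Sb h \<longleftrightarrow> cutoff Sb h \<in> borel_measurable lborel \<and> integrable lborel (\<lambda>T. (cutoff Sb h T)\<^sup>2)"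
proof (cases "cutoff Sb h \<in> borel_measurable lborel")
  case True
  have "(\<integral>\<^sup>+T. ennreal ((cutoff Sb h T)\<^sup>2) \<partial>lborel) < \<infinity> \<longleftrightarrow> integrable lborel (\<lambda>T. (cutoff Sb h T)\<^sup>2)"
    using True by (simp add: integrable_iff_bounded)
  then show ?thesis using True by (simp add: in_H_def sqnorm_H_cutoff)
qed (simp add: in_H_def sqnorm_H_cutoff)

lemma H_norm_nonneg: "0 \<le> H_norm Sb h"
  unfolding H_norm_def by (auto intro!: integral_nonneg_AE)

lemma H_norm_square: "(H_norm Sb h)\<^sup>2 = (\<integral>T. (cutoff Sb h T)\<^sup>2 \<partial>lborel)"
  unfolding H_norm_def by (auto intro!: integral_nonneg_AE)

lemma sqnorm_H_H_norm: "in_H Sb h \<Longrightarrow> sqnorm_H Sb h = ennreal ((H_norm Sb h)\<^sup>2)"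
  unfolding H_norm_square using in_H_iff[of Sb h] by (simp add: sqnorm_H_cutoff nn_integral_eq_integral)

lemma seminorm_of_H: "in_H Sb h \<Longrightarrow> seminorm_of (sqnorm_H Sb) h = ennreal (H_norm Sb h)"
  by (simp add: seminorm_of_def sqnorm_H_H_norm H_norm_nonneg)

lemma cutoff_add: "cutoff Sb (x + y) T = cutoff Sb x T + cutoff Sb y T"
  and cutoff_diff: "cutoff Sb (x - y) T = cutoff Sb x T - cutoff Sb y T"
  and cutoff_scale: "cutoff Sb (c *\<^sub>R x) T = c * cutoff Sb x T"
  by (simp_all add: cutoff_def algebra_simps scaleR_fun_def)

lemma in_H_scale: "in_H Sb x \<Longrightarrow> in_H Sb (c *\<^sub>R x)"
  unfolding in_H_iff cutoff_scale[abs_def] by (auto simp: power_mult_distrib)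

lemma H_norm_scale: "H_norm Sb (c *\<^sub>R x) = \<bar>c\<bar> * H_norm Sb x"
  unfolding H_norm_def cutoff_scale by (simp add: power_mult_distrib real_sqrt_mult)

lemma in_H_add:
  assumes x: "in_H Sb x" and y: "in_H Sb y"
  shows "in_H Sb (x + y)" "H_norm Sb (x + y) \<le> H_norm Sb x + H_norm Sb y"
proof -
  let ?x = "cutoff Sb x" and ?y = "cutoff Sb y"
  have m: "?x \<in> borel_measurable lborel" "?y \<in> borel_measurable lborel"
    and i: "integrable lborel (\<lambda>T. (?x T)\<^sup>2)" "integrable lborel (\<lambda>T. (?y T)\<^sup>2)"
    using x y by (auto simp: in_H_iff)
  have ixy: "integrable lborel (\<lambda>T. ?x T * ?y T)" by (rule integrable_mult_of_squares[OF m i])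
  have e: "(cutoff Sb (x + y) T)\<^sup>2 = (?x T)\<^sup>2 + (2 * (?x T * ?y T) + (?y T)\<^sup>2)" for T
    unfolding cutoff_add by (simp add: power2_sum)
  have isum: "integrable lborel (\<lambda>T. (cutoff Sb (x + y) T)\<^sup>2)"
    unfolding e using i ixy by (intro Bochner_Integration.integrable_add integrable_mult_right) auto
  have ms: "cutoff Sb (x + y) \<in> borel_measurable lborel"
    unfolding cutoff_add[abs_def] using m by (rule borel_measurable_add)
  show "in_H Sb (x + y)" unfolding in_H_iff using isum ms by blast
  note CS = Cauchy_Schwarz_integral[OF m i]
  have "(\<integral>T. ?x T * ?y T \<partial>lborel) \<le> H_norm Sb x * H_norm Sb y"
    unfolding H_norm_def using CS(2) integral_mono[OF ixy CS(1)] by (meson abs_ge_self order_trans)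
  then have "(H_norm Sb (x + y))\<^sup>2 \<le> (H_norm Sb x + H_norm Sb y)\<^sup>2"
    unfolding H_norm_square[of Sb "x + y"] e power2_sum H_norm_square[of Sb x] H_norm_square[of Sb y]
    using i ixy by (simp add: Bochner_Integration.integral_add)
  then show "H_norm Sb (x + y) \<le> H_norm Sb x + H_norm Sb y"
    by (rule power2_le_imp_le) (intro add_nonneg_nonneg H_norm_nonneg)
qed

lemma in_H_0: "in_H Sb 0" and H_norm_0: "H_norm Sb 0 = 0"
  by (simp_all add: in_H_iff H_norm_def cutoff_def[abs_def])

lemma in_H_diff:
  assumes x: "in_H Sb x" and y: "in_H Sb y"
  shows "in_H Sb (x - y)" "H_norm Sb (x - y) \<le> H_norm Sb x + H_norm Sb y"
proof -
  have e: "x - y = x + (-1) *\<^sub>R y" by (simp add: fun_eq_iff scaleR_fun_def)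
  show "in_H Sb (x - y)" unfolding e by (intro in_H_add in_H_scale x y)
  show "H_norm Sb (x - y) \<le> H_norm Sb x + H_norm Sb y"
    unfolding e using in_H_add(2)[OF x in_H_scale[OF y, of "-1"]] by (simp only: H_norm_scale abs_minus abs_one mult_1_left)
qed

lemma H_norm_minus_commute: "H_norm Sb (x - y) = H_norm Sb (y - x)"
  unfolding H_norm_def cutoff_diff by (simp add: power2_commute)

lemma H_norm_triangle:
  assumes "in_H Sb x" "in_H Sb y" "in_H Sb z"
  shows "H_norm Sb (x - z) \<le> H_norm Sb (x - y) + H_norm Sb (y - z)"
  using in_H_add(2)[OF in_H_diff(1)[OF assms(1,2)] in_H_diff(1)[OF assms(2,3)]] by simp

lemma H_norm_triangle': 
  assumes "in_H Sb x" "in_H Sb y"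
  shows "H_norm Sb x \<le> H_norm Sb y + H_norm Sb (x - y)"
  using in_H_add(2)[OF assms(2) in_H_diff(1)[OF assms]] by simp

lemma in_H_sum:
  assumes "\<And>i. i \<in> A \<Longrightarrow> in_H Sb (x i)"
  shows "in_H Sb (\<Sum>i\<in>A. x i)" "H_norm Sb (\<Sum>i\<in>A. x i) \<le> (\<Sum>i\<in>A. H_norm Sb (x i))"
proof -
  have "in_H Sb (\<Sum>i\<in>A. x i) \<and> H_norm Sb (\<Sum>i\<in>A. x i) \<le> (\<Sum>i\<in>A. H_norm Sb (x i))"
    using assms
  proof (induction A rule: infinite_finite_induct)
    case (insert a A)
    then have "in_H Sb (x a)" "in_H Sb (\<Sum>i\<in>A. x i)" "H_norm Sb (\<Sum>i\<in>A. x i) \<le> (\<Sum>i\<in>A. H_norm Sb (x i))" by auto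
    note IH = this
    note add = in_H_add[OF IH(1,2)]
    show ?case unfolding sum.insert[OF insert(1,2)]
      using add(1) order_trans[OF add(2) add_left_mono[OF IH(3)]] by (rule conjI)
  qed (simp_all add: in_H_0 H_norm_0)
  then show "in_H Sb (\<Sum>i\<in>A. x i)" "H_norm Sb (\<Sum>i\<in>A. x i) \<le> (\<Sum>i\<in>A. H_norm Sb (x i))" by auto
qed

lemma in_H_of_sqnorm_limit:
  assumes "(\<lambda>k. sqnorm_H Sb (x k - y)) \<longlonglongrightarrow> 0" "\<And>k. in_H Sb (x k)"
  shows "in_H Sb y"
proof -
  have "\<forall>\<^sub>F k in sequentially. sqnorm_H Sb (x k - y) < 1" using order_tendstoD(2)[OF assms(1), of 1] by simp
  then obtain k where "sqnorm_H Sb (x k - y) < 1" by (auto simp: eventually_sequentially)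
  then have "in_H Sb (x k - y)" by (simp add: in_H_def less_trans[OF _ ennreal_one_less_top])
  from in_H_diff(1)[OF assms(2)[of k] this] show ?thesis by simp
qed

lemma H_norm_tendsto:
  assumes "\<And>k. in_H Sb (x k)"
  shows "(\<lambda>k. sqnorm_H Sb (x k)) \<longlonglongrightarrow> 0 \<longleftrightarrow> (\<lambda>k. H_norm Sb (x k)) \<longlonglongrightarrow> 0"
proof -
  have "(\<lambda>k. sqnorm_H Sb (x k)) \<longlonglongrightarrow> 0 \<longleftrightarrow> (\<lambda>k. (H_norm Sb (x k))\<^sup>2) \<longlonglongrightarrow> 0"
    unfolding sqnorm_H_H_norm[OF assms] by (rule ennreal_tendsto_0_iff) simp
  also have "\<dots> \<longleftrightarrow> (\<lambda>k. H_norm Sb (x k)) \<longlonglongrightarrow> 0"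
  proof
    assume "(\<lambda>k. (H_norm Sb (x k))\<^sup>2) \<longlonglongrightarrow> 0"
    from tendsto_real_sqrt[OF this] show "(\<lambda>k. H_norm Sb (x k)) \<longlonglongrightarrow> 0" by (simp add: H_norm_nonneg)
  next
    assume "(\<lambda>k. H_norm Sb (x k)) \<longlonglongrightarrow> 0"
    from tendsto_power[OF this, of 2] show "(\<lambda>k. (H_norm Sb (x k))\<^sup>2) \<longlonglongrightarrow> 0" by simp
  qed
  finally show ?thesis .
qed

text \<open>Cauchy-Schwarz against the indicator of the interval, whose L2 norm is sqrt Sb.\<close>

lemma in_H_integrable:
  assumes h: "in_H Sb h" and Sb: "0 \<le> Sb"
  shows "set_integrable lborel {0..Sb} h" "primitive (\<lambda>u. \<bar>h u\<bar>) Sb \<le> sqrt Sb * H_norm Sb h"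
proof -
  have m: "cutoff Sb h \<in> borel_measurable lborel" "integrable lborel (\<lambda>T. (cutoff Sb h T)\<^sup>2)"
    using h by (auto simp: in_H_iff)
  let ?i = "indicator {0..Sb} :: real \<Rightarrow> real"
  have i: "?i \<in> borel_measurable lborel" "integrable lborel (\<lambda>T. (?i T)\<^sup>2)" "(\<integral>T. (?i T)\<^sup>2 \<partial>lborel) = Sb"
    using Sb by (auto simp: power2_eq_square indicator_inter_arith[symmetric])
  note CS = Cauchy_Schwarz_integral[OF i(1) m(1) i(2) m(2)]
  have e: "\<bar>?i T * cutoff Sb h T\<bar> = ?i T *\<^sub>R \<bar>h T\<bar>" for T by (auto simp: cutoff_def indicator_def)
  have "integrable lborel (cutoff Sb h)"
    by (rule Bochner_Integration.integrable_bound[OF CS(1) m(1)]) (auto simp: cutoff_def indicator_def)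
  then show "set_integrable lborel {0..Sb} h" by (simp add: set_integrable_def cutoff_def[abs_def])
  show "primitive (\<lambda>u. \<bar>h u\<bar>) Sb \<le> sqrt Sb * H_norm Sb h"
    using CS(2) unfolding e i(3) H_norm_def primitive_def set_lebesgue_integral_def .
qed

lemma in_H_primitive_bound:
  assumes h: "in_H Sb h" and T: "T \<in> {0..Sb}"
  shows "\<bar>primitive h T\<bar> \<le> sqrt Sb * H_norm Sb h"
  using primitive_bound[OF in_H_integrable(1)[OF h] T] in_H_integrable(2)[OF h] T by auto

lemma primitive_linear:
  assumes "in_H Sb x" "in_H Sb y" "T \<in> {0..Sb}"
  shows "primitive (x + y) T = primitive x T + primitive y T" "primitive (x - y) T = primitive x T - primitive y T" "primitive (c *\<^sub>R x) T = c * primitive x T"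
  using set_integrable_sub(2)[OF in_H_integrable(1)[OF assms(1)], of 0 T] set_integrable_sub(2)[OF in_H_integrable(1)[OF assms(2)], of 0 T] assms(3)
  by (auto simp: primitive_def scaleR_fun_def)

lemma primitive_cong: "(\<And>u. u \<in> {0..T} \<Longrightarrow> h u = k u) \<Longrightarrow> primitive h T = primitive k T"
  unfolding primitive_def by (rule set_lebesgue_integral_cong) auto

lemma in_H_mult_continuous:
  assumes x: "in_H Sb x" and k: "continuous_on {0..Sb} k" and c: "\<And>u. u \<in> {0..Sb} \<Longrightarrow> \<bar>k u\<bar> \<le> c" and c0: "0 \<le> c"
  shows "in_H Sb (\<lambda>u. k u * x u)" "H_norm Sb (\<lambda>u. k u * x u) \<le> c * H_norm Sb x"
proof -
  let ?y = "\<lambda>u. k u * x u"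
  have m: "cutoff Sb x \<in> borel_measurable lborel" "integrable lborel (\<lambda>T. (cutoff Sb x T)\<^sup>2)"
    using x by (auto simp: in_H_iff)
  have km: "(\<lambda>u. indicator {0..Sb} u *\<^sub>R k u) \<in> borel_measurable lborel"
    using borel_measurable_continuous_on_indicator[OF _ k] by simp
  have e: "cutoff Sb ?y = (\<lambda>u. (indicator {0..Sb} u *\<^sub>R k u) * cutoff Sb x u)"
    by (auto simp: cutoff_def indicator_def fun_eq_iff)
  have ym: "cutoff Sb ?y \<in> borel_measurable lborel" unfolding e using km m(1) by (rule borel_measurable_times)
  have le: "(cutoff Sb ?y u)\<^sup>2 \<le> c\<^sup>2 * (cutoff Sb x u)\<^sup>2" for u
  proof (cases "u \<in> {0..Sb}")
    case True
    then have "(k u)\<^sup>2 \<le> c\<^sup>2" using c[OF True] c0 by (simp add: abs_le_square_iff[symmetric])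
    then show ?thesis using True by (simp add: cutoff_def power_mult_distrib mult_right_mono)
  qed (simp add: cutoff_def)
  have i2: "integrable lborel (\<lambda>u. c\<^sup>2 * (cutoff Sb x u)\<^sup>2)" using m(2) by simp
  have iy: "integrable lborel (\<lambda>u. (cutoff Sb ?y u)\<^sup>2)"
    using ym le by (intro Bochner_Integration.integrable_bound[OF i2]) (auto simp: abs_mult)
  show "in_H Sb ?y" unfolding in_H_iff using ym iy by blast
  have "(H_norm Sb ?y)\<^sup>2 \<le> (c * H_norm Sb x)\<^sup>2"
    unfolding H_norm_square power_mult_distrib using integral_mono[OF iy i2 le] by simp
  then show "H_norm Sb ?y \<le> c * H_norm Sb x"
    by (rule power2_le_imp_le) (intro mult_nonneg_nonneg c0 H_norm_nonneg)
qed

section \<open>Absolutely continuous curves vanishing at 0, and functionals on them\<close>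

definition in_G :: "real \<Rightarrow> (real \<Rightarrow> real) \<Rightarrow> (real \<Rightarrow> real) \<Rightarrow> bool" where
  "in_G Sb g g' \<longleftrightarrow> in_H Sb g' \<and> (\<forall>T\<in>{0..Sb}. g T = primitive g' T)"

text \<open>Volatility curves vanish at 0, so their norm in G is controlled by the L2 norm of the
  derivative alone; \<open>in_G\<close> carries the derivative explicitly instead of recovering it
  from the curve.\<close>

lemma in_G_sqnorm:
  assumes "in_G Sb g g'" "0 \<le> Sb"
  shows "sqnorm_G Sb g \<le> ennreal ((H_norm Sb g')\<^sup>2)" "g \<in> G_space Sb"
proof -
  have g0: "g 0 = 0" using assms by (auto simp: in_G_def)
  have "sqnorm_G Sb g \<le> ennreal ((g 0)\<^sup>2) + sqnorm_H Sb g'"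
    unfolding sqnorm_G_def using assms g0 by (intro INF_lower) (auto simp: in_G_def in_H_def primitive_def)
  then show 1: "sqnorm_G Sb g \<le> ennreal ((H_norm Sb g')\<^sup>2)" using assms g0 by (simp add: in_G_def sqnorm_H_H_norm)
  show "g \<in> G_space Sb" unfolding G_space_def using le_less_trans[OF 1 ennreal_less_top] by simp
qed

lemma in_G_lin:
  assumes "in_G Sb g g'" "in_G Sb h h'"
  shows "in_G Sb (g + h) (g' + h')" "in_G Sb (g - h) (g' - h')" "in_G Sb (c *\<^sub>R g) (c *\<^sub>R g')"
  using assms by (auto simp: in_G_def in_H_add in_H_diff in_H_scale primitive_linear scaleR_fun_def[of c g])

lemma Gdual_linear:
  assumes "\<phi> \<in> Gdual Sb" "g \<in> G_space Sb" "h \<in> G_space Sb"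
  shows "\<phi> (g + h) = \<phi> g + \<phi> h" "\<phi> (c *\<^sub>R g) = c * \<phi> g"
proof -
  have "linear_on_G Sb \<phi>" using assms(1) by (auto simp: Gdual_def sqnorm_Gdual_def split: if_splits)
  then show "\<phi> (g + h) = \<phi> g + \<phi> h" "\<phi> (c *\<^sub>R g) = c * \<phi> g"
    using assms by (auto simp: linear_on_G_def)
qed

lemma Gdual_diff:
  assumes \<phi>: "\<phi> \<in> Gdual Sb" and g: "in_G Sb g g'" "in_G Sb h h'" and Sb: "0 \<le> Sb"
  shows "\<phi> (g - h) = \<phi> g - \<phi> h"
proof -
  have "\<phi> ((g - h) + h) = \<phi> (g - h) + \<phi> h"
    using in_G_sqnorm(2)[OF in_G_lin(2)[OF g] Sb] in_G_sqnorm(2)[OF g(2) Sb] by (rule Gdual_linear(1)[OF \<phi>])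
  then show ?thesis by simp
qed

text \<open>A curve is scaled into the unit ball. Its norm may be zero, so the division is by any
  positive r that is at least the norm, and r is then brought down to the norm.\<close>

lemma Gdual_bound:
  assumes \<phi>: "\<phi> \<in> Gdual Sb" and Sb: "0 \<le> Sb"
  obtains C where "0 \<le> C" "\<And>g g'. in_G Sb g g' \<Longrightarrow> \<bar>\<phi> g\<bar> \<le> C * H_norm Sb g'"
proof -
  have fin: "sqnorm_Gdual Sb \<phi> < \<infinity>" and lin: "linear_on_G Sb \<phi>"
    using \<phi> by (auto simp: Gdual_def sqnorm_Gdual_def split: if_splits)
  define C where "C = sqrt (enn2real (sqnorm_Gdual Sb \<phi>))"
  have unit: "\<bar>\<phi> g\<bar> \<le> C" if "sqnorm_G Sb g \<le> 1" for g
  proof -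
    have "ennreal ((\<phi> g)\<^sup>2) \<le> sqnorm_Gdual Sb \<phi>"
      using lin that by (auto simp: sqnorm_Gdual_def intro!: SUP_upper)
    also have "\<dots> = ennreal (enn2real (sqnorm_Gdual Sb \<phi>))" using fin by simp
    finally have "(\<phi> g)\<^sup>2 \<le> enn2real (sqnorm_Gdual Sb \<phi>)" by (simp add: ennreal_le_iff)
    from real_sqrt_le_mono[OF this] show ?thesis by (simp add: C_def)
  qed
  have C0: "0 \<le> C" by (simp add: C_def)
  have scaled: "\<bar>\<phi> g\<bar> \<le> C * r" if g: "in_G Sb g g'" and r: "0 < r" "H_norm Sb g' \<le> r" for g g' r
  proof -
    have G: "in_G Sb ((1 / r) *\<^sub>R g) ((1 / r) *\<^sub>R g')" by (rule in_G_lin(3)[OF g g])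
    have "H_norm Sb ((1 / r) *\<^sub>R g') \<le> 1" unfolding H_norm_scale using r by simp
    then have "(H_norm Sb ((1 / r) *\<^sub>R g'))\<^sup>2 \<le> 1" using H_norm_nonneg by (simp add: power_le_one)
    then have "sqnorm_G Sb ((1 / r) *\<^sub>R g) \<le> 1"
      using in_G_sqnorm(1)[OF G Sb] by (meson ennreal_le_1 order_trans)
    from unit[OF this] have "\<bar>(1 / r) * \<phi> g\<bar> \<le> C"
      using Gdual_linear(2)[OF \<phi> in_G_sqnorm(2)[OF g Sb] in_G_sqnorm(2)[OF g Sb]] by simp
    then show ?thesis using r by (simp add: abs_mult field_simps)
  qed
  have "\<bar>\<phi> g\<bar> \<le> C * H_norm Sb g'" if g: "in_G Sb g g'" for g g'
  proof (rule field_le_epsilon)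
    fix e :: real assume e: "0 < e"
    have "\<bar>\<phi> g\<bar> \<le> C * (H_norm Sb g' + e / (C + 1))"
      using e C0 H_norm_nonneg[of Sb g'] by (intro scaled[OF g]) (auto intro!: add_nonneg_pos)
    also have "\<dots> \<le> C * H_norm Sb g' + e" using e C0 by (simp add: distrib_left field_simps)
    finally show "\<bar>\<phi> g\<bar> \<le> C * H_norm Sb g' + e" .
  qed
  then show ?thesis using C0 that by blast
qed

lemma Cauchy_Schwarz_suminf:
  fixes a b :: "nat \<Rightarrow> real"
  assumes a: "summable (\<lambda>i. (a i)\<^sup>2)" and b: "summable (\<lambda>i. (b i)\<^sup>2)"
  shows "summable (\<lambda>i. a i * b i)" "(\<Sum>i. a i * b i)\<^sup>2 \<le> (\<Sum>i. (a i)\<^sup>2) * (\<Sum>i. (b i)\<^sup>2)"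
proof -
  have le: "norm (a i * b i) \<le> (a i)\<^sup>2 + (b i)\<^sup>2" for i
  proof -
    have "0 \<le> (\<bar>a i\<bar> - \<bar>b i\<bar>)\<^sup>2" by simp
    moreover have "(\<bar>a i\<bar> - \<bar>b i\<bar>)\<^sup>2 = (a i)\<^sup>2 - 2 * (\<bar>a i\<bar> * \<bar>b i\<bar>) + (b i)\<^sup>2"
      by (simp add: power2_diff)
    moreover have "0 \<le> \<bar>a i\<bar> * \<bar>b i\<bar>" by simp
    ultimately have "\<bar>a i\<bar> * \<bar>b i\<bar> \<le> (a i)\<^sup>2 + (b i)\<^sup>2" by linarith
    then show ?thesis by (simp add: abs_mult)
  qed
  show s: "summable (\<lambda>i. a i * b i)"
    by (rule summable_comparison_test'[OF summable_add[OF a b], of 0]) (use le in auto)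
  have "(\<lambda>n. (\<Sum>i<n. a i * b i)\<^sup>2) \<longlonglongrightarrow> (\<Sum>i. a i * b i)\<^sup>2"
    by (intro tendsto_power summable_LIMSEQ s)
  moreover have "(\<Sum>i<n. a i * b i)\<^sup>2 \<le> (\<Sum>i. (a i)\<^sup>2) * (\<Sum>i. (b i)\<^sup>2)" for n
  proof -
    have "(\<Sum>i<n. a i * b i)\<^sup>2 \<le> (\<Sum>i<n. (a i)\<^sup>2) * (\<Sum>i<n. (b i)\<^sup>2)" by (rule Cauchy_Schwarz_ineq_sum)
    also have "\<dots> \<le> (\<Sum>i. (a i)\<^sup>2) * (\<Sum>i. (b i)\<^sup>2)"
      using a b by (intro mult_mono sum_le_suminf sum_nonneg suminf_nonneg) auto
    finally show ?thesis .
  qed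
  ultimately show "(\<Sum>i. a i * b i)\<^sup>2 \<le> (\<Sum>i. (a i)\<^sup>2) * (\<Sum>i. (b i)\<^sup>2)"
    by (intro LIMSEQ_le_const2) auto
qed

lemma l2_iff: "u \<in> l2 \<longleftrightarrow> summable (\<lambda>i. (u i)\<^sup>2)"
proof
  assume "u \<in> l2"
  then have "(\<Sum>i. ennreal ((u i)\<^sup>2)) \<noteq> top" by (simp add: l2_def sqnorm_HS_def sqnorm_real_def)
  then show "summable (\<lambda>i. (u i)\<^sup>2)" by (intro summable_suminf_not_top) auto
next
  assume "summable (\<lambda>i. (u i)\<^sup>2)"
  then have "(\<Sum>i. ennreal ((u i)\<^sup>2)) < top" by (subst suminf_ennreal2) auto
  then show "u \<in> l2" by (simp add: l2_def sqnorm_HS_def sqnorm_real_def)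
qed

lemma cutoff_cong: "(\<And>u. u \<in> {0..Sb} \<Longrightarrow> x u = y u) \<Longrightarrow> cutoff Sb x = cutoff Sb y"
  by (auto simp: cutoff_def fun_eq_iff indicator_def)

lemma H_norm_cong: "(\<And>u. u \<in> {0..Sb} \<Longrightarrow> x u = y u) \<Longrightarrow> H_norm Sb x = H_norm Sb y"
  using cutoff_cong[of Sb x y] by (simp add: H_norm_def)

text \<open>The series is formed pointwise. The sum of the squares of the \<rho> i is an integrable
  function R, hence finite almost everywhere, and Cauchy-Schwarz bounds the squared remainder by the
  tail of u times R.\<close>

lemma in_H_series:
  fixes \<rho> :: "nat \<Rightarrow> real \<Rightarrow> real"
  assumes \<rho>: "\<And>i. in_H Sb (\<rho> i)" "summable (\<lambda>i. (H_norm Sb (\<rho> i))\<^sup>2)" and u: "summable (\<lambda>i. (u i)\<^sup>2)"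
  defines "S T \<equiv> \<Sum>i. u i * \<rho> i T"
  shows "in_H Sb S" "(\<lambda>n. H_norm Sb (S - (\<Sum>i<n. u i *\<^sub>R \<rho> i))) \<longlonglongrightarrow> 0"
proof -
  let ?t = "\<lambda>i. cutoff Sb (\<rho> i)"
  have tm: "?t i \<in> borel_measurable lborel" and ti: "integrable lborel (\<lambda>T. (?t i T)\<^sup>2)" for i
    using \<rho>(1)[of i] by (auto simp: in_H_iff)
  have Hi: "(\<integral>T. (?t i T)\<^sup>2 \<partial>lborel) = (H_norm Sb (\<rho> i))\<^sup>2" for i by (simp add: H_norm_square)
  have "(\<integral>\<^sup>+T. (\<Sum>i. ennreal ((?t i T)\<^sup>2)) \<partial>lborel) = (\<Sum>i. \<integral>\<^sup>+T. ennreal ((?t i T)\<^sup>2) \<partial>lborel)"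
    using tm by (intro nn_integral_suminf) auto
  also have "\<dots> = (\<Sum>i. ennreal ((H_norm Sb (\<rho> i))\<^sup>2))"
    using ti by (simp add: nn_integral_eq_integral Hi)
  also have "\<dots> < \<infinity>" using \<rho>(2) by (subst suminf_ennreal2) auto
  finally have "AE T in lborel. (\<Sum>i. ennreal ((?t i T)\<^sup>2)) \<noteq> \<infinity>"
    using tm by (intro nn_integral_PInf_AE) auto
  then have AEs: "AE T in lborel. summable (\<lambda>i. (?t i T)\<^sup>2)"
    by eventually_elim (auto intro: summable_suminf_not_top)
  define R where "R T = (\<Sum>i. (?t i T)\<^sup>2)" for T
  have Ri: "integrable lborel R"
    unfolding R_def using AEs \<rho>(2) by (intro integrable_suminf ti) (auto simp: Hi)
  have trS: "cutoff Sb S T = (\<Sum>i. u i * ?t i T)" for T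
    by (cases "T \<in> {0..Sb}") (auto simp: cutoff_def S_def)
  define D where "D n = S - (\<Sum>i<n. u i *\<^sub>R \<rho> i)" for n
  have trsum: "cutoff Sb (\<Sum>i<n. u i *\<^sub>R \<rho> i) T = (\<Sum>i<n. u i * ?t i T)" for n T
    by (simp add: cutoff_def sum_fun_apply scaleR_fun_def sum_distrib_left ac_simps)
  have Dm: "cutoff Sb (D n) \<in> borel_measurable lborel" for n
  proof -
    have "cutoff Sb (D n) = (\<lambda>T. (\<Sum>i. u i * ?t i T) - (\<Sum>i<n. u i * ?t i T))"
      unfolding D_def cutoff_diff trS trsum by (simp add: fun_eq_iff cutoff_diff[of Sb S] trS trsum)
    then show ?thesis using tm by simp
  qed
  define tail where "tail n = (\<Sum>i. (u (i + n))\<^sup>2)" for n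
  have tail0: "0 \<le> tail n" for n
    unfolding tail_def using u by (intro suminf_nonneg) (auto simp: summable_iff_shift[of "\<lambda>i. (u i)\<^sup>2"])
  have le: "AE T in lborel. (cutoff Sb (D n) T)\<^sup>2 \<le> tail n * R T" for n
    using AEs
  proof eventually_elim
    fix T assume s: "summable (\<lambda>i. (?t i T)\<^sup>2)"
    have sa: "summable (\<lambda>i. (u (i + n))\<^sup>2)" "summable (\<lambda>i. (?t (i + n) T)\<^sup>2)"
      using u s by (auto simp: summable_iff_shift[of "\<lambda>i. (u i)\<^sup>2"] summable_iff_shift[of "\<lambda>i. (?t i T)\<^sup>2"])
    have sab: "summable (\<lambda>i. u i * ?t i T)" by (rule Cauchy_Schwarz_suminf(1)[OF u s])
    have "cutoff Sb (D n) T = (\<Sum>i. u (i + n) * ?t (i + n) T)"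
      unfolding D_def cutoff_diff trS trsum using suminf_minus_initial_segment[OF sab, of n] by simp
    then have "(cutoff Sb (D n) T)\<^sup>2 \<le> tail n * (\<Sum>i. (?t (i + n) T)\<^sup>2)"
      unfolding tail_def using Cauchy_Schwarz_suminf(2)[OF sa] by simp
    also have "\<dots> \<le> tail n * R T"
    proof (intro mult_left_mono tail0)
      have "(\<Sum>i. (?t (i + n) T)\<^sup>2) = R T - (\<Sum>i<n. (?t i T)\<^sup>2)"
        unfolding R_def by (rule suminf_minus_initial_segment[OF s])
      then show "(\<Sum>i. (?t (i + n) T)\<^sup>2) \<le> R T" by (simp add: sum_nonneg)
    qed
    finally show "(cutoff Sb (D n) T)\<^sup>2 \<le> tail n * R T" .
  qed
  have iR: "integrable lborel (\<lambda>T. tail n * R T)" for n using Ri by simp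
  have Di: "integrable lborel (\<lambda>T. (cutoff Sb (D n) T)\<^sup>2)" for n
  proof (rule Bochner_Integration.integrable_bound[OF iR])
    show "AE T in lborel. norm ((cutoff Sb (D n) T)\<^sup>2) \<le> norm (tail n * R T)"
      using le[of n] by eventually_elim (auto intro: order_trans[OF _ abs_ge_self])
  qed (use Dm in auto)
  have L2D: "in_H Sb (D n)" for n unfolding in_H_iff using Dm Di by blast
  then show "in_H Sb S" using L2D[of 0] by (simp add: D_def)
  have HD: "(H_norm Sb (D n))\<^sup>2 \<le> tail n * (\<integral>T. R T \<partial>lborel)" for n
    unfolding H_norm_square using integral_mono_AE[OF Di iR le] by simp
  have "(\<lambda>n. tail n) \<longlonglongrightarrow> 0"
  proof -
    have "tail n = (\<Sum>i. (u i)\<^sup>2) - (\<Sum>i<n. (u i)\<^sup>2)" for n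
      unfolding tail_def by (rule suminf_minus_initial_segment[OF u])
    moreover have "(\<lambda>n. (\<Sum>i. (u i)\<^sup>2) - (\<Sum>i<n. (u i)\<^sup>2)) \<longlonglongrightarrow> (\<Sum>i. (u i)\<^sup>2) - (\<Sum>i. (u i)\<^sup>2)"
      by (intro tendsto_intros summable_LIMSEQ u)
    ultimately show ?thesis by simp
  qed
  then have "(\<lambda>n. tail n * (\<integral>T. R T \<partial>lborel)) \<longlonglongrightarrow> 0" by (rule tendsto_mult_left_zero)
  then have "(\<lambda>n. (H_norm Sb (D n))\<^sup>2) \<longlonglongrightarrow> 0"
    by (rule real_tendsto_sandwich[OF _ _ tendsto_const, rotated 2]) (simp_all add: HD)
  from tendsto_real_sqrt[OF this] show "(\<lambda>n. H_norm Sb (S - (\<Sum>i<n. u i *\<^sub>R \<rho> i))) \<longlonglongrightarrow> 0"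
    by (simp add: H_norm_nonneg D_def)
qed

section \<open>The adjoint of the price volatility\<close>

text \<open>For a forward curve \<open>f\<close>, \<open>price_curve f\<close> is the discounted bond price curve, and the component \<open>i\<close> of its
  volatility $\Gamma$ is \<open>volatility_curve f s\<close> with $s = -\sigma^i$; its derivative is \<open>volatility_slope f s\<close>.\<close>

definition price_curve :: "(real \<Rightarrow> real) \<Rightarrow> real \<Rightarrow> real" where "price_curve f T = exp (- primitive f T)"

definition volatility_curve :: "(real \<Rightarrow> real) \<Rightarrow> (real \<Rightarrow> real) \<Rightarrow> real \<Rightarrow> real" where
  "volatility_curve f s T = price_curve f T * primitive s T"

definition volatility_slope :: "(real \<Rightarrow> real) \<Rightarrow> (real \<Rightarrow> real) \<Rightarrow> real \<Rightarrow> real" where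
  "volatility_slope f s u = price_curve f u * s u - (price_curve f u * primitive s u) * f u"

lemma primitive_continuous_L2:
  assumes "in_H Sb f" "0 \<le> Sb"
  shows "continuous_on {0..Sb} (primitive f)"
  using primitive_continuous[OF in_H_integrable(1)[OF assms]] .

lemma price_curve_bound:
  assumes "in_H Sb f" "T \<in> {0..Sb}"
  shows "\<bar>price_curve f T\<bar> \<le> exp (sqrt Sb * H_norm Sb f)"
  using in_H_primitive_bound[OF assms] by (auto simp: price_curve_def)

lemma price_curve_continuous:
  assumes "in_H Sb f" "0 \<le> Sb"
  shows "continuous_on {0..Sb} (price_curve f)"
  unfolding price_curve_def[abs_def] by (intro continuous_intros primitive_continuous_L2[OF assms])

lemma price_curve_diff:
  assumes f: "in_H Sb f" and h: "in_H Sb h" and T: "T \<in> {0..Sb}" and R: "H_norm Sb f \<le> R" "H_norm Sb h \<le> R"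
  shows "\<bar>price_curve h T - price_curve f T\<bar> \<le> exp (sqrt Sb * R) * (sqrt Sb * H_norm Sb (h - f))"
proof -
  have S: "0 \<le> sqrt Sb" using T by simp
  have "\<bar>price_curve h T - price_curve f T\<bar> \<le> exp (max (- primitive h T) (- primitive f T)) * \<bar>- primitive h T - - primitive f T\<bar>"
    unfolding price_curve_def by (rule abs_exp_diff_le)
  also have "\<dots> \<le> exp (sqrt Sb * R) * (sqrt Sb * H_norm Sb (h - f))"
  proof (rule mult_mono)
    have "- primitive h T \<le> sqrt Sb * R" "- primitive f T \<le> sqrt Sb * R"
      using in_H_primitive_bound[OF h T] in_H_primitive_bound[OF f T] mult_left_mono[OF R(1) S] mult_left_mono[OF R(2) S] by linarith+
    then show "exp (max (- primitive h T) (- primitive f T)) \<le> exp (sqrt Sb * R)" by simp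
    have "primitive (h - f) T = primitive h T - primitive f T" by (rule primitive_linear(2)[OF h f T])
    then show "\<bar>- primitive h T - - primitive f T\<bar> \<le> sqrt Sb * H_norm Sb (h - f)"
      using in_H_primitive_bound[OF in_H_diff(1)[OF h f] T] by simp
  qed auto
  finally show ?thesis .
qed

text \<open>Both parts of the slope are linear in s: a bounded function times s, and f times a
  function whose bound is proportional to the norm of s. This linear bound is the source of the
  decay of the adjoint's coordinates.\<close>

lemma volatility_slope_L2:
  assumes f: "in_H Sb f" and s: "in_H Sb s" and Sb: "0 \<le> Sb"
  shows "in_H Sb (volatility_slope f s)" "H_norm Sb (volatility_slope f s) \<le> exp (sqrt Sb * H_norm Sb f) * (1 + sqrt Sb * H_norm Sb f) * H_norm Sb s"
proof -
  let ?E = "exp (sqrt Sb * H_norm Sb f)"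
  have e: "volatility_slope f s = (\<lambda>u. price_curve f u * s u) - (\<lambda>u. (price_curve f u * primitive s u) * f u)" by (simp add: volatility_slope_def fun_eq_iff)
  note A = in_H_mult_continuous[OF s price_curve_continuous[OF f Sb] price_curve_bound[OF f] exp_ge_zero]
  have c: "continuous_on {0..Sb} (\<lambda>u. price_curve f u * primitive s u)"
    by (intro continuous_intros price_curve_continuous[OF f Sb] primitive_continuous_L2[OF s Sb])
  have b: "\<bar>price_curve f u * primitive s u\<bar> \<le> ?E * (sqrt Sb * H_norm Sb s)" if "u \<in> {0..Sb}" for u
    unfolding abs_mult using price_curve_bound[OF f that] in_H_primitive_bound[OF s that] by (intro mult_mono) auto
  have n: "0 \<le> ?E * (sqrt Sb * H_norm Sb s)" using Sb H_norm_nonneg by auto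
  note B = in_H_mult_continuous[OF f c b n]
  show "in_H Sb (volatility_slope f s)" unfolding e using A(1) B(1) by (intro in_H_diff(1)) auto
  have "H_norm Sb (volatility_slope f s) \<le> ?E * H_norm Sb s + ?E * (sqrt Sb * H_norm Sb s) * H_norm Sb f"
    unfolding e by (rule order_trans[OF in_H_diff(2) add_mono[OF A(2) B(2)]]) (use A(1) B(1) in auto)
  also have "\<dots> = ?E * (1 + sqrt Sb * H_norm Sb f) * H_norm Sb s" by (simp add: algebra_simps)
  finally show "H_norm Sb (volatility_slope f s) \<le> ?E * (1 + sqrt Sb * H_norm Sb f) * H_norm Sb s" .
qed

text \<open>\<open>primitive_exp\<close> makes the price curve an indefinite integral up to the
  constant 1, and \<open>primitive_product\<close> then handles its product with the indefinite
  integral of s.\<close>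

lemma in_G_volatility_curve:
  assumes f: "in_H Sb f" and s: "in_H Sb s" and Sb: "0 \<le> Sb"
  shows "in_G Sb (volatility_curve f s) (volatility_slope f s)"
  unfolding in_G_def
proof (intro conjI ballI)
  show "in_H Sb (volatility_slope f s)" by (rule volatility_slope_L2(1)[OF f s Sb])
  fix T assume T: "T \<in> {0..Sb}"
  have fi: "set_integrable lborel {0..T} f" and si: "set_integrable lborel {0..T} s"
    using set_integrable_sub(2)[OF in_H_integrable(1)[OF f Sb], of 0 T] set_integrable_sub(2)[OF in_H_integrable(1)[OF s Sb], of 0 T] T by auto
  define a where "a u = - (f u * exp (- primitive f u))" for u
  have ai: "set_integrable lborel {0..T} a"
  proof -
    have "continuous_on {0..T} (\<lambda>u. - exp (- primitive f u))" by (intro continuous_intros primitive_continuous[OF fi])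
    from set_integrable_mult_continuous[OF fi this] show ?thesis by (simp add: a_def[abs_def])
  qed
  have Ee: "price_curve f u = 1 + primitive a u" if "u \<in> {0..T}" for u
    unfolding price_curve_def a_def using that set_integrable_sub(2)[OF fi, of 0 u] by (intro primitive_exp) auto
  have "(1 + primitive a T) * (0 + primitive s T) = 1 * 0 + primitive (\<lambda>u. a u * (0 + primitive s u) + s u * (1 + primitive a u)) T"
    using T by (intro primitive_product ai si) auto
  also have "primitive (\<lambda>u. a u * (0 + primitive s u) + s u * (1 + primitive a u)) T = primitive (volatility_slope f s) T"
  proof (rule primitive_cong)
    fix u assume u: "u \<in> {0..T}"
    show "a u * (0 + primitive s u) + s u * (1 + primitive a u) = volatility_slope f s u"
      unfolding volatility_slope_def Ee[OF u, symmetric] by (simp add: a_def price_curve_def)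
  qed
  finally show "volatility_curve f s T = primitive (volatility_slope f s) T" using Ee[of T] T by (simp add: volatility_curve_def)
qed

lemma volatility_slope_diff_forward:
  assumes f: "in_H Sb f" and h: "in_H Sb h" and s: "in_H Sb s" and Sb: "0 \<le> Sb" and R: "H_norm Sb f \<le> R" "H_norm Sb h \<le> R"
  shows "H_norm Sb (volatility_slope h s - volatility_slope f s) \<le> exp (sqrt Sb * R) * sqrt Sb * H_norm Sb s * (2 + sqrt Sb * R) * H_norm Sb (h - f)"
proof -
  let ?E = "exp (sqrt Sb * R)" and ?d = "H_norm Sb (h - f)"
  have nn: "0 \<le> ?d" "0 \<le> H_norm Sb s" "0 \<le> H_norm Sb f" by (simp_all add: H_norm_nonneg)
  \<comment> \<open>Three terms with one difference each: of the prices in the first and third, of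
    the forward curves in the second.\<close>
  have e: "volatility_slope h s - volatility_slope f s = ((\<lambda>u. (price_curve h u - price_curve f u) * s u) - (\<lambda>u. (price_curve h u * primitive s u) * (h - f) u)) -
      (\<lambda>u. ((price_curve h u - price_curve f u) * primitive s u) * f u)"
    by (simp add: volatility_slope_def fun_eq_iff algebra_simps)
  have cE: "continuous_on {0..Sb} (\<lambda>u. price_curve h u - price_curve f u)"
    by (intro continuous_intros price_curve_continuous f h Sb)
  have bE: "\<bar>price_curve h u - price_curve f u\<bar> \<le> ?E * (sqrt Sb * ?d)" if "u \<in> {0..Sb}" for u by (rule price_curve_diff[OF f h that R])
  have b1: "\<bar>price_curve h u\<bar> \<le> ?E" if "u \<in> {0..Sb}" for u
  proof -
    have "sqrt Sb * H_norm Sb h \<le> sqrt Sb * R" using R Sb by (intro mult_left_mono) auto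
    then show ?thesis using price_curve_bound[OF h that] by (meson exp_le_cancel_iff order_trans)
  qed
  note A = in_H_mult_continuous[OF s cE bE]
  have cB: "continuous_on {0..Sb} (\<lambda>u. price_curve h u * primitive s u)" and cC: "continuous_on {0..Sb} (\<lambda>u. (price_curve h u - price_curve f u) * primitive s u)"
    by (intro continuous_intros price_curve_continuous f h primitive_continuous_L2 s Sb)+
  have bB: "\<bar>price_curve h u * primitive s u\<bar> \<le> ?E * (sqrt Sb * H_norm Sb s)" if "u \<in> {0..Sb}" for u
    unfolding abs_mult using b1[OF that] in_H_primitive_bound[OF s that] by (intro mult_mono) auto
  have bC: "\<bar>(price_curve h u - price_curve f u) * primitive s u\<bar> \<le> ?E * (sqrt Sb * ?d) * (sqrt Sb * H_norm Sb s)" if "u \<in> {0..Sb}" for u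
    unfolding abs_mult using bE[OF that] in_H_primitive_bound[OF s that] nn Sb by (intro mult_mono) auto
  note B = in_H_mult_continuous[OF in_H_diff(1)[OF h f] cB bB] and C = in_H_mult_continuous[OF f cC bC]
  have n: "0 \<le> ?E * (sqrt Sb * ?d)" "0 \<le> ?E * (sqrt Sb * H_norm Sb s)" "0 \<le> ?E * (sqrt Sb * ?d) * (sqrt Sb * H_norm Sb s)"
    using nn Sb by auto
  note A' = A[OF _ n(1)] and B' = B[OF _ n(2)] and C' = C[OF _ n(3)]
  have "H_norm Sb (volatility_slope h s - volatility_slope f s) \<le> (?E * (sqrt Sb * ?d) * H_norm Sb s + ?E * (sqrt Sb * H_norm Sb s) * ?d) + ?E * (sqrt Sb * ?d) * (sqrt Sb * H_norm Sb s) * H_norm Sb f"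
    unfolding e
    by (rule order_trans[OF in_H_diff(2) add_mono[OF order_trans[OF in_H_diff(2) add_mono[OF A'(2) B'(2)]] C'(2)]])
      (use A'(1) B'(1) C'(1) in \<open>auto intro!: in_H_diff(1)\<close>)
  also have "\<dots> \<le> (?E * (sqrt Sb * ?d) * H_norm Sb s + ?E * (sqrt Sb * H_norm Sb s) * ?d) + ?E * (sqrt Sb * ?d) * (sqrt Sb * H_norm Sb s) * R"
    using n R by (intro add_left_mono mult_left_mono) auto
  also have "\<dots> = ?E * sqrt Sb * H_norm Sb s * (2 + sqrt Sb * R) * ?d" by (simp add: algebra_simps)
  finally show ?thesis .
qed

lemma volatility_slope_diff_vol:
  assumes s: "in_H Sb s" "in_H Sb s'"
  shows "H_norm Sb (volatility_slope f s - volatility_slope f s') = H_norm Sb (volatility_slope f (s - s'))"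
  by (rule H_norm_cong) (simp add: volatility_slope_def primitive_linear(2)[OF s] algebra_simps)

lemma Gdual_dist:
  assumes \<phi>: "\<phi> \<in> Gdual Sb" and Sb: "0 \<le> Sb" and C: "\<And>g g'. in_G Sb g g' \<Longrightarrow> \<bar>\<phi> g\<bar> \<le> C * H_norm Sb g'"
    and g: "in_G Sb g g'" "in_G Sb h h'"
  shows "\<bar>\<phi> g - \<phi> h\<bar> \<le> C * H_norm Sb (g' - h')"
  using C[OF in_G_lin(2)[OF g]] Gdual_diff[OF \<phi> g Sb] by simp

lemma Gdual_sum:
  fixes g g' :: "nat \<Rightarrow> real \<Rightarrow> real"
  assumes \<phi>: "\<phi> \<in> Gdual Sb" and Sb: "0 \<le> Sb" and g: "\<And>i. in_G Sb (g i) (g' i)"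
  shows "\<phi> (\<Sum>i<n. c i *\<^sub>R g i) = (\<Sum>i<n. c i * \<phi> (g i)) \<and> in_G Sb (\<Sum>i<n. c i *\<^sub>R g i) (\<Sum>i<n. c i *\<^sub>R g' i)"
proof (induction n)
  case 0
  have G0: "in_G Sb 0 0" by (simp add: in_G_def in_H_0 primitive_def)
  have "\<phi> (0 *\<^sub>R g 0) = 0 * \<phi> (g 0)"
    using in_G_sqnorm(2)[OF g[of 0] Sb] by (rule Gdual_linear(2)[OF \<phi> _ in_G_sqnorm(2)[OF G0 Sb]])
  then have "\<phi> 0 = 0" by simp
  then show ?case using G0 by (simp only: lessThan_0 sum.empty simp_thms)
next
  case (Suc n)
  have Gn: "in_G Sb (c n *\<^sub>R g n) (c n *\<^sub>R g' n)" by (rule in_G_lin(3)[OF g g])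
  have "\<phi> ((\<Sum>i<n. c i *\<^sub>R g i) + c n *\<^sub>R g n) = \<phi> (\<Sum>i<n. c i *\<^sub>R g i) + \<phi> (c n *\<^sub>R g n)"
    using Suc Gn in_G_sqnorm(2)[OF _ Sb] by (intro Gdual_linear(1)[OF \<phi>]) auto
  moreover have "\<phi> (c n *\<^sub>R g n) = c n * \<phi> (g n)"
    using in_G_sqnorm(2)[OF g Sb] by (intro Gdual_linear(2)[OF \<phi>]) auto
  ultimately show ?case using Suc in_G_lin(1)[OF _ Gn] by (simp only: sum.lessThan_Suc)
qed

text \<open>The candidate x evaluates \<phi> at the volatility curves of the coordinates. The
  partial sums of u give curves converging in G, so \<phi> can be applied termwise; x is square
  summable by its bound through the norms of \<sigma> i, and unit vectors give uniqueness, so the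
  definite description in \<open>adjoint_l2\<close> picks x. The constant in the second conclusion
  does not depend on i: the coordinates decay at least as fast as the volatilities.\<close>

lemma adjoint_properties:
  fixes \<sigma> :: "nat \<Rightarrow> real \<Rightarrow> real"
  assumes Sb: "0 \<le> Sb" and f: "in_H Sb f" and \<sigma>: "\<And>i. in_H Sb (\<sigma> i)" "summable (\<lambda>i. (H_norm Sb (\<sigma> i))\<^sup>2)"
    and \<phi>: "\<phi> \<in> Gdual Sb"
  defines "y \<equiv> adjoint_l2 (price_operator f \<sigma>) \<phi>"
  shows "\<And>i. y i = \<phi> (volatility_curve f ((-1) *\<^sub>R \<sigma> i))" "\<exists>C. \<forall>i. \<bar>y i\<bar> \<le> C * H_norm Sb (\<sigma> i)"
proof -
  \<comment> \<open>Bond volatilities are minus the integrals of \<sigma> i; the sign is moved into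
    the integrand.\<close>
  define \<rho> where "\<rho> i = (-1) *\<^sub>R \<sigma> i" for i
  have \<rho>: "in_H Sb (\<rho> i)" "H_norm Sb (\<rho> i) = H_norm Sb (\<sigma> i)" for i
    unfolding \<rho>_def H_norm_scale by (rule in_H_scale[OF \<sigma>(1)], simp only: abs_minus abs_one mult_1_left)
  have \<rho>s: "summable (\<lambda>i. (H_norm Sb (\<rho> i))\<^sup>2)" using \<sigma>(2) \<rho>(2) by simp
  obtain C where C: "0 \<le> C" "\<And>g g'. in_G Sb g g' \<Longrightarrow> \<bar>\<phi> g\<bar> \<le> C * H_norm Sb g'" using Gdual_bound[OF \<phi> Sb] by blast
  define K where "K = exp (sqrt Sb * H_norm Sb f) * (1 + sqrt Sb * H_norm Sb f)"
  have K: "0 \<le> K" unfolding K_def using Sb H_norm_nonneg[of Sb f] by (intro mult_nonneg_nonneg add_nonneg_nonneg) auto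
  define x where "x i = \<phi> (volatility_curve f (\<rho> i))" for i
  have GP: "in_G Sb (volatility_curve f (\<rho> i)) (volatility_slope f (\<rho> i))" for i by (rule in_G_volatility_curve[OF f \<rho>(1) Sb])
  have xb: "\<bar>x i\<bar> \<le> (C * K) * H_norm Sb (\<sigma> i)" for i
  proof -
    have "\<bar>x i\<bar> \<le> C * H_norm Sb (volatility_slope f (\<rho> i))" unfolding x_def by (rule C(2)[OF GP])
    also have "\<dots> \<le> C * (K * H_norm Sb (\<rho> i))" unfolding K_def using volatility_slope_L2(2)[OF f \<rho>(1) Sb] C(1) by (intro mult_left_mono)
    finally show ?thesis by (simp add: \<rho>(2) mult.assoc)
  qed
  have xs: "summable (\<lambda>i. (x i)\<^sup>2)"
  proof (rule summable_comparison_test'[of "\<lambda>i. (C * K)\<^sup>2 * (H_norm Sb (\<sigma> i))\<^sup>2" 0])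
    show "summable (\<lambda>i. (C * K)\<^sup>2 * (H_norm Sb (\<sigma> i))\<^sup>2)" by (rule summable_mult[OF \<sigma>(2)])
    fix i
    have "\<bar>x i\<bar>\<^sup>2 \<le> ((C * K) * H_norm Sb (\<sigma> i))\<^sup>2" by (rule power_mono[OF xb]) simp
    then show "norm ((x i)\<^sup>2) \<le> (C * K)\<^sup>2 * (H_norm Sb (\<sigma> i))\<^sup>2" by (simp add: power_mult_distrib)
  qed
  have main: "\<phi> (price_operator f \<sigma> u) = (\<Sum>i. x i * u i)" if u: "u \<in> l2" for u
  proof -
    have us: "summable (\<lambda>i. (u i)\<^sup>2)" using u by (simp add: l2_iff)
    define S where "S T = (\<Sum>i. u i * \<rho> i T)" for T
    define s where "s n = (\<Sum>i<n. u i *\<^sub>R \<rho> i)" for n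
    have S: "in_H Sb S" "(\<lambda>n. H_norm Sb (S - s n)) \<longlonglongrightarrow> 0"
      unfolding S_def s_def using in_H_series[OF \<rho>(1) \<rho>s us] by auto
    have sn: "in_H Sb (s n)" for n unfolding s_def by (intro in_H_sum(1) in_H_scale \<rho>(1))
    have psn: "primitive (s n) T = (\<Sum>i<n. u i * primitive (\<rho> i) T)" if "T \<in> {0..Sb}" for n T
    proof (induction n)
      case 0 then show ?case by (simp add: s_def primitive_def)
    next
      case (Suc n)
      have e: "s (Suc n) = s n + u n *\<^sub>R \<rho> n" by (simp only: s_def sum.lessThan_Suc)
      show ?case unfolding e primitive_linear(1)[OF sn in_H_scale[OF \<rho>(1)] that] primitive_linear(3)[OF \<rho>(1) \<rho>(1) that] Suc by simp
    qed
    have pS: "price_operator f \<sigma> u T = volatility_curve f S T" if T: "T \<in> {0..Sb}" for T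
    proof -
      have "(\<lambda>n. primitive S T - primitive (s n) T) \<longlonglongrightarrow> 0"
      proof (rule Lim_null_comparison)
        show "\<forall>\<^sub>F n in sequentially. norm (primitive S T - primitive (s n) T) \<le> sqrt Sb * H_norm Sb (S - s n)"
          using in_H_primitive_bound[OF in_H_diff(1)[OF S(1) sn] T] primitive_linear(2)[OF S(1) sn T] by simp
        show "(\<lambda>n. sqrt Sb * H_norm Sb (S - s n)) \<longlonglongrightarrow> 0" by (rule tendsto_mult_right_zero[OF S(2)])
      qed
      from tendsto_diff[OF tendsto_const[of "primitive S T"] this]
      have "(\<lambda>n. \<Sum>i<n. u i * primitive (\<rho> i) T) \<longlonglongrightarrow> primitive S T" by (simp add: psn[OF T])
      then have "(\<lambda>i. u i * primitive (\<rho> i) T) sums primitive S T" by (simp add: sums_def)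
      then have "(\<Sum>i. primitive (\<rho> i) T * u i) = primitive S T" by (simp add: sums_iff mult.commute)
      moreover have "bond_volatility \<sigma> i T = primitive (\<rho> i) T" for i
        unfolding \<rho>_def primitive_linear(3)[OF \<sigma>(1) \<sigma>(1) T] by (simp add: bond_volatility_def primitive_def)
      ultimately show ?thesis
        by (simp add: price_operator_def volatility_curve_def price_curve_def discounted_price_def primitive_def[of f])
    qed
    have GS: "in_G Sb (price_operator f \<sigma> u) (volatility_slope f S)"
      using in_G_volatility_curve[OF f S(1) Sb] pS by (simp add: in_G_def)
    let ?g = "\<lambda>n. \<Sum>i<n. u i *\<^sub>R volatility_curve f (\<rho> i)" and ?g' = "\<lambda>n. \<Sum>i<n. u i *\<^sub>R volatility_slope f (\<rho> i)"
    have Gn: "in_G Sb (?g n) (?g' n)" "\<phi> (?g n) = (\<Sum>i<n. u i * x i)" for n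
      using Gdual_sum[OF \<phi> Sb GP, where c=u and n=n] by (auto simp: x_def)
    \<comment> \<open>By linearity in the volatility, but on [0, Sb] only; this suffices because the
      norm of H sees nothing else.\<close>
    have Dn: "?g' n v = volatility_slope f (s n) v" if "v \<in> {0..Sb}" for n v
      unfolding sum_fun_apply scaleR_fun_def volatility_slope_def psn[OF that]
      by (simp add: s_def sum_fun_apply scaleR_fun_def sum_subtractf sum_distrib_left sum_distrib_right algebra_simps)
    have "\<bar>\<phi> (price_operator f \<sigma> u) - (\<Sum>i<n. u i * x i)\<bar> \<le> C * K * H_norm Sb (S - s n)" for n
    proof -
      have "\<bar>\<phi> (price_operator f \<sigma> u) - \<phi> (?g n)\<bar> \<le> C * H_norm Sb (volatility_slope f S - ?g' n)"
        by (rule Gdual_dist[OF \<phi> Sb C(2) GS Gn(1)])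
      also have "H_norm Sb (volatility_slope f S - ?g' n) = H_norm Sb (volatility_slope f S - volatility_slope f (s n))"
        by (rule H_norm_cong) (simp only: fun_diff_def Dn)
      also have "\<dots> = H_norm Sb (volatility_slope f (S - s n))" by (rule volatility_slope_diff_vol[OF S(1) sn])
      also have "C * \<dots> \<le> C * (K * H_norm Sb (S - s n))"
        unfolding K_def by (intro mult_left_mono volatility_slope_L2(2) f in_H_diff(1) S(1) sn Sb C(1))
      finally show ?thesis by (simp add: Gn(2) mult.assoc)
    qed
    then have "(\<lambda>n. \<phi> (price_operator f \<sigma> u) - (\<Sum>i<n. u i * x i)) \<longlonglongrightarrow> 0"
      by (intro Lim_null_comparison[OF _ tendsto_mult_right_zero[OF S(2), of "C * K"]]) (auto intro!: always_eventually)
    from tendsto_diff[OF tendsto_const[of "\<phi> (price_operator f \<sigma> u)"] this]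
    have "(\<lambda>i. u i * x i) sums \<phi> (price_operator f \<sigma> u)" by (simp add: sums_def)
    then show ?thesis by (simp add: sums_iff mult.commute)
  qed
  have "y = x"
    unfolding y_def adjoint_l2_def
  proof (rule the_equality)
    show "x \<in> l2 \<and> (\<forall>u\<in>l2. \<phi> (price_operator f \<sigma> u) = (\<Sum>i. x i * u i))"
      using xs main by (simp add: l2_iff)
    fix z assume z: "z \<in> l2 \<and> (\<forall>u\<in>l2. \<phi> (price_operator f \<sigma> u) = (\<Sum>i. z i * u i))"
    show "z = x"
    proof
      fix i
      let ?e = "\<lambda>j::nat. if j = i then 1 else 0 :: real"
      have "?e \<in> l2" unfolding l2_iff by (rule summable_finite[of "{i}"]) auto
      then have "\<phi> (price_operator f \<sigma> ?e) = (\<Sum>j. z j * ?e j)" "\<phi> (price_operator f \<sigma> ?e) = (\<Sum>j. x j * ?e j)"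
        using z main by blast+
      then have "(\<Sum>j. z j * ?e j) = (\<Sum>j. x j * ?e j)" by (rule trans[OF sym])
      moreover have "(\<Sum>j. w j * ?e j) = w i" for w :: "nat \<Rightarrow> real"
        by (subst suminf_finite[of "{i}"]) auto
      ultimately show "z i = x i" by simp
    qed
  qed
  then show "\<And>i. y i = \<phi> (volatility_curve f ((-1) *\<^sub>R \<sigma> i))" "\<exists>C. \<forall>i. \<bar>y i\<bar> \<le> C * H_norm Sb (\<sigma> i)"
    using xb by (auto simp: x_def \<rho>_def)
qed

section \<open>Measurability in time\<close>

lemma seminorm_borel_open:
  assumes "U \<subseteq> {x. q x < \<infinity>}" "\<And>x. x \<in> U \<Longrightarrow> \<exists>e>0. \<forall>y. q (y - x) < e \<longrightarrow> y \<in> U"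
  shows "U \<in> sets (seminorm_borel q)"
  unfolding seminorm_borel_def using assms by (auto intro!: in_measure_of)

text \<open>Sublevel sets of a real function that is continuous for q are open in the sense of
  \<open>seminorm_borel\<close>. Paths in the function spaces enter measurability arguments through
  such real functions.\<close>

lemma measurable_of_seminorm_borel:
  fixes g :: "'v::real_vector \<Rightarrow> real"
  assumes h: "h \<in> N \<rightarrow>\<^sub>M seminorm_borel q" and fin: "\<And>x. x \<in> space N \<Longrightarrow> q (h x) < \<infinity>"
    and g: "\<And>x e. q x < \<infinity> \<Longrightarrow> 0 < e \<Longrightarrow> \<exists>d>0. \<forall>y. q (y - x) < d \<longrightarrow> q y < \<infinity> \<and> \<bar>g y - g x\<bar> < e"
  shows "(\<lambda>x. g (h x)) \<in> borel_measurable N"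
proof (rule borel_measurableI_less)
  fix a
  let ?U = "{x. q x < \<infinity> \<and> g x < a}"
  have "?U \<in> sets (seminorm_borel q)"
  proof (rule seminorm_borel_open)
    fix x assume x: "x \<in> ?U"
    then obtain d where d: "0 < d" "\<And>y. q (y - x) < d \<Longrightarrow> q y < \<infinity> \<and> \<bar>g y - g x\<bar> < a - g x"
      using g[of x "a - g x"] by auto
    show "\<exists>e>0. \<forall>y. q (y - x) < e \<longrightarrow> y \<in> ?U"
    proof (intro exI[of _ d] conjI allI impI)
      show "0 < d" by (rule d(1))
      fix y assume "q (y - x) < d"
      then have "\<bar>g y - g x\<bar> < a - g x" "q y < \<infinity>" using d(2) by auto
      then show "y \<in> ?U" using abs_ge_self[of "g y - g x"] by simp
    qed
  qed auto
  from measurable_sets[OF h this] have "h -` ?U \<inter> space N \<in> sets N" .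
  moreover have "h -` ?U \<inter> space N = {x \<in> space N. g (h x) < a}" using fin by auto
  ultimately show "{x \<in> space N. g (h x) < a} \<in> sets N" by simp
qed

lemma sqnorm_H_less:
  assumes "sqnorm_H Sb x < ennreal (e\<^sup>2)" "0 < e"
  shows "in_H Sb x" "H_norm Sb x < e"
proof -
  show l: "in_H Sb x" using less_trans[OF assms(1) ennreal_less_top] by (simp add: in_H_def)
  have "ennreal ((H_norm Sb x)\<^sup>2) < ennreal (e\<^sup>2)" using assms(1) unfolding sqnorm_H_H_norm[OF l] .
  then have "(H_norm Sb x)\<^sup>2 < e\<^sup>2" by (rule ennreal_less_iff[THEN iffD1, rotated]) simp
  then show "H_norm Sb x < e" by (rule power2_less_imp_less) (use assms(2) in simp)
qed

lemma H_norm_dist_dist: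
  assumes "in_H Sb x" "in_H Sb y" "in_H Sb v"
  shows "\<bar>H_norm Sb (y - v) - H_norm Sb (x - v)\<bar> \<le> H_norm Sb (y - x)"
  using H_norm_triangle[OF assms(2,1,3)] H_norm_triangle[OF assms(1,2,3)] H_norm_minus_commute[of Sb x y] by linarith

lemma H_norm_measurable:
  assumes h: "h \<in> N \<rightarrow>\<^sub>M seminorm_borel (sqnorm_H Sb)" and fin: "\<And>x. x \<in> space N \<Longrightarrow> in_H Sb (h x)" and v: "in_H Sb v"
  shows "(\<lambda>x. H_norm Sb (h x - v)) \<in> borel_measurable N"
proof (rule measurable_of_seminorm_borel[OF h])
  show "sqnorm_H Sb (h x) < \<infinity>" if "x \<in> space N" for x using fin[OF that] by (simp add: in_H_def)
  fix x e assume x: "sqnorm_H Sb x < \<infinity>" and e: "0 < (e::real)"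
  have lx: "in_H Sb x" using x by (simp add: in_H_def)
  show "\<exists>d>0. \<forall>y. sqnorm_H Sb (y - x) < d \<longrightarrow> sqnorm_H Sb y < \<infinity> \<and> \<bar>H_norm Sb (y - v) - H_norm Sb (x - v)\<bar> < e"
  proof (intro exI[of _ "ennreal (e\<^sup>2)"] conjI allI impI)
    show "0 < ennreal (e\<^sup>2)" using e by simp
    fix y assume y: "sqnorm_H Sb (y - x) < ennreal (e\<^sup>2)"
    note d = sqnorm_H_less[OF y e]
    have ly: "in_H Sb y" using in_H_add(1)[OF d(1) lx] by simp
    then show "sqnorm_H Sb y < \<infinity>" by (simp add: in_H_def)
    show "\<bar>H_norm Sb (y - v) - H_norm Sb (x - v)\<bar> < e"
      using H_norm_dist_dist[OF lx ly v] d(2) by linarith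
  qed
qed

lemma HS_component:
  assumes "sqnorm_HS (sqnorm_H Sb) s < \<infinity>"
  shows "in_H Sb (s i)" "summable (\<lambda>i. (H_norm Sb (s i))\<^sup>2)" "sqnorm_H Sb (s i) \<le> sqnorm_HS (sqnorm_H Sb) s"
proof -
  have le: "sqnorm_H Sb (s i) \<le> sqnorm_HS (sqnorm_H Sb) s" for i
  proof -
    have "(\<Sum>j\<in>{i}. sqnorm_H Sb (s j)) \<le> (\<Sum>j. sqnorm_H Sb (s j))" by (rule sum_le_suminf) auto
    then show ?thesis by (simp add: sqnorm_HS_def)
  qed
  then show "sqnorm_H Sb (s i) \<le> sqnorm_HS (sqnorm_H Sb) s" .
  have l: "in_H Sb (s i)" for i using le_less_trans[OF le assms] by (simp add: in_H_def)
  then show "in_H Sb (s i)" .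
  have "(\<Sum>i. ennreal ((H_norm Sb (s i))\<^sup>2)) < \<infinity>"
    using assms by (simp add: sqnorm_HS_def sqnorm_H_H_norm[OF l])
  then show "summable (\<lambda>i. (H_norm Sb (s i))\<^sup>2)" by (intro summable_suminf_not_top) auto
qed

lemma sqnorm_H_triangle: "sqnorm_H Sb x \<le> 2 * sqnorm_H Sb (x - y) + 2 * sqnorm_H Sb y"
proof (cases "in_H Sb (x - y) \<and> in_H Sb y")
  case True
  then have l: "in_H Sb (x - y)" "in_H Sb y" by auto
  have lx: "in_H Sb x" using in_H_add(1)[OF l] by simp
  have "H_norm Sb x \<le> H_norm Sb (x - y) + H_norm Sb y" using in_H_add(2)[OF l] by simp
  then have "(H_norm Sb x)\<^sup>2 \<le> (H_norm Sb (x - y) + H_norm Sb y)\<^sup>2" by (rule power_mono) (rule H_norm_nonneg)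
  also have "\<dots> \<le> 2 * (H_norm Sb (x - y))\<^sup>2 + 2 * (H_norm Sb y)\<^sup>2"
    using zero_le_power2[of "H_norm Sb (x - y) - H_norm Sb y"] by (simp add: power2_sum power2_diff)
  finally have "ennreal ((H_norm Sb x)\<^sup>2) \<le> ennreal (2 * (H_norm Sb (x - y))\<^sup>2 + 2 * (H_norm Sb y)\<^sup>2)" by (rule ennreal_leI)
  then show ?thesis by (simp add: sqnorm_H_H_norm l lx ennreal_plus ennreal_mult)
next
  case False
  then have "sqnorm_H Sb (x - y) = \<infinity> \<or> sqnorm_H Sb y = \<infinity>" by (auto simp: in_H_def less_top[symmetric])
  then show ?thesis by (auto simp: ennreal_mult_top)
qed

lemma HS_finite_add:
  assumes "sqnorm_HS (sqnorm_H Sb) (y - x) < \<infinity>" "sqnorm_HS (sqnorm_H Sb) x < \<infinity>"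
  shows "sqnorm_HS (sqnorm_H Sb) y < \<infinity>"
proof -
  have "sqnorm_HS (sqnorm_H Sb) y \<le> (\<Sum>i. 2 * sqnorm_H Sb (y i - x i) + 2 * sqnorm_H Sb (x i))"
    unfolding sqnorm_HS_def by (intro suminf_le sqnorm_H_triangle) auto
  also have "\<dots> = 2 * sqnorm_HS (sqnorm_H Sb) (y - x) + 2 * sqnorm_HS (sqnorm_H Sb) x"
    unfolding sqnorm_HS_def by (subst suminf_add[symmetric]) (auto simp: ennreal_suminf_cmult)
  also have "\<dots> < \<infinity>" using assms by (simp add: ennreal_mult_less_top)
  finally show ?thesis .
qed

lemma HS_component_measurable:
  assumes h: "h \<in> N \<rightarrow>\<^sub>M seminorm_borel (sqnorm_HS (sqnorm_H Sb))"
    and fin: "\<And>x. x \<in> space N \<Longrightarrow> sqnorm_HS (sqnorm_H Sb) (h x) < \<infinity>" and v: "in_H Sb v"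
  shows "(\<lambda>x. H_norm Sb (h x i - v)) \<in> borel_measurable N"
proof (rule measurable_of_seminorm_borel[OF h, where g="\<lambda>y. H_norm Sb (y i - v)"])
  show "sqnorm_HS (sqnorm_H Sb) (h x) < \<infinity>" if "x \<in> space N" for x by (rule fin[OF that])
  fix x e assume x: "sqnorm_HS (sqnorm_H Sb) x < \<infinity>" and e: "0 < (e::real)"
  show "\<exists>d>0. \<forall>y. sqnorm_HS (sqnorm_H Sb) (y - x) < d \<longrightarrow> sqnorm_HS (sqnorm_H Sb) y < \<infinity> \<and> \<bar>H_norm Sb (y i - v) - H_norm Sb (x i - v)\<bar> < e"
  proof (intro exI[of _ "ennreal (e\<^sup>2)"] conjI allI impI)
    show "0 < ennreal (e\<^sup>2)" using e by simp
    fix y assume y: "sqnorm_HS (sqnorm_H Sb) (y - x) < ennreal (e\<^sup>2)"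
    have yf: "sqnorm_HS (sqnorm_H Sb) (y - x) < \<infinity>" using less_trans[OF y ennreal_less_top] by simp
    show yfin: "sqnorm_HS (sqnorm_H Sb) y < \<infinity>" by (rule HS_finite_add[OF yf x])
    have "sqnorm_H Sb (y i - x i) < ennreal (e\<^sup>2)" using HS_component(3)[OF yf, of i] y by simp
    from sqnorm_H_less(2)[OF this e]
    show "\<bar>H_norm Sb (y i - v) - H_norm Sb (x i - v)\<bar> < e"
      using H_norm_dist_dist[OF HS_component(1)[OF x] HS_component(1)[OF yfin] v, of i i] by linarith
  qed
qed

text \<open>The distance of the functionals controls their evaluations at g after g is scaled into
  the unit ball. The positive upper bound r is used for scaling, because the norm itself may be
  zero.\<close>

lemma Gdual_dist_less:
  assumes q: "sqnorm_Gdual Sb (\<psi>' - \<psi>) < ennreal (e\<^sup>2)" and \<psi>: "\<psi> \<in> Gdual Sb" and e: "0 < e"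
    and Sb: "0 \<le> Sb" and g: "in_G Sb g g'" "H_norm Sb g' \<le> r" and r: "0 < r"
  shows "\<psi>' \<in> Gdual Sb" "\<bar>\<psi>' g - \<psi> g\<bar> \<le> e * r"
proof -
  let ?d = "\<psi>' - \<psi>"
  have dfin: "sqnorm_Gdual Sb ?d < \<infinity>" using less_trans[OF q ennreal_less_top] by simp
  have dlin: "linear_on_G Sb ?d" using dfin by (auto simp: sqnorm_Gdual_def split: if_splits)
  have plin: "linear_on_G Sb \<psi>" and pfin: "sqnorm_Gdual Sb \<psi> < \<infinity>" using \<psi> by (auto simp: Gdual_def sqnorm_Gdual_def split: if_splits)
  have lin: "linear_on_G Sb \<psi>'"
    unfolding linear_on_G_def
  proof (intro conjI ballI allI)
    fix g h assume gh: "g \<in> G_space Sb" "h \<in> G_space Sb"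
    have "?d (g + h) = ?d g + ?d h" "\<psi> (g + h) = \<psi> g + \<psi> h" using dlin plin gh by (auto simp: linear_on_G_def)
    then show "\<psi>' (g + h) = \<psi>' g + \<psi>' h" by simp
  next
    fix c g assume g: "g \<in> G_space Sb"
    have "?d (c *\<^sub>R g) = c * ?d g" "\<psi> (c *\<^sub>R g) = c * \<psi> g" using dlin plin g by (auto simp: linear_on_G_def)
    then show "\<psi>' (c *\<^sub>R g) = c * \<psi>' g" by (simp add: algebra_simps)
  qed
  have "sqnorm_Gdual Sb \<psi>' \<le> 2 * sqnorm_Gdual Sb ?d + 2 * sqnorm_Gdual Sb \<psi>"
  proof -
    have "ennreal ((\<psi>' g)\<^sup>2) \<le> 2 * sqnorm_Gdual Sb ?d + 2 * sqnorm_Gdual Sb \<psi>" if g: "sqnorm_G Sb g \<le> 1" for g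
    proof -
      have "(\<psi>' g)\<^sup>2 \<le> 2 * (?d g)\<^sup>2 + 2 * (\<psi> g)\<^sup>2"
        using zero_le_power2[of "\<psi>' g - 2 * \<psi> g"] by (simp add: power2_diff power_mult_distrib algebra_simps)
      then have "ennreal ((\<psi>' g)\<^sup>2) \<le> ennreal (2 * (?d g)\<^sup>2 + 2 * (\<psi> g)\<^sup>2)" by (rule ennreal_leI)
      also have "\<dots> = 2 * ennreal ((?d g)\<^sup>2) + 2 * ennreal ((\<psi> g)\<^sup>2)" by (simp add: ennreal_plus ennreal_mult)
      also have "\<dots> \<le> 2 * sqnorm_Gdual Sb ?d + 2 * sqnorm_Gdual Sb \<psi>"
        using dlin plin g unfolding sqnorm_Gdual_def by (intro add_mono mult_left_mono) (auto intro!: SUP_upper simp del: fun_diff_def minus_apply)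
      finally show ?thesis .
    qed
    then show ?thesis using lin by (subst (1) sqnorm_Gdual_def) (auto intro!: SUP_least)
  qed
  also have "\<dots> < \<infinity>" using dfin pfin by (simp add: ennreal_mult_less_top)
  finally show "\<psi>' \<in> Gdual Sb" by (simp add: Gdual_def)
  have dG: "?d \<in> Gdual Sb" using dfin by (simp add: Gdual_def)
  have G: "in_G Sb ((1 / r) *\<^sub>R g) ((1 / r) *\<^sub>R g')" by (rule in_G_lin(3)[OF g(1) g(1)])
  have "H_norm Sb ((1 / r) *\<^sub>R g') \<le> 1" unfolding H_norm_scale using r g by simp
  then have "(H_norm Sb ((1 / r) *\<^sub>R g'))\<^sup>2 \<le> 1" using H_norm_nonneg by (simp add: power_le_one)
  then have "sqnorm_G Sb ((1 / r) *\<^sub>R g) \<le> 1"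
    using in_G_sqnorm(1)[OF G Sb] by (meson ennreal_le_1 order_trans)
  then have "ennreal ((?d ((1 / r) *\<^sub>R g))\<^sup>2) \<le> sqnorm_Gdual Sb ?d"
    using dlin unfolding sqnorm_Gdual_def by (auto intro!: SUP_upper simp del: fun_diff_def minus_apply)
  then have "ennreal ((?d ((1 / r) *\<^sub>R g))\<^sup>2) < ennreal (e\<^sup>2)" using q by (rule le_less_trans)
  then have "(?d ((1 / r) *\<^sub>R g))\<^sup>2 < e\<^sup>2" by (simp add: ennreal_less_iff)
  then have "\<bar>?d ((1 / r) *\<^sub>R g)\<bar> < e" using e power2_less_imp_less[of "\<bar>?d ((1 / r) *\<^sub>R g)\<bar>" e] unfolding power2_abs by linarith
  moreover have "?d ((1 / r) *\<^sub>R g) = (1 / r) * ?d g"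
    using in_G_sqnorm(2)[OF g(1) Sb] by (intro Gdual_linear(2)[OF dG])
  moreover have "\<bar>D\<bar> < e * r" if "\<bar>(1 / r) * D\<bar> < e" for D :: real
    using r that by (simp add: abs_mult field_simps)
  ultimately have "\<bar>?d g\<bar> < e * r" by metis
  then show "\<bar>\<psi>' g - \<psi> g\<bar> \<le> e * r" by simp
qed

lemma Gdual_evaluation_measurable:
  assumes h: "h \<in> N \<rightarrow>\<^sub>M seminorm_borel (sqnorm_Gdual Sb)" and fin: "\<And>x. x \<in> space N \<Longrightarrow> h x \<in> Gdual Sb"
    and g: "in_G Sb g g'" and Sb: "0 \<le> Sb"
  shows "(\<lambda>x. h x g) \<in> borel_measurable N"
proof (rule measurable_of_seminorm_borel[OF h, where g="\<lambda>\<psi>. \<psi> g"])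
  show "sqnorm_Gdual Sb (h x) < \<infinity>" if "x \<in> space N" for x using fin[OF that] by (simp add: Gdual_def)
  fix \<psi> e assume \<psi>: "sqnorm_Gdual Sb \<psi> < \<infinity>" and e: "0 < (e::real)"
  define r where "r = H_norm Sb g' + 1"
  have r: "0 < r" "H_norm Sb g' \<le> r" using H_norm_nonneg[of Sb g'] by (auto simp: r_def)
  define \<delta> where "\<delta> = e / (2 * r)"
  have \<delta>: "0 < \<delta>" "\<delta> * r < e" using e r by (auto simp: \<delta>_def)
  show "\<exists>d>0. \<forall>y. sqnorm_Gdual Sb (y - \<psi>) < d \<longrightarrow> sqnorm_Gdual Sb y < \<infinity> \<and> \<bar>y g - \<psi> g\<bar> < e"
  proof (intro exI[of _ "ennreal (\<delta>\<^sup>2)"] conjI allI impI)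
    show "0 < ennreal (\<delta>\<^sup>2)" using \<delta> by simp
    fix y assume y: "sqnorm_Gdual Sb (y - \<psi>) < ennreal (\<delta>\<^sup>2)"
    have pG: "\<psi> \<in> Gdual Sb" using \<psi> by (simp add: Gdual_def)
    note d = Gdual_dist_less[OF y pG \<delta>(1) Sb g r(2) r(1)]
    show "sqnorm_Gdual Sb y < \<infinity>" using d(1) by (simp add: Gdual_def)
    show "\<bar>y g - \<psi> g\<bar> < e" using d(2) \<delta>(2) by linarith
  qed
qed

text \<open>The slope is Lipschitz in the volatility and locally Lipschitz in the forward curve, and
  \<phi> is bounded by the norm of the slope. The radius R, the norm of the limit curve f' plus 1,
  bounds the approximating forward curves eventually.\<close>

lemma Gdual_volatility_curve_continuous:
  assumes Sb: "0 \<le> Sb" and \<phi>: "\<phi> \<in> Gdual Sb" and f: "\<And>k. in_H Sb (f k)" "in_H Sb f'" "(\<lambda>k. H_norm Sb (f k - f')) \<longlonglongrightarrow> 0"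
    and s: "\<And>k. in_H Sb (s k)" "in_H Sb s'" "(\<lambda>k. H_norm Sb (s k - s')) \<longlonglongrightarrow> 0"
  shows "(\<lambda>k. \<phi> (volatility_curve (f k) (s k))) \<longlonglongrightarrow> \<phi> (volatility_curve f' s')"
proof -
  obtain C where C: "0 \<le> C" "\<And>g g'. in_G Sb g g' \<Longrightarrow> \<bar>\<phi> g\<bar> \<le> C * H_norm Sb g'" using Gdual_bound[OF \<phi> Sb] by blast
  define R where "R = H_norm Sb f' + 1"
  define K1 where "K1 = exp (sqrt Sb * R) * (1 + sqrt Sb * R)"
  define K2 where "K2 = exp (sqrt Sb * R) * sqrt Sb * H_norm Sb s' * (2 + sqrt Sb * R)"
  have R0: "0 \<le> R" using H_norm_nonneg[of Sb f'] by (simp add: R_def)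
  have "\<forall>\<^sub>F k in sequentially. H_norm Sb (f k - f') < 1" using order_tendstoD(2)[OF f(3), of 1] by simp
  then have "\<forall>\<^sub>F k in sequentially. norm (\<phi> (volatility_curve (f k) (s k)) - \<phi> (volatility_curve f' s')) \<le>
      C * (K1 * H_norm Sb (s k - s') + K2 * H_norm Sb (f k - f'))"
  proof eventually_elim
    fix k assume "H_norm Sb (f k - f') < 1"
    then have fk: "H_norm Sb (f k) \<le> R" using H_norm_triangle'[OF f(1)[of k] f(2)] by (simp add: R_def)
    have f'R: "H_norm Sb f' \<le> R" by (simp add: R_def)
    have DL: "in_H Sb (volatility_slope (f k) (s k))" "in_H Sb (volatility_slope (f k) s')" "in_H Sb (volatility_slope f' s')"
      by (rule volatility_slope_L2(1)[OF f(1) s(1) Sb], rule volatility_slope_L2(1)[OF f(1) s(2) Sb], rule volatility_slope_L2(1)[OF f(2) s(2) Sb])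
    have 1: "H_norm Sb (volatility_slope (f k) (s k) - volatility_slope (f k) s') \<le> K1 * H_norm Sb (s k - s')"
    proof -
      have "H_norm Sb (volatility_slope (f k) (s k) - volatility_slope (f k) s') \<le> exp (sqrt Sb * H_norm Sb (f k)) * (1 + sqrt Sb * H_norm Sb (f k)) * H_norm Sb (s k - s')"
        unfolding volatility_slope_diff_vol[OF s(1,2)] by (rule volatility_slope_L2(2)[OF f(1) in_H_diff(1)[OF s(1,2)] Sb])
      also have "\<dots> \<le> K1 * H_norm Sb (s k - s')"
        unfolding K1_def using fk Sb H_norm_nonneg mult_left_mono[OF fk, of "sqrt Sb"] R0
        by (intro mult_right_mono mult_mono) auto
      finally show ?thesis .
    qed
    have 2: "H_norm Sb (volatility_slope (f k) s' - volatility_slope f' s') \<le> K2 * H_norm Sb (f k - f')"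
      unfolding K2_def by (rule volatility_slope_diff_forward[OF f(2) f(1) s(2) Sb f'R fk])
    have "\<bar>\<phi> (volatility_curve (f k) (s k)) - \<phi> (volatility_curve f' s')\<bar> \<le> C * H_norm Sb (volatility_slope (f k) (s k) - volatility_slope f' s')"
      by (rule Gdual_dist[OF \<phi> Sb C(2) in_G_volatility_curve[OF f(1) s(1) Sb] in_G_volatility_curve[OF f(2) s(2) Sb]])
    also have "\<dots> \<le> C * (K1 * H_norm Sb (s k - s') + K2 * H_norm Sb (f k - f'))"
      using H_norm_triangle[OF DL] 1 2 by (intro mult_left_mono C(1)) linarith
    finally show "norm (\<phi> (volatility_curve (f k) (s k)) - \<phi> (volatility_curve f' s')) \<le> C * (K1 * H_norm Sb (s k - s') + K2 * H_norm Sb (f k - f'))" by simp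
  qed
  moreover
  have "(\<lambda>k. C * (K1 * H_norm Sb (s k - s') + K2 * H_norm Sb (f k - f'))) \<longlonglongrightarrow> C * (K1 * 0 + K2 * 0)"
    by (intro tendsto_intros f s)
  then have "(\<lambda>k. C * (K1 * H_norm Sb (s k - s') + K2 * H_norm Sb (f k - f'))) \<longlonglongrightarrow> 0" by simp
  ultimately have "(\<lambda>k. \<phi> (volatility_curve (f k) (s k)) - \<phi> (volatility_curve f' s')) \<longlonglongrightarrow> 0"
    by (rule Lim_null_comparison)
  then show ?thesis by (rule LIM_zero_cancel)
qed

text \<open>Shifted by one: 0 stands for times outside every step. Through this index the step
  process depends on time only via a measurable choice among finitely many coefficients.\<close>

definition step_index :: "nat \<Rightarrow> (nat \<Rightarrow> real) \<Rightarrow> real \<Rightarrow> nat" where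
  "step_index n \<tau> t = (\<Sum>j<n. if t \<in> {\<tau> j<..\<tau> (Suc j)} then Suc j else 0)"

lemma step_index_measurable: "step_index n \<tau> \<in> borel \<rightarrow>\<^sub>M count_space UNIV"
  unfolding step_index_def by measurable

lemma elementary_process_step_index:
  fixes \<xi> :: "nat \<Rightarrow> 'w \<Rightarrow> nat \<Rightarrow> 'v::real_vector"
  assumes mono: "\<forall>j<n. \<tau> j \<le> \<tau> (Suc j)"
  shows "elementary_process n \<tau> \<xi> t \<omega> = (case step_index n \<tau> t of 0 \<Rightarrow> 0 | Suc j \<Rightarrow> \<xi> j \<omega>)" "step_index n \<tau> t \<le> n"
proof -
  have "elementary_process n \<tau> \<xi> t \<omega> = (case step_index n \<tau> t of 0 \<Rightarrow> 0 | Suc j \<Rightarrow> \<xi> j \<omega>) \<and> step_index n \<tau> t \<le> n"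
  proof (cases "\<exists>l<n. t \<in> {\<tau> l<..\<tau> (Suc l)}")
    case True
    then obtain l where l: "l < n" "t \<in> {\<tau> l<..\<tau> (Suc l)}" by blast
    have "step_index n \<tau> t = (\<Sum>j<n. if j = l then Suc l else 0)"
      unfolding step_index_def
    proof (rule sum.cong[OF refl])
      fix j assume j: "j \<in> {..<n}"
      show "(if t \<in> {\<tau> j<..\<tau> (Suc j)} then Suc j else 0) = (if j = l then Suc l else 0)"
      proof (cases j l rule: linorder_cases)
        case less then show ?thesis using mono_grid[OF mono, of "Suc j" l] l by auto
      next
        case greater then show ?thesis using mono_grid[OF mono, of "Suc l" j] l j by auto
      qed (use l in auto)
    qed
    then have "step_index n \<tau> t = Suc l" using l by simp
    then show ?thesis using elementary_process_eq[OF mono l, of \<xi> \<omega>] l by simp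
  next
    case False
    then have "step_index n \<tau> t = 0" by (auto simp: step_index_def)
    moreover have "elementary_process n \<tau> \<xi> t \<omega> = 0" using False by (intro elementary_process_eq_0) auto
    ultimately show ?thesis by simp
  qed
  then show "elementary_process n \<tau> \<xi> t \<omega> = (case step_index n \<tau> t of 0 \<Rightarrow> 0 | Suc j \<Rightarrow> \<xi> j \<omega>)" "step_index n \<tau> t \<le> n" by auto
qed

text \<open>The inner integral of nonmeasurable functions is not subadditive, so the integrands have to be shown
  measurable in time.\<close>

lemma pairing_measurable:
  fixes f :: "real \<Rightarrow> real \<Rightarrow> real" and s :: "real \<Rightarrow> real \<Rightarrow> real" and v :: "nat \<Rightarrow> nat \<Rightarrow> real \<Rightarrow> real"
  assumes Sb: "0 < Sb" and f: "\<And>t. t \<in> {0..Sb} \<Longrightarrow> in_H Sb (f t)"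
    and fc: "\<And>t x. t \<in> {0..Sb} \<Longrightarrow> (\<And>k. x k \<in> {0..Sb}) \<Longrightarrow> x \<longlonglongrightarrow> t \<Longrightarrow> (\<lambda>k. H_norm Sb (f (x k) - f t)) \<longlonglongrightarrow> 0"
    and s: "\<And>t. t \<in> {0..Sb} \<Longrightarrow> in_H Sb (s t)"
    and sm: "\<And>w. in_H Sb w \<Longrightarrow> (\<lambda>t. H_norm Sb (s t - w)) \<in> borel_measurable (restrict_space borel {0..Sb})"
    and v: "\<And>k j. in_H Sb (v k j)" and J: "\<And>k. J k \<in> borel \<rightarrow>\<^sub>M count_space UNIV"
    and lim: "(\<lambda>k. \<integral>\<^sup>+t\<in>{0..Sb}. sqnorm_H Sb (v k (J k t) - s t) \<partial>lborel) \<longlonglongrightarrow> 0"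
    and \<phi>: "\<And>t. t \<in> {0..Sb} \<Longrightarrow> \<phi> t \<in> Gdual Sb"
    and \<phi>m: "\<And>g g'. in_G Sb g g' \<Longrightarrow> (\<lambda>t. \<phi> t g) \<in> borel_measurable (restrict_space borel {0..Sb})"
  shows "\<exists>y. y \<in> borel_measurable lborel \<and> (AE t in lborel. t \<in> {0..Sb} \<longrightarrow> \<phi> t (volatility_curve (f t) (s t)) = y t)"
proof -
  let ?N = "restrict_space borel {0..Sb} :: real measure"
  have Sb0: "0 \<le> Sb" using Sb by simp
  have JN: "J k \<in> ?N \<rightarrow>\<^sub>M count_space UNIV" for k using J by (rule measurable_restrict_space1)
  define u where "u k t = (H_norm Sb (v k (J k t) - s t))\<^sup>2" for k t
  have um: "u k \<in> borel_measurable ?N" for k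
  proof -
    have "(\<lambda>t. H_norm Sb (s t - v k (J k t))) \<in> borel_measurable ?N"
      by (rule measurable_compose_countable[OF sm[OF v] JN])
    then show ?thesis unfolding u_def H_norm_minus_commute[of Sb "v k _"] by measurable
  qed
  define U where "U k t = indicator {0..Sb} t *\<^sub>R u k t" for k t
  have Um: "U k \<in> borel_measurable lborel" for k
    unfolding U_def using um[of k] borel_measurable_restrict_space_iff[of "{0..Sb}" borel "u k"] by simp
  have Ueq: "(\<integral>\<^sup>+t\<in>{0..Sb}. sqnorm_H Sb (v k (J k t) - s t) \<partial>lborel) = (\<integral>\<^sup>+t. ennreal (U k t) \<partial>lborel)" for k
    by (intro nn_integral_cong) (auto simp: U_def u_def indicator_def sqnorm_H_H_norm in_H_diff v s)
  have U0: "0 \<le> U k t" for k t by (simp add: U_def u_def)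
  have limU: "(\<lambda>k. \<integral>\<^sup>+t. ennreal (U k t) \<partial>lborel) \<longlonglongrightarrow> 0" using lim unfolding Ueq .
  \<comment> \<open>The time integrals are known to be finite only from some index on; earlier
    approximations are dropped, so that convergence in mean gives a subsequence converging almost
    everywhere.\<close>
  from order_tendstoD(2)[OF limU, of 1] obtain n0 where n0: "\<And>k. n0 \<le> k \<Longrightarrow> (\<integral>\<^sup>+t. ennreal (U k t) \<partial>lborel) < 1"
    by (auto simp: eventually_sequentially)
  have Ui: "integrable lborel (U (k + n0))" for k
    unfolding integrable_iff_bounded using Um n0[of "k + n0"] U0 by (auto simp: less_trans[OF _ ennreal_one_less_top])
  have "(\<lambda>k. \<integral>t. norm (U (k + n0) t) \<partial>lborel) \<longlonglongrightarrow> 0"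
  proof -
    have "(\<lambda>k. ennreal (\<integral>t. U (k + n0) t \<partial>lborel)) \<longlonglongrightarrow> 0"
      using LIMSEQ_ignore_initial_segment[OF limU, of n0] nn_integral_eq_integral[OF Ui] U0 by simp
    then show ?thesis using U0 by (subst (asm) ennreal_tendsto_0_iff) (auto intro!: integral_nonneg_AE)
  qed
  from tendsto_L1_AE_subseq[OF Ui this] obtain r :: "nat \<Rightarrow> nat"
    where r: "strict_mono r" "AE t in lborel. (\<lambda>k. U (r k + n0) t) \<longlonglongrightarrow> 0" by blast
  define p where "p k = r k + n0" for k
  \<comment> \<open>t rounded down to a multiple of 1 / Suc k. Forward curves are frozen at these
    times because \<phi> is known to be measurable in time only against a fixed curve.\<close>
  define d where "d k t = real (nat \<lfloor>real (Suc k) * t\<rfloor>) / real (Suc k)" for k t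
  have dr: "d k t \<in> {0..Sb}" "\<bar>d k t - t\<bar> \<le> 1 / real (Suc k)" if t: "t \<in> {0..Sb}" for k t
  proof -
    have nn: "0 \<le> \<lfloor>real (Suc k) * t\<rfloor>" using t by simp
    have "real_of_int \<lfloor>real (Suc k) * t\<rfloor> \<le> real (Suc k) * t" "real (Suc k) * t < real_of_int \<lfloor>real (Suc k) * t\<rfloor> + 1" by linarith+
    then have 1: "d k t \<le> t" "t \<le> d k t + 1 / real (Suc k)"
      unfolding d_def using nn by (simp_all add: field_simps del: of_nat_Suc)
    have "0 \<le> d k t" by (simp add: d_def)
    then show "d k t \<in> {0..Sb}" using 1 t by auto
    show "\<bar>d k t - t\<bar> \<le> 1 / real (Suc k)" using 1 by (simp add: abs_le_iff)
  qed
  define y where "y k t = \<phi> t (volatility_curve (f (d k t)) (v (p k) (J (p k) t)))" for k t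
  have ym: "y k \<in> borel_measurable ?N" for k
  proof -
    have c: "(\<lambda>t. nat \<lfloor>real (Suc k) * t\<rfloor>) \<in> ?N \<rightarrow>\<^sub>M count_space UNIV"
      by (rule measurable_restrict_space1) measurable
    \<comment> \<open>Pairing with the forward curve frozen at index m and the volatility frozen at
      index j; grid points outside [0, Sb], where f need not lie in H, get the value 0.\<close>
    let ?F = "\<lambda>m j t. if real m / real (Suc k) \<in> {0..Sb} then \<phi> t (volatility_curve (f (real m / real (Suc k))) (v (p k) j)) else 0"
    have F: "?F m j \<in> borel_measurable ?N" for m j
      by (cases "real m / real (Suc k) \<in> {0..Sb}") (auto intro!: \<phi>m[OF in_G_volatility_curve[OF f v Sb0]] simp del: of_nat_Suc)
    have "(\<lambda>t. ?F (nat \<lfloor>real (Suc k) * t\<rfloor>) (J (p k) t) t) \<in> borel_measurable ?N"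
      by (rule measurable_compose_countable[OF measurable_compose_countable[OF F JN] c])
    then show ?thesis
      by (rule measurable_cong[THEN iffD1, rotated]) (use dr in \<open>auto simp: y_def d_def space_restrict_space\<close>)
  qed
  define Y where "Y t = indicator {0..Sb} t *\<^sub>R lim (\<lambda>k. y k t)" for t
  have "(\<lambda>t. lim (\<lambda>k. y k t)) \<in> borel_measurable ?N" by (rule borel_measurable_lim_metric[OF ym])
  then have "Y \<in> borel_measurable lborel"
    unfolding Y_def using borel_measurable_restrict_space_iff[of "{0..Sb}" borel "\<lambda>t. lim (\<lambda>k. y k t)"] by simp
  moreover have "AE t in lborel. t \<in> {0..Sb} \<longrightarrow> \<phi> t (volatility_curve (f t) (s t)) = Y t"
    using r(2)
  proof eventually_elim
    fix t assume l: "(\<lambda>k. U (r k + n0) t) \<longlonglongrightarrow> 0"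
    show "t \<in> {0..Sb} \<longrightarrow> \<phi> t (volatility_curve (f t) (s t)) = Y t"
    proof
      assume t: "t \<in> {0..Sb}"
      have "(\<lambda>k. sqrt (U (r k + n0) t)) \<longlonglongrightarrow> sqrt 0" by (rule tendsto_real_sqrt[OF l])
      then have sl: "(\<lambda>k. H_norm Sb (v (p k) (J (p k) t) - s t)) \<longlonglongrightarrow> 0"
        using t by (simp add: U_def u_def p_def H_norm_nonneg)
      have "(\<lambda>k. d k t - t) \<longlonglongrightarrow> 0"
      proof (rule Lim_null_comparison)
        show "\<forall>\<^sub>F k in sequentially. norm (d k t - t) \<le> 1 / real (Suc k)" using dr(2)[OF t] by simp
        show "(\<lambda>k. 1 / real (Suc k)) \<longlonglongrightarrow> 0" using LIMSEQ_inverse_real_of_nat by (simp add: divide_inverse)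
      qed
      then have dl: "(\<lambda>k. d k t) \<longlonglongrightarrow> t" by (rule LIM_zero_cancel)
      have fl: "(\<lambda>k. H_norm Sb (f (d k t) - f t)) \<longlonglongrightarrow> 0" by (rule fc[OF t dr(1)[OF t] dl])
      have "(\<lambda>k. y k t) \<longlonglongrightarrow> \<phi> t (volatility_curve (f t) (s t))"
        unfolding y_def by (rule Gdual_volatility_curve_continuous[OF Sb0 \<phi>[OF t] f[OF dr(1)[OF t]] f[OF t] fl v s[OF t] sl])
      then show "\<phi> t (volatility_curve (f t) (s t)) = Y t" using t by (simp add: Y_def limI)
    qed
  qed
  ultimately show ?thesis by blast
qed

lemma integral_simple_function:
  fixes s :: "'a \<Rightarrow> 'v" and g :: "'v \<Rightarrow> real"
  assumes N: "finite_measure N" and s: "simple_function N s"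
  shows "integrable N (\<lambda>x. g (s x))"
    "(\<integral>x. g (s x) \<partial>N) = (\<Sum>v\<in>s ` space N. measure N {x \<in> space N. s x = v} * g v)"
proof -
  interpret finite_measure N by (rule N)
  let ?A = "\<lambda>v. {x \<in> space N. s x = v}"
  have fin: "finite (s ` space N)" using s by (simp add: simple_function_def)
  have A: "?A v \<in> sets N" for v
  proof -
    have "?A v = s -` {v} \<inter> space N" by auto
    then show ?thesis using simple_functionD(2)[OF s, of "{v}"] by simp
  qed
  have rep: "g (s x) = (\<Sum>v\<in>s ` space N. indicator (?A v) x * g v)" if x: "x \<in> space N" for x
  proof -
    have "(\<Sum>v\<in>s ` space N. indicator (?A v) x * g v) = (\<Sum>v\<in>s ` space N. if v = s x then g v else 0)"
      using x by (intro sum.cong) (auto simp: indicator_def)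
    then show ?thesis using fin x by simp
  qed
  have i: "integrable N (\<lambda>x. indicator (?A v) x * g v)" for v
    using A[of v] by (intro integrable_mult_left) (simp add: emeasure_finite less_top[symmetric])
  have isum: "integrable N (\<lambda>x. \<Sum>v\<in>s ` space N. indicator (?A v) x * g v)"
    by (intro Bochner_Integration.integrable_sum i)
  show "integrable N (\<lambda>x. g (s x))"
    by (rule Bochner_Integration.integrable_cong[THEN iffD2, OF refl rep isum])
  have "(\<integral>x. g (s x) \<partial>N) = (\<integral>x. (\<Sum>v\<in>s ` space N. indicator (?A v) x * g v) \<partial>N)"
    by (rule Bochner_Integration.integral_cong[OF refl rep])
  also have "\<dots> = (\<Sum>v\<in>s ` space N. \<integral>x. indicator (?A v) x * g v \<partial>N)"
    by (intro Bochner_Integration.integral_sum i)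
  also have "\<dots> = (\<Sum>v\<in>s ` space N. measure N (?A v) * g v)"
    using A by (intro sum.cong refl) (simp add: Int_absorb1 sets.sets_into_space)
  finally show "(\<integral>x. g (s x) \<partial>N) = (\<Sum>v\<in>s ` space N. measure N (?A v) * g v)" .
qed

text \<open>For each T the integral is the same finite combination of the values of s, so the
  triangle inequality for finite sums applies.\<close>

lemma H_norm_integral_simple:
  assumes N: "finite_measure N" and s: "simple_function N s" and L: "\<And>x. x \<in> space N \<Longrightarrow> in_H Sb (s x)"
  shows "in_H Sb (\<lambda>T. \<integral>x. s x T \<partial>N)" "H_norm Sb (\<lambda>T. \<integral>x. s x T \<partial>N) \<le> (\<integral>x. H_norm Sb (s x) \<partial>N)"
proof -
  let ?c = "\<lambda>v. measure N {x \<in> space N. s x = v}"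
  have e: "(\<lambda>T. \<integral>x. s x T \<partial>N) = (\<Sum>v\<in>s ` space N. ?c v *\<^sub>R v)"
  proof
    fix T
    show "(\<integral>x. s x T \<partial>N) = (\<Sum>v\<in>s ` space N. ?c v *\<^sub>R v) T"
      using integral_simple_function(2)[OF N s, of "\<lambda>v. v T"] by (simp add: sum_fun_apply scaleR_fun_def)
  qed
  have Lv: "in_H Sb (?c v *\<^sub>R v)" if "v \<in> s ` space N" for v
    using that L by (intro in_H_scale) auto
  show "in_H Sb (\<lambda>T. \<integral>x. s x T \<partial>N)" unfolding e by (rule in_H_sum(1)[OF Lv])
  have "H_norm Sb (\<lambda>T. \<integral>x. s x T \<partial>N) \<le> (\<Sum>v\<in>s ` space N. H_norm Sb (?c v *\<^sub>R v))"
    unfolding e by (rule in_H_sum(2)[OF Lv])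
  also have "\<dots> = (\<integral>x. H_norm Sb (s x) \<partial>N)"
    unfolding integral_simple_function(2)[OF N s, of "H_norm Sb"] H_norm_scale by simp
  finally show "H_norm Sb (\<lambda>T. \<integral>x. s x T \<partial>N) \<le> (\<integral>x. H_norm Sb (s x) \<partial>N)" .
qed

lemma simple_bochner_integral_apply:
  fixes s :: "'a \<Rightarrow> real \<Rightarrow> real"
  assumes "finite_measure N" "simple_function N s"
  shows "Bochner_Integration.simple_bochner_integral N s = (\<lambda>T. \<integral>x. s x T \<partial>N)"
proof
  fix T
  show "Bochner_Integration.simple_bochner_integral N s T = (\<integral>x. s x T \<partial>N)"
    using integral_simple_function(2)[OF assms, of "\<lambda>v. v T"]
    by (simp add: Bochner_Integration.simple_bochner_integral_def sum_fun_apply scaleR_fun_def)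
qed

lemma H_norm_diff_simple_measurable:
  assumes h: "h \<in> N \<rightarrow>\<^sub>M seminorm_borel (sqnorm_H Sb)" and L: "\<And>x. x \<in> space N \<Longrightarrow> in_H Sb (h x)"
    and s: "simple_function N s" and Ls: "\<And>x. x \<in> space N \<Longrightarrow> in_H Sb (s x)"
  shows "(\<lambda>x. H_norm Sb (h x - s x)) \<in> borel_measurable N"
proof -
  let ?A = "\<lambda>v. s -` {v} \<inter> space N"
  have fin: "finite (s ` space N)" using s by (simp add: simple_function_def)
  have m: "(\<lambda>x. \<Sum>v\<in>s ` space N. indicator (?A v) x * H_norm Sb (h x - v)) \<in> borel_measurable N"
  proof (intro borel_measurable_sum borel_measurable_times)
    fix v assume v: "v \<in> s ` space N"
    show "indicator (?A v) \<in> borel_measurable N" using simple_functionD(2)[OF s, of "{v}"] by simp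
    show "(\<lambda>x. H_norm Sb (h x - v)) \<in> borel_measurable N" using v Ls by (intro H_norm_measurable[OF h L]) auto
  qed
  have "H_norm Sb (h x - s x) = (\<Sum>v\<in>s ` space N. indicator (?A v) x * H_norm Sb (h x - v))" if x: "x \<in> space N" for x
  proof -
    have "(\<Sum>v\<in>s ` space N. indicator (?A v) x * H_norm Sb (h x - v)) = (\<Sum>v\<in>s ` space N. if v = s x then H_norm Sb (h x - v) else 0)"
      using x by (intro sum.cong) (auto simp: indicator_def)
    then show ?thesis using fin x by simp
  qed
  from measurable_cong[THEN iffD2, OF this m] show ?thesis .
qed

lemma finite_measure_interval: "finite_measure (restrict_space lborel {0..t::real})"
  by (intro finite_measureI) (auto simp: space_restrict_space emeasure_restrict_space emeasure_lborel_Icc_eq)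

lemma seminorm_integral_limits:
  fixes \<alpha> :: "real \<Rightarrow> real \<Rightarrow> real"
  assumes L: "\<And>r. r \<in> {0..t} \<Longrightarrow> in_H Sb (\<alpha> r)"
    and A: "has_seminorm_integral (sqnorm_H Sb) (restrict_space lborel {0..t}) \<alpha> A"
  shows "\<exists>s. (\<forall>k. simple_function (restrict_space lborel {0..t}) (s k)) \<and> (\<forall>k. \<forall>r\<in>{0..t}. in_H Sb (s k r)) \<and>
    (\<lambda>k. \<integral>\<^sup>+r. ennreal (H_norm Sb (\<alpha> r - s k r)) \<partial>restrict_space lborel {0..t}) \<longlonglongrightarrow> 0 \<and>
    (\<lambda>k. H_norm Sb ((\<lambda>T. \<integral>r. s k r T \<partial>restrict_space lborel {0..t}) - A)) \<longlonglongrightarrow> 0"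
    "in_H Sb A"
proof -
  let ?N = "restrict_space lborel {0..t}"
  have sp: "space ?N = {0..t}" by (simp add: space_restrict_space)
  from A obtain s where s: "\<And>k. Bochner_Integration.simple_bochner_integrable ?N (s k)" "\<And>k x. x \<in> space ?N \<Longrightarrow> sqnorm_H Sb (s k x) < \<infinity>"
    and l1: "(\<lambda>k. \<integral>\<^sup>+x. seminorm_of (sqnorm_H Sb) (\<alpha> x - s k x) \<partial>?N) \<longlonglongrightarrow> 0"
    and l2: "(\<lambda>k. sqnorm_H Sb (Bochner_Integration.simple_bochner_integral ?N (s k) - A)) \<longlonglongrightarrow> 0"
    unfolding has_seminorm_integral_def by blast
  have sf: "simple_function ?N (s k)" for k using s(1)[of k] by (auto simp: Bochner_Integration.simple_bochner_integrable.simps)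
  have Ls: "in_H Sb (s k r)" if "r \<in> {0..t}" for k r using s(2)[of r k] that sp by (simp add: in_H_def)
  have LI: "in_H Sb (\<lambda>T. \<integral>r. s k r T \<partial>?N)" for k
    by (rule H_norm_integral_simple(1)[OF finite_measure_interval sf]) (use Ls sp in auto)
  have l2': "(\<lambda>k. sqnorm_H Sb ((\<lambda>T. \<integral>r. s k r T \<partial>?N) - A)) \<longlonglongrightarrow> 0"
    using l2 unfolding simple_bochner_integral_apply[OF finite_measure_interval sf] .
  show LA: "in_H Sb A" by (rule in_H_of_sqnorm_limit[OF l2' LI])
  have "(\<integral>\<^sup>+x. seminorm_of (sqnorm_H Sb) (\<alpha> x - s k x) \<partial>?N) = (\<integral>\<^sup>+r. ennreal (H_norm Sb (\<alpha> r - s k r)) \<partial>?N)" for k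
    by (intro nn_integral_cong seminorm_of_H in_H_diff(1)) (use L Ls sp in auto)
  then have l1': "(\<lambda>k. \<integral>\<^sup>+r. ennreal (H_norm Sb (\<alpha> r - s k r)) \<partial>?N) \<longlonglongrightarrow> 0" using l1 by simp
  have "(\<lambda>k. H_norm Sb ((\<lambda>T. \<integral>r. s k r T \<partial>?N) - A)) \<longlonglongrightarrow> 0"
    by (rule H_norm_tendsto[THEN iffD1, OF in_H_diff(1)[OF LI LA] l2'])
  then show "\<exists>s. (\<forall>k. simple_function ?N (s k)) \<and> (\<forall>k. \<forall>r\<in>{0..t}. in_H Sb (s k r)) \<and>
    (\<lambda>k. \<integral>\<^sup>+r. ennreal (H_norm Sb (\<alpha> r - s k r)) \<partial>?N) \<longlonglongrightarrow> 0 \<and>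
    (\<lambda>k. H_norm Sb ((\<lambda>T. \<integral>r. s k r T \<partial>?N) - A)) \<longlonglongrightarrow> 0"
    using sf Ls l1' by blast
qed

text \<open>The two integrals come with unrelated approximations. Extending the simple functions for
  [0, s] by zero to [0, t] makes both comparable on one interval; on (s, t] the extension misses
  \<alpha> entirely, which leaves exactly the right-hand side.\<close>

lemma seminorm_integral_increment:
  fixes \<alpha> :: "real \<Rightarrow> real \<Rightarrow> real"
  assumes st: "0 \<le> s" "s \<le> t" and L: "\<And>r. r \<in> {0..t} \<Longrightarrow> in_H Sb (\<alpha> r)"
    and At: "has_seminorm_integral (sqnorm_H Sb) (restrict_space lborel {0..t}) \<alpha> At"
    and As: "has_seminorm_integral (sqnorm_H Sb) (restrict_space lborel {0..s}) \<alpha> As"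
  shows "ennreal (H_norm Sb (At - As)) \<le> (\<integral>\<^sup>+r\<in>{s<..t}. ennreal (H_norm Sb (\<alpha> r)) \<partial>lborel)"
proof -
  let ?Nt = "restrict_space lborel {0..t}" and ?Ns = "restrict_space lborel {0..s}"
  have sp: "space ?Nt = {0..t}" "space ?Ns = {0..s}" by (simp_all add: space_restrict_space)
  have sub: "{0..s} \<subseteq> {0..t}" using st by auto
  obtain p where p: "\<And>k. simple_function ?Nt (p k)" "\<And>k r. r \<in> {0..t} \<Longrightarrow> in_H Sb (p k r)"
    "(\<lambda>k. \<integral>\<^sup>+r. ennreal (H_norm Sb (\<alpha> r - p k r)) \<partial>?Nt) \<longlonglongrightarrow> 0"
    "(\<lambda>k. H_norm Sb ((\<lambda>T. \<integral>r. p k r T \<partial>?Nt) - At)) \<longlonglongrightarrow> 0"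
    using seminorm_integral_limits(1)[OF L At] by blast
  have LAt: "in_H Sb At" by (rule seminorm_integral_limits(2)[OF L At])
  have Ls: "in_H Sb (\<alpha> r)" if "r \<in> {0..s}" for r using L sub that by blast
  obtain p' where p': "\<And>k. simple_function ?Ns (p' k)" "\<And>k r. r \<in> {0..s} \<Longrightarrow> in_H Sb (p' k r)"
    "(\<lambda>k. \<integral>\<^sup>+r. ennreal (H_norm Sb (\<alpha> r - p' k r)) \<partial>?Ns) \<longlonglongrightarrow> 0"
    "(\<lambda>k. H_norm Sb ((\<lambda>T. \<integral>r. p' k r T \<partial>?Ns) - As)) \<longlonglongrightarrow> 0"
    using seminorm_integral_limits(1)[OF Ls As] by blast
  have LAs: "in_H Sb As" by (rule seminorm_integral_limits(2)[OF Ls As])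
  have \<alpha>m: "\<alpha> \<in> ?Nt \<rightarrow>\<^sub>M seminorm_borel (sqnorm_H Sb)" using At by (simp add: has_seminorm_integral_def)
  define q where "q k r = (if r \<le> s then p' k r else 0)" for k r
  have qs: "simple_function ?Nt (q k)" for k
    unfolding simple_function_def
  proof (intro conjI ballI)
    have "q k ` space ?Nt \<subseteq> insert 0 (p' k ` space ?Ns)" unfolding sp by (auto simp: q_def)
    then show "finite (q k ` space ?Nt)" using p'(1)[of k] by (auto simp: simple_function_def intro: finite_subset)
    fix v
    have "p' k -` {v} \<inter> {0..s} \<in> sets ?Ns" using simple_functionD(2)[OF p'(1)[of k], of "{v}"] sp by simp
    then have 1: "p' k -` {v} \<inter> {0..s} \<in> sets borel" by (auto simp: sets_restrict_space)
    have "q k -` {v} \<inter> space ?Nt = (p' k -` {v} \<inter> {0..s}) \<union> (if v = 0 then {s<..t} else {})"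
      unfolding sp using st by (auto simp: q_def split: if_splits)
    also have "\<dots> \<in> sets ?Nt" using 1 st by (subst sets_restrict_space_iff) auto
    finally show "q k -` {v} \<inter> space ?Nt \<in> sets ?Nt" .
  qed
  have Lq: "in_H Sb (q k r)" if "r \<in> {0..t}" for k r using p'(2)[of r k] that by (auto simp: q_def in_H_0)
  let ?I = "\<lambda>k T. \<integral>r. p k r T \<partial>?Nt" and ?I' = "\<lambda>k T. \<integral>r. p' k r T \<partial>?Ns"
  have LI: "in_H Sb (?I k)" for k by (rule H_norm_integral_simple(1)[OF finite_measure_interval p(1)]) (use p(2) sp in auto)
  have LI': "in_H Sb (?I' k)" for k by (rule H_norm_integral_simple(1)[OF finite_measure_interval p'(1)]) (use p'(2) sp in auto)
  define a where "a k = (\<integral>\<^sup>+r. ennreal (H_norm Sb (\<alpha> r - p k r)) \<partial>?Nt)" for k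
  define b where "b k = (\<integral>\<^sup>+r. ennreal (H_norm Sb (\<alpha> r - p' k r)) \<partial>?Ns)" for k
  define c where "c = (\<integral>\<^sup>+r\<in>{s<..t}. ennreal (H_norm Sb (\<alpha> r)) \<partial>lborel)"
  have main: "ennreal (H_norm Sb (?I k - ?I' k)) \<le> a k + (b k + c)" for k
  proof -
    define d where "d r = p k r - q k r" for r
    have ds: "simple_function ?Nt d" unfolding d_def by (rule simple_function_compose2[OF p(1) qs])
    have Ld: "in_H Sb (d r)" if "r \<in> space ?Nt" for r unfolding d_def using that sp p(2) Lq by (intro in_H_diff(1)) auto
    have e: "?I k - ?I' k = (\<lambda>T. \<integral>r. d r T \<partial>?Nt)"
    proof
      fix T
      have "?I' k T = (\<integral>r. indicator {0..s} r *\<^sub>R p' k r T \<partial>lborel)" by (subst integral_restrict_space) auto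
      also have "\<dots> = (\<integral>r. indicator {0..t} r *\<^sub>R q k r T \<partial>lborel)"
        using st by (intro Bochner_Integration.integral_cong refl) (auto simp: q_def indicator_def)
      also have "\<dots> = (\<integral>r. q k r T \<partial>?Nt)" by (subst integral_restrict_space) auto
      finally have "?I' k T = (\<integral>r. q k r T \<partial>?Nt)" .
      then show "(?I k - ?I' k) T = (\<integral>r. d r T \<partial>?Nt)"
        unfolding d_def using integral_simple_function(1)[OF finite_measure_interval p(1), of "\<lambda>v. v T"]
          integral_simple_function(1)[OF finite_measure_interval qs, of "\<lambda>v. v T"]
        by (simp add: Bochner_Integration.integral_diff)
    qed
    have "ennreal (H_norm Sb (?I k - ?I' k)) \<le> ennreal (\<integral>r. H_norm Sb (d r) \<partial>?Nt)"
      unfolding e by (intro ennreal_leI H_norm_integral_simple(2)[OF finite_measure_interval ds Ld])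
    also have "\<dots> = (\<integral>\<^sup>+r. ennreal (H_norm Sb (d r)) \<partial>?Nt)"
      using integral_simple_function(1)[OF finite_measure_interval ds, of "H_norm Sb"]
      by (intro nn_integral_eq_integral[symmetric]) (auto simp: H_norm_nonneg)
    also have "\<dots> \<le> (\<integral>\<^sup>+r. ennreal (H_norm Sb (\<alpha> r - p k r)) + ennreal (H_norm Sb (\<alpha> r - q k r)) \<partial>?Nt)"
    proof (intro nn_integral_mono)
      fix r assume "r \<in> space ?Nt"
      then have r: "r \<in> {0..t}" by (simp add: sp)
      have "H_norm Sb (d r) \<le> H_norm Sb (\<alpha> r - p k r) + H_norm Sb (\<alpha> r - q k r)"
        unfolding d_def using H_norm_triangle[OF p(2)[OF r] L[OF r] Lq[OF r], of k k] H_norm_minus_commute[of Sb "p k r" "\<alpha> r"] by linarith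
      then show "ennreal (H_norm Sb (d r)) \<le> ennreal (H_norm Sb (\<alpha> r - p k r)) + ennreal (H_norm Sb (\<alpha> r - q k r))"
        by (simp add: ennreal_plus[symmetric] H_norm_nonneg del: ennreal_plus)
    qed
    also have "\<dots> = a k + (\<integral>\<^sup>+r. ennreal (H_norm Sb (\<alpha> r - q k r)) \<partial>?Nt)"
      unfolding a_def
      using H_norm_diff_simple_measurable[OF \<alpha>m _ p(1)] H_norm_diff_simple_measurable[OF \<alpha>m _ qs] L p(2) Lq sp
      by (intro nn_integral_add) auto
    also have "(\<integral>\<^sup>+r. ennreal (H_norm Sb (\<alpha> r - q k r)) \<partial>?Nt) = b k + c"
    proof -
      let ?h = "\<lambda>r. H_norm Sb (\<alpha> r - q k r)"
      have "?h \<in> borel_measurable ?Nt" using H_norm_diff_simple_measurable[OF \<alpha>m _ qs] L Lq sp by auto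
      then have hm: "(\<lambda>r. indicator {0..t} r *\<^sub>R ?h r) \<in> borel_measurable lborel"
        using borel_measurable_restrict_space_iff[of "{0..t}" lborel ?h] by simp
      have m: "(\<lambda>r. ennreal (?h r) * indicator A r) \<in> borel_measurable lborel" if A: "A \<in> sets borel" "A \<subseteq> {0..t}" for A
      proof -
        have "(\<lambda>r. ennreal (indicator {0..t} r *\<^sub>R ?h r) * indicator A r) \<in> borel_measurable lborel" using hm A(1) by measurable
        then show ?thesis by (rule measurable_cong[THEN iffD1, rotated]) (use A in \<open>auto simp: indicator_def\<close>)
      qed
      have "(\<integral>\<^sup>+r. ennreal (?h r) \<partial>?Nt) = (\<integral>\<^sup>+r. ennreal (?h r) * indicator {0..t} r \<partial>lborel)"
        by (subst nn_integral_restrict_space) auto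
      also have "\<dots> = (\<integral>\<^sup>+r. ennreal (?h r) * indicator {0..s} r + ennreal (?h r) * indicator {s<..t} r \<partial>lborel)"
        using st by (intro nn_integral_cong) (auto simp: indicator_def)
      also have "\<dots> = (\<integral>\<^sup>+r. ennreal (?h r) * indicator {0..s} r \<partial>lborel) + (\<integral>\<^sup>+r. ennreal (?h r) * indicator {s<..t} r \<partial>lborel)"
        using st by (intro nn_integral_add m) auto
      also have "(\<integral>\<^sup>+r. ennreal (?h r) * indicator {0..s} r \<partial>lborel) = (\<integral>\<^sup>+r. ennreal (H_norm Sb (\<alpha> r - p' k r)) * indicator {0..s} r \<partial>lborel)"
        by (intro nn_integral_cong) (auto simp: q_def indicator_def)
      also have "\<dots> = b k" unfolding b_def by (subst nn_integral_restrict_space) auto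
      also have "(\<integral>\<^sup>+r. ennreal (?h r) * indicator {s<..t} r \<partial>lborel) = c"
        unfolding c_def by (intro nn_integral_cong) (auto simp: q_def indicator_def)
      finally show ?thesis .
    qed
    finally show ?thesis .
  qed
  have "ennreal (H_norm Sb (At - As)) \<le> ennreal (H_norm Sb (?I k - At)) + (a k + (b k + c)) + ennreal (H_norm Sb (?I' k - As))" for k
  proof -
    have "H_norm Sb (At - As) \<le> H_norm Sb (?I k - At) + H_norm Sb (?I k - ?I' k) + H_norm Sb (?I' k - As)"
      using H_norm_triangle[OF LAt LI LAs, of k] H_norm_triangle[OF LI LI' LAs, of k k] H_norm_minus_commute[of Sb At "?I k"] by linarith
    then have "ennreal (H_norm Sb (At - As)) \<le> ennreal (H_norm Sb (?I k - At) + H_norm Sb (?I k - ?I' k) + H_norm Sb (?I' k - As))" by (rule ennreal_leI)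
    also have "\<dots> = ennreal (H_norm Sb (?I k - At)) + ennreal (H_norm Sb (?I k - ?I' k)) + ennreal (H_norm Sb (?I' k - As))"
      by (simp add: H_norm_nonneg)
    also have "\<dots> \<le> ennreal (H_norm Sb (?I k - At)) + (a k + (b k + c)) + ennreal (H_norm Sb (?I' k - As))"
      by (intro add_mono main order_refl)
    finally show ?thesis .
  qed
  moreover have "(\<lambda>k. ennreal (H_norm Sb (?I k - At)) + (a k + (b k + c)) + ennreal (H_norm Sb (?I' k - As))) \<longlonglongrightarrow> ennreal 0 + (0 + (0 + c)) + ennreal 0"
    using p(3,4) p'(3,4) unfolding a_def b_def by (intro tendsto_intros) auto
  ultimately have "ennreal (H_norm Sb (At - As)) \<le> ennreal 0 + (0 + (0 + c)) + ennreal 0"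
    by (intro LIMSEQ_le_const) auto
  then show ?thesis by (simp add: c_def)
qed

text \<open>Along continuous paths of W the elementary integrals are continuous with values in H,
  and the convergence to X is uniform in time.\<close>

lemma elementary_limit_continuous:
  fixes \<xi> :: "nat \<Rightarrow> nat \<Rightarrow> 'w \<Rightarrow> nat \<Rightarrow> real \<Rightarrow> real"
  assumes W: "\<And>i. continuous_on {0..Sb} (\<lambda>t. W i t \<omega>)"
    and \<tau>: "\<And>k j. j \<le> n k \<Longrightarrow> \<tau> k j \<in> {0..Sb}"
    and \<xi>: "\<And>k j i. j < n k \<Longrightarrow> in_H Sb (\<xi> k j \<omega> i)"
    and lim: "(\<lambda>k. SUP t\<in>{0..Sb}. sqnorm_H Sb (elementary_integral W (n k) (m k) (\<tau> k) (\<xi> k) t \<omega> - X t)) \<longlonglongrightarrow> 0"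
  shows "\<And>t. t \<in> {0..Sb} \<Longrightarrow> in_H Sb (X t)"
    "\<And>t x. t \<in> {0..Sb} \<Longrightarrow> (\<And>k. x k \<in> {0..Sb}) \<Longrightarrow> x \<longlonglongrightarrow> t \<Longrightarrow> (\<lambda>k. H_norm Sb (X (x k) - X t)) \<longlonglongrightarrow> 0"
proof -
  let ?I = "\<lambda>k t. elementary_integral W (n k) (m k) (\<tau> k) (\<xi> k) t \<omega>"
  let ?c = "\<lambda>k j i t. W i (min t (\<tau> k (Suc j))) \<omega> - W i (min t (\<tau> k j)) \<omega>"
  have LI: "in_H Sb (?I k t)" for k t
    unfolding elementary_integral_def using \<xi> by (intro in_H_sum(1) in_H_scale) auto
  have LX: "in_H Sb (X t)" if t: "t \<in> {0..Sb}" for t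
  proof (rule in_H_of_sqnorm_limit[OF _ LI])
    show "(\<lambda>k. sqnorm_H Sb (?I k t - X t)) \<longlonglongrightarrow> 0"
      by (rule tendsto_sandwich[OF _ _ tendsto_const lim]) (auto intro!: always_eventually SUP_upper t)
  qed
  then show "\<And>t. t \<in> {0..Sb} \<Longrightarrow> in_H Sb (X t)" .
  fix t x assume t: "t \<in> {0..Sb}" and x: "\<And>k. x k \<in> {0..Sb}" "x \<longlonglongrightarrow> t"
  show "(\<lambda>l. H_norm Sb (X (x l) - X t)) \<longlonglongrightarrow> 0"
  proof (rule LIMSEQ_I)
    fix e :: real assume e: "0 < e"
    have "\<forall>\<^sub>F k in sequentially. (SUP t\<in>{0..Sb}. sqnorm_H Sb (?I k t - X t)) < ennreal ((e / 4)\<^sup>2)"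
      using order_tendstoD(2)[OF lim, of "ennreal ((e / 4)\<^sup>2)"] e by simp
    then obtain k where k: "(SUP t\<in>{0..Sb}. sqnorm_H Sb (?I k t - X t)) < ennreal ((e / 4)\<^sup>2)" by (auto simp: eventually_sequentially)
    have small: "H_norm Sb (?I k u - X u) < e / 4" if u: "u \<in> {0..Sb}" for u
    proof (rule sqnorm_H_less(2))
      have "sqnorm_H Sb (?I k u - X u) \<le> (SUP t\<in>{0..Sb}. sqnorm_H Sb (?I k t - X t))" by (rule SUP_upper[OF u])
      then show "sqnorm_H Sb (?I k u - X u) < ennreal ((e / 4)\<^sup>2)" using k by (rule le_less_trans)
    qed (use e in simp)
    have le: "H_norm Sb (?I k u - ?I k t) \<le> (\<Sum>j<n k. \<Sum>i<m k. \<bar>?c k j i u - ?c k j i t\<bar> * H_norm Sb (\<xi> k j \<omega> i))" for u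
    proof -
      have eq: "?I k u - ?I k t = (\<Sum>j<n k. \<Sum>i<m k. (?c k j i u - ?c k j i t) *\<^sub>R \<xi> k j \<omega> i)"
        by (simp only: elementary_integral_def sum_subtractf scaleR_diff_left)
      have "H_norm Sb (?I k u - ?I k t) \<le> (\<Sum>j<n k. H_norm Sb (\<Sum>i<m k. (?c k j i u - ?c k j i t) *\<^sub>R \<xi> k j \<omega> i))"
        unfolding eq using \<xi> by (intro in_H_sum(2) in_H_sum(1) in_H_scale) auto
      also have "\<dots> \<le> (\<Sum>j<n k. \<Sum>i<m k. H_norm Sb ((?c k j i u - ?c k j i t) *\<^sub>R \<xi> k j \<omega> i))"
        using \<xi> by (intro sum_mono in_H_sum(2) in_H_scale) auto
      finally show ?thesis by (simp only: H_norm_scale)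
    qed
    have cl: "(\<lambda>l. ?c k j i (x l)) \<longlonglongrightarrow> ?c k j i t" if j: "j < n k" for j i
    proof -
      have "(\<lambda>l. W i (min (x l) r) \<omega>) \<longlonglongrightarrow> W i (min t r) \<omega>" if r: "r \<in> {0..Sb}" for r
      proof (rule continuous_on_tendsto_compose[OF W])
        show "(\<lambda>l. min (x l) r) \<longlonglongrightarrow> min t r" by (intro tendsto_intros x)
        show "min t r \<in> {0..Sb}" using t r by auto
        show "\<forall>\<^sub>F l in sequentially. min (x l) r \<in> {0..Sb}" using x(1) r by (auto simp: min_def)
      qed
      then show ?thesis using \<tau>[of "Suc j" k] \<tau>[of j k] j by (intro tendsto_diff) auto
    qed
    have "(\<lambda>l. \<Sum>j<n k. \<Sum>i<m k. \<bar>?c k j i (x l) - ?c k j i t\<bar> * H_norm Sb (\<xi> k j \<omega> i)) \<longlonglongrightarrow>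
        (\<Sum>j<n k. \<Sum>i<m k. \<bar>?c k j i t - ?c k j i t\<bar> * H_norm Sb (\<xi> k j \<omega> i))"
      by (intro tendsto_intros cl) auto
    then have "\<forall>\<^sub>F l in sequentially. (\<Sum>j<n k. \<Sum>i<m k. \<bar>?c k j i (x l) - ?c k j i t\<bar> * H_norm Sb (\<xi> k j \<omega> i)) < e / 4"
      using e by (intro order_tendstoD(2)) auto
    then obtain l0 where l0: "\<And>l. l0 \<le> l \<Longrightarrow> (\<Sum>j<n k. \<Sum>i<m k. \<bar>?c k j i (x l) - ?c k j i t\<bar> * H_norm Sb (\<xi> k j \<omega> i)) < e / 4"
      by (auto simp: eventually_sequentially)
    have "H_norm Sb (X (x l) - X t) < e" if l: "l0 \<le> l" for l
    proof -
      have "H_norm Sb (X (x l) - X t) \<le> H_norm Sb (X (x l) - ?I k (x l)) + (H_norm Sb (?I k (x l) - ?I k t) + H_norm Sb (?I k t - X t))"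
        using H_norm_triangle[OF LX[OF x(1)] LI LX[OF t], of l k "x l"] H_norm_triangle[OF LI LI LX[OF t], of k "x l" k t] by linarith
      then show ?thesis
        using small[OF x(1)[of l]] small[OF t] le[of "x l"] l0[OF l] H_norm_minus_commute[of Sb "X (x l)" "?I k (x l)"] e by linarith
    qed
    then show "\<exists>no. \<forall>l\<ge>no. norm (H_norm Sb (X (x l) - X t) - 0) < e" by (auto simp: H_norm_nonneg)
  qed
qed

section \<open>Incompleteness\<close>

sublocale bond_market \<subseteq> cylindrical_wiener M Sb F W
  by unfold_locales (rule horizon wiener wiener_indep usual generated)+

context bond_market begin

section \<open>Path regularity of the forward rates and of the integrands\<close>

lemma Sb0: "0 \<le> Sb"
  using horizon by simp

text \<open>The drift integral moves at most by the integral of the norm of \<alpha>, and the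
  stochastic part is a uniform limit of continuous elementary integrals; together they give
  continuity of the forward curve in H.\<close>

lemma forward_rates_regular:
  "AE \<omega> in M. (\<forall>t\<in>{0..Sb}. in_H Sb (f t \<omega>)) \<and>
     (\<forall>t\<in>{0..Sb}. \<forall>x. (\<forall>k. x k \<in> {0..Sb}) \<longrightarrow> x \<longlonglongrightarrow> t \<longrightarrow> (\<lambda>k. H_norm Sb (f (x k) \<omega> - f t \<omega>)) \<longlonglongrightarrow> 0)"
proof -
  obtain X where X: "has_stochastic_integral M Sb F W (sqnorm_H Sb) \<sigma> X"
    and fA: "AE \<omega> in M. \<forall>t\<in>{0..Sb}. \<exists>A.
              has_seminorm_integral (sqnorm_H Sb) (restrict_space lborel {0..t}) (\<lambda>s. \<alpha> s \<omega>) A \<and>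
              sqnorm_H Sb (f t \<omega> - (f0 + A + X t \<omega>)) = 0"
    using forward_rates by blast
  from X obtain n m \<tau> \<xi> where e: "\<And>k. elementary_integrand Sb F (sqnorm_H Sb) (n k) (m k) (\<tau> k) (\<xi> k)"
    and E2: "AE \<omega> in M. (\<lambda>k. SUP t\<in>{0..Sb}. sqnorm_H Sb (elementary_integral W (n k) (m k) (\<tau> k) (\<xi> k) t \<omega> - X t \<omega>)) \<longlonglongrightarrow> 0"
    unfolding has_stochastic_integral_def by blast
  have Wc: "AE \<omega> in M. \<forall>i. continuous_on {0..Sb} (\<lambda>t. W i t \<omega>)"
    unfolding AE_all_countable using wiener by (auto simp: standard_wiener_def)
  show ?thesis
    using fA E2 Wc drift_integrable AE_space
  proof eventually_elim
    fix \<omega> assume fA: "\<forall>t\<in>{0..Sb}. \<exists>A.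
              has_seminorm_integral (sqnorm_H Sb) (restrict_space lborel {0..t}) (\<lambda>s. \<alpha> s \<omega>) A \<and>
              sqnorm_H Sb (f t \<omega> - (f0 + A + X t \<omega>)) = 0"
      and E2: "(\<lambda>k. SUP t\<in>{0..Sb}. sqnorm_H Sb (elementary_integral W (n k) (m k) (\<tau> k) (\<xi> k) t \<omega> - X t \<omega>)) \<longlonglongrightarrow> 0"
      and Wc: "\<forall>i. continuous_on {0..Sb} (\<lambda>t. W i t \<omega>)"
      and di: "(\<integral>\<^sup>+t\<in>{0..Sb}. seminorm_of (sqnorm_H Sb) (\<alpha> t \<omega>) \<partial>lborel) < \<infinity>" and \<omega>: "\<omega> \<in> space M"
    have \<tau>r: "\<tau> k j \<in> {0..Sb}" if "j \<le> n k" for k j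
      using e[of k] mono_grid[of "n k" "\<tau> k" 0 j] mono_grid[of "n k" "\<tau> k" j "n k"] that
      by (auto simp: elementary_integrand_def)
    have \<xi>L: "in_H Sb (\<xi> k j \<omega> i)" if "j < n k" for k j i
      using e[of k] that \<omega> F_space[OF \<tau>r[of j k]] by (auto simp: elementary_integrand_def in_H_def)
    have XL: "in_H Sb (X t \<omega>)" if "t \<in> {0..Sb}" for t
      by (rule elementary_limit_continuous(1)[OF _ _ _ E2 that]) (use Wc \<tau>r \<xi>L in blast)+
    have XC: "(\<lambda>k. H_norm Sb (X (x k) \<omega> - X t \<omega>)) \<longlonglongrightarrow> 0"
      if "t \<in> {0..Sb}" "\<And>k. x k \<in> {0..Sb}" "x \<longlonglongrightarrow> t" for t x
      by (rule elementary_limit_continuous(2)[OF _ _ _ E2 that]) (use Wc \<tau>r \<xi>L in blast)+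
    have \<alpha>L: "in_H Sb (\<alpha> t \<omega>)" if "t \<in> {0..Sb}" for t using drift_in_H[OF that \<omega>] by (simp add: in_H_def)
    from bchoice[OF fA] obtain A where A: "\<And>t. t \<in> {0..Sb} \<Longrightarrow> has_seminorm_integral (sqnorm_H Sb) (restrict_space lborel {0..t}) (\<lambda>s. \<alpha> s \<omega>) (A t)"
      and fe: "\<And>t. t \<in> {0..Sb} \<Longrightarrow> sqnorm_H Sb (f t \<omega> - (f0 + A t + X t \<omega>)) = 0" by blast
    define g where "g t = f0 + A t + X t \<omega>" for t
    have AL: "in_H Sb (A t)" if "t \<in> {0..Sb}" for t
      by (rule seminorm_integral_limits(2)[OF _ A[OF that]]) (use that \<alpha>L in auto)
    have gL: "in_H Sb (g t)" if "t \<in> {0..Sb}" for t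
      unfolding g_def using initial_curve AL[OF that] XL[OF that] by (intro in_H_add(1)) (auto simp: in_H_def)
    have dL: "in_H Sb (f t \<omega> - g t)" "H_norm Sb (f t \<omega> - g t) = 0" if "t \<in> {0..Sb}" for t
    proof -
      show l: "in_H Sb (f t \<omega> - g t)" using fe[OF that] by (simp add: g_def in_H_def)
      have "ennreal ((H_norm Sb (f t \<omega> - g t))\<^sup>2) = 0" using fe[OF that] unfolding sqnorm_H_H_norm[OF l, symmetric] by (simp add: g_def)
      then show "H_norm Sb (f t \<omega> - g t) = 0" by (simp add: ennreal_eq_0_iff)
    qed
    have fL: "in_H Sb (f t \<omega>)" if "t \<in> {0..Sb}" for t using in_H_add(1)[OF dL(1)[OF that] gL[OF that]] by simp
    define h where "h r = H_norm Sb (\<alpha> r \<omega>)" for r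
    have hi: "set_integrable lborel {0..Sb} h"
    proof -
      have SbI: "Sb \<in> {0..Sb}" using horizon by simp
      have am: "(\<lambda>s. \<alpha> s \<omega>) \<in> restrict_space lborel {0..Sb} \<rightarrow>\<^sub>M seminorm_borel (sqnorm_H Sb)"
        using A[OF SbI] by (simp add: has_seminorm_integral_def)
      have "(\<lambda>r. H_norm Sb (\<alpha> r \<omega> - 0)) \<in> borel_measurable (restrict_space lborel {0..Sb})"
        by (rule H_norm_measurable[OF am _ in_H_0]) (use \<alpha>L in \<open>auto simp: space_restrict_space\<close>)
      then have "h \<in> borel_measurable (restrict_space lborel {0..Sb})" by (simp add: h_def[abs_def])
      then have m: "(\<lambda>r. indicator {0..Sb} r *\<^sub>R h r) \<in> borel_measurable lborel"
        using borel_measurable_restrict_space_iff[of "{0..Sb}" lborel h] by simp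
      have "(\<integral>\<^sup>+r. ennreal (norm (indicator {0..Sb} r *\<^sub>R h r)) \<partial>lborel) = (\<integral>\<^sup>+t\<in>{0..Sb}. seminorm_of (sqnorm_H Sb) (\<alpha> t \<omega>) \<partial>lborel)"
        by (intro nn_integral_cong) (auto simp: indicator_def h_def seminorm_of_H[OF \<alpha>L] H_norm_nonneg)
      then show ?thesis unfolding set_integrable_def integrable_iff_bounded using m di by simp
    qed
    have Ainc: "H_norm Sb (A t - A s) \<le> \<bar>primitive h t - primitive h s\<bar>" if st: "s \<in> {0..Sb}" "t \<in> {0..Sb}" for s t
    proof -
      have *: "H_norm Sb (A t - A s) \<le> \<bar>primitive h t - primitive h s\<bar>" if st: "0 \<le> s" "s \<le> t" "t \<le> Sb" for s t
      proof -
        have "ennreal (H_norm Sb (A t - A s)) \<le> (\<integral>\<^sup>+r\<in>{s<..t}. ennreal (H_norm Sb (\<alpha> r \<omega>)) \<partial>lborel)"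
          using st by (intro seminorm_integral_increment A \<alpha>L) auto
        also have "\<dots> = (\<integral>\<^sup>+r. ennreal (indicator {s<..t} r *\<^sub>R h r) \<partial>lborel)"
          by (intro nn_integral_cong) (auto simp: indicator_def h_def)
        also have "\<dots> = ennreal (LINT r:{s<..t}|lborel. h r)"
          unfolding set_lebesgue_integral_def using set_integrable_sub(1)[OF hi st(1,3)]
          by (intro nn_integral_eq_integral) (auto simp: set_integrable_def h_def H_norm_nonneg)
        also have "(LINT r:{s<..t}|lborel. h r) = primitive h t - primitive h s" by (rule primitive_diff[OF hi st, symmetric])
        finally have "ennreal (H_norm Sb (A t - A s)) \<le> ennreal \<bar>primitive h t - primitive h s\<bar>"
          by (rule order_trans) (intro ennreal_leI abs_ge_self)
        then show ?thesis by (subst (asm) ennreal_le_iff) auto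
      qed
      show ?thesis
      proof (cases "s \<le> t")
        case True then show ?thesis using *[of s t] st by auto
      next
        case False
        then have "H_norm Sb (A s - A t) \<le> \<bar>primitive h s - primitive h t\<bar>" using *[of t s] st by auto
        then show ?thesis unfolding H_norm_minus_commute[of Sb "A t"] abs_minus_commute[of "primitive h t"] .
      qed
    qed
    have fc: "(\<lambda>k. H_norm Sb (f (x k) \<omega> - f t \<omega>)) \<longlonglongrightarrow> 0"
      if t: "t \<in> {0..Sb}" and x: "\<And>k. x k \<in> {0..Sb}" "x \<longlonglongrightarrow> t" for t x
    proof (rule Lim_null_comparison)
      have le: "H_norm Sb (f u \<omega> - f t \<omega>) \<le> \<bar>primitive h u - primitive h t\<bar> + H_norm Sb (X u \<omega> - X t \<omega>)" if u: "u \<in> {0..Sb}" for u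
      proof -
        have 1: "H_norm Sb (f u \<omega> - f t \<omega>) \<le> H_norm Sb (f u \<omega> - g u) + (H_norm Sb (g u - g t) + H_norm Sb (g t - f t \<omega>))"
          using H_norm_triangle[OF fL[OF u] gL[OF u] fL[OF t]] H_norm_triangle[OF gL[OF u] gL[OF t] fL[OF t]] by linarith
        have ge: "g u - g t = (A u - A t) + (X u \<omega> - X t \<omega>)" by (simp add: g_def)
        have "H_norm Sb (g u - g t) \<le> H_norm Sb (A u - A t) + H_norm Sb (X u \<omega> - X t \<omega>)"
          unfolding ge by (intro in_H_add(2) in_H_diff(1) AL XL u t)
        then show ?thesis using 1 dL(2)[OF u] dL(2)[OF t] Ainc[OF t u] H_norm_minus_commute[of Sb "g t" "f t \<omega>"] by linarith
      qed
      show "\<forall>\<^sub>F k in sequentially. norm (H_norm Sb (f (x k) \<omega> - f t \<omega>)) \<le> \<bar>primitive h (x k) - primitive h t\<bar> + H_norm Sb (X (x k) \<omega> - X t \<omega>)"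
        using le[OF x(1)] by (intro always_eventually) (simp add: H_norm_nonneg)
      have "(\<lambda>k. primitive h (x k)) \<longlonglongrightarrow> primitive h t"
        by (rule continuous_on_tendsto_compose[OF primitive_continuous[OF hi] x(2) t]) (use x(1) in auto)
      then have "(\<lambda>k. \<bar>primitive h (x k) - primitive h t\<bar>) \<longlonglongrightarrow> \<bar>primitive h t - primitive h t\<bar>" by (intro tendsto_intros)
      then show "(\<lambda>k. \<bar>primitive h (x k) - primitive h t\<bar> + H_norm Sb (X (x k) \<omega> - X t \<omega>)) \<longlonglongrightarrow> 0"
        using tendsto_add[OF _ XC[OF t x]] by fastforce
    qed
    show "(\<forall>t\<in>{0..Sb}. in_H Sb (f t \<omega>)) \<and>
     (\<forall>t\<in>{0..Sb}. \<forall>x. (\<forall>k. x k \<in> {0..Sb}) \<longrightarrow> x \<longlonglongrightarrow> t \<longrightarrow> (\<lambda>k. H_norm Sb (f (x k) \<omega> - f t \<omega>)) \<longlonglongrightarrow> 0)"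
      using fL fc by blast
  qed
qed

lemma predictable_section:
  assumes "\<omega> \<in> space M"
  shows "(\<lambda>t. (t, \<omega>)) \<in> restrict_space borel {0..Sb} \<rightarrow>\<^sub>M predictable_algebra M Sb F"
  unfolding predictable_algebra_def
proof (rule measurable_measure_of)
  show "{{0} \<times> A | A. A \<in> sets (F 0)} \<union>
      {{s<..t} \<times> A | s t A. 0 \<le> s \<and> s \<le> t \<and> t \<le> Sb \<and> A \<in> sets (F s)} \<subseteq> Pow ({0..Sb} \<times> space M)"
    using F_sets_M[THEN sets.sets_into_space] Sb0 by fastforce
  show "(\<lambda>t. (t, \<omega>)) \<in> space (restrict_space borel {0..Sb}) \<rightarrow> {0..Sb} \<times> space M"
    using assms by (auto simp: space_restrict_space)
  fix Z assume "Z \<in> {{0} \<times> A | A. A \<in> sets (F 0)} \<union>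
      {{s<..t} \<times> A | s t A. 0 \<le> s \<and> s \<le> t \<and> t \<le> Sb \<and> A \<in> sets (F s)}"
  then obtain B A where Z: "Z = B \<times> A" "B \<in> sets borel" by auto
  have "(\<lambda>t. (t, \<omega>)) -` Z \<inter> space (restrict_space borel {0..Sb}) = (if \<omega> \<in> A then B \<inter> {0..Sb} else {})"
    by (auto simp: Z space_restrict_space)
  then show "(\<lambda>t. (t, \<omega>)) -` Z \<inter> space (restrict_space borel {0..Sb}) \<in> sets (restrict_space borel {0..Sb})"
    using Z by (auto simp: sets_restrict_space_iff)
qed

text \<open>The bound is \<open>adjoint_properties\<close> path by path. For measurability in time,
  \<open>pairing_measurable\<close> is fed with the elementary processes that approximate the
  volatility in the equation for the forward rates.\<close>

lemma integrand_regular: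
  assumes \<phi>: "trading_strategy M Sb F K \<phi>" and K: "K \<subseteq> Gdual Sb"
  defines "y \<equiv> strategy_integrand f \<sigma> \<phi>"
  shows "AE \<omega> in M. (\<forall>t\<in>{0..Sb}. \<exists>C. \<forall>i. \<bar>y t \<omega> i\<bar> \<le> C * H_norm Sb (\<sigma> t \<omega> i))"
    "AE \<omega> in M. \<exists>y'. (\<forall>i. (\<lambda>t. y' t i) \<in> borel_measurable lborel) \<and> (AE t in lborel. t \<in> {0..Sb} \<longrightarrow> y t \<omega> = y' t)"
proof -
  have \<phi>G: "\<phi> t \<omega> \<in> Gdual Sb" if "t \<in> {0..Sb}" "\<omega> \<in> space M" for t \<omega>
    using \<phi> K that by (auto simp: trading_strategy_def)
  show "AE \<omega> in M. (\<forall>t\<in>{0..Sb}. \<exists>C. \<forall>i. \<bar>y t \<omega> i\<bar> \<le> C * H_norm Sb (\<sigma> t \<omega> i))"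
    using forward_rates_regular volatility_HS AE_space
  proof eventually_elim
    fix \<omega> assume a: "(\<forall>t\<in>{0..Sb}. in_H Sb (f t \<omega>)) \<and>
     (\<forall>t\<in>{0..Sb}. \<forall>x. (\<forall>k. x k \<in> {0..Sb}) \<longrightarrow> x \<longlonglongrightarrow> t \<longrightarrow> (\<lambda>k. H_norm Sb (f (x k) \<omega> - f t \<omega>)) \<longlonglongrightarrow> 0)"
      and v: "\<forall>t\<in>{0..Sb}. sqnorm_HS (sqnorm_H Sb) (\<sigma> t \<omega>) < \<infinity>" and \<omega>: "\<omega> \<in> space M"
    show "\<forall>t\<in>{0..Sb}. \<exists>C. \<forall>i. \<bar>y t \<omega> i\<bar> \<le> C * H_norm Sb (\<sigma> t \<omega> i)"
    proof
      fix t assume t: "t \<in> {0..Sb}"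
      have ft: "in_H Sb (f t \<omega>)" and vt: "sqnorm_HS (sqnorm_H Sb) (\<sigma> t \<omega>) < \<infinity>" using a v t by auto
      show "\<exists>C. \<forall>i. \<bar>y t \<omega> i\<bar> \<le> C * H_norm Sb (\<sigma> t \<omega> i)"
        unfolding y_def strategy_integrand_def
        by (rule adjoint_properties(2)[OF Sb0 ft HS_component(1)[OF vt] HS_component(2)[OF vt] \<phi>G[OF t \<omega>]])
    qed
  qed
  obtain X where X: "has_stochastic_integral M Sb F W (sqnorm_H Sb) \<sigma> X" using forward_rates by blast
  from X obtain n m \<tau> \<xi> where e: "\<And>k. elementary_integrand Sb F (sqnorm_H Sb) (n k) (m k) (\<tau> k) (\<xi> k)"
    and E1: "AE \<omega> in M. (\<lambda>k. \<integral>\<^sup>+t\<in>{0..Sb}. sqnorm_HS (sqnorm_H Sb) (elementary_process (n k) (\<tau> k) (\<xi> k) t \<omega> - \<sigma> t \<omega>) \<partial>lborel) \<longlonglongrightarrow> 0"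
    unfolding has_stochastic_integral_def by blast
  have mono: "\<forall>j<n k. \<tau> k j \<le> \<tau> k (Suc j)" for k using e[of k] by (auto simp: elementary_integrand_def)
  have \<tau>r: "\<tau> k j \<in> {0..Sb}" if "j \<le> n k" for k j
    using e[of k] mono_grid[of "n k" "\<tau> k" 0 j] mono_grid[of "n k" "\<tau> k" j "n k"] that
    by (auto simp: elementary_integrand_def)
  show "AE \<omega> in M. \<exists>y'. (\<forall>i. (\<lambda>t. y' t i) \<in> borel_measurable lborel) \<and> (AE t in lborel. t \<in> {0..Sb} \<longrightarrow> y t \<omega> = y' t)"
    using forward_rates_regular volatility_HS E1 AE_space
  proof eventually_elim
    fix \<omega> assume a: "(\<forall>t\<in>{0..Sb}. in_H Sb (f t \<omega>)) \<and>
     (\<forall>t\<in>{0..Sb}. \<forall>x. (\<forall>k. x k \<in> {0..Sb}) \<longrightarrow> x \<longlonglongrightarrow> t \<longrightarrow> (\<lambda>k. H_norm Sb (f (x k) \<omega> - f t \<omega>)) \<longlonglongrightarrow> 0)"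
      and v: "\<forall>t\<in>{0..Sb}. sqnorm_HS (sqnorm_H Sb) (\<sigma> t \<omega>) < \<infinity>"
      and E1: "(\<lambda>k. \<integral>\<^sup>+t\<in>{0..Sb}. sqnorm_HS (sqnorm_H Sb) (elementary_process (n k) (\<tau> k) (\<xi> k) t \<omega> - \<sigma> t \<omega>) \<partial>lborel) \<longlonglongrightarrow> 0"
      and \<omega>: "\<omega> \<in> space M"
    let ?N = "restrict_space borel {0..Sb} :: real measure"
    have spN: "space ?N = {0..Sb}" by (simp add: space_restrict_space)
    have fL: "in_H Sb (f t \<omega>)" if "t \<in> {0..Sb}" for t using a that by blast
    have vt: "sqnorm_HS (sqnorm_H Sb) (\<sigma> t \<omega>) < \<infinity>" if "t \<in> {0..Sb}" for t using v that by blast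
    have \<xi>L: "in_H Sb (\<xi> k j \<omega> i)" if "j < n k" for k j i
      using e[of k] that \<omega> F_space[OF \<tau>r[of j k]] by (auto simp: elementary_integrand_def in_H_def)
    have \<sigma>m: "(\<lambda>t. \<sigma> t \<omega>) \<in> ?N \<rightarrow>\<^sub>M seminorm_borel (sqnorm_HS (sqnorm_H Sb))"
      using measurable_compose[OF predictable_section[OF \<omega>] volatility_predictable] by simp
    have "(\<lambda>(t, \<omega>). \<phi> t \<omega>) \<in> predictable_algebra M Sb F \<rightarrow>\<^sub>M seminorm_borel (sqnorm_Gdual Sb)"
      using \<phi> by (simp add: trading_strategy_def)
    from measurable_compose[OF predictable_section[OF \<omega>] this]
    have \<phi>m: "(\<lambda>t. \<phi> t \<omega>) \<in> ?N \<rightarrow>\<^sub>M seminorm_borel (sqnorm_Gdual Sb)" by simp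
    have "\<exists>y'. y' \<in> borel_measurable lborel \<and> (AE t in lborel. t \<in> {0..Sb} \<longrightarrow> y t \<omega> i = y' t)" for i
    proof -
      define s where "s t = (-1) *\<^sub>R \<sigma> t \<omega> i" for t
      \<comment> \<open>The values of the approximating step process in the numbering of
        \<open>step_index\<close>; the test \<open>j < n k\<close> and the zeros keep every value in
        H, also at indices that never occur.\<close>
      define w where "w k j = (case j of 0 \<Rightarrow> 0 | Suc j \<Rightarrow> if j < n k then (-1) *\<^sub>R \<xi> k j \<omega> i else 0)" for k j
      have "\<exists>y'. y' \<in> borel_measurable lborel \<and> (AE t in lborel. t \<in> {0..Sb} \<longrightarrow> \<phi> t \<omega> (volatility_curve (f t \<omega>) (s t)) = y' t)"
      proof (rule pairing_measurable[OF horizon fL, where v=w and J="\<lambda>k. step_index (n k) (\<tau> k)"])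
        show "(\<lambda>k. H_norm Sb (f (x k) \<omega> - f t \<omega>)) \<longlonglongrightarrow> 0" if "t \<in> {0..Sb}" "\<And>k. x k \<in> {0..Sb}" "x \<longlonglongrightarrow> t" for t x
          using a that by blast
        show "in_H Sb (s t)" if "t \<in> {0..Sb}" for t unfolding s_def by (rule in_H_scale[OF HS_component(1)[OF vt[OF that]]])
        show "(\<lambda>t. H_norm Sb (s t - w)) \<in> borel_measurable ?N" if w: "in_H Sb w" for w
        proof -
          have "s t - w = (-1) *\<^sub>R (\<sigma> t \<omega> i - (-1) *\<^sub>R w)" for t by (simp add: s_def fun_eq_iff scaleR_fun_def)
          then have e: "H_norm Sb (s t - w) = H_norm Sb (\<sigma> t \<omega> i - (-1) *\<^sub>R w)" for t
            by (simp only: H_norm_scale abs_minus abs_one mult_1_left)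
          show ?thesis unfolding e by (rule HS_component_measurable[OF \<sigma>m vt in_H_scale[OF w]]) (simp add: spN)
        qed
        have "in_H Sb ((-1) *\<^sub>R \<xi> k j \<omega> i)" if "j < n k" for k j by (rule in_H_scale[OF \<xi>L[OF that]])
        then show "in_H Sb (w k j)" for k j
          using in_H_0 by (cases j) (simp_all add: w_def del: scaleR_minus1_left)
        show "step_index (n k) (\<tau> k) \<in> borel \<rightarrow>\<^sub>M count_space UNIV" for k by (rule step_index_measurable)
        show "\<phi> t \<omega> \<in> Gdual Sb" if "t \<in> {0..Sb}" for t by (rule \<phi>G[OF that \<omega>])
        show "(\<lambda>t. \<phi> t \<omega> g) \<in> borel_measurable ?N" if "in_G Sb g g'" for g g'
          by (rule Gdual_evaluation_measurable[OF \<phi>m _ that Sb0]) (use \<phi>G \<omega> spN in auto)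
        have le: "sqnorm_H Sb (w k (step_index (n k) (\<tau> k) t) - s t) \<le>
            sqnorm_HS (sqnorm_H Sb) (elementary_process (n k) (\<tau> k) (\<xi> k) t \<omega> - \<sigma> t \<omega>)" for k t
        proof -
          let ?P = "elementary_process (n k) (\<tau> k) (\<xi> k) t \<omega>"
          have we: "w k (step_index (n k) (\<tau> k) t) = (-1) *\<^sub>R ?P i"
            unfolding elementary_process_step_index(1)[OF mono] w_def using elementary_process_step_index(2)[OF mono, of k t] by (auto split: nat.split)
          have "w k (step_index (n k) (\<tau> k) t) - s t = (-1) *\<^sub>R (?P - \<sigma> t \<omega>) i"
            unfolding we s_def by (simp add: fun_eq_iff scaleR_fun_def)
          then have "sqnorm_H Sb (w k (step_index (n k) (\<tau> k) t) - s t) = sqnorm_H Sb ((?P - \<sigma> t \<omega>) i)"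
            unfolding sqnorm_H_cutoff by (simp only: cutoff_scale[abs_def] power_mult_distrib) simp
          also have "\<dots> \<le> sqnorm_HS (sqnorm_H Sb) (?P - \<sigma> t \<omega>)"
          proof -
            have "(\<Sum>j\<in>{i}. sqnorm_H Sb ((?P - \<sigma> t \<omega>) j)) \<le> (\<Sum>j. sqnorm_H Sb ((?P - \<sigma> t \<omega>) j))" by (rule sum_le_suminf) auto
            then show ?thesis by (simp add: sqnorm_HS_def)
          qed
          finally show ?thesis .
        qed
        show "(\<lambda>k. \<integral>\<^sup>+t\<in>{0..Sb}. sqnorm_H Sb (w k (step_index (n k) (\<tau> k) t) - s t) \<partial>lborel) \<longlonglongrightarrow> 0"
          by (rule tendsto_sandwich[OF _ _ tendsto_const E1])
            (auto intro!: always_eventually nn_integral_mono mult_right_mono le)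
      qed
      moreover have "y t \<omega> i = \<phi> t \<omega> (volatility_curve (f t \<omega>) (s t))" if t: "t \<in> {0..Sb}" for t
        unfolding y_def strategy_integrand_def s_def
        by (rule adjoint_properties(1)[OF Sb0 fL[OF t] HS_component(1)[OF vt[OF t]] HS_component(2)[OF vt[OF t]] \<phi>G[OF t \<omega>]])
      ultimately show ?thesis by (auto elim!: eventually_mono)
    qed
    then obtain Y where Y: "\<And>i. Y i \<in> borel_measurable lborel" "\<And>i. AE t in lborel. t \<in> {0..Sb} \<longrightarrow> y t \<omega> i = Y i t" by metis
    have "AE t in lborel. \<forall>i. t \<in> {0..Sb} \<longrightarrow> y t \<omega> i = Y i t" unfolding AE_all_countable using Y(2) by blast
    then have "AE t in lborel. t \<in> {0..Sb} \<longrightarrow> y t \<omega> = (\<lambda>i. Y i t)" by eventually_elim (auto simp: fun_eq_iff)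
    then show "\<exists>y'. (\<forall>i. (\<lambda>t. y' t i) \<in> borel_measurable lborel) \<and> (AE t in lborel. t \<in> {0..Sb} \<longrightarrow> y t \<omega> = y' t)"
      using Y(1) by (intro exI[of _ "\<lambda>t i. Y i t"]) auto
  qed
qed

section \<open>A deterministic direction outside the ranges, and the contradiction\<close>

lemma predictable_swap:
  "(\<lambda>(\<omega>, t). (t, \<omega>)) \<in> M \<Otimes>\<^sub>M restrict_space lborel {0..Sb} \<rightarrow>\<^sub>M predictable_algebra M Sb F"
  unfolding predictable_algebra_def
proof (rule measurable_measure_of)
  let ?P = "M \<Otimes>\<^sub>M restrict_space lborel {0..Sb}"
  have sp: "space ?P = space M \<times> {0..Sb}" by (simp add: space_pair_measure space_restrict_space)
  show "{{0} \<times> A | A. A \<in> sets (F 0)} \<union>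
      {{s<..t} \<times> A | s t A. 0 \<le> s \<and> s \<le> t \<and> t \<le> Sb \<and> A \<in> sets (F s)} \<subseteq> Pow ({0..Sb} \<times> space M)"
    using F_sets_M[THEN sets.sets_into_space] Sb0 by fastforce
  show "(\<lambda>(\<omega>, t). (t, \<omega>)) \<in> space ?P \<rightarrow> {0..Sb} \<times> space M" by (auto simp: sp)
  fix Z assume "Z \<in> {{0} \<times> A | A. A \<in> sets (F 0)} \<union>
      {{s<..t} \<times> A | s t A. 0 \<le> s \<and> s \<le> t \<and> t \<le> Sb \<and> A \<in> sets (F s)}"
  then obtain B A where Z: "Z = B \<times> A" "B \<in> sets borel" "A \<in> sets M"
  proof (elim UnE CollectE exE conjE)
    fix A assume "Z = {0} \<times> A" "A \<in> sets (F 0)"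
    then show ?thesis using F_sets_M[of 0 A] Sb0 by (intro that[of "{0}" A]) auto
  next
    fix s t A assume "Z = {s<..t} \<times> A" "0 \<le> s" "s \<le> t" "t \<le> Sb" "A \<in> sets (F s)"
    then show ?thesis using F_sets_M[of s A] by (intro that[of "{s<..t}" A]) auto
  qed
  have "(\<lambda>(\<omega>, t). (t, \<omega>)) -` Z \<inter> space ?P = A \<times> (B \<inter> {0..Sb})"
    using sets.sets_into_space[OF Z(3)] by (auto simp: Z(1) sp)
  also have "\<dots> \<in> sets ?P" using Z by (intro pair_measureI) (auto simp: sets_restrict_space_iff)
  finally show "(\<lambda>(\<omega>, t). (t, \<omega>)) -` Z \<inter> space ?P \<in> sets ?P" .
qed

text \<open>Wherever the volatility is Hilbert-Schmidt its i-th norm tends to 0, hence, after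
  truncation, also in mean over the product space. Means below 8^(-k) along r, weighted by 4^k, are
  summable like 2^(-k), so the weighted series converges at almost every (t, \<omega>) and its terms
  are eventually small. Averaging over both variables is what makes r deterministic and independent
  of time.\<close>

lemma fast_decay_subsequence:
  obtains r :: "nat \<Rightarrow> nat" where "strict_mono r"
    "AE \<omega> in M. AE t in lborel. t \<in> {0..Sb} \<longrightarrow> (\<forall>\<^sub>F k in sequentially. H_norm Sb (\<sigma> t \<omega> (r k)) \<le> (1 / 4) ^ k)"
proof -
  let ?N = "restrict_space lborel {0..Sb}" let ?P = "M \<Otimes>\<^sub>M ?N"
  interpret N: finite_measure ?N by (rule finite_measure_interval)
  have PF: "finite_measure ?P" by (rule finite_measure_pair_measure) (unfold_locales)
  interpret P: finite_measure ?P by (rule PF)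
  interpret MN: pair_sigma_finite M ?N by unfold_locales
  let ?q = "sqnorm_HS (sqnorm_H Sb)"
  \<comment> \<open>Truncation at 1 supplies the domination, as the norms themselves may fail to be
    integrable over the product space. The value 0 off the Hilbert-Schmidt operators makes the
    convergence hold at every point.\<close>
  define a where "a i s = (if ?q s < \<infinity> then min 1 (H_norm Sb (s i)) else 0)" for i and s :: "nat \<Rightarrow> real \<Rightarrow> real"
  have am: "a i \<in> borel_measurable (seminorm_borel ?q)" for i
  proof (rule borel_measurableI_less)
    fix c
    have spU: "space (seminorm_borel ?q) = UNIV" by (simp add: seminorm_borel_def space_measure_of_conv)
    have V: "{s. ?q s < \<infinity> \<and> a i s < c} \<in> sets (seminorm_borel ?q)" for c
    proof (rule seminorm_borel_open)
      fix s assume s: "s \<in> {s. ?q s < \<infinity> \<and> a i s < c}"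
      then have sq: "?q s < \<infinity>" and l: "min 1 (H_norm Sb (s i)) < c" by (auto simp: a_def)
      define e where "e = c - min 1 (H_norm Sb (s i))"
      have e: "0 < e" using l by (simp add: e_def)
      have "s' \<in> {s. ?q s < \<infinity> \<and> a i s < c}" if s': "?q (s' - s) < ennreal (e\<^sup>2)" for s'
      proof -
        have f: "?q (s' - s) < \<infinity>" using less_trans[OF s' ennreal_less_top] by simp
        have q': "?q s' < \<infinity>" by (rule HS_finite_add[OF f sq])
        have "sqnorm_H Sb (s' i - s i) < ennreal (e\<^sup>2)" using HS_component(3)[OF f, of i] s' by simp
        from sqnorm_H_less(2)[OF this e] have "H_norm Sb (s' i - s i) < e" .
        then have "H_norm Sb (s' i) < H_norm Sb (s i) + e"
          using H_norm_triangle'[OF HS_component(1)[OF q'] HS_component(1)[OF sq], of i i] by linarith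
        then have "min 1 (H_norm Sb (s' i)) < c" using e unfolding e_def by linarith
        then show ?thesis using q' by (simp add: a_def)
      qed
      then show "\<exists>e>0. \<forall>s'. ?q (s' - s) < e \<longrightarrow> s' \<in> {s. ?q s < \<infinity> \<and> a i s < c}"
        using e by (intro exI[of _ "ennreal (e\<^sup>2)"]) auto
    qed auto
    have F: "{s. ?q s < \<infinity>} \<in> sets (seminorm_borel ?q)"
    proof -
      have "{s. ?q s < \<infinity>} = {s. ?q s < \<infinity> \<and> a i s < 2}" by (auto simp: a_def)
      then show ?thesis using V[of 2] by simp
    qed
    have "{x \<in> space (seminorm_borel ?q). a i x < c} =
        {s. ?q s < \<infinity> \<and> a i s < c} \<union> (if 0 < c then space (seminorm_borel ?q) - {s. ?q s < \<infinity>} else {})"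
      by (auto simp: spU a_def)
    also have "\<dots> \<in> sets (seminorm_borel ?q)" using V[of c] F by auto
    finally show "{x \<in> space (seminorm_borel ?q). a i x < c} \<in> sets (seminorm_borel ?q)" .
  qed
  define b where "b i x = a i (\<sigma> (snd x) (fst x))" for i and x :: "'w \<times> real"
  have bm: "b i \<in> borel_measurable ?P" for i
  proof -
    have "(\<lambda>x. a i ((\<lambda>(t, \<omega>). \<sigma> t \<omega>) ((\<lambda>(\<omega>, t). (t, \<omega>)) x))) \<in> borel_measurable ?P"
      by (rule measurable_compose[OF measurable_compose[OF predictable_swap volatility_predictable] am])
    then show ?thesis by (simp add: b_def[abs_def] case_prod_beta)
  qed
  have b01: "0 \<le> b i x" "b i x \<le> 1" for i x by (auto simp: b_def a_def H_norm_nonneg)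
  have bi: "integrable ?P (b i)" for i using bm b01 by (intro P.integrable_const_bound[of _ 1]) (auto simp: abs_le_iff)
  have blim: "(\<lambda>i. b i x) \<longlonglongrightarrow> 0" for x
  proof (cases "?q (\<sigma> (snd x) (fst x)) < \<infinity>")
    case True
    from summable_LIMSEQ_zero[OF HS_component(2)[OF True]]
    have "(\<lambda>i. sqrt ((H_norm Sb (\<sigma> (snd x) (fst x) i))\<^sup>2)) \<longlonglongrightarrow> sqrt 0" by (rule tendsto_real_sqrt)
    then have "(\<lambda>i. H_norm Sb (\<sigma> (snd x) (fst x) i)) \<longlonglongrightarrow> 0" by (simp add: H_norm_nonneg)
    from tendsto_min[OF tendsto_const[of 1] this] show ?thesis using True by (simp add: b_def a_def)
  qed (simp add: b_def a_def)
  have "(\<lambda>i. \<integral>x. b i x \<partial>?P) \<longlonglongrightarrow> (\<integral>x. 0 \<partial>?P)"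
    by (rule integral_dominated_convergence[where w="\<lambda>_. 1"]) (use bm blim b01 in \<open>auto simp: abs_le_iff\<close>)
  then have lim: "(\<lambda>i. \<integral>x. b i x \<partial>?P) \<longlonglongrightarrow> 0" by simp
  have "\<exists>n0. \<forall>i\<ge>n0. (\<integral>x. b i x \<partial>?P) < (1 / 8) ^ k" for k
    using order_tendstoD(2)[OF lim, of "(1 / 8) ^ k"] by (auto simp: eventually_sequentially)
  then obtain n0 where n0: "\<And>k i. n0 k \<le> i \<Longrightarrow> (\<integral>x. b i x \<partial>?P) < (1 / 8) ^ k" by metis
  \<comment> \<open>A strictly increasing sequence above n0.\<close>
  define r where "r k = (\<Sum>j\<le>k. Suc (n0 j))" for k
  have r: "strict_mono r" by (rule strict_mono_Suc_iff[THEN iffD2]) (simp add: r_def)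
  have rn: "n0 k \<le> r k" for k
  proof -
    have "Suc (n0 k) \<le> r k" unfolding r_def by (rule member_le_sum) auto
    then show ?thesis by simp
  qed
  have "(\<integral>\<^sup>+x. (\<Sum>k. ennreal (4 ^ k * b (r k) x)) \<partial>?P) = (\<Sum>k. \<integral>\<^sup>+x. ennreal (4 ^ k * b (r k) x) \<partial>?P)"
    using bm by (intro nn_integral_suminf) auto
  also have "\<dots> \<le> (\<Sum>k. ennreal ((1 / 2) ^ k))"
  proof (rule suminf_le)
    fix k
    have "(\<integral>\<^sup>+x. ennreal (4 ^ k * b (r k) x) \<partial>?P) = ennreal (\<integral>x. 4 ^ k * b (r k) x \<partial>?P)"
      using bi b01 by (intro nn_integral_eq_integral) auto
    also have "(\<integral>x. 4 ^ k * b (r k) x \<partial>?P) = 4 ^ k * (\<integral>x. b (r k) x \<partial>?P)" by (rule integral_mult_right_zero)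
    also have "\<dots> \<le> 4 ^ k * (1 / 8) ^ k" using n0[OF rn[of k]] by (intro mult_left_mono) auto
    also have "\<dots> = (1 / 2 :: real) ^ k" by (simp add: power_mult_distrib[symmetric])
    finally show "(\<integral>\<^sup>+x. ennreal (4 ^ k * b (r k) x) \<partial>?P) \<le> ennreal ((1 / 2) ^ k)" by (simp add: ennreal_leI)
  qed auto
  also have "\<dots> < \<infinity>" by (subst suminf_ennreal2) (auto intro: summable_geometric)
  finally have "AE x in ?P. (\<Sum>k. ennreal (4 ^ k * b (r k) x)) \<noteq> \<infinity>"
    using bm by (intro nn_integral_PInf_AE) auto
  \<comment> \<open>The factor 1 / 2 keeps the bound below 1 also for k = 0, so that the truncation
    at 1 can be undone at the end.\<close>
  then have "AE x in ?P. \<forall>\<^sub>F k in sequentially. b (r k) x \<le> (1 / 4) ^ k / 2"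
  proof eventually_elim
    fix x assume "(\<Sum>k. ennreal (4 ^ k * b (r k) x)) \<noteq> \<infinity>"
    then have "summable (\<lambda>k. 4 ^ k * b (r k) x)" using b01 by (intro summable_suminf_not_top) auto
    from order_tendstoD(2)[OF summable_LIMSEQ_zero[OF this], of "1 / 2"]
    have "\<forall>\<^sub>F k in sequentially. 4 ^ k * b (r k) x < 1 / 2" by simp
    then show "\<forall>\<^sub>F k in sequentially. b (r k) x \<le> (1 / 4) ^ k / 2"
      by eventually_elim (simp add: field_simps power_divide)
  qed
  then have AE1: "AE \<omega> in M. AE t in ?N. \<forall>\<^sub>F k in sequentially. b (r k) (\<omega>, t) \<le> (1 / 4) ^ k / 2"
    by (rule MN.AE_pair)
  have "AE \<omega> in M. AE t in lborel. t \<in> {0..Sb} \<longrightarrow> (\<forall>\<^sub>F k in sequentially. H_norm Sb (\<sigma> t \<omega> (r k)) \<le> (1 / 4) ^ k)"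
    using AE1 volatility_HS
  proof eventually_elim
    fix \<omega> assume "AE t in ?N. \<forall>\<^sub>F k in sequentially. b (r k) (\<omega>, t) \<le> (1 / 4) ^ k / 2"
      and v: "\<forall>t\<in>{0..Sb}. ?q (\<sigma> t \<omega>) < \<infinity>"
    then have "AE t in lborel. t \<in> {0..Sb} \<longrightarrow> (\<forall>\<^sub>F k in sequentially. b (r k) (\<omega>, t) \<le> (1 / 4) ^ k / 2)"
      by (subst (asm) AE_restrict_space_iff) auto
    then show "AE t in lborel. t \<in> {0..Sb} \<longrightarrow> (\<forall>\<^sub>F k in sequentially. H_norm Sb (\<sigma> t \<omega> (r k)) \<le> (1 / 4) ^ k)"
    proof eventually_elim
      fix t assume ev: "t \<in> {0..Sb} \<longrightarrow> (\<forall>\<^sub>F k in sequentially. b (r k) (\<omega>, t) \<le> (1 / 4) ^ k / 2)"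
      show "t \<in> {0..Sb} \<longrightarrow> (\<forall>\<^sub>F k in sequentially. H_norm Sb (\<sigma> t \<omega> (r k)) \<le> (1 / 4) ^ k)"
      proof
        assume t: "t \<in> {0..Sb}"
        have "\<forall>\<^sub>F k in sequentially. b (r k) (\<omega>, t) \<le> (1 / 4) ^ k / 2" using ev t by blast
        then show "\<forall>\<^sub>F k in sequentially. H_norm Sb (\<sigma> t \<omega> (r k)) \<le> (1 / 4) ^ k"
        proof eventually_elim
          fix k assume "b (r k) (\<omega>, t) \<le> (1 / 4) ^ k / 2"
          then have "min 1 (H_norm Sb (\<sigma> t \<omega> (r k))) \<le> (1 / 4) ^ k / 2" using v t by (simp add: b_def a_def)
          moreover have "(1 / 4 :: real) ^ k \<le> 1" by (rule power_le_one) auto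
          moreover have "0 \<le> (1 / 4 :: real) ^ k" by simp
          ultimately show "H_norm Sb (\<sigma> t \<omega> (r k)) \<le> (1 / 4) ^ k" by linarith
        qed
      qed
    qed
  qed
  then show ?thesis using r that by blast
qed

text \<open>Formulated for any class inside the dual of G, which covers the three classes of
  strategies at once.\<close>

lemma not_complete:
  assumes K: "K \<subseteq> Gdual Sb" and S: "0 < S" "S \<le> Sb"
  shows "\<not> market_complete M Sb F W f \<sigma> K S"
proof
  assume complete: "market_complete M Sb F W f \<sigma> K S"
  have S0: "0 \<le> S" using S by simp
  obtain r :: "nat \<Rightarrow> nat" where r: "strict_mono r"
    and decay: "AE \<omega> in M. AE t in lborel. t \<in> {0..Sb} \<longrightarrow> (\<forall>\<^sub>F k in sequentially. H_norm Sb (\<sigma> t \<omega> (r k)) \<le> (1 / 4) ^ k)"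
    by (rule fast_decay_subsequence)
  \<comment> \<open>Slower than the decay 4^(-k) of the volatilities at r k, yet absolutely
    summable, so that the series in the claim converges. The entry at r 0 is 1 and serves as
    normalization.\<close>
  define Y where "Y i = (if i \<in> range r then (1 / 2 :: real) ^ (the_inv r i) else 0)" for i
  have inj: "inj r" using r by (rule strict_mono_imp_inj_on)
  have Yr: "Y (r k) = (1 / 2) ^ k" for k by (simp add: Y_def the_inv_f_f[OF inj])
  define p where "p = r 0"
  have Yp: "Y p = 1" using Yr[of 0] by (simp add: p_def)
  have Ys: "summable (\<lambda>i. \<bar>Y i\<bar>)"
  proof -
    have "summable (\<lambda>k. \<bar>Y (r k)\<bar>)" unfolding Yr by (auto intro: summable_geometric simp: power_abs)
    then show ?thesis by (subst (asm) summable_mono_reindex[OF r]) (auto simp: Y_def)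
  qed
  let ?\<xi> = "\<lambda>\<omega>. sin (Zlim Y S \<omega>)"
  have \<xi>F: "?\<xi> \<in> borel_measurable (F S)" using Zlim_adapted[OF S0 S(2)] by measurable
  have \<xi>M: "?\<xi> \<in> borel_measurable M" using F_meas_M[OF _ \<xi>F] S by auto
  have "\<exists>B. \<forall>\<omega>\<in>space M. \<bar>?\<xi> \<omega>\<bar> \<le> B" by (intro exI[of _ 1]) auto
  with complete \<xi>F obtain c0 \<phi> X where adm: "admissible M Sb F W f \<sigma> K \<phi>"
    and pi: "has_price_integral M Sb F W f \<sigma> \<phi> X" and rep: "AE \<omega> in M. ?\<xi> \<omega> = c0 + X S \<omega>"
    unfolding market_complete_def by blast
  define y where "y = strategy_integrand f \<sigma> \<phi>"
  have ts: "trading_strategy M Sb F K \<phi>" and pint: "price_integrable M Sb f \<sigma> \<phi>" and mart: "martingale_on M Sb F X"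
    using adm pi by (auto simp: admissible_def)
  have si: "has_stochastic_integral M Sb F W sqnorm_real y X" using pi by (simp add: has_price_integral_def y_def)
  note reg = integrand_regular[OF ts K, folded y_def]
  have fin: "AE \<omega> in M. (\<integral>\<^sup>+t\<in>{0..Sb}. sqnorm_HS sqnorm_real (y t \<omega>) \<partial>lborel) < \<infinity>"
    using pint by (simp add: price_integrable_def y_def)
  \<comment> \<open>The constant is moved to the claim, so that N is a bounded version of the value
    of the martingale X at S.\<close>
  define N where "N \<omega> = ?\<xi> \<omega> - c0" for \<omega>
  have Nm: "N \<in> borel_measurable M" unfolding N_def using \<xi>M by measurable
  have Nb: "\<bar>N \<omega>\<bar> \<le> 1 + \<bar>c0\<bar>" for \<omega>
    unfolding N_def using abs_triangle_ineq4[of "?\<xi> \<omega>" c0] abs_sin_le_one[of "Zlim Y S \<omega>"] by linarith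
  have NX: "AE \<omega> in M. N \<omega> = X S \<omega>" using rep by eventually_elim (simp add: N_def)
  have parallel: "AE \<omega> in M. AE t in lborel. t \<in> {0..S} \<longrightarrow> y t \<omega> i = Y i * y t \<omega> p" for i
  proof -
    \<comment> \<open>The i-th unit vector minus Y i times the p-th one. It is orthogonal to Y
      because Y p = 1, and orthogonality of y to these vectors for all i says that y is y p times
      Y.\<close>
    define c where "c j = (if j = i then 1 else 0) - Y i * (if j = p then 1 else 0)" for j
    define m0 where "m0 = Suc (max i p)"
    have c0': "c j = 0" if "m0 \<le> j" for j using that by (auto simp: c_def m0_def)
    have ipc: "ip m0 v c = v i - Y i * v p" for v
    proof -
      have "ip m0 v c = (\<Sum>j<m0. (if j = i then v j else 0)) - Y i * (\<Sum>j<m0. (if j = p then v j else 0))"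
        unfolding ip_def c_def sum_distrib_left sum_subtractf[symmetric] by (intro sum.cong) (auto simp: algebra_simps)
      then show ?thesis by (simp add: m0_def)
    qed
    have ipc': "ip m0 c v = v i - Y i * v p" for v using ipc[of v] by (simp add: ip_def mult.commute)
    have "AE \<omega> in M. AE t in lborel. t \<in> {0..S} \<longrightarrow> ip m0 c (y t \<omega>) = 0"
    proof (rule integrand_orthogonal[OF S0 S(2) si mart Nm Nb NX c0' _ reg(2) fin])
      fix m s t and H :: "'w \<Rightarrow> real" assume m: "m0 \<le> m" and st: "0 \<le> s" "s \<le> t" "t \<le> S" and H: "simple_function (F s) H"
      have st': "0 \<le> s" "s \<le> t" "t \<le> Sb" using st S by auto
      have Hi: "integrable M H" using simple_integrable[of s H "\<lambda>x. x"] H st' by auto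
      have HF: "H \<in> borel_measurable (F s)" using H by (rule borel_measurable_simple_function)
      note sm = step_mean[OF st' HF Hi, of "\<lambda>_. c" m, simplified]
      have i1: "integrable M (\<lambda>\<omega>. H \<omega> * dW m c s t \<omega> * ?\<xi> \<omega>)"
        by (rule integrable_mult_bounded[OF sm(1) \<xi>M, of 1]) simp
      have i2: "integrable M (\<lambda>\<omega>. H \<omega> * dW m c s t \<omega> * c0)" using sm(1) by auto
      \<comment> \<open>The constant c0 contributes nothing, because increments weighted by the past
        have mean zero.\<close>
      have "(\<integral>\<omega>. H \<omega> * dW m c s t \<omega> * N \<omega> \<partial>M) = (\<integral>\<omega>. H \<omega> * dW m c s t \<omega> * ?\<xi> \<omega> \<partial>M) - (\<integral>\<omega>. H \<omega> * dW m c s t \<omega> * c0 \<partial>M)"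
        unfolding N_def right_diff_distrib by (rule Bochner_Integration.integral_diff[OF i1 i2])
      also have "(\<integral>\<omega>. H \<omega> * dW m c s t \<omega> * c0 \<partial>M) = 0" using sm(2) by simp
      also have "(\<integral>\<omega>. H \<omega> * dW m c s t \<omega> * ?\<xi> \<omega> \<partial>M) = 0"
        by (rule sin_Zlim_orthogonal[OF st S(2) H Ys c0' _ m]) (simp_all add: ipc Yp)
      finally show "(\<integral>\<omega>. H \<omega> * dW m c s t \<omega> * N \<omega> \<partial>M) = 0" by simp
    qed
    then show ?thesis by (simp add: ipc')
  qed
  have "AE \<omega> in M. \<forall>i. AE t in lborel. t \<in> {0..S} \<longrightarrow> y t \<omega> i = Y i * y t \<omega> p"
    unfolding AE_all_countable using parallel by blast
  then have "AE \<omega> in M. AE t in lborel. t \<in> {0..S} \<longrightarrow> y t \<omega> = 0"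
    using decay reg(1)
  proof eventually_elim
    fix \<omega> assume "\<forall>i. AE t in lborel. t \<in> {0..S} \<longrightarrow> y t \<omega> i = Y i * y t \<omega> p"
      and d: "AE t in lborel. t \<in> {0..Sb} \<longrightarrow> (\<forall>\<^sub>F k in sequentially. H_norm Sb (\<sigma> t \<omega> (r k)) \<le> (1 / 4) ^ k)"
      and R: "\<forall>t\<in>{0..Sb}. \<exists>C. \<forall>i. \<bar>y t \<omega> i\<bar> \<le> C * H_norm Sb (\<sigma> t \<omega> i)"
    then have "AE t in lborel. \<forall>i. t \<in> {0..S} \<longrightarrow> y t \<omega> i = Y i * y t \<omega> p" unfolding AE_all_countable by blast
    then show "AE t in lborel. t \<in> {0..S} \<longrightarrow> y t \<omega> = 0"
      using d
    proof eventually_elim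
      fix t assume P: "\<forall>i. t \<in> {0..S} \<longrightarrow> y t \<omega> i = Y i * y t \<omega> p"
        and D: "t \<in> {0..Sb} \<longrightarrow> (\<forall>\<^sub>F k in sequentially. H_norm Sb (\<sigma> t \<omega> (r k)) \<le> (1 / 4) ^ k)"
      show "t \<in> {0..S} \<longrightarrow> y t \<omega> = 0"
      proof
        assume t: "t \<in> {0..S}"
        then have tb: "t \<in> {0..Sb}" using S by auto
        have Py: "y t \<omega> i = Y i * y t \<omega> p" for i using P t by blast
        obtain C where C: "\<And>i. \<bar>y t \<omega> i\<bar> \<le> C * H_norm Sb (\<sigma> t \<omega> i)" using R tb by blast
        \<comment> \<open>At index r k parallelism gives the size 2^(-k) |y p|, while the adjoint
          bound allows at most |C| 4^(-k); cancelling 2^(-k) leaves a bound that tends to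
          zero.\<close>
        have ev: "\<forall>\<^sub>F k in sequentially. \<bar>y t \<omega> p\<bar> \<le> \<bar>C\<bar> * (1 / 2) ^ k"
          using D[rule_format, OF tb]
        proof eventually_elim
          fix k assume h: "H_norm Sb (\<sigma> t \<omega> (r k)) \<le> (1 / 4) ^ k"
          have "(1 / 2) ^ k * \<bar>y t \<omega> p\<bar> = \<bar>y t \<omega> (r k)\<bar>"
            by (simp only: Py[of "r k"] Yr abs_mult power_abs abs_divide abs_one abs_numeral)
          also have "\<dots> \<le> C * H_norm Sb (\<sigma> t \<omega> (r k))" by (rule C)
          also have "\<dots> \<le> \<bar>C\<bar> * H_norm Sb (\<sigma> t \<omega> (r k))" by (intro mult_right_mono H_norm_nonneg) simp
          also have "\<dots> \<le> \<bar>C\<bar> * (1 / 4) ^ k" by (intro mult_left_mono h) simp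
          also have "\<dots> = (1 / 2) ^ k * (\<bar>C\<bar> * (1 / 2) ^ k)" by (simp add: power_mult_distrib[symmetric] mult.left_commute)
          finally show "\<bar>y t \<omega> p\<bar> \<le> \<bar>C\<bar> * (1 / 2) ^ k" by (rule mult_left_le_imp_le) simp
        qed
        have "(\<lambda>k. \<bar>C\<bar> * (1 / 2) ^ k) \<longlonglongrightarrow> \<bar>C\<bar> * 0" by (intro tendsto_intros LIMSEQ_realpow_zero) auto
        then have "\<bar>y t \<omega> p\<bar> \<le> \<bar>C\<bar> * 0" by (rule tendsto_lowerbound[OF _ ev]) simp
        then have "y t \<omega> p = 0" by simp
        then have "y t \<omega> i = 0" for i using Py[of i] by simp
        then show "y t \<omega> = 0" by (simp add: fun_eq_iff)
      qed
    qed
  qed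
  \<comment> \<open>A vanishing integrand leaves the claim almost surely equal to the constant
    c0.\<close>
  from integral_0_of_integrand_0[OF S0 S(2) si this] have "AE \<omega> in M. X S \<omega> = 0" .
  then have "AE \<omega> in M. sin (Zlim Y S \<omega>) = c0" using rep by eventually_elim simp
  then show False using sin_Zlim_not_constant[OF S Ys Yp] by blast
qed

end

theorem theorem3p2:
  fixes M :: "'w measure"
    and F :: "real \<Rightarrow> 'w measure"
    and W :: "nat \<Rightarrow> real \<Rightarrow> 'w \<Rightarrow> real"
    and f0 :: "real \<Rightarrow> real"
    and f \<alpha> :: "real \<Rightarrow> 'w \<Rightarrow> real \<Rightarrow> real"
    and \<sigma> :: "real \<Rightarrow> 'w \<Rightarrow> nat \<Rightarrow> real \<Rightarrow> real"
    and Sb :: real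
  assumes "bond_market M Sb F W f0 f \<alpha> \<sigma>"
  shows "\<forall>K\<in>strategy_classes Sb. \<forall>S. 0 < S \<and> S \<le> Sb \<longrightarrow>
           \<not> market_complete M Sb F W f \<sigma> K S"
proof (intro ballI allI impI)
  interpret bond_market M Sb F W f0 f \<alpha> \<sigma> by (rule assms)
  fix K S assume K: "K \<in> strategy_classes Sb" and S: "0 < S \<and> S \<le> Sb"
  have "K \<subseteq> Gdual Sb"
    using K by (auto simp: strategy_classes_def point_mass_portfolios_def measure_portfolios_def)
  then show "\<not> market_complete M Sb F W f \<sigma> K S" using S by (intro not_complete) auto
qed

end
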